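(* Let $d\ge3$ and $n\ge2$. Then the set \[ \{ f\in\mathrm{End}_d^n : f \text{ is post-critically periodic}\} \] is contained in a proper Zariski closed subset of $\mathrm{End}_d^n$.
   Context: Work over an algebraically closed field $\mathbb{F}$ of characteristic $0$. $\mathrm{End}_d^n$ is the set of morphisms $f:\mathbb{P}^n\to\mathbb{P}^n$ of algebraic degree $d$ (i.e. $f=[f_0:\dots:f_n]$, $f_i$ homogeneous of degree $d$ with no common zero), viewed as a Zariski open subset of $\mathbb{P}^N$, $N=(n+1)\binom{d+n}{n}-1$. The critical locus is $\mathcal{C}_f=\{\det(\partial f_i/\partial x_j)=0\}$. A map $f$ is post-critically periodic if $f^k(\mathcal{C}_f)\subseteq\mathcal{C}_f$ for some $k\ge1$. *)

theory Defs
  imports "HOL-Computational_Algebra.Polynomial" "Jordan_Normal_Form.Determinant"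
begin

definition alg_closed :: "'a::field itself \<Rightarrow> bool" where
  "alg_closed _ \<longleftrightarrow> (\<forall>p::'a poly. degree p \<ge> 1 \<longrightarrow> (\<exists>x. poly p x = 0))"

text \<open>Multivariate polynomials over variables of type 'v, given by their coefficient
  function on monomials (exponent functions 'v => nat).\<close>
type_synonym ('v, 'a) mpol = "('v \<Rightarrow> nat) \<Rightarrow> 'a"

definition mp_monoms :: "('v, 'a::zero) mpol \<Rightarrow> ('v \<Rightarrow> nat) set" where
  "mp_monoms P = {m. P m \<noteq> 0}"

definition mp_supp :: "('v \<Rightarrow> nat) \<Rightarrow> 'v set" where
  "mp_supp m = {v. m v \<noteq> 0}"

definition is_mpoly :: "('v, 'a::zero) mpol \<Rightarrow> bool" where
  "is_mpoly P \<longleftrightarrow> finite (mp_monoms P) \<and> (\<forall>m\<in>mp_monoms P. finite (mp_supp m))"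

definition mp_vars_in :: "'v set \<Rightarrow> ('v, 'a::zero) mpol \<Rightarrow> bool" where
  "mp_vars_in V P \<longleftrightarrow> (\<forall>m\<in>mp_monoms P. mp_supp m \<subseteq> V)"

definition mp_homog :: "nat \<Rightarrow> ('v, 'a::zero) mpol \<Rightarrow> bool" where
  "mp_homog e P \<longleftrightarrow> is_mpoly P \<and> (\<forall>m\<in>mp_monoms P. (\<Sum>v\<in>mp_supp m. m v) = e)"

definition mp_eval :: "('v, 'a::comm_semiring_1) mpol \<Rightarrow> ('v \<Rightarrow> 'a) \<Rightarrow> 'a" where
  "mp_eval P x = (\<Sum>m\<in>mp_monoms P. P m * (\<Prod>v\<in>mp_supp m. x v ^ m v))"

definition mp_pderiv :: "'v \<Rightarrow> ('v, 'a::comm_semiring_1) mpol \<Rightarrow> ('v, 'a) mpol" where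
  "mp_pderiv j P = (\<lambda>m. of_nat (m j + 1) * P (m(j := m j + 1)))"

definition monoms_deg :: "nat \<Rightarrow> nat \<Rightarrow> (nat \<Rightarrow> nat) set" where
  "monoms_deg n d = {\<alpha>. mp_supp \<alpha> \<subseteq> {0..n} \<and> (\<Sum>v\<in>{0..n}. \<alpha> v) = d}"

text \<open>A point of F^(n+1) (coordinates 0..n, the rest zero).\<close>
definition vec_n :: "nat \<Rightarrow> (nat \<Rightarrow> 'a::zero) \<Rightarrow> bool" where
  "vec_n n x \<longleftrightarrow> (\<forall>j>n. x j = 0)"

text \<open>End_d^n (affine cone over it): tuples f = (f_0,...,f_n) of homogeneous polynomials of
  degree d in x_0..x_n with no common zero in F^(n+1) minus 0.\<close>
definition End_maps :: "nat \<Rightarrow> nat \<Rightarrow> (nat \<Rightarrow> (nat, 'a::comm_semiring_1) mpol) set" where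
  "End_maps n d = {f. (\<forall>i\<le>n. mp_homog d (f i) \<and> mp_vars_in {0..n} (f i))
       \<and> (\<forall>i>n. f i = (\<lambda>_. 0))
       \<and> (\<forall>x. vec_n n x \<and> (\<forall>i\<le>n. mp_eval (f i) x = 0) \<longrightarrow> (\<forall>j\<le>n. x j = 0))}"

definition map_apply :: "nat \<Rightarrow> (nat \<Rightarrow> (nat, 'a::comm_semiring_1) mpol) \<Rightarrow> (nat \<Rightarrow> 'a) \<Rightarrow> (nat \<Rightarrow> 'a)" where
  "map_apply n f x = (\<lambda>i. if i \<le> n then mp_eval (f i) x else 0)"

definition jac_det :: "nat \<Rightarrow> (nat \<Rightarrow> (nat, 'a::comm_ring_1) mpol) \<Rightarrow> (nat \<Rightarrow> 'a) \<Rightarrow> 'a" where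
  "jac_det n f x = det (mat (n+1) (n+1) (\<lambda>(i,j). mp_eval (mp_pderiv j (f i)) x))"

text \<open>Critical locus C_f (as points of the affine cone F^(n+1) minus 0).\<close>
definition crit_locus :: "nat \<Rightarrow> (nat \<Rightarrow> (nat, 'a::comm_ring_1) mpol) \<Rightarrow> (nat \<Rightarrow> 'a) set" where
  "crit_locus n f = {x. vec_n n x \<and> (\<exists>j\<le>n. x j \<noteq> 0) \<and> jac_det n f x = 0}"

definition post_crit_periodic :: "nat \<Rightarrow> (nat \<Rightarrow> (nat, 'a::comm_ring_1) mpol) \<Rightarrow> bool" where
  "post_crit_periodic n f \<longleftrightarrow>
     (\<exists>k\<ge>1. (map_apply n f ^^ k) ` crit_locus n f \<subseteq> crit_locus n f)"

definition coeff_index :: "nat \<Rightarrow> nat \<Rightarrow> (nat \<times> (nat \<Rightarrow> nat)) set" where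
  "coeff_index n d = {(i, \<alpha>). i \<le> n \<and> \<alpha> \<in> monoms_deg n d}"

definition coeff_vec :: "(nat \<Rightarrow> (nat, 'a) mpol) \<Rightarrow> (nat \<times> (nat \<Rightarrow> nat) \<Rightarrow> 'a)" where
  "coeff_vec f = (\<lambda>(i, \<alpha>). f i \<alpha>)"

text \<open>Zariski closed subset of End_d^n: common zero locus in End_d^n of a set S of
  homogeneous polynomials in the coefficient coordinates of P^N.\<close>
definition zariski_closed_End ::
  "nat \<Rightarrow> nat \<Rightarrow> (nat \<Rightarrow> (nat, 'a::comm_ring_1) mpol) set \<Rightarrow> bool" where
  "zariski_closed_End n d Z \<longleftrightarrow>
     (\<exists>S. (\<forall>G\<in>S. \<exists>e. mp_homog e G \<and> mp_vars_in (coeff_index n d) G) \<and>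
          Z = {f\<in>End_maps n d. \<forall>G\<in>S. mp_eval G (coeff_vec f) = 0})"

end

theory Submission
  imports Defs "Berlekamp_Zassenhaus.Unique_Factorization_Poly" "Jordan_Normal_Form.Char_Poly"
begin

text \<open>
  Let \<open>J\<close> be the Jacobian determinant of \<open>f\<close>. Call \<open>f\<close> good if its components have no common zero, \<open>J\<close> is
  monic in \<open>x\<^sub>0\<close> up to a unit, and the plane \<open>x\<^sub>3 = \<dots> = x\<^sub>n = 0\<close> cuts the critical locus in a smooth curve.
  These are open conditions on the coefficients, and each of them holds for some map.

  For good \<open>f\<close> the form \<open>J\<close> is prime. Suppose that \<open>F = f\<^sup>k\<close> maps the critical locus into itself, with \<open>k\<close>
  minimal, so that \<open>J \<circ> F = J H\<close>, and \<open>det DF = J M\<close> with \<open>M\<close> not divisible by \<open>J\<close>. Multiplying the gradient of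
  \<open>J \<circ> F = J H\<close> by the adjugate of \<open>DF\<close> shows that \<open>J\<close> divides \<open>H\<close> or that the columns of the adjugate are tangent
  to \<open>J = 0\<close>. In the second case they are derivations of the coordinate ring which kill the components of the
  finite map \<open>F\<close>, hence they vanish, which is absurd. So \<open>J \<circ> F = J\<^sup>2 H'\<close>, and \<open>M \<cdot> (\<partial>\<^sub>iJ \<circ> F)\<close> lies in \<open>(J, H')\<close>
  with a cofactor of \<open>H'\<close> of smaller degree than \<open>\<partial>\<^sub>iJ \<circ> F\<close>. Since \<open>J, \<partial>\<^sub>0J \<circ> F, \<partial>\<^sub>1J \<circ> F, \<partial>\<^sub>2J \<circ> F, F\<^sub>3, \<dots>, F\<^sub>n\<close> generate
  a primary ideal, counting dimensions modulo \<open>J\<close> produces a form outside \<open>(J)\<close> whose product with \<open>M\<close> lies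
  in \<open>(J)\<close>, contradicting primality.
\<close>

text \<open>Each geometric condition is encoded as ideal membership in one fixed degree. Such a
  membership is a finite linear system, so it persists wherever a suitable determinant does not
  vanish; this gives openness, and counting monomials takes the place of dimension theory. The bound
  n >= 2 supplies plane sections: a nonsingular plane curve is irreducible because two components
  would meet, and a general plane through prescribed points inherits nonsingularity from one special
  plane. The bound d >= 3 enters through deg J = (n + 1)(d - 1) > n + 1: with D = d^k, the cofactor
  of H' has degree lower by (D - 1)(deg J - n - 1), which would be 0 for d = 2. A positive drop
  costs about m^(n-2) dimensions modulo J in degree m, while the primary ideal leaves only about
  m^(n-3) uncovered; this gap is the contradiction. M is the product of the J o f^i with 0 < i < k,
  so minimality of k keeps it outside (J). The open conditions are witnessed by unrelated maps.
  Smoothness is the hard one; it is obtained from a pencil of plane curves, by showing that all but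
  finitely many of its members are smooth.\<close>

text \<open>Over an infinite field polynomials are identified with the functions they induce: \<open>homp V m\<close> are the
  forms of degree \<open>m\<close> in the variables \<open>V\<close>, and \<open>polyf V\<close> all polynomials in them.\<close>

inductive homp :: "'v set \<Rightarrow> nat \<Rightarrow> (('v \<Rightarrow> 'a::comm_ring_1) \<Rightarrow> 'a) \<Rightarrow> bool" for V where
  homp_const: "homp V 0 (\<lambda>_. c)"
| homp_var: "v \<in> V \<Longrightarrow> homp V 1 (\<lambda>x. x v)"
| homp_add: "homp V m P \<Longrightarrow> homp V m Q \<Longrightarrow> homp V m (\<lambda>x. P x + Q x)"
| homp_mult: "homp V m P \<Longrightarrow> homp V k Q \<Longrightarrow> homp V (m + k) (\<lambda>x. P x * Q x)"

inductive polyf :: "'v set \<Rightarrow> (('v \<Rightarrow> 'a::comm_ring_1) \<Rightarrow> 'a) \<Rightarrow> bool" for V where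
  polyf_const: "polyf V (\<lambda>_. c)"
| polyf_var: "v \<in> V \<Longrightarrow> polyf V (\<lambda>x. x v)"
| polyf_add: "polyf V P \<Longrightarrow> polyf V Q \<Longrightarrow> polyf V (\<lambda>x. P x + Q x)"
| polyf_mult: "polyf V P \<Longrightarrow> polyf V Q \<Longrightarrow> polyf V (\<lambda>x. P x * Q x)"

lemma homp_polyf: "homp V m P \<Longrightarrow> polyf V P"
  by (induction rule: homp.induct) (auto intro: polyf.intros)

lemma homp_cong_deg: "homp V m P \<Longrightarrow> m = k \<Longrightarrow> homp V k P"
  by simp

lemma homp_scale: "homp V m P \<Longrightarrow> homp V m (\<lambda>x. c * P x)"
  using homp_mult[OF homp_const, of V m P c] by simp

lemma homp_uminus: "homp V m P \<Longrightarrow> homp V m (\<lambda>x. - P x)"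
  using homp_scale[of V m P "-1"] by simp

lemma homp_diff: "homp V m P \<Longrightarrow> homp V m Q \<Longrightarrow> homp V m (\<lambda>x. P x - Q x)"
  using homp_add[OF _ homp_uminus, of V m P Q] by simp

lemma homp_power: "homp V m P \<Longrightarrow> homp V (k * m) (\<lambda>x. P x ^ k)"
proof (induction k)
  case 0
  then show ?case using homp_const[of V 1] by simp
next
  case (Suc k)
  from homp_mult[OF Suc.prems Suc.IH[OF Suc.prems]] show ?case by simp
qed

lemma homp_varpow: "v \<in> V \<Longrightarrow> homp V k (\<lambda>x. x v ^ k)"
  using homp_power[OF homp_var, of v V k] by simp

lemma homp_prod:
  assumes "finite I" "\<And>i. i \<in> I \<Longrightarrow> homp V (a i) (P i)"
  shows "homp V (sum a I) (\<lambda>x. \<Prod>i\<in>I. P i x)"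
  using assms
proof (induction I rule: finite_induct)
  case empty
  then show ?case using homp_const[of V 1] by simp
next
  case (insert i I)
  have "homp V (a i + sum a I) (\<lambda>x. P i x * (\<Prod>i\<in>I. P i x))"
    using insert by (intro homp_mult) auto
  then show ?case using insert(1,2) by simp
qed

lemma polyf_uminus: "polyf V P \<Longrightarrow> polyf V (\<lambda>x. - P x)"
  using polyf_mult[OF polyf_const, of V P "-1"] by simp

lemma polyf_diff: "polyf V P \<Longrightarrow> polyf V Q \<Longrightarrow> polyf V (\<lambda>x. P x - Q x)"
  using polyf_add[OF _ polyf_uminus, of V P Q] by simp

lemma polyf_power: "polyf V P \<Longrightarrow> polyf V (\<lambda>x. P x ^ k)"
proof (induction k)
  case 0
  then show ?case using polyf_const[of V 1] by simp
next
  case (Suc k)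
  from polyf_mult[OF Suc.prems Suc.IH[OF Suc.prems]] show ?case by simp
qed

lemma polyf_sum: "(\<And>i. i \<in> I \<Longrightarrow> polyf V (P i)) \<Longrightarrow> polyf V (\<lambda>x. \<Sum>i\<in>I. P i x)"
proof (induction I rule: infinite_finite_induct)
  case (insert i I)
  have "polyf V (\<lambda>x. P i x + (\<Sum>i\<in>I. P i x))"
    using insert by (intro polyf_add) auto
  then show ?case using insert(1,2) by simp
qed (auto intro: polyf_const)

lemma polyf_prod: "(\<And>i. i \<in> I \<Longrightarrow> polyf V (P i)) \<Longrightarrow> polyf V (\<lambda>x. \<Prod>i\<in>I. P i x)"
proof (induction I rule: infinite_finite_induct)
  case (insert i I)
  have "polyf V (\<lambda>x. P i x * (\<Prod>i\<in>I. P i x))"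
    using insert by (intro polyf_mult) auto
  then show ?case using insert(1,2) by simp
qed (auto intro: polyf_const)

lemma homp_eval_cong: "homp V m P \<Longrightarrow> (\<And>v. v \<in> V \<Longrightarrow> x v = y v) \<Longrightarrow> P x = P y"
  by (induction rule: homp.induct) auto

lemma homp_homogeneous: "homp V m P \<Longrightarrow> P (\<lambda>v. t * x v) = t ^ m * P x"
  by (induction rule: homp.induct) (auto simp: algebra_simps power_add)

lemma homp_zero_at: "homp V m P \<Longrightarrow> m > 0 \<Longrightarrow> (\<And>v. v \<in> V \<Longrightarrow> x v = 0) \<Longrightarrow> P x = 0"
proof -
  assume P: "homp V m P" and m: "m > 0" and x: "\<And>v. v \<in> V \<Longrightarrow> x v = 0"
  have "P x = P (\<lambda>v. 0 * x v)" using x by (intro homp_eval_cong[OF P]) auto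
  also have "\<dots> = 0 ^ m * P x" by (rule homp_homogeneous[OF P])
  finally show ?thesis using m by (simp add: zero_power)
qed

lemma homp_compose:
  assumes "homp V m P" "\<And>v. v \<in> V \<Longrightarrow> homp U k (F v)"
  shows "homp U (k * m) (\<lambda>x. P (\<lambda>v. F v x))"
  using assms(1)
proof (induction rule: homp.induct)
  case (homp_const c) then show ?case by (simp add: homp.homp_const)
next
  case (homp_var v) then show ?case using assms(2) by simp
next
  case homp_add then show ?case by (simp add: homp.homp_add)
next
  case homp_mult then show ?case by (simp add: homp.homp_mult distrib_left)
qed

lemma polyf_compose:
  assumes "polyf V P" "\<And>v. v \<in> V \<Longrightarrow> polyf U (F v)"
  shows "polyf U (\<lambda>x. P (\<lambda>v. F v x))"
  using assms(1) by (induction rule: polyf.induct) (auto intro: polyf.intros assms(2))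

section \<open>Monomials and the expansion of a form\<close>

definition mons :: "'v set \<Rightarrow> nat \<Rightarrow> ('v \<Rightarrow> nat) set" where
  "mons V m = {\<alpha>. mp_supp \<alpha> \<subseteq> V \<and> (\<Sum>v\<in>V. \<alpha> v) = m}"

definition monv :: "'v set \<Rightarrow> ('v \<Rightarrow> nat) \<Rightarrow> ('v \<Rightarrow> 'a::comm_ring_1) \<Rightarrow> 'a" where
  "monv V \<alpha> x = (\<Prod>v\<in>V. x v ^ \<alpha> v)"

lemma monoms_deg_eq: "monoms_deg n d = mons {0..n} d"
  by (simp add: monoms_deg_def mons_def)

lemma finite_mons: assumes "finite V" shows "finite (mons V m)"
proof -
  have "mons V m \<subseteq> {f. \<forall>v. (v \<in> V \<longrightarrow> f v \<in> {0..m}) \<and> (v \<notin> V \<longrightarrow> f v = 0)}"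
    using assms by (auto simp: mons_def mp_supp_def member_le_sum)
  then show ?thesis
    using finite_set_of_finite_funs[OF assms, of "{0..m}" 0] by (auto intro: finite_subset)
qed

lemma mons_add: "\<alpha> \<in> mons V m \<Longrightarrow> \<beta> \<in> mons V k \<Longrightarrow> (\<lambda>v. \<alpha> v + \<beta> v) \<in> mons V (m + k)"
  by (auto simp: mons_def mp_supp_def sum.distrib)

lemma monv_add: "monv V (\<lambda>v. \<alpha> v + \<beta> v) x = monv V \<alpha> x * monv V \<beta> x"
  by (simp add: monv_def power_add prod.distrib)

lemma homp_mon: "finite V \<Longrightarrow> \<alpha> \<in> mons V m \<Longrightarrow> homp V m (monv V \<alpha>)"
proof -
  assume V: "finite V" and a: "\<alpha> \<in> mons V m"
  have "homp V (\<Sum>v\<in>V. \<alpha> v) (\<lambda>x. \<Prod>v\<in>V. x v ^ \<alpha> v)"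
    using V by (intro homp_prod homp_varpow)
  then show ?thesis using a by (simp add: monv_def[abs_def] mons_def)
qed

lemma mons_0: "mons V 0 = {\<lambda>_. 0}" if "finite V"
proof -
  have "x = (\<lambda>_. 0)" if "x \<in> mons V 0" for x :: "'a \<Rightarrow> nat"
  proof
    fix v show "x v = 0" using that \<open>finite V\<close> by (cases "v \<in> V") (auto simp: mons_def mp_supp_def)
  qed
  then show ?thesis by (auto simp: mons_def mp_supp_def)
qed

lemma homp_zero: "finite V \<Longrightarrow> V \<noteq> {} \<Longrightarrow> homp V m (\<lambda>_. 0)"
proof -
  assume "V \<noteq> {}"
  then obtain v where "v \<in> V" by auto
  from homp_scale[OF homp_varpow[OF this], of m 0] show ?thesis by simp
qed

lemma homp_sum:
  assumes "finite V" "V \<noteq> {}" "\<And>i. i \<in> I \<Longrightarrow> homp V m (P i)"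
  shows "homp V m (\<lambda>x. \<Sum>i\<in>I. P i x)"
  using assms(3)
proof (induction I rule: infinite_finite_induct)
  case (insert i I)
  have "homp V m (\<lambda>x. P i x + (\<Sum>i\<in>I. P i x))"
    using insert by (intro homp_add) auto
  then show ?case using insert(1,2) by simp
qed (use homp_zero[OF assms(1,2)] in auto)

lemma sum_fiberwise:
  assumes "finite A" "finite B" "g ` A \<subseteq> B"
  shows "(\<Sum>b\<in>B. \<Sum>a\<in>{a\<in>A. g a = b}. h a) = sum h A"
  using sum.group[OF assms] by simp

text \<open>The convolution coefficients are kept explicit because \<open>bh_mult\<close> uses the
  same identity with coefficients that are forms in a parameter and has to see their degree.\<close>

lemma monv_expand_mult:
  fixes c c' :: "('v \<Rightarrow> nat) \<Rightarrow> 'a::comm_ring_1"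
  assumes V: "finite V"
  shows "(\<Sum>\<alpha>\<in>mons V m. c \<alpha> * monv V \<alpha> x) * (\<Sum>\<beta>\<in>mons V k. c' \<beta> * monv V \<beta> x)
     = (\<Sum>\<gamma>\<in>mons V (m + k). (\<Sum>p\<in>{p\<in>mons V m \<times> mons V k. (\<lambda>v. fst p v + snd p v) = \<gamma>}. c (fst p) * c' (snd p)) * monv V \<gamma> x)"
proof -
  let ?g = "\<lambda>p. (\<lambda>v. fst p v + snd p v)"
  let ?A = "mons V m \<times> mons V k"
  have "(\<Sum>\<alpha>\<in>mons V m. c \<alpha> * monv V \<alpha> x) * (\<Sum>\<beta>\<in>mons V k. c' \<beta> * monv V \<beta> x)
    = (\<Sum>p\<in>?A. c (fst p) * c' (snd p) * monv V (?g p) x)"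
    by (simp add: sum_product sum.cartesian_product monv_add split_def mult_ac)
  also have "\<dots> = (\<Sum>\<gamma>\<in>mons V (m + k). \<Sum>p\<in>{p\<in>?A. ?g p = \<gamma>}. c (fst p) * c' (snd p) * monv V (?g p) x)"
    using V by (intro sum_fiberwise[symmetric]) (auto intro: finite_mons mons_add)
  also have "\<dots> = (\<Sum>\<gamma>\<in>mons V (m + k). (\<Sum>p\<in>{p\<in>?A. ?g p = \<gamma>}. c (fst p) * c' (snd p)) * monv V \<gamma> x)"
    by (intro sum.cong refl) (auto simp: sum_distrib_right intro!: sum.cong)
  finally show ?thesis .
qed

lemma monv_single: "v \<in> V \<Longrightarrow> finite V \<Longrightarrow> monv V (\<lambda>u. if u = v then k else 0) x = x v ^ k"
proof -
  assume v: "v \<in> V" "finite V"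
  have "monv V (\<lambda>u. if u = v then k else 0) x = (\<Prod>u\<in>V. if u = v then x v ^ k else 1)"
    unfolding monv_def by (intro prod.cong) auto
  then show ?thesis using v by simp
qed

lemma mons_single: "v \<in> V \<Longrightarrow> finite V \<Longrightarrow> (\<lambda>u. if u = v then k else 0) \<in> mons V k"
  by (auto simp: mons_def mp_supp_def)

lemma homp_expand:
  assumes "homp V m P" "finite V"
  shows "\<exists>c. \<forall>x. P x = (\<Sum>\<alpha>\<in>mons V m. c \<alpha> * monv V \<alpha> x)"
  using assms(1)
proof (induction rule: homp.induct)
  case (homp_const c)
  show ?case using assms(2) by (intro exI[of _ "\<lambda>_. c"]) (simp add: mons_0 monv_def)
next
  case (homp_var v)
  let ?a = "\<lambda>u. if u = v then 1 else (0::nat)"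
  have "(\<Sum>\<alpha>\<in>mons V 1. (if \<alpha> = ?a then 1 else 0) * monv V \<alpha> x) = x v" for x :: "'a \<Rightarrow> 'b"
  proof -
    have "(\<Sum>\<alpha>\<in>mons V 1. (if \<alpha> = ?a then 1 else 0) * monv V \<alpha> x) = (\<Sum>\<alpha>\<in>mons V 1. if \<alpha> = ?a then monv V ?a x else 0)"
      by (intro sum.cong) auto
    also have "\<dots> = monv V ?a x"
      using mons_single[OF homp_var assms(2), of 1] finite_mons[OF assms(2), of 1] by (simp only: sum.delta if_True)
    finally show ?thesis using monv_single[OF homp_var assms(2), of 1 x] by simp
  qed
  then show ?case by (intro exI[of _ "\<lambda>\<alpha>. if \<alpha> = ?a then 1 else 0"]) simp
next
  case (homp_add m P Q)
  then obtain c c' where "\<forall>x. P x = (\<Sum>\<alpha>\<in>mons V m. c \<alpha> * monv V \<alpha> x)" "\<forall>x. Q x = (\<Sum>\<alpha>\<in>mons V m. c' \<alpha> * monv V \<alpha> x)"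
    by blast
  then show ?case
    by (intro exI[of _ "\<lambda>\<alpha>. c \<alpha> + c' \<alpha>"]) (simp add: sum.distrib distrib_right)
next
  case (homp_mult m P k Q)
  then obtain c c' where *: "\<And>x. P x = (\<Sum>\<alpha>\<in>mons V m. c \<alpha> * monv V \<alpha> x)" "\<And>x. Q x = (\<Sum>\<alpha>\<in>mons V k. c' \<alpha> * monv V \<alpha> x)"
    by blast
  show ?case unfolding * monv_expand_mult[OF assms(2)] by (rule exI) (rule allI, rule refl)
qed

lemma homp_of_expand:
  assumes "finite V" "V \<noteq> {}"
  shows "homp V m (\<lambda>x. \<Sum>\<alpha>\<in>mons V m. c \<alpha> * monv V \<alpha> x)"
  using assms by (intro homp_sum homp_scale homp_mon) auto

subsection \<open>Univariate restrictions\<close>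

text \<open>Bridge to univariate polynomials: finiteness of zeros, identity principles and
  derivatives are obtained by restricting a polynomial function to a curve with polynomial
  coordinates.\<close>

lemma polyf_uni:
  assumes "polyf V P" "\<And>v. v \<in> V \<Longrightarrow> \<exists>q. \<forall>t. poly q t = G v t"
  shows "\<exists>q. \<forall>t. poly q t = P (\<lambda>v. G v t)"
  using assms(1)
proof (induction rule: polyf.induct)
  case (polyf_const c) show ?case by (intro exI[of _ "[:c:]"]) simp
next
  case (polyf_var v) then show ?case using assms(2) by blast
next
  case (polyf_add P Q)
  then obtain p q where "\<forall>t. poly p t = P (\<lambda>v. G v t)" "\<forall>t. poly q t = Q (\<lambda>v. G v t)" by blast
  then show ?case by (intro exI[of _ "p + q"]) simp
next
  case (polyf_mult P Q)
  then obtain p q where "\<forall>t. poly p t = P (\<lambda>v. G v t)" "\<forall>t. poly q t = Q (\<lambda>v. G v t)" by blast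
  then show ?case by (intro exI[of _ "p * q"]) simp
qed

lemma polyf_line:
  fixes P :: "('v \<Rightarrow> 'a::comm_ring_1) \<Rightarrow> 'a"
  assumes "polyf V P"
  shows "\<exists>q. \<forall>t. poly q t = P (\<lambda>v. x v + t * y v)"
  using assms
proof (rule polyf_uni)
  fix v show "\<exists>q. \<forall>t. poly q t = x v + t * y v"
    by (intro exI[of _ "[:x v, y v:]"]) (simp add: algebra_simps)
qed

text \<open>The product of the restrictions to the line is a nonzero univariate polynomial, and an
  infinite field has a point outside its finitely many roots.\<close>

lemma common_nonroot:
  fixes p :: "'i \<Rightarrow> ('v \<Rightarrow> 'a::field_char_0) \<Rightarrow> 'a"
  assumes "finite I" "\<And>i. i \<in> I \<Longrightarrow> polyf V (p i)" "\<And>i. i \<in> I \<Longrightarrow> \<exists>t. p i (\<lambda>v. x v + t * y v) \<noteq> 0"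
  shows "\<exists>t. \<forall>i\<in>I. p i (\<lambda>v. x v + t * y v) \<noteq> 0"
proof -
  have "\<forall>i\<in>I. \<exists>q. \<forall>t. poly q t = p i (\<lambda>v. x v + t * y v)"
    using polyf_line assms(2) by blast
  then obtain q where q: "\<And>i t. i \<in> I \<Longrightarrow> poly (q i) t = p i (\<lambda>v. x v + t * y v)" by metis
  have "q i \<noteq> 0" if "i \<in> I" for i using assms(3)[OF that] q[OF that, symmetric] by auto
  then have "(\<Prod>i\<in>I. q i) \<noteq> 0" using assms(1) by simp
  then have "finite {t. poly (\<Prod>i\<in>I. q i) t = 0}" by (rule poly_roots_finite)
  then obtain t where "poly (\<Prod>i\<in>I. q i) t \<noteq> 0"
    using ex_new_if_finite[OF infinite_UNIV_char_0] by blast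
  then have "\<forall>i\<in>I. poly (q i) t \<noteq> 0" using assms(1) by (simp add: poly_prod)
  then show ?thesis using q by auto
qed

text \<open>Nonempty principal open sets intersect: a point good for the old conditions and one good
  for the new condition are joined by a line, on which no condition fails identically. Independent
  witnesses of open conditions are combined in this way.\<close>

lemma common_nonzero_point:
  fixes p :: "'i \<Rightarrow> ('v \<Rightarrow> 'a::field_char_0) \<Rightarrow> 'a"
  assumes "finite I" "\<And>i. i \<in> I \<Longrightarrow> polyf V (p i)" "\<And>i. i \<in> I \<Longrightarrow> \<exists>x. p i x \<noteq> 0"
  shows "\<exists>x. \<forall>i\<in>I. p i x \<noteq> 0"
  using assms
proof (induction I rule: finite_induct)
  case (insert i I)
  then obtain x where x: "\<forall>i\<in>I. p i x \<noteq> 0" by auto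
  from insert.prems obtain y where y: "p i y \<noteq> 0" by auto
  have "\<exists>t. \<forall>j\<in>insert i I. p j (\<lambda>v. x v + t * (y v - x v)) \<noteq> 0"
  proof (rule common_nonroot)
    fix j assume j: "j \<in> insert i I"
    then consider "j = i" | "j \<in> I" by auto
    then show "\<exists>t. p j (\<lambda>v. x v + t * (y v - x v)) \<noteq> 0"
    proof cases
      case 1 then show ?thesis using y by (intro exI[of _ 1]) simp
    next
      case 2 then show ?thesis using x by (intro exI[of _ 0]) simp
    qed
  qed (use insert in auto)
  then show ?case by blast
qed auto

lemma polyf_mult_zero:
  fixes P Q :: "('v \<Rightarrow> 'a::field_char_0) \<Rightarrow> 'a"
  assumes "polyf V P" "polyf V Q" "\<And>x. P x * Q x = 0" "P x0 \<noteq> 0"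
  shows "Q x = 0"
proof (rule ccontr)
  assume "Q x \<noteq> 0"
  then have "\<exists>y. \<forall>i\<in>{True, False}. (if i then P else Q) y \<noteq> 0"
    using assms by (intro common_nonzero_point[where V=V]) auto
  then show False using assms(3) by auto
qed

text \<open>Cancellation reaches the zeros of \<open>P\<close> as well, because polynomial functions
  over an infinite field form an integral domain.\<close>

lemma polyf_cancel:
  fixes P Q R :: "('v \<Rightarrow> 'a::field_char_0) \<Rightarrow> 'a"
  assumes "polyf V P" "polyf V Q" "polyf V R" "\<And>x. P x * Q x = P x * R x" "P x0 \<noteq> 0"
  shows "Q x = R x"
  using polyf_mult_zero[OF assms(1) polyf_diff[OF assms(2,3)], of x0 x] assms(4,5)
  by (simp add: algebra_simps)

text \<open>Induction on the variables: with the other coordinates fixed, comparing the coefficients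
  of one power of \<open>v\<close> leaves a relation among monomials in fewer variables.\<close>

lemma monv_indep:
  fixes c :: "('v \<Rightarrow> nat) \<Rightarrow> 'a::field_char_0"
  assumes "finite V" "finite A" "\<And>\<alpha>. \<alpha> \<in> A \<Longrightarrow> mp_supp \<alpha> \<subseteq> V" "\<And>x. (\<Sum>\<alpha>\<in>A. c \<alpha> * monv V \<alpha> x) = 0" "\<alpha> \<in> A"
  shows "c \<alpha> = 0"
  using assms
proof (induction V arbitrary: A c \<alpha> rule: finite_induct)
  case empty
  have "\<beta> = (\<lambda>_. 0)" if "\<beta> \<in> A" for \<beta> using empty(2)[OF that] by (auto simp: mp_supp_def fun_eq_iff)
  then have "A = {\<alpha>}" using empty(4) by blast
  then show ?case using empty(3)[of undefined] by (simp add: monv_def)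
next
  case (insert v V)
  have sp: "monv (insert v V) \<beta> x = x v ^ \<beta> v * monv V \<beta> x" for \<beta> and x :: "'v \<Rightarrow> 'a"
    using insert by (simp add: monv_def)
  have upd: "monv V \<beta> (x(v := t)) = monv V \<beta> x" for \<beta> t and x :: "'v \<Rightarrow> 'a"
    unfolding monv_def using insert by (intro prod.cong) auto
  let ?B = "{\<beta>\<in>A. \<beta> v = \<alpha> v}"
  have B0: "(\<Sum>\<beta>\<in>?B. c \<beta> * monv V \<beta> x) = 0" for x
  proof -
    define p where "p = (\<Sum>\<beta>\<in>A. monom (c \<beta> * monv V \<beta> x) (\<beta> v))"
    have "poly p t = 0" for t
    proof -
      have "poly p t = (\<Sum>\<beta>\<in>A. c \<beta> * monv (insert v V) \<beta> (x(v := t)))"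
        by (simp add: p_def poly_sum poly_monom sp upd mult_ac)
      then show ?thesis using insert.prems(3) by simp
    qed
    then have "p = 0" using poly_all_0_iff_0 by blast
    then have "0 = coeff p (\<alpha> v)" by simp
    also have "\<dots> = (\<Sum>\<beta>\<in>A. if \<beta> v = \<alpha> v then c \<beta> * monv V \<beta> x else 0)"
      by (simp add: p_def coeff_sum)
    also have "\<dots> = (\<Sum>\<beta>\<in>?B. c \<beta> * monv V \<beta> x)"
      using insert.prems(1) by (simp add: sum.inter_filter)
    finally show ?thesis by simp
  qed
  \<comment> \<open>All members of \<open>?B\<close> have the same exponent at \<open>v\<close>, so
    erasing it loses nothing and \<open>?w\<close> restores it.\<close>
  let ?z = "\<lambda>\<beta>::'v \<Rightarrow> nat. \<beta>(v := 0)" and ?w = "\<lambda>\<beta>::'v \<Rightarrow> nat. \<beta>(v := \<alpha> v)"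
  have inv: "?w (?z \<beta>) = \<beta>" if "\<beta> \<in> ?B" for \<beta> using that by auto
  have inj: "inj_on ?z ?B" by (rule inj_on_inverseI[where g = ?w]) (rule inv)
  have "c (?w (?z \<alpha>)) = 0"
  proof (rule insert.IH[of "?z ` ?B" "\<lambda>\<beta>. c (?w \<beta>)" "?z \<alpha>"])
    show "finite (?z ` ?B)" using insert.prems(1) by auto
    show "mp_supp \<beta> \<subseteq> V" if "\<beta> \<in> ?z ` ?B" for \<beta>
    proof -
      from that obtain \<gamma> where g: "\<gamma> \<in> A" "\<beta> = ?z \<gamma>" by blast
      show ?thesis using insert.prems(2)[OF g(1)] unfolding g(2) by (auto simp: mp_supp_def split: if_splits)
    qed
    show "?z \<alpha> \<in> ?z ` ?B" using insert.prems(4) by auto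
    fix x
    have "(\<Sum>\<beta>\<in>?z ` ?B. c (?w \<beta>) * monv V \<beta> x) = (\<Sum>\<beta>\<in>?B. c (?w (?z \<beta>)) * monv V (?z \<beta>) x)"
      by (simp add: sum.reindex[OF inj])
    also have "\<dots> = (\<Sum>\<beta>\<in>?B. c \<beta> * monv V \<beta> x)"
    proof (intro sum.cong refl)
      fix \<beta> assume b: "\<beta> \<in> ?B"
      have "monv V (?z \<beta>) x = monv V \<beta> x" unfolding monv_def using insert.hyps by (intro prod.cong) auto
      then show "c (?w (?z \<beta>)) * monv V (?z \<beta>) x = c \<beta> * monv V \<beta> x" using inv[OF b] by simp
    qed
    finally show "(\<Sum>\<beta>\<in>?z ` ?B. c (?w \<beta>) * monv V \<beta> x) = 0" using B0 by simp
  qed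
  then show ?case by simp
qed

subsection \<open>Correspondence with coefficient functions\<close>

lemma monv_supp: "finite V \<Longrightarrow> mp_supp \<alpha> \<subseteq> V \<Longrightarrow> (\<Prod>v\<in>mp_supp \<alpha>. x v ^ \<alpha> v) = monv V \<alpha> x"
  unfolding monv_def by (intro prod.mono_neutral_left) (auto simp: mp_supp_def)

lemma deg_supp: "finite V \<Longrightarrow> mp_supp \<alpha> \<subseteq> V \<Longrightarrow> (\<Sum>v\<in>mp_supp \<alpha>. \<alpha> v) = (\<Sum>v\<in>V. \<alpha> v)"
  by (intro sum.mono_neutral_left) (auto simp: mp_supp_def)

lemma mp_homog_mons: "finite V \<Longrightarrow> mp_homog e G \<Longrightarrow> mp_vars_in V G \<Longrightarrow> mp_monoms G \<subseteq> mons V e"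
  by (auto simp: mp_homog_def mp_vars_in_def mons_def deg_supp)

lemma mp_eval_expand:
  assumes "finite V" "mp_monoms G \<subseteq> mons V e"
  shows "mp_eval G x = (\<Sum>\<alpha>\<in>mons V e. G \<alpha> * monv V \<alpha> x)"
proof -
  have "mp_eval G x = (\<Sum>\<alpha>\<in>mp_monoms G. G \<alpha> * monv V \<alpha> x)"
    unfolding mp_eval_def using assms by (intro sum.cong) (auto simp: mons_def monv_supp)
  also have "\<dots> = (\<Sum>\<alpha>\<in>mons V e. G \<alpha> * monv V \<alpha> x)"
    using assms by (intro sum.mono_neutral_left) (auto simp: mp_monoms_def finite_mons)
  finally show ?thesis .
qed

lemma homp_mp_eval:
  fixes G :: "('v, 'a::comm_ring_1) mpol"
  assumes "finite V" "V \<noteq> {}" "mp_homog e G" "mp_vars_in V G"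
  shows "homp V e (mp_eval G)"
proof -
  have "mp_eval G = (\<lambda>x. \<Sum>\<alpha>\<in>mons V e. G \<alpha> * monv V \<alpha> x)"
    using mp_eval_expand[OF assms(1) mp_homog_mons[OF assms(1,3,4)]] by auto
  then show ?thesis using homp_of_expand[OF assms(1,2)] by simp
qed

text \<open>The way back from functions to coefficient functions, as the definition of a Zariski
  closed set demands.\<close>

lemma homp_imp_mpol:
  assumes "homp V e \<Gamma>" "finite V"
  shows "\<exists>G. mp_homog e G \<and> mp_vars_in V G \<and> mp_eval G = \<Gamma>"
proof -
  obtain c where c: "\<And>x. \<Gamma> x = (\<Sum>\<alpha>\<in>mons V e. c \<alpha> * monv V \<alpha> x)"
    using homp_expand[OF assms] by blast
  define G where "G \<alpha> = (if \<alpha> \<in> mons V e then c \<alpha> else 0)" for \<alpha>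
  have sub: "mp_monoms G \<subseteq> mons V e" by (auto simp: mp_monoms_def G_def)
  have "mp_eval G x = \<Gamma> x" for x
    unfolding mp_eval_expand[OF assms(2) sub] c by (intro sum.cong) (auto simp: G_def)
  moreover have "mp_vars_in V G" using sub by (auto simp: mp_vars_in_def mons_def)
  moreover have "mp_homog e G"
    unfolding mp_homog_def is_mpoly_def
  proof (intro conjI ballI)
    show "finite (mp_monoms G)" using finite_subset[OF sub finite_mons[OF assms(2)]] .
  next
    fix m assume "m \<in> mp_monoms G"
    then have "m \<in> mons V e" using sub by auto
    then show "finite (mp_supp m)" "(\<Sum>v\<in>mp_supp m. m v) = e"
      using assms(2) by (auto simp: mons_def deg_supp intro: finite_subset)
  qed
  ultimately show ?thesis by blast
qed

subsection \<open>Partial derivatives\<close>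

text \<open>The formal derivative, read off from the restriction to the coordinate line in direction
  \<open>i\<close>. The restriction determines its polynomial because the field is infinite.\<close>

definition pd :: "'v \<Rightarrow> (('v \<Rightarrow> 'a::field_char_0) \<Rightarrow> 'a) \<Rightarrow> ('v \<Rightarrow> 'a) \<Rightarrow> 'a" where
  "pd i P x = poly (pderiv (THE q. \<forall>t. poly q t = P (x(i := t)))) (x i)"

lemma pd_eqI:
  assumes "\<And>t. poly q t = P (x(i := t))"
  shows "pd i P x = poly (pderiv q) (x i)"
proof -
  have "(THE q. \<forall>t. poly q t = P (x(i := t))) = q"
  proof (rule the_equality)
    fix q' assume "\<forall>t. poly q' t = P (x(i := t))"
    then have "poly q' = poly q" using assms by auto
    then show "q' = q" using poly_eq_poly_eq_iff by blast
  qed (use assms in auto)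
  then show ?thesis by (simp add: pd_def)
qed

lemma polyf_upd:
  fixes P :: "('v \<Rightarrow> 'a::comm_ring_1) \<Rightarrow> 'a"
  assumes "polyf V P"
  shows "\<exists>q. \<forall>t. poly q t = P (x(i := t))"
proof -
  have "\<exists>q. \<forall>t. poly q t = (x(i := t)) v" for v
    by (cases "v = i") (auto intro: exI[of _ "[:0, 1:]"] exI[of _ "[:x v:]"])
  then have "\<exists>q. \<forall>t. poly q t = P (\<lambda>v. (x(i := t)) v)"
    by (intro polyf_uni[OF assms]) auto
  then show ?thesis .
qed

lemma pd_const [simp]: "pd i (\<lambda>_. c) x = 0"
  by (subst pd_eqI[where q = "[:c:]"]) (auto simp: pderiv_pCons)

lemma pd_var: "pd i (\<lambda>x. x v) x = (if v = i then 1 else 0)"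
proof (cases "v = i")
  case True
  then show ?thesis by (subst pd_eqI[where q = "[:0, 1:]"]) (auto simp: pderiv_pCons)
next
  case False
  then show ?thesis by (subst pd_eqI[where q = "[:x v:]"]) (auto simp: pderiv_pCons)
qed

lemma pd_add:
  assumes "polyf V P" "polyf V Q"
  shows "pd i (\<lambda>x. P x + Q x) x = pd i P x + pd i Q x"
proof -
  obtain p q where p: "\<And>t. poly p t = P (x(i := t))" and q: "\<And>t. poly q t = Q (x(i := t))"
    using polyf_upd[OF assms(1)] polyf_upd[OF assms(2)] by metis
  have "pd i (\<lambda>x. P x + Q x) x = poly (pderiv (p + q)) (x i)"
    by (rule pd_eqI) (simp add: p q)
  then show ?thesis by (simp add: pd_eqI[OF p] pd_eqI[OF q] pderiv_add)
qed

lemma pd_mult: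
  assumes "polyf V P" "polyf V Q"
  shows "pd i (\<lambda>x. P x * Q x) x = pd i P x * Q x + P x * pd i Q x"
proof -
  obtain p q where p: "\<And>t. poly p t = P (x(i := t))" and q: "\<And>t. poly q t = Q (x(i := t))"
    using polyf_upd[OF assms(1)] polyf_upd[OF assms(2)] by metis
  have "pd i (\<lambda>x. P x * Q x) x = poly (pderiv (p * q)) (x i)"
    by (rule pd_eqI) (simp add: p q)
  then show ?thesis by (simp add: pd_eqI[OF p] pd_eqI[OF q] pderiv_mult p q algebra_simps)
qed

lemma pd_scale: "polyf V P \<Longrightarrow> pd i (\<lambda>x. c * P x) x = c * pd i P x"
  by (subst pd_mult[of V]) (auto intro: polyf_const)

lemma pd_diff:
  assumes "polyf V P" "polyf V Q"
  shows "pd i (\<lambda>x. P x - Q x) x = pd i P x - pd i Q x"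
proof -
  have "pd i (\<lambda>x. P x + (-1) * Q x) x = pd i P x + pd i (\<lambda>x. (-1) * Q x) x"
    by (rule pd_add[OF assms(1) polyf_mult[OF polyf_const assms(2)]])
  then show ?thesis using pd_scale[OF assms(2), of i "-1" x] by simp
qed

lemma pd_sum:
  "(\<And>j. j \<in> I \<Longrightarrow> polyf V (P j)) \<Longrightarrow> pd i (\<lambda>x. \<Sum>j\<in>I. P j x) x = (\<Sum>j\<in>I. pd i (P j) x)"
proof (induction I rule: infinite_finite_induct)
  case (insert j I)
  have "pd i (\<lambda>x. P j x + (\<Sum>j\<in>I. P j x)) x = pd i (P j) x + pd i (\<lambda>x. \<Sum>j\<in>I. P j x) x"
    using insert by (intro pd_add[of V] polyf_sum) auto
  then show ?case using insert by simp
qed auto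

lemma pd_power:
  assumes "polyf V P"
  shows "pd i (\<lambda>x. P x ^ k) x = of_nat k * P x ^ (k - 1) * pd i P x"
proof (induction k)
  case (Suc k)
  have "pd i (\<lambda>x. P x * P x ^ k) x = pd i P x * P x ^ k + P x * pd i (\<lambda>x. P x ^ k) x"
    using assms by (intro pd_mult[of V] polyf_power)
  then show ?case using Suc by (cases k) (auto simp: algebra_simps)
qed auto

lemma pd_cong: "(\<And>x. P x = Q x) \<Longrightarrow> pd i P x = pd i Q x"
proof -
  assume "\<And>x. P x = Q x"
  then have "P = Q" by auto
  then show ?thesis by simp
qed

lemma polyf_pd: "polyf V P \<Longrightarrow> polyf V (pd i P)"
proof (induction rule: polyf.induct)
  case (polyf_const c)
  have "pd i (\<lambda>_. c) = (\<lambda>_. 0)" by auto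
  then show ?case by (simp add: polyf.polyf_const)
next
  case (polyf_var v)
  have eq: "pd i (\<lambda>x. x v) = (\<lambda>_. if v = i then 1 else 0)" by (rule ext) (rule pd_var)
  show ?case unfolding eq by (rule polyf.polyf_const)
next
  case (polyf_add P Q)
  have eq: "pd i (\<lambda>x. P x + Q x) = (\<lambda>x. pd i P x + pd i Q x)" by (rule ext) (rule pd_add[OF polyf_add(1,2)])
  show ?case unfolding eq by (rule polyf.polyf_add[OF polyf_add(3,4)])
next
  case (polyf_mult P Q)
  have eq: "pd i (\<lambda>x. P x * Q x) = (\<lambda>x. pd i P x * Q x + P x * pd i Q x)" by (rule ext) (rule pd_mult[OF polyf_mult(1,2)])
  show ?case unfolding eq by (intro polyf.polyf_add polyf.polyf_mult polyf_mult)
qed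

text \<open>The second conjunct guards against truncated subtraction: for a factor of degree 0 the
  product rule would otherwise produce a term of the wrong degree.\<close>

lemma homp_pd_aux:
  assumes "finite V" "V \<noteq> {}"
  shows "homp V m P \<Longrightarrow> homp V (m - 1) (pd i P) \<and> (m = 0 \<longrightarrow> pd i P = (\<lambda>_. 0))"
proof (induction rule: homp.induct)
  case (homp_const c)
  have "pd i (\<lambda>_. c) = (\<lambda>_. 0)" by auto
  then show ?case by (simp add: homp_zero assms)
next
  case (homp_var v)
  have eq: "pd i (\<lambda>x. x v) = (\<lambda>_. if v = i then 1 else 0)" by (rule ext) (rule pd_var)
  show ?case unfolding eq by (simp add: homp.homp_const)
next
  case (homp_add m P Q)
  have eq: "pd i (\<lambda>x. P x + Q x) = (\<lambda>x. pd i P x + pd i Q x)"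
    by (rule ext) (rule pd_add[OF homp_polyf[OF homp_add(1)] homp_polyf[OF homp_add(2)]])
  show ?case unfolding eq using homp_add by (auto intro: homp.homp_add)
next
  case (homp_mult m P k Q)
  have eq: "pd i (\<lambda>x. P x * Q x) = (\<lambda>x. pd i P x * Q x + P x * pd i Q x)"
    by (rule ext) (rule pd_mult[OF homp_polyf[OF homp_mult(1)] homp_polyf[OF homp_mult(2)]])
  have "homp V (m + k - 1) (\<lambda>x. pd i P x * Q x)"
  proof (cases "m = 0")
    case True then show ?thesis using homp_mult by (simp add: homp_zero assms)
  next
    case False
    then have "m + k - 1 = m - 1 + k" by simp
    then show ?thesis using homp.homp_mult[of V "m - 1" "pd i P" k Q] homp_mult by simp
  qed
  moreover have "homp V (m + k - 1) (\<lambda>x. P x * pd i Q x)"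
  proof (cases "k = 0")
    case True then show ?thesis using homp_mult by (simp add: homp_zero assms)
  next
    case False
    then have "m + k - 1 = m + (k - 1)" by simp
    then show ?thesis using homp.homp_mult[of V m P "k - 1" "pd i Q"] homp_mult by simp
  qed
  ultimately show ?case unfolding eq using homp_mult by (auto intro: homp.homp_add)
qed

lemma homp_pd: "finite V \<Longrightarrow> V \<noteq> {} \<Longrightarrow> homp V m P \<Longrightarrow> homp V (m - 1) (pd i P)"
  by (rule conjunct1[OF homp_pd_aux])

lemma euler:
  assumes V: "finite V"
  shows "homp V m P \<Longrightarrow> (\<Sum>v\<in>V. x v * pd v P x) = of_nat m * P x"
proof (induction rule: homp.induct)
  case (homp_var u)
  have "(\<Sum>v\<in>V. x v * pd v (\<lambda>x. x u) x) = (\<Sum>v\<in>V. if v = u then x u else 0)"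
    by (intro sum.cong) (auto simp: pd_var)
  then show ?case using V homp_var by simp
next
  case (homp_add m P Q)
  then show ?case
    by (simp add: pd_add[OF homp_polyf homp_polyf, OF homp_add(1,2)] distrib_left sum.distrib)
next
  case (homp_mult m P k Q)
  have "(\<Sum>v\<in>V. x v * pd v (\<lambda>x. P x * Q x) x) = (\<Sum>v\<in>V. x v * pd v P x) * Q x + P x * (\<Sum>v\<in>V. x v * pd v Q x)"
    by (simp add: pd_mult[OF homp_polyf homp_polyf, OF homp_mult(1,2)] distrib_left sum.distrib
        sum_distrib_left sum_distrib_right mult_ac)
  then show ?case using homp_mult by (simp add: algebra_simps)
qed auto

lemma pd_compose:
  assumes V: "finite V" and P: "polyf V P" and F: "\<And>v. v \<in> V \<Longrightarrow> polyf U (F v)"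
  shows "pd i (\<lambda>x. P (\<lambda>v. F v x)) x = (\<Sum>v\<in>V. pd v P (\<lambda>v. F v x) * pd i (F v) x)"
  using P
proof (induction rule: polyf.induct)
  case (polyf_const c) then show ?case by simp
next
  case (polyf_var u)
  have "(\<Sum>v\<in>V. pd v (\<lambda>x. x u) (\<lambda>v. F v x) * pd i (F v) x) = (\<Sum>v\<in>V. if v = u then pd i (F u) x else 0)"
    by (intro sum.cong) (auto simp: pd_var)
  then show ?case using V polyf_var by simp
next
  case (polyf_add P Q)
  have "pd i (\<lambda>x. P (\<lambda>v. F v x) + Q (\<lambda>v. F v x)) x = pd i (\<lambda>x. P (\<lambda>v. F v x)) x + pd i (\<lambda>x. Q (\<lambda>v. F v x)) x"
    by (rule pd_add[OF polyf_compose[OF polyf_add(1) F] polyf_compose[OF polyf_add(2) F]])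
  then show ?case using polyf_add by (simp add: pd_add[OF polyf_add(1,2)] distrib_right sum.distrib)
next
  case (polyf_mult P Q)
  have "pd i (\<lambda>x. P (\<lambda>v. F v x) * Q (\<lambda>v. F v x)) x = pd i (\<lambda>x. P (\<lambda>v. F v x)) x * Q (\<lambda>v. F v x) + P (\<lambda>v. F v x) * pd i (\<lambda>x. Q (\<lambda>v. F v x)) x"
    by (rule pd_mult[OF polyf_compose[OF polyf_mult(1) F] polyf_compose[OF polyf_mult(2) F]])
  then show ?case using polyf_mult
    by (simp add: pd_mult[OF polyf_mult(1,2)] distrib_right distrib_left sum.distrib sum_distrib_left sum_distrib_right mult_ac)
qed

lemma pd_monv:
  assumes "finite V" "j \<in> V"
  shows "pd j (monv V \<alpha>) x = of_nat (\<alpha> j) * monv V (\<alpha>(j := \<alpha> j - 1)) x"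
proof -
  let ?c = "\<Prod>v\<in>V - {j}. x v ^ \<alpha> v"
  have sp: "monv V \<beta> y = y j ^ \<beta> j * (\<Prod>v\<in>V - {j}. y v ^ \<beta> v)" for \<beta> and y :: "'a \<Rightarrow> 'b"
    unfolding monv_def using assms by (simp add: prod.remove)
  have "pd j (monv V \<alpha>) x = poly (pderiv (monom ?c (\<alpha> j))) (x j)"
  proof (rule pd_eqI)
    fix t
    have "(\<Prod>v\<in>V - {j}. (x(j := t)) v ^ \<alpha> v) = ?c" by (intro prod.cong) auto
    then show "poly (monom ?c (\<alpha> j)) t = monv V \<alpha> (x(j := t))"
      by (simp add: sp poly_monom mult_ac)
  qed
  moreover have "(\<Prod>v\<in>V - {j}. x v ^ (\<alpha>(j := \<alpha> j - 1)) v) = ?c" by (intro prod.cong) auto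
  ultimately show ?thesis by (simp add: sp pderiv_monom poly_monom mult_ac)
qed

lemma mons_raise: "finite V \<Longrightarrow> j \<in> V \<Longrightarrow> \<beta> \<in> mons V e \<Longrightarrow> \<beta>(j := \<beta> j + 1) \<in> mons V (Suc e)"
  by (auto simp: mons_def mp_supp_def sum.remove[of V j])

lemma mons_lower: "finite V \<Longrightarrow> j \<in> V \<Longrightarrow> \<beta> \<in> mons V (Suc e) \<Longrightarrow> \<beta> j > 0 \<Longrightarrow> \<beta>(j := \<beta> j - 1) \<in> mons V e"
  by (auto simp: mons_def mp_supp_def sum.remove[of V j] split: if_splits)

lemma mp_eval_pderiv:
  fixes G :: "('v, 'a::field_char_0) mpol"
  assumes V: "finite V" "j \<in> V" and G: "mp_monoms G \<subseteq> mons V (Suc e)"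
  shows "mp_eval (mp_pderiv j G) x = pd j (mp_eval G) x"
proof -
  have sub: "mp_monoms (mp_pderiv j G) \<subseteq> mons V e"
  proof
    fix \<beta> assume "\<beta> \<in> mp_monoms (mp_pderiv j G)"
    then have "\<beta>(j := \<beta> j + 1) \<in> mons V (Suc e)" using G by (auto simp: mp_monoms_def mp_pderiv_def)
    from mons_lower[OF V this] show "\<beta> \<in> mons V e" by simp
  qed
  let ?A = "{\<alpha>\<in>mons V (Suc e). \<alpha> j > 0}"
  have "pd j (mp_eval G) x = pd j (\<lambda>x. \<Sum>\<alpha>\<in>mons V (Suc e). G \<alpha> * monv V \<alpha> x) x"
    by (rule pd_cong) (rule mp_eval_expand[OF V(1) G])
  also have "\<dots> = (\<Sum>\<alpha>\<in>mons V (Suc e). pd j (\<lambda>x. G \<alpha> * monv V \<alpha> x) x)"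
    using V by (intro pd_sum[of _ V] polyf_mult polyf_const homp_polyf[OF homp_mon]) auto
  also have "\<dots> = (\<Sum>\<alpha>\<in>mons V (Suc e). G \<alpha> * (of_nat (\<alpha> j) * monv V (\<alpha>(j := \<alpha> j - 1)) x))"
    using V by (intro sum.cong refl) (simp add: pd_scale[OF homp_polyf[OF homp_mon]] pd_monv)
  also have "\<dots> = (\<Sum>\<alpha>\<in>?A. G \<alpha> * (of_nat (\<alpha> j) * monv V (\<alpha>(j := \<alpha> j - 1)) x))"
    using finite_mons[OF V(1)] by (intro sum.mono_neutral_right) auto
  also have "\<dots> = (\<Sum>\<beta>\<in>mons V e. mp_pderiv j G \<beta> * monv V \<beta> x)"
    by (rule sum.reindex_bij_witness[where i = "\<lambda>\<beta>. \<beta>(j := \<beta> j + 1)" and j = "\<lambda>\<alpha>. \<alpha>(j := \<alpha> j - 1)"])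
      (use mons_raise[OF V] mons_lower[OF V] in \<open>auto simp: mp_pderiv_def mult_ac\<close>)
  finally show ?thesis by (simp add: mp_eval_expand[OF V(1) sub])
qed

subsection \<open>Graded ideals\<close>

text \<open>\<open>gid V H m\<close> is the degree \<open>m\<close> part of the ideal generated by the forms \<open>h\<close> with \<open>(deg h, h)\<close> in \<open>H\<close>, and
  \<open>cert V H N\<close> certifies that this ideal contains all forms of degree \<open>N\<close>, that is, that the forms in \<open>H\<close> have
  no common projective zero.\<close>

inductive gid :: "'v set \<Rightarrow> (nat \<times> (('v \<Rightarrow> 'a::comm_ring_1) \<Rightarrow> 'a)) set \<Rightarrow> nat \<Rightarrow> (('v \<Rightarrow> 'a) \<Rightarrow> 'a) \<Rightarrow> bool"
  for V H where
  gid_zero: "gid V H m (\<lambda>_. 0)"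
| gid_gen: "(a, h) \<in> H \<Longrightarrow> homp V b c \<Longrightarrow> gid V H (a + b) (\<lambda>x. c x * h x)"
| gid_add: "gid V H m P \<Longrightarrow> gid V H m Q \<Longrightarrow> gid V H m (\<lambda>x. P x + Q x)"

definition cert :: "'v set \<Rightarrow> (nat \<times> (('v \<Rightarrow> 'a::comm_ring_1) \<Rightarrow> 'a)) set \<Rightarrow> nat \<Rightarrow> bool" where
  "cert V H N \<longleftrightarrow> (\<forall>P. homp V N P \<longrightarrow> gid V H N P)"

lemma gid_in: "(a, h) \<in> H \<Longrightarrow> gid V H a h"
  using gid_gen[of a h H V 0 "\<lambda>_. 1"] by (simp add: homp_const)

lemma gid_mult: "gid V H m P \<Longrightarrow> homp V k Q \<Longrightarrow> gid V H (m + k) (\<lambda>x. Q x * P x)"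
proof (induction rule: gid.induct)
  case (gid_zero m) then show ?case by (simp add: gid.gid_zero)
next
  case (gid_gen a h b c)
  from gid.gid_gen[OF gid_gen(1) homp_mult[OF gid_gen(3,2)]] show ?case by (simp add: ac_simps)
next
  case (gid_add m P Q') then show ?case by (simp add: distrib_left gid.gid_add)
qed

lemma gid_scale: "gid V H m P \<Longrightarrow> gid V H m (\<lambda>x. c * P x)"
  using gid_mult[OF _ homp_const, of V H m P c] by simp

lemma gid_diff: "gid V H m P \<Longrightarrow> gid V H m Q \<Longrightarrow> gid V H m (\<lambda>x. P x - Q x)"
  using gid_add[OF _ gid_scale[where c = "-1"], of V H m P Q] by simp

lemma gid_sum: "(\<And>i. i \<in> I \<Longrightarrow> gid V H m (P i)) \<Longrightarrow> gid V H m (\<lambda>x. \<Sum>i\<in>I. P i x)"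
proof (induction I rule: infinite_finite_induct)
  case (insert i I)
  have "gid V H m (\<lambda>x. P i x + (\<Sum>i\<in>I. P i x))" using insert by (intro gid_add) auto
  then show ?case using insert(1,2) by simp
qed (auto intro: gid_zero)

lemma gid_cong: "gid V H m P \<Longrightarrow> (\<And>x. P x = Q x) \<Longrightarrow> m = k \<Longrightarrow> gid V H k Q"
proof -
  assume "gid V H m P" "\<And>x. P x = Q x" "m = k"
  moreover from this(2) have "P = Q" by auto
  ultimately show ?thesis by simp
qed

lemma gid_trans:
  assumes "gid V H m P" "\<And>a h. (a, h) \<in> H \<Longrightarrow> gid V H' a h"
  shows "gid V H' m P"
  using assms(1)
proof (induction rule: gid.induct)
  case (gid_gen a h b c)
  show ?case by (rule gid_mult[OF assms(2)[OF gid_gen(1)] gid_gen(2)])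
next
  case (gid_zero m) show ?case by (rule gid.gid_zero)
next
  case (gid_add m P Q) show ?case by (rule gid.gid_add[OF gid_add(3,4)])
qed

lemma gid_mono: "gid V H m P \<Longrightarrow> H \<subseteq> H' \<Longrightarrow> gid V H' m P"
  by (erule gid_trans) (auto intro: gid_in)

lemma gid_homp:
  assumes "finite V" "V \<noteq> {}" "\<And>a h. (a, h) \<in> H \<Longrightarrow> homp V a h"
  shows "gid V H m P \<Longrightarrow> homp V m P"
proof (induction rule: gid.induct)
  case (gid_gen a h b c)
  from homp_mult[OF gid_gen(2) assms(3)[OF gid_gen(1)]] show ?case by (simp add: add.commute)
next
  case (gid_zero m) show ?case by (rule homp_zero[OF assms(1,2)])
next
  case (gid_add m P Q) show ?case by (rule homp_add[OF gid_add(3,4)])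
qed

lemma cert_trans: "cert V H N \<Longrightarrow> (\<And>a h. (a, h) \<in> H \<Longrightarrow> gid V H' a h) \<Longrightarrow> cert V H' N"
  unfolding cert_def by (intro allI impI) (rule gid_trans, auto)

lemma cert_monI:
  fixes H :: "(nat \<times> (('v \<Rightarrow> 'a::comm_ring_1) \<Rightarrow> 'a)) set"
  assumes "finite V" "\<And>\<alpha>. \<alpha> \<in> mons V N \<Longrightarrow> gid V H N (monv V \<alpha>)"
  shows "cert V H N"
  unfolding cert_def
proof (intro allI impI)
  fix P :: "('v \<Rightarrow> 'a) \<Rightarrow> 'a" assume "homp V N P"
  then obtain c where c: "\<And>x. P x = (\<Sum>\<alpha>\<in>mons V N. c \<alpha> * monv V \<alpha> x)"
    using homp_expand assms(1) by blast
  have "gid V H N (\<lambda>x. \<Sum>\<alpha>\<in>mons V N. c \<alpha> * monv V \<alpha> x)"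
    by (intro gid_sum gid_scale assms(2))
  then show "gid V H N P" by (rule gid_cong) (auto simp: c)
qed

lemma mons_split:
  assumes "finite V"
  shows "\<alpha> \<in> mons V (m + k) \<Longrightarrow> \<exists>\<beta>\<in>mons V m. \<exists>\<gamma>\<in>mons V k. \<alpha> = (\<lambda>v. \<beta> v + \<gamma> v)"
proof (induction k arbitrary: \<alpha>)
  case 0
  then show ?case using assms by (auto simp: mons_0)
next
  case (Suc k)
  then have S: "\<alpha> \<in> mons V (Suc (m + k))" by simp
  then have "(\<Sum>v\<in>V. \<alpha> v) \<noteq> 0" by (auto simp: mons_def)
  then obtain j where j: "j \<in> V" "\<alpha> j > 0" by (metis bot_nat_0.not_eq_extremum sum.neutral)
  from Suc.IH[OF mons_lower[OF assms j(1) S j(2)]] obtain \<beta> \<gamma> where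
    bg: "\<beta> \<in> mons V m" "\<gamma> \<in> mons V k" "\<alpha>(j := \<alpha> j - 1) = (\<lambda>v. \<beta> v + \<gamma> v)" by blast
  have "\<alpha> v = \<beta> v + (\<gamma>(j := \<gamma> j + 1)) v" for v
    using fun_cong[OF bg(3), of v] j(2) by (auto split: if_splits)
  then show ?case using bg mons_raise[OF assms j(1) bg(2)] by blast
qed

lemma cert_mono:
  assumes "finite V" "cert V H N" "N \<le> M"
  shows "cert V H M"
proof (rule cert_monI[OF assms(1)])
  fix \<alpha> assume "\<alpha> \<in> mons V M"
  then obtain \<beta> \<gamma> where bg: "\<beta> \<in> mons V N" "\<gamma> \<in> mons V (M - N)" "\<alpha> = (\<lambda>v. \<beta> v + \<gamma> v)"
    using mons_split[OF assms(1), of \<alpha> N "M - N"] assms(3) by auto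
  have "gid V H N (monv V \<beta>)" using assms(2) homp_mon[OF assms(1) bg(1)] by (auto simp: cert_def)
  from gid_mult[OF this homp_mon[OF assms(1) bg(2)]]
  show "gid V H M (monv V \<alpha>)" by (rule gid_cong) (use assms(3) in \<open>auto simp: bg(3) monv_add mult_ac\<close>)
qed

text \<open>Ideal arithmetic: \<open>(S + A)(S + B)\<close> lies in \<open>S + AB\<close>. One
  membership is expanded and then the other; every term with a generator from \<open>S\<close> is
  absorbed.\<close>

lemma gid_prod:
  assumes "gid V (S \<union> A) m P" "gid V (S \<union> B) k Q"
    and S: "\<And>a h. (a, h) \<in> S \<Longrightarrow> homp V a h" and A: "\<And>a h. (a, h) \<in> A \<Longrightarrow> homp V a h"
    and B: "\<And>a h. (a, h) \<in> B \<Longrightarrow> homp V a h" and V: "finite V" "V \<noteq> {}"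
  shows "gid V (S \<union> {(a + b, \<lambda>x. h x * g x) | a h b g. (a, h) \<in> A \<and> (b, g) \<in> B}) (m + k) (\<lambda>x. P x * Q x)"
    (is "gid V ?S _ _")
  using assms(1)
proof (induction rule: gid.induct)
  case (gid_zero m) then show ?case by (simp add: gid.gid_zero)
next
  case (gid_add m P P') then show ?case by (simp add: distrib_right gid.gid_add)
next
  case (gid_gen a h j c)
  have Qh: "homp V k Q" using gid_homp[OF V _ assms(2)] S B by blast
  show ?case
  proof (cases "(a, h) \<in> S")
    case True
    have "gid V ?S (a + (j + k)) (\<lambda>x. (c x * Q x) * h x)"
      using True by (intro gid.gid_gen homp_mult[OF gid_gen(2) Qh]) auto
    then show ?thesis by (rule gid_cong) auto
  next
    case False
    then have hA: "(a, h) \<in> A" using gid_gen(1) by auto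
    show ?thesis using assms(2)
    proof (induction rule: gid.induct)
      case (gid_zero m) then show ?case by (simp add: gid.gid_zero)
    next
      case (gid_add m P P') then show ?case by (simp add: distrib_left gid.gid_add)
    next
      case inner: (gid_gen b g l c')
      show ?case
      proof (cases "(b, g) \<in> S")
        case True
        have "gid V ?S (b + (l + (j + a))) (\<lambda>x. (c' x * (c x * h x)) * g x)"
          using True by (intro gid.gid_gen homp_mult inner(2) gid_gen(2) A[OF hA]) auto
        then show ?thesis by (rule gid_cong) auto
      next
        case False
        then have gB: "(b, g) \<in> B" using inner(1) by auto
        have "gid V ?S ((a + b) + (j + l)) (\<lambda>x. (c x * c' x) * (h x * g x))"
          using hA gB by (intro gid.gid_gen homp_mult inner(2) gid_gen(2)) auto
        then show ?thesis by (rule gid_cong) auto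
      qed
    qed
  qed
qed

text \<open>Geometrically: if neither \<open>A\<close> nor \<open>B\<close> has a common zero on the
  zero set of \<open>S\<close>, then the products of their members have none there.\<close>

lemma cert_prod:
  assumes "cert V (S \<union> A) N" "cert V (S \<union> B) M"
    and S: "\<And>a h. (a, h) \<in> S \<Longrightarrow> homp V a h" and A: "\<And>a h. (a, h) \<in> A \<Longrightarrow> homp V a h"
    and B: "\<And>a h. (a, h) \<in> B \<Longrightarrow> homp V a h" and V: "finite V" "V \<noteq> {}"
  shows "cert V (S \<union> {(a + b, \<lambda>x. h x * g x) | a h b g. (a, h) \<in> A \<and> (b, g) \<in> B}) (N + M)"
proof (rule cert_monI[OF V(1)])
  fix \<alpha> assume "\<alpha> \<in> mons V (N + M)"
  then obtain \<beta> \<gamma> where bg: "\<beta> \<in> mons V N" "\<gamma> \<in> mons V M" "\<alpha> = (\<lambda>v. \<beta> v + \<gamma> v)"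
    using mons_split[OF V(1)] by blast
  have "gid V (S \<union> A) N (monv V \<beta>)" "gid V (S \<union> B) M (monv V \<gamma>)"
    using assms(1,2) homp_mon[OF V(1)] bg by (auto simp: cert_def)
  from gid_prod[OF this S A B V] show "gid V (S \<union> {(a + b, \<lambda>x. h x * g x) | a h b g. (a, h) \<in> A \<and> (b, g) \<in> B}) (N + M) (monv V \<alpha>)"
    by (rule gid_cong) (auto simp: bg(3) monv_add)
qed

lemma gid_compose:
  assumes "gid V H m P" "\<And>v. v \<in> V \<Longrightarrow> homp U D (F v)"
  shows "gid U {(D * a, \<lambda>x. h (\<lambda>v. F v x)) | a h. (a, h) \<in> H} (D * m) (\<lambda>x. P (\<lambda>v. F v x))"
  using assms(1)
proof (induction rule: gid.induct)
  case (gid_zero m) then show ?case by (simp add: gid.gid_zero)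
next
  case (gid_add m P P') then show ?case by (simp add: gid.gid_add)
next
  case (gid_gen a h b c)
  have "gid U {(D * a, \<lambda>x. h (\<lambda>v. F v x)) | a h. (a, h) \<in> H} (D * a + D * b) (\<lambda>x. c (\<lambda>v. F v x) * h (\<lambda>v. F v x))"
    using gid_gen by (intro gid.gid_gen homp_compose[OF _ assms(2)]) auto
  then show ?case by (simp add: distrib_left)
qed

text \<open>If the \<open>F v\<close> have no common projective zero, then neither have the
  monomials of degree \<open>N\<close> in them. Each induction step multiplies by one more factor
  through \<open>cert_prod\<close> with empty \<open>S\<close>.\<close>

lemma cert_power:
  assumes V: "finite V" "V \<noteq> {}" and U: "finite U" "U \<noteq> {}" and F: "\<And>v. v \<in> V \<Longrightarrow> homp U D (F v)"
    and c: "cert U {(D, F v) | v. v \<in> V} N1"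
  shows "cert U {(D * N, \<lambda>x. monv V \<beta> (\<lambda>v. F v x)) | \<beta>. \<beta> \<in> mons V N} (N * N1)"
proof (induction N)
  case 0
  have m: "(0, \<lambda>_. 1) \<in> {(D * 0, \<lambda>x. monv V \<beta> (\<lambda>v. F v x)) | \<beta>. \<beta> \<in> mons V 0}"
    using V by (auto simp: mons_0 monv_def)
  show ?case unfolding cert_def
  proof (intro allI impI)
    fix P :: "('b \<Rightarrow> 'c) \<Rightarrow> 'c" assume "homp U (0 * N1) P"
    then have P: "homp U 0 P" by simp
    from gid_gen[OF m, of U 0 P] P show "gid U {(D * 0, \<lambda>x. monv V \<beta> (\<lambda>v. F v x)) | \<beta>. \<beta> \<in> mons V 0} (0 * N1) P"
      by simp
  qed
next
  case (Suc N)
  let ?A = "{(D, F v) | v. v \<in> V}" and ?B = "{(D * N, \<lambda>x. monv V \<beta> (\<lambda>v. F v x)) | \<beta>. \<beta> \<in> mons V N}"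
  have B: "homp U a h" if "(a, h) \<in> ?B" for a h
  proof -
    from that obtain \<beta> where "\<beta> \<in> mons V N" "a = D * N" "h = (\<lambda>x. monv V \<beta> (\<lambda>v. F v x))" by blast
    then show ?thesis using homp_compose[where F = F and k = D and U = U, OF homp_mon[OF V(1)]] F by simp
  qed
  have c1: "cert U ({} \<union> {(a + b, \<lambda>x. h x * g x) | a h b g. (a, h) \<in> ?A \<and> (b, g) \<in> ?B}) (N1 + N * N1)"
    using c Suc F B U by (intro cert_prod) auto
  have "gid U {(D * Suc N, \<lambda>x. monv V \<beta> (\<lambda>v. F v x)) | \<beta>. \<beta> \<in> mons V (Suc N)} a h"
    if "(a, h) \<in> {} \<union> {(a + b, \<lambda>x. h x * g x) | a h b g. (a, h) \<in> ?A \<and> (b, g) \<in> ?B}" for a h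
  proof -
    from that obtain v \<beta> where v: "v \<in> V" "\<beta> \<in> mons V N" "a = D + D * N" "h = (\<lambda>x. F v x * monv V \<beta> (\<lambda>v. F v x))"
      by auto
    have eq: "monv V (\<lambda>u. (if u = v then 1 else 0) + \<beta> u) y = y v * monv V \<beta> y" for y :: "'a \<Rightarrow> 'c"
      using monv_single[OF v(1) V(1), of 1 y] by (simp add: monv_add)
    have "h = (\<lambda>x. monv V (\<lambda>u. (if u = v then 1 else 0) + \<beta> u) (\<lambda>v. F v x))" unfolding v(4) eq ..
    moreover have "(\<lambda>u. (if u = v then 1 else 0) + \<beta> u) \<in> mons V (1 + N)"
      using mons_add[OF mons_single[OF v(1) V(1)] v(2)] .
    ultimately have "(a, h) \<in> {(D * Suc N, \<lambda>x. monv V \<beta> (\<lambda>v. F v x)) | \<beta>. \<beta> \<in> mons V (Suc N)}"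
      using v(3) by auto
    then show ?thesis by (rule gid_in)
  qed
  from cert_trans[OF c1 this] show ?case by simp
qed

text \<open>Pullback along a morphism: a common zero of the composed forms would go under
  \<open>F\<close> to a common zero of \<open>H\<close>, and \<open>F\<close> sends no projective
  point to the origin.\<close>

lemma cert_compose:
  assumes V: "finite V" "V \<noteq> {}" and U: "finite U" "U \<noteq> {}" and F: "\<And>v. v \<in> V \<Longrightarrow> homp U D (F v)"
    and c: "cert U {(D, F v) | v. v \<in> V} N1" and H: "cert V H N"
  shows "cert U {(D * a, \<lambda>x. h (\<lambda>v. F v x)) | a h. (a, h) \<in> H} (N * N1)"
proof (rule cert_trans[OF cert_power[OF V U F c]])
  fix a h assume "(a, h) \<in> {(D * N, \<lambda>x. monv V \<beta> (\<lambda>v. F v x)) | \<beta>. \<beta> \<in> mons V N}"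
  then obtain \<beta> where b: "\<beta> \<in> mons V N" "a = D * N" "h = (\<lambda>x. monv V \<beta> (\<lambda>v. F v x))" by auto
  have "gid V H N (monv V \<beta>)" using H homp_mon[OF V(1) b(1)] by (auto simp: cert_def)
  from gid_compose[where F = F and U = U and D = D, OF this] F show "gid U {(D * a, \<lambda>x. h (\<lambda>v. F v x)) | a h. (a, h) \<in> H} a h"
    unfolding b(2,3) by blast
qed

subsection \<open>Determinants and bihomogeneous families\<close>

lemma homp_det:
  assumes "finite W" "W \<noteq> {}" "\<And>i j. i < K \<Longrightarrow> j < K \<Longrightarrow> homp W e (\<lambda>w. M w i j)"
  shows "homp W (K * e) (\<lambda>w. det (mat K K (\<lambda>(i, j). M w i j)))"
proof -
  have eq: "(\<lambda>w. det (mat K K (\<lambda>(i, j). M w i j))) =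
    (\<lambda>w. \<Sum>p\<in>{p. p permutes {0..<K}}. signof p * (\<Prod>i=0..<K. M w i (p i)))"
  proof
    fix w
    have "det (mat K K (\<lambda>(i, j). M w i j)) = (\<Sum>p\<in>{p. p permutes {0..<K}}. signof p * (\<Prod>i=0..<K. mat K K (\<lambda>(i, j). M w i j) $$ (i, p i)))"
      by (rule det_def') auto
    also have "\<dots> = (\<Sum>p\<in>{p. p permutes {0..<K}}. signof p * (\<Prod>i=0..<K. M w i (p i)))"
    proof (intro sum.cong refl arg_cong2[where f = "(*)"] prod.cong)
      fix p i assume "p \<in> {p. p permutes {0..<K}}" "i \<in> {0..<K}"
      then show "mat K K (\<lambda>(i, j). M w i j) $$ (i, p i) = M w i (p i)"
        using permutes_in_image[of p "{0..<K}" i] by auto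
    qed
    finally show "det (mat K K (\<lambda>(i, j). M w i j)) = (\<Sum>p\<in>{p. p permutes {0..<K}}. signof p * (\<Prod>i=0..<K. M w i (p i)))" .
  qed
  have *: "homp W (K * e) (\<lambda>w. \<Prod>i=0..<K. M w i (p i))" if "p permutes {0..<K}" for p
  proof -
    have "homp W (sum (\<lambda>_. e) {0..<K}) (\<lambda>w. \<Prod>i\<in>{0..<K}. M w i (p i))"
    proof (rule homp_prod)
      fix i assume "i \<in> {0..<K}"
      then show "homp W e (\<lambda>w. M w i (p i))" using permutes_in_image[OF that, of i] assms(3) by auto
    qed simp
    then show ?thesis by simp
  qed
  show ?thesis unfolding eq
    by (rule homp_sum[OF assms(1,2)]) (auto intro!: homp_scale *)
qed

lemma polyf_det:
  assumes "\<And>i j. i < K \<Longrightarrow> j < K \<Longrightarrow> polyf W (\<lambda>w. M w i j)"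
  shows "polyf W (\<lambda>w. det (mat K K (\<lambda>(i, j). M w i j)))"
proof -
  have eq: "(\<lambda>w. det (mat K K (\<lambda>(i, j). M w i j))) =
    (\<lambda>w. \<Sum>p\<in>{p. p permutes {0..<K}}. signof p * (\<Prod>i=0..<K. M w i (p i)))"
  proof
    fix w
    have "det (mat K K (\<lambda>(i, j). M w i j)) = (\<Sum>p\<in>{p. p permutes {0..<K}}. signof p * (\<Prod>i=0..<K. mat K K (\<lambda>(i, j). M w i j) $$ (i, p i)))"
      by (rule det_def') auto
    also have "\<dots> = (\<Sum>p\<in>{p. p permutes {0..<K}}. signof p * (\<Prod>i=0..<K. M w i (p i)))"
    proof (intro sum.cong refl arg_cong2[where f = "(*)"] prod.cong)
      fix p i assume "p \<in> {p. p permutes {0..<K}}" "i \<in> {0..<K}"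
      then show "mat K K (\<lambda>(i, j). M w i j) $$ (i, p i) = M w i (p i)"
        using permutes_in_image[of p "{0..<K}" i] by auto
    qed
    finally show "det (mat K K (\<lambda>(i, j). M w i j)) = (\<Sum>p\<in>{p. p permutes {0..<K}}. signof p * (\<Prod>i=0..<K. M w i (p i)))" .
  qed
  show ?thesis unfolding eq
  proof (rule polyf_sum, rule polyf_mult[OF polyf_const], rule polyf_prod)
    fix p i assume "p \<in> {p. p permutes {0..<K}}" "i \<in> {0..<K}"
    then show "polyf W (\<lambda>w. M w i (p i))" using permutes_in_image[of p "{0..<K}" i] assms by auto
  qed
qed

text \<open>Forms of bidegree (\<open>e\<close>, \<open>m\<close>) in parameters and variables,
  stored through their coefficients in the variables because the openness argument takes
  determinants of coefficient matrices.\<close>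

definition bh :: "'w set \<Rightarrow> 'v set \<Rightarrow> nat \<Rightarrow> nat \<Rightarrow> (('w \<Rightarrow> 'a::comm_ring_1) \<Rightarrow> ('v \<Rightarrow> 'a) \<Rightarrow> 'a) \<Rightarrow> bool" where
  "bh W V e m \<Theta> \<longleftrightarrow> (\<exists>t. (\<forall>\<beta>. homp W e (t \<beta>)) \<and> (\<forall>w x. \<Theta> w x = (\<Sum>\<beta>\<in>mons V m. t \<beta> w * monv V \<beta> x)))"

locale bihom =
  fixes W :: "'w set" and V :: "'v set"
  assumes finW: "finite W" and neW: "W \<noteq> {}" and finV: "finite V" and neV: "V \<noteq> {}"
begin

lemma bh_add: "bh W V e m P \<Longrightarrow> bh W V e m Q \<Longrightarrow> bh W V e m (\<lambda>w x. P w x + Q w x)"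
proof -
  assume "bh W V e m P" "bh W V e m Q"
  then obtain t t' where "\<And>\<beta>. homp W e (t \<beta>)" "\<And>\<beta>. homp W e (t' \<beta>)"
     "\<And>w x. P w x = (\<Sum>\<beta>\<in>mons V m. t \<beta> w * monv V \<beta> x)" "\<And>w x. Q w x = (\<Sum>\<beta>\<in>mons V m. t' \<beta> w * monv V \<beta> x)"
    unfolding bh_def by blast
  then show ?thesis unfolding bh_def
    by (intro exI[of _ "\<lambda>\<beta> w. t \<beta> w + t' \<beta> w"]) (simp add: homp_add sum.distrib distrib_right)
qed

lemma bh_mult: "bh W V e m P \<Longrightarrow> bh W V e' k Q \<Longrightarrow> bh W V (e + e') (m + k) (\<lambda>w x. P w x * Q w x)"
proof -
  assume "bh W V e m P" "bh W V e' k Q"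
  then obtain t t' where t: "\<And>\<beta>. homp W e (t \<beta>)" "\<And>\<beta>. homp W e' (t' \<beta>)" and
     *: "\<And>w x. P w x = (\<Sum>\<beta>\<in>mons V m. t \<beta> w * monv V \<beta> x)" "\<And>w x. Q w x = (\<Sum>\<beta>\<in>mons V k. t' \<beta> w * monv V \<beta> x)"
    unfolding bh_def by blast
  define u where "u \<gamma> w = (\<Sum>p\<in>{p\<in>mons V m \<times> mons V k. (\<lambda>v. fst p v + snd p v) = \<gamma>}. t (fst p) w * t' (snd p) w)" for \<gamma> w
  have "homp W (e + e') (u \<gamma>)" for \<gamma>
    unfolding u_def by (intro homp_sum finW neW homp_mult t)
  moreover have "P w x * Q w x = (\<Sum>\<gamma>\<in>mons V (m + k). u \<gamma> w * monv V \<gamma> x)" for w x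
    unfolding * u_def by (rule monv_expand_mult[OF finV])
  ultimately show ?thesis unfolding bh_def by blast
qed

lemma bh_param: "homp W e \<Gamma> \<Longrightarrow> bh W V e 0 (\<lambda>w x. \<Gamma> w)"
  unfolding bh_def using finV by (intro exI[of _ "\<lambda>_. \<Gamma>"]) (auto simp: mons_0 monv_def)

lemma bh_form: "homp V m P \<Longrightarrow> bh W V 0 m (\<lambda>w. P)"
proof -
  assume "homp V m P"
  then obtain c where "\<And>x. P x = (\<Sum>\<alpha>\<in>mons V m. c \<alpha> * monv V \<alpha> x)" using homp_expand finV by blast
  then show ?thesis unfolding bh_def by (intro exI[of _ "\<lambda>\<beta> _. c \<beta>"]) (auto simp: homp_const)
qed

lemma bh_zero: "bh W V e m (\<lambda>w x. 0)"
  unfolding bh_def by (intro exI[of _ "\<lambda>_ _. 0"]) (auto simp: homp_zero finW neW)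

lemma bh_const: "bh W V 0 0 (\<lambda>w x. c)"
  by (rule bh_param[OF homp_const])

lemma bh_scale: "bh W V e m P \<Longrightarrow> bh W V e m (\<lambda>w x. c * P w x)"
  using bh_mult[OF bh_const, of e m P c] by simp

lemma bh_sum: "(\<And>i. i \<in> I \<Longrightarrow> bh W V e m (P i)) \<Longrightarrow> bh W V e m (\<lambda>w x. \<Sum>i\<in>I. P i w x)"
proof (induction I rule: infinite_finite_induct)
  case (insert i I)
  have "bh W V e m (\<lambda>w x. P i w x + (\<Sum>i\<in>I. P i w x))" using insert by (intro bh_add) auto
  then show ?case using insert(1,2) by simp
qed (auto simp: bh_zero)

lemma bh_prod: "finite I \<Longrightarrow> (\<And>i. i \<in> I \<Longrightarrow> bh W V e m (P i)) \<Longrightarrow> bh W V (card I * e) (card I * m) (\<lambda>w x. \<Prod>i\<in>I. P i w x)"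
proof (induction I rule: finite_induct)
  case empty then show ?case using bh_const[of 1] by simp
next
  case (insert i I)
  have "bh W V (e + card I * e) (m + card I * m) (\<lambda>w x. P i w x * (\<Prod>i\<in>I. P i w x))"
    using insert by (intro bh_mult) auto
  then show ?case using insert(1,2) by simp
qed

lemma bh_det:
  assumes "\<And>i j. i < K \<Longrightarrow> j < K \<Longrightarrow> bh W V e m (\<lambda>w x. M w x i j)"
  shows "bh W V (K * e) (K * m) (\<lambda>w x. det (mat K K (\<lambda>(i, j). M w x i j)))"
proof -
  have eq: "det (mat K K (\<lambda>(i, j). M w x i j)) =
    (\<Sum>p\<in>{p. p permutes {0..<K}}. signof p * (\<Prod>i=0..<K. M w x i (p i)))" for w x
  proof -
    have "det (mat K K (\<lambda>(i, j). M w x i j)) = (\<Sum>p\<in>{p. p permutes {0..<K}}. signof p * (\<Prod>i=0..<K. mat K K (\<lambda>(i, j). M w x i j) $$ (i, p i)))"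
      by (rule det_def') auto
    also have "\<dots> = (\<Sum>p\<in>{p. p permutes {0..<K}}. signof p * (\<Prod>i=0..<K. M w x i (p i)))"
    proof (intro sum.cong refl arg_cong2[where f = "(*)"] prod.cong)
      fix p i assume "p \<in> {p. p permutes {0..<K}}" "i \<in> {0..<K}"
      then show "mat K K (\<lambda>(i, j). M w x i j) $$ (i, p i) = M w x i (p i)"
        using permutes_in_image[of p "{0..<K}" i] by auto
    qed
    finally show ?thesis .
  qed
  have *: "bh W V (K * e) (K * m) (\<lambda>w x. \<Prod>i=0..<K. M w x i (p i))" if "p permutes {0..<K}" for p
  proof -
    have "bh W V (card {0..<K} * e) (card {0..<K} * m) (\<lambda>w x. \<Prod>i\<in>{0..<K}. M w x i (p i))"
    proof (rule bh_prod)
      fix i assume "i \<in> {0..<K}"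
      then show "bh W V e m (\<lambda>w x. M w x i (p i))" using permutes_in_image[OF that, of i] assms by auto
    qed simp
    then show ?thesis by simp
  qed
  show ?thesis unfolding eq
    by (rule bh_sum) (auto intro!: bh_scale *)
qed

lemma bh_eval: "bh W V e m \<Theta> \<Longrightarrow> homp W e (\<lambda>w. \<Theta> w x)"
proof -
  assume "bh W V e m \<Theta>"
  then obtain t where t: "\<And>\<beta>. homp W e (t \<beta>)" "\<And>w x. \<Theta> w x = (\<Sum>\<beta>\<in>mons V m. t \<beta> w * monv V \<beta> x)"
    unfolding bh_def by blast
  have "homp W e (\<lambda>w. \<Sum>\<beta>\<in>mons V m. monv V \<beta> x * t \<beta> w)"
    by (intro homp_sum finW neW homp_scale t)
  then show ?thesis unfolding t(2) by (simp add: mult.commute)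
qed

lemma bh_homp: "bh W V e m \<Theta> \<Longrightarrow> homp V m (\<Theta> w)"
proof -
  assume "bh W V e m \<Theta>"
  then obtain t where t: "\<And>w x. \<Theta> w x = (\<Sum>\<beta>\<in>mons V m. t \<beta> w * monv V \<beta> x)"
    unfolding bh_def by blast
  have "\<Theta> w = (\<lambda>x. \<Sum>\<beta>\<in>mons V m. t \<beta> w * monv V \<beta> x)" using t by auto
  then show ?thesis using homp_of_expand[OF finV neV] by simp
qed

end

lemma (in bihom) bh_pd:
  fixes \<Theta> :: "('w \<Rightarrow> 'a::field_char_0) \<Rightarrow> ('v \<Rightarrow> 'a) \<Rightarrow> 'a"
  assumes "bh W V e m \<Theta>"
  shows "bh W V e (m - 1) (\<lambda>w. pd i (\<Theta> w))"
proof -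
  from assms obtain t where t: "\<And>\<beta>. homp W e (t \<beta>)" "\<And>w x. \<Theta> w x = (\<Sum>\<beta>\<in>mons V m. t \<beta> w * monv V \<beta> x)"
    unfolding bh_def by blast
  have "pd i (\<Theta> w) x = (\<Sum>\<beta>\<in>mons V m. t \<beta> w * pd i (monv V \<beta>) x)" for w x
  proof -
    have "pd i (\<Theta> w) x = pd i (\<lambda>x. \<Sum>\<beta>\<in>mons V m. t \<beta> w * monv V \<beta> x) x"
      by (rule pd_cong) (rule t(2))
    also have "\<dots> = (\<Sum>\<beta>\<in>mons V m. pd i (\<lambda>x. t \<beta> w * monv V \<beta> x) x)"
      by (intro pd_sum[of _ V] polyf_mult polyf_const homp_polyf[OF homp_mon[OF finV]])
    also have "\<dots> = (\<Sum>\<beta>\<in>mons V m. t \<beta> w * pd i (monv V \<beta>) x)"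
      by (intro sum.cong refl pd_scale[OF homp_polyf[OF homp_mon[OF finV]]])
    finally show ?thesis .
  qed
  then have eq: "(\<lambda>w. pd i (\<Theta> w)) = (\<lambda>w x. \<Sum>\<beta>\<in>mons V m. t \<beta> w * pd i (monv V \<beta>) x)" by (intro ext)
  show ?thesis unfolding eq
  proof (rule bh_sum)
    fix \<beta> assume b: "\<beta> \<in> mons V m"
    have "bh W V (e + 0) (0 + (m - 1)) (\<lambda>w x. t \<beta> w * pd i (monv V \<beta>) x)"
      by (intro bh_mult bh_param t bh_form homp_pd[OF finV neV homp_mon[OF finV b]])
    then show "bh W V e (m - 1) (\<lambda>w x. t \<beta> w * pd i (monv V \<beta>) x)" by simp
  qed
qed

text \<open>Cofactors free of the parameter leave the family with the parameter degree
  \<open>e\<close> of the generators. This uniform degree makes the later determinant of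
  coefficients homogeneous.\<close>

lemma (in bihom) gid_family:
  fixes h :: "'i \<Rightarrow> ('w \<Rightarrow> 'a::comm_ring_1) \<Rightarrow> ('v \<Rightarrow> 'a) \<Rightarrow> 'a"
  assumes h: "\<And>i. i \<in> I \<Longrightarrow> bh W V e (a i) (h i)"
    and g: "gid V {(a i, h i w1) | i. i \<in> I} m P"
  shows "\<exists>E. bh W V e m E \<and> (\<forall>x. E w1 x = P x) \<and> (\<forall>w. gid V {(a i, h i w) | i. i \<in> I} m (E w))"
  using g
proof (induction rule: gid.induct)
  case (gid_zero m)
  show ?case by (intro exI[of _ "\<lambda>_ _. 0"]) (auto simp: bh_zero gid.gid_zero)
next
  case (gid_gen d g b c)
  then obtain i where i: "i \<in> I" "d = a i" "g = h i w1" by auto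
  have "bh W V (0 + e) (b + a i) (\<lambda>w x. c x * h i w x)"
    by (intro bh_mult bh_form gid_gen h i)
  then have "bh W V e (d + b) (\<lambda>w x. c x * h i w x)" by (simp add: i(2) add.commute)
  moreover have "gid V {(a i, h i w) | i. i \<in> I} (d + b) (\<lambda>x. c x * h i w x)" for w
    using i by (intro gid.gid_gen gid_gen(2)) auto
  ultimately show ?case by (intro exI[of _ "\<lambda>w x. c x * h i w x"]) (auto simp: i)
next
  case (gid_add m P Q)
  then obtain E E' where "bh W V e m E" "\<forall>x. E w1 x = P x" "\<forall>w. gid V {(a i, h i w) | i. i \<in> I} m (E w)"
    "bh W V e m E'" "\<forall>x. E' w1 x = Q x" "\<forall>w. gid V {(a i, h i w) | i. i \<in> I} m (E' w)" by blast
  then show ?case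
    by (intro exI[of _ "\<lambda>w x. E w x + E' w x"] conjI) (simp_all add: bh_add gid.gid_add)
qed

text \<open>Membership certificates at one parameter value persist on a principal Zariski open set: fix the
  cofactors and let the generators vary; the coefficient matrix is the identity at the given parameter.\<close>
lemma (in bihom) cert_open:
  fixes h :: "'i \<Rightarrow> ('w \<Rightarrow> 'a::field_char_0) \<Rightarrow> ('v \<Rightarrow> 'a) \<Rightarrow> 'a"
  assumes h: "\<And>i. i \<in> I \<Longrightarrow> bh W V e (a i) (h i)"
    and c: "cert V {(a i, h i w1) | i. i \<in> I} N"
  shows "\<exists>e' \<Gamma>. homp W e' \<Gamma> \<and> \<Gamma> w1 \<noteq> 0 \<and> (\<forall>w. \<Gamma> w \<noteq> 0 \<longrightarrow> cert V {(a i, h i w) | i. i \<in> I} N)"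
proof -
  let ?K = "card (mons V N)"
  obtain en where en: "bij_betw en {0..<?K} (mons V N)"
    using ex_bij_betw_nat_finite[OF finite_mons[OF finV]] by blast
  have enin: "en i \<in> mons V N" if "i < ?K" for i using en that by (auto simp: bij_betw_def)
  have "\<forall>i. \<exists>E. i < ?K \<longrightarrow> bh W V e N E \<and> (\<forall>x. E w1 x = monv V (en i) x) \<and> (\<forall>w. gid V {(a i, h i w) | i. i \<in> I} N (E w))"
  proof
    fix i
    show "\<exists>E. i < ?K \<longrightarrow> bh W V e N E \<and> (\<forall>x. E w1 x = monv V (en i) x) \<and> (\<forall>w. gid V {(a i, h i w) | i. i \<in> I} N (E w))"
    proof (cases "i < ?K")
      case True
      have "gid V {(a i, h i w1) | i. i \<in> I} N (monv V (en i))"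
        using c homp_mon[OF finV enin[OF True]] unfolding cert_def by blast
      from gid_family[OF h this] show ?thesis by blast
    qed auto
  qed
  from choice[OF this] obtain E where "\<forall>i. i < ?K \<longrightarrow> bh W V e N (E i) \<and> (\<forall>x. E i w1 x = monv V (en i) x) \<and> (\<forall>w. gid V {(a i, h i w) | i. i \<in> I} N (E i w))" ..
  then have E: "\<And>i. i < ?K \<Longrightarrow> bh W V e N (E i)" "\<And>i x. i < ?K \<Longrightarrow> E i w1 x = monv V (en i) x"
    "\<And>i w. i < ?K \<Longrightarrow> gid V {(a i, h i w) | i. i \<in> I} N (E i w)" by auto
  have "\<forall>i. \<exists>t. i < ?K \<longrightarrow> (\<forall>\<beta>. homp W e (t \<beta>)) \<and> (\<forall>w x. E i w x = (\<Sum>\<beta>\<in>mons V N. t \<beta> w * monv V \<beta> x))"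
    using E(1) unfolding bh_def by blast
  from choice[OF this] obtain t where "\<forall>i. i < ?K \<longrightarrow> (\<forall>\<beta>. homp W e (t i \<beta>)) \<and> (\<forall>w x. E i w x = (\<Sum>\<beta>\<in>mons V N. t i \<beta> w * monv V \<beta> x))" ..
  then have t: "\<And>i \<beta>. i < ?K \<Longrightarrow> homp W e (t i \<beta>)"
    "\<And>i w x. i < ?K \<Longrightarrow> E i w x = (\<Sum>\<beta>\<in>mons V N. t i \<beta> w * monv V \<beta> x)" by auto
  \<comment> \<open>Row \<open>i\<close> holds the coefficients of the family that specialises to
    the monomial \<open>en i\<close> at \<open>w1\<close>.\<close>
  define T where "T w = mat ?K ?K (\<lambda>(i, j). t i (en j) w)" for w
  have sumen: "(\<Sum>\<beta>\<in>mons V N. f \<beta>) = (\<Sum>j\<in>{0..<?K}. f (en j))" for f :: "('v \<Rightarrow> nat) \<Rightarrow> 'a"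
    by (rule sum.reindex_bij_betw[OF en, symmetric])
  have "T w1 = 1\<^sub>m ?K"
  proof (rule eq_matI)
    fix i j assume ij: "i < dim_row (1\<^sub>m ?K :: 'a mat)" "j < dim_col (1\<^sub>m ?K :: 'a mat)"
    define cc where "cc \<beta> = t i \<beta> w1 - (if \<beta> = en i then 1 else 0)" for \<beta>
    have "(\<Sum>\<beta>\<in>mons V N. cc \<beta> * monv V \<beta> x) = 0" for x
    proof -
      have "(\<Sum>\<beta>\<in>mons V N. (if \<beta> = en i then 1 else 0) * monv V \<beta> x) = (\<Sum>\<beta>\<in>mons V N. if \<beta> = en i then monv V (en i) x else 0)"
        by (intro sum.cong) auto
      also have "\<dots> = monv V (en i) x" using enin ij finite_mons[OF finV] by simp
      finally show ?thesis using t(2)[of i w1 x] E(2)[of i x] ij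
        by (simp add: cc_def left_diff_distrib sum_subtractf)
    qed
    from monv_indep[where c = cc and A = "mons V N" and \<alpha> = "en j", OF finV finite_mons[OF finV] _ this]
    have "cc (en j) = 0" using enin ij by (auto simp: mons_def)
    moreover have "en j = en i \<longleftrightarrow> i = j"
      using en ij by (auto simp: bij_betw_def inj_on_def)
    ultimately show "T w1 $$ (i, j) = 1\<^sub>m ?K $$ (i, j)" using ij by (auto simp: T_def cc_def)
  qed (auto simp: T_def)
  then have n0: "det (T w1) \<noteq> 0" by simp
  have hom: "homp W (?K * e) (\<lambda>w. det (T w))"
    unfolding T_def by (rule homp_det[OF finW neW]) (auto intro: t)
  have "cert V {(a i, h i w) | i. i \<in> I} N" if nz: "det (T w) \<noteq> 0" for w
  proof (rule cert_monI[OF finV])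
    fix \<alpha> assume "\<alpha> \<in> mons V N"
    then have "\<alpha> \<in> en ` {0..<?K}" using en by (simp add: bij_betw_def)
    then obtain k where k: "k < ?K" "\<alpha> = en k" by auto
    have Tc: "T w \<in> carrier_mat ?K ?K" by (auto simp: T_def)
    note adj = adj_mat[OF Tc]
    \<comment> \<open>Cramer's rule: row \<open>k\<close> of the adjugate combines the families into
      \<open>det (T w)\<close> times the monomial \<open>en k\<close>.\<close>
    have "gid V {(a i, h i w) | i. i \<in> I} N (\<lambda>x. (1 / det (T w)) * (\<Sum>i\<in>{0..<?K}. adj_mat (T w) $$ (k, i) * E i w x))"
      by (intro gid_scale gid_sum E(3)) auto
    then show "gid V {(a i, h i w) | i. i \<in> I} N (monv V \<alpha>)"
    proof (rule gid_cong)
      fix x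
      have "(\<Sum>i\<in>{0..<?K}. adj_mat (T w) $$ (k, i) * E i w x)
        = (\<Sum>i\<in>{0..<?K}. \<Sum>j\<in>{0..<?K}. adj_mat (T w) $$ (k, i) * (T w $$ (i, j)) * monv V (en j) x)"
        by (intro sum.cong refl) (simp add: t(2) sumen T_def sum_distrib_left mult.assoc)
      also have "\<dots> = (\<Sum>j\<in>{0..<?K}. (\<Sum>i\<in>{0..<?K}. adj_mat (T w) $$ (k, i) * (T w $$ (i, j))) * monv V (en j) x)"
        by (subst sum.swap) (simp add: sum_distrib_right)
      also have "\<dots> = (\<Sum>j\<in>{0..<?K}. (adj_mat (T w) * T w) $$ (k, j) * monv V (en j) x)"
        using k adj(1) Tc by (intro sum.cong refl) (simp add: scalar_prod_def)
      also have "\<dots> = (\<Sum>j\<in>{0..<?K}. if j = k then det (T w) * monv V (en k) x else 0)"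
        unfolding adj(3) using k by (intro sum.cong) auto
      also have "\<dots> = det (T w) * monv V (en k) x" using k by simp
      finally show "(1 / det (T w)) * (\<Sum>i\<in>{0..<?K}. adj_mat (T w) $$ (k, i) * E i w x) = monv V \<alpha> x"
        using nz k by simp
    qed simp
  qed
  then show ?thesis using hom n0 by blast
qed

subsection \<open>Linear systems with more unknowns than equations\<close>

text \<open>Induction on the equations: an equation with a nonzero coefficient is solved for one
  unknown, which is then eliminated from the others.\<close>

lemma nontrivial_solution:
  fixes a :: "'e \<Rightarrow> 'i \<Rightarrow> 'a::field"
  assumes "finite E" "finite I" "card E < card I"
  shows "\<exists>l. (\<exists>i\<in>I. l i \<noteq> 0) \<and> (\<forall>e\<in>E. (\<Sum>i\<in>I. l i * a e i) = 0)"
  using assms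
proof (induction E arbitrary: I a rule: finite_induct)
  case empty
  then obtain i where "i \<in> I" by fastforce
  then show ?case by (intro exI[of _ "\<lambda>_. 1"]) auto
next
  case (insert e E)
  show ?case
  proof (cases "\<forall>i\<in>I. a e i = 0")
    case True
    from insert.IH[of I a] insert.prems insert.hyps obtain l where
      "\<exists>i\<in>I. l i \<noteq> 0" "\<forall>e\<in>E. (\<Sum>i\<in>I. l i * a e i) = 0" by auto
    then show ?thesis using True by (intro exI[of _ l]) auto
  next
    case False
    then obtain p where p: "p \<in> I" "a e p \<noteq> 0" by auto
    let ?I = "I - {p}"
    have "card E < card ?I" using insert p by simp
    with insert.IH[of ?I "\<lambda>e' i. a e' i - a e' p / a e p * a e i"] insert.prems obtain l where
      l: "\<exists>i\<in>?I. l i \<noteq> 0" "\<And>e'. e' \<in> E \<Longrightarrow> (\<Sum>i\<in>?I. l i * (a e' i - a e' p / a e p * a e i)) = 0" by auto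
    define s where "s = (\<Sum>i\<in>?I. l i * a e i)"
    define l' where "l' = l(p := - s / a e p)"
    have sum: "(\<Sum>i\<in>I. l' i * a e' i) = - s / a e p * a e' p + (\<Sum>i\<in>?I. l i * a e' i)" for e'
    proof -
      have "(\<Sum>i\<in>I. l' i * a e' i) = l' p * a e' p + (\<Sum>i\<in>?I. l' i * a e' i)"
        using p insert.prems by (simp add: sum.remove)
      also have "(\<Sum>i\<in>?I. l' i * a e' i) = (\<Sum>i\<in>?I. l i * a e' i)"
        by (intro sum.cong) (auto simp: l'_def)
      finally show ?thesis by (simp add: l'_def)
    qed
    have "(\<Sum>i\<in>I. l' i * a e' i) = 0" if "e' \<in> insert e E" for e'
    proof (cases "e' = e")
      case True then show ?thesis using p by (simp add: sum s_def)
    next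
      case False
      then have "e' \<in> E" using that by auto
      from l(2)[OF this] have "(\<Sum>i\<in>?I. l i * a e' i) = a e' p / a e p * s"
        by (simp add: right_diff_distrib sum_subtractf s_def sum_distrib_left mult_ac)
      then show ?thesis by (simp add: sum)
    qed
    moreover have "\<exists>i\<in>I. l' i \<noteq> 0" using l(1) by (auto simp: l'_def)
    ultimately show ?thesis by blast
  qed
qed

subsection \<open>Division by a form that is monic in one variable\<close>

lemma polyf_graded:
  assumes V: "finite V" "V \<noteq> {}"
  shows "polyf V P \<Longrightarrow> \<exists>K Q. (\<forall>m. homp V m (Q m)) \<and> (\<forall>x. P x = (\<Sum>m<K. Q m x))"
proof (induction rule: polyf.induct)
  case (polyf_const c)
  show ?case
    by (intro exI[of _ 1] exI[of _ "\<lambda>m x. if m = 0 then c else 0"])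
      (auto simp: homp_const homp_zero V)
next
  case (polyf_var v)
  have "homp V m (if m = 1 then (\<lambda>x. x v) else (\<lambda>_. 0))" for m
    using homp_var[OF polyf_var] by (auto simp: homp_zero V)
  then show ?case
    by (intro exI[of _ 2] exI[of _ "\<lambda>m. if m = 1 then (\<lambda>x. x v) else (\<lambda>_. 0)"] conjI allI) (assumption, simp add: numeral_2_eq_2)
next
  case (polyf_add P P')
  then obtain K Q K' Q' where *: "\<And>m. homp V m (Q m)" "\<And>x. P x = (\<Sum>m<K. Q m x)"
     "\<And>m. homp V m (Q' m)" "\<And>x. P' x = (\<Sum>m<K'. Q' m x)" by blast
  \<comment> \<open>The indicators cut off \<open>Q m\<close> and \<open>Q' m\<close>, which are
    arbitrary forms beyond \<open>K\<close> and \<open>K'\<close>.\<close>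
  define R where "R m = (\<lambda>x. (if m < K then 1 else 0) * Q m x + (if m < K' then 1 else 0) * Q' m x)" for m
  have "homp V m (R m)" for m unfolding R_def by (rule homp_add[OF homp_scale[OF *(1)] homp_scale[OF *(3)]])
  moreover have "P x + P' x = (\<Sum>m<K + K'. R m x)" for x
  proof -
    have "(\<Sum>m<K + K'. R m x) = (\<Sum>m<K + K'. if m < K then Q m x else 0) + (\<Sum>m<K + K'. if m < K' then Q' m x else 0)"
      unfolding R_def sum.distrib[symmetric] by (intro sum.cong) auto
    also have "(\<Sum>m<K + K'. if m < K then Q m x else 0) = (\<Sum>m<K. Q m x)"
      by (intro sum.mono_neutral_cong_right) auto
    also have "(\<Sum>m<K + K'. if m < K' then Q' m x else 0) = (\<Sum>m<K'. Q' m x)"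
      by (intro sum.mono_neutral_cong_right) auto
    finally show ?thesis by (simp add: *)
  qed
  ultimately show ?case by (intro exI[of _ "K + K'"] exI[of _ R]) simp
next
  case (polyf_mult P P')
  then obtain K Q K' Q' where *: "\<And>m. homp V m (Q m)" "\<And>x. P x = (\<Sum>m<K. Q m x)"
     "\<And>m. homp V m (Q' m)" "\<And>x. P' x = (\<Sum>m<K'. Q' m x)" by blast
  define R where "R s = (\<lambda>x. \<Sum>p\<in>{p\<in>{..<K} \<times> {..<K'}. fst p + snd p = s}. Q (fst p) x * Q' (snd p) x)" for s
  have "homp V s (R s)" for s unfolding R_def
  proof (intro homp_sum V)
    fix p assume "p \<in> {p\<in>{..<K} \<times> {..<K'}. fst p + snd p = s}"
    then show "homp V s (\<lambda>x. Q (fst p) x * Q' (snd p) x)"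
      using homp_mult[OF *(1)[of "fst p"] *(3)[of "snd p"]] by simp
  qed
  moreover have "P x * P' x = (\<Sum>s<K + K'. R s x)" for x
  proof -
    have "P x * P' x = (\<Sum>p\<in>{..<K} \<times> {..<K'}. Q (fst p) x * Q' (snd p) x)"
      by (simp add: * sum_product sum.cartesian_product split_def)
    also have "\<dots> = (\<Sum>s<K + K'. R s x)" unfolding R_def
      by (rule sum_fiberwise[symmetric]) auto
    finally show ?thesis .
  qed
  ultimately show ?case by (intro exI[of _ "K + K'"] exI[of _ R]) simp
qed

text \<open>Normal forms: these monomials are a basis of the forms of degree \<open>m\<close> modulo
  a form of degree \<open>e\<close> that is monic in \<open>v0\<close>. Their number plays the part
  of the Hilbert function of the quotient.\<close>

definition red :: "'v set \<Rightarrow> 'v \<Rightarrow> nat \<Rightarrow> nat \<Rightarrow> ('v \<Rightarrow> nat) set" where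
  "red V v0 e m = {\<alpha>\<in>mons V m. \<alpha> v0 < e}"

definition unitv :: "'v \<Rightarrow> 'v \<Rightarrow> 'a::comm_ring_1" where
  "unitv v = (\<lambda>u. if u = v then 1 else 0)"

definition dvdp :: "'v set \<Rightarrow> (('v \<Rightarrow> 'a::comm_ring_1) \<Rightarrow> 'a) \<Rightarrow> (('v \<Rightarrow> 'a) \<Rightarrow> 'a) \<Rightarrow> bool" where
  "dvdp V J P \<longleftrightarrow> (\<exists>S. polyf V S \<and> (\<forall>x. P x = J x * S x))"

text \<open>The value at the unit vector is the coefficient of the \<open>e\<close>-th power of
  \<open>v0\<close>, so \<open>lead\<close> expresses monicity up to a unit.\<close>

locale monic_form =
  fixes V :: "'v set" and v0 :: 'v and e :: nat and J :: "('v \<Rightarrow> 'a::field_char_0) \<Rightarrow> 'a"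
  assumes finV: "finite V" and v0: "v0 \<in> V" and J: "homp V e J" and lead: "J (unitv v0) \<noteq> 0"
begin

lemma neV: "V \<noteq> {}" using v0 by auto

lemma J_expand: "\<exists>c. (\<forall>x. J x = (\<Sum>\<alpha>\<in>mons V e. c \<alpha> * monv V \<alpha> x)) \<and> c (\<lambda>v. if v = v0 then e else 0) \<noteq> 0"
proof -
  let ?top = "\<lambda>v. if v = v0 then e else 0"
  obtain c where c: "\<And>x. J x = (\<Sum>\<alpha>\<in>mons V e. c \<alpha> * monv V \<alpha> x)" using homp_expand[OF J finV] by blast
  have "monv V \<alpha> (unitv v0 :: 'v \<Rightarrow> 'a) = (if \<alpha> = ?top then 1 else 0)" if a: "\<alpha> \<in> mons V e" for \<alpha>
  proof (cases "\<alpha> = ?top")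
    case True
    then show ?thesis using monv_single[OF v0 finV, of e "unitv v0 :: 'v \<Rightarrow> 'a"] by (simp add: unitv_def)
  next
    case False
    have "\<exists>v\<in>V. v \<noteq> v0 \<and> \<alpha> v \<noteq> 0"
    proof (rule ccontr)
      assume "\<not> ?thesis"
      then have z: "\<alpha> v = 0" if "v \<noteq> v0" for v using that a by (cases "v \<in> V") (auto simp: mons_def mp_supp_def)
      then have "(\<Sum>v\<in>V. \<alpha> v) = \<alpha> v0" using finV v0 by (simp add: sum.remove)
      then have "\<alpha> = ?top" using z a by (auto simp: mons_def)
      with False show False by simp
    qed
    then obtain v where "v \<in> V" "v \<noteq> v0" "\<alpha> v \<noteq> 0" by auto
    then have "(unitv v0 v :: 'a) ^ \<alpha> v = 0" by (simp add: unitv_def)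
    then show ?thesis using False \<open>v \<in> V\<close> finV by (auto simp: monv_def intro: prod_zero)
  qed
  then have "J (unitv v0) = (\<Sum>\<alpha>\<in>mons V e. if \<alpha> = ?top then c ?top else 0)"
    unfolding c by (intro sum.cong) auto
  also have "\<dots> = c ?top" using mons_single[OF v0 finV, of e] finite_mons[OF finV] by simp
  finally show ?thesis using c lead by auto
qed

lemma mons_top: "\<alpha> \<in> mons V e \<Longrightarrow> \<alpha> \<noteq> (\<lambda>v. if v = v0 then e else 0) \<Longrightarrow> \<alpha> v0 < e"
proof -
  assume a: "\<alpha> \<in> mons V e" and n: "\<alpha> \<noteq> (\<lambda>v. if v = v0 then e else 0)"
  have s: "\<alpha> v0 + (\<Sum>v\<in>V - {v0}. \<alpha> v) = e" using a finV v0 by (simp add: mons_def sum.remove)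
  show ?thesis
  proof (rule ccontr)
    assume "\<not> \<alpha> v0 < e"
    with s have e: "\<alpha> v0 = e" "(\<Sum>v\<in>V - {v0}. \<alpha> v) = 0" by auto
    then have "\<forall>v\<in>V - {v0}. \<alpha> v = 0" using finV by simp
    then have "\<alpha> v = (if v = v0 then e else 0)" for v
      using a e by (cases "v \<in> V") (auto simp: mons_def mp_supp_def)
    then show False using n by auto
  qed
qed

text \<open>Degree-preserving division by \<open>J\<close>. The clause for \<open>m < e\<close>
  excludes a constant quotient, which the truncated degree \<open>m - e = 0\<close> would
  permit.\<close>

definition divs :: "nat \<Rightarrow> (('v \<Rightarrow> 'a) \<Rightarrow> 'a) \<Rightarrow> bool" where
  "divs m P \<longleftrightarrow> (\<exists>S r. homp V (m - e) S \<and> (m < e \<longrightarrow> (\<forall>x. S x = 0)) \<and>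
     (\<forall>x. P x = J x * S x + (\<Sum>\<beta>\<in>red V v0 e m. r \<beta> * monv V \<beta> x)))"

lemma divs_zero: "divs m (\<lambda>_. 0)"
  unfolding divs_def by (intro exI[of _ "\<lambda>_. 0"]) (auto simp: homp_zero finV neV)

lemma divs_add: "divs m P \<Longrightarrow> divs m Q \<Longrightarrow> divs m (\<lambda>x. P x + Q x)"
proof -
  assume "divs m P" "divs m Q"
  then obtain S r S' r' where "homp V (m - e) S" "m < e \<longrightarrow> (\<forall>x. S x = 0)"
     "\<And>x. P x = J x * S x + (\<Sum>\<beta>\<in>red V v0 e m. r \<beta> * monv V \<beta> x)"
     "homp V (m - e) S'" "m < e \<longrightarrow> (\<forall>x. S' x = 0)"
     "\<And>x. Q x = J x * S' x + (\<Sum>\<beta>\<in>red V v0 e m. r' \<beta> * monv V \<beta> x)" unfolding divs_def by blast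
  then show ?thesis unfolding divs_def
    by (intro exI[of _ "\<lambda>x. S x + S' x"] exI[of _ "\<lambda>\<beta>. r \<beta> + r' \<beta>"])
      (auto simp: homp_add distrib_left distrib_right sum.distrib)
qed

lemma divs_scale: "divs m P \<Longrightarrow> divs m (\<lambda>x. c * P x)"
proof -
  assume "divs m P"
  then obtain S r where "homp V (m - e) S" "m < e \<longrightarrow> (\<forall>x. S x = 0)"
     "\<And>x. P x = J x * S x + (\<Sum>\<beta>\<in>red V v0 e m. r \<beta> * monv V \<beta> x)" unfolding divs_def by blast
  then show ?thesis unfolding divs_def
    by (intro exI[of _ "\<lambda>x. c * S x"] exI[of _ "\<lambda>\<beta>. c * r \<beta>"])
      (auto simp: homp_scale distrib_left sum_distrib_left mult_ac)
qed

lemma divs_sum: "(\<And>i. i \<in> I \<Longrightarrow> divs m (P i)) \<Longrightarrow> divs m (\<lambda>x. \<Sum>i\<in>I. P i x)"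
proof (induction I rule: infinite_finite_induct)
  case (insert i I)
  have "divs m (\<lambda>x. P i x + (\<Sum>i\<in>I. P i x))" using insert by (intro divs_add) auto
  then show ?case using insert(1,2) by simp
qed (auto simp: divs_zero)

lemma divs_mult_J: "homp V k Q \<Longrightarrow> divs (e + k) (\<lambda>x. J x * Q x)"
  unfolding divs_def by (intro exI[of _ Q] exI[of _ "\<lambda>_. 0"]) auto

lemma divs_red: "\<alpha> \<in> red V v0 e m \<Longrightarrow> divs m (monv V \<alpha>)"
proof -
  assume a: "\<alpha> \<in> red V v0 e m"
  have fin: "finite (red V v0 e m)" using finite_mons[OF finV] by (simp add: red_def)
  have "(\<Sum>\<beta>\<in>red V v0 e m. (if \<beta> = \<alpha> then 1 else 0) * monv V \<beta> x) = monv V \<alpha> x" for x :: "'v \<Rightarrow> 'a"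
  proof -
    have "(\<Sum>\<beta>\<in>red V v0 e m. (if \<beta> = \<alpha> then 1 else 0) * monv V \<beta> x) = (\<Sum>\<beta>\<in>red V v0 e m. if \<beta> = \<alpha> then monv V \<alpha> x else 0)"
      by (intro sum.cong) auto
    then show ?thesis using a fin by simp
  qed
  then show ?thesis unfolding divs_def
    by (intro exI[of _ "\<lambda>_. 0"] exI[of _ "\<lambda>\<beta>. if \<beta> = \<alpha> then 1 else 0"]) (auto simp: homp_zero finV neV)
qed

text \<open>Rewriting with \<open>J\<close> replaces the \<open>e\<close>-th power of
  \<open>v0\<close> by terms of lower degree in \<open>v0\<close>, hence the induction on that
  exponent.\<close>

lemma divs_mon: "\<alpha> \<in> mons V m \<Longrightarrow> divs m (monv V \<alpha>)"
proof (induction "\<alpha> v0" arbitrary: \<alpha> rule: less_induct)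
  case less
  show ?case
  proof (cases "\<alpha> v0 < e")
    case True
    then show ?thesis using less by (intro divs_red) (auto simp: red_def)
  next
    case False
    let ?top = "\<lambda>v. if v = v0 then e else 0"
    obtain c where c: "\<And>x. J x = (\<Sum>\<alpha>\<in>mons V e. c \<alpha> * monv V \<alpha> x)" and c0: "c ?top \<noteq> 0"
      using J_expand by blast
    define \<beta> where "\<beta> = \<alpha>(v0 := \<alpha> v0 - e)"
    have ab: "\<alpha> = (\<lambda>v. \<beta> v + ?top v)" using False by (auto simp: \<beta>_def)
    have sa: "\<alpha> v0 + (\<Sum>v\<in>V - {v0}. \<alpha> v) = m" using less.prems finV v0 by (simp add: mons_def sum.remove)
    have sb: "(\<Sum>v\<in>V - {v0}. \<beta> v) = (\<Sum>v\<in>V - {v0}. \<alpha> v)" by (intro sum.cong) (auto simp: \<beta>_def)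
    have b: "\<beta> \<in> mons V (m - e)" and me: "e + (m - e) = m"
    proof -
      have "(\<Sum>v\<in>V. \<beta> v) = \<beta> v0 + (\<Sum>v\<in>V - {v0}. \<beta> v)" using finV v0 by (simp add: sum.remove)
      also have "\<dots> = m - e" using sa sb False by (simp add: \<beta>_def)
      finally have "(\<Sum>v\<in>V. \<beta> v) = m - e" .
      moreover have "mp_supp \<beta> \<subseteq> V" using less.prems v0 by (auto simp: mons_def mp_supp_def \<beta>_def split: if_splits)
      ultimately show "\<beta> \<in> mons V (m - e)" by (simp add: mons_def)
      show "e + (m - e) = m" using sa False by simp
    qed
    have small: "divs m (monv V (\<lambda>v. \<beta> v + \<gamma> v))" if g: "\<gamma> \<in> mons V e - {?top}" for \<gamma>
    proof (rule less.hyps)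
      have "\<gamma> v0 < e" using mons_top g by auto
      then show "\<beta> v0 + \<gamma> v0 < \<alpha> v0" using False by (simp add: \<beta>_def)
      show "(\<lambda>v. \<beta> v + \<gamma> v) \<in> mons V m" using mons_add[OF b, of \<gamma> e] g me by (simp add: add.commute)
    qed
    have "divs m (\<lambda>x. (1 / c ?top) * (J x * monv V \<beta> x + (\<Sum>\<gamma>\<in>mons V e - {?top}. (- c \<gamma>) * monv V (\<lambda>v. \<beta> v + \<gamma> v) x)))"
      using divs_mult_J[OF homp_mon[OF finV b]] me by (intro divs_scale divs_add divs_sum small) auto
    moreover have "(1 / c ?top) * (J x * monv V \<beta> x + (\<Sum>\<gamma>\<in>mons V e - {?top}. (- c \<gamma>) * monv V (\<lambda>v. \<beta> v + \<gamma> v) x)) = monv V \<alpha> x" for x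
    proof -
      have "J x * monv V \<beta> x = (\<Sum>\<gamma>\<in>mons V e. c \<gamma> * monv V (\<lambda>v. \<beta> v + \<gamma> v) x)"
        by (simp add: c sum_distrib_left sum_distrib_right monv_add mult_ac)
      also have "\<dots> = c ?top * monv V \<alpha> x + (\<Sum>\<gamma>\<in>mons V e - {?top}. c \<gamma> * monv V (\<lambda>v. \<beta> v + \<gamma> v) x)"
        using mons_single[OF v0 finV, of e] finite_mons[OF finV] by (subst sum.remove[of _ ?top]) (auto simp: ab)
      finally show ?thesis using c0 by (simp add: sum_negf)
    qed
    ultimately show ?thesis by simp
  qed
qed

lemma divs_homp: "homp V m P \<Longrightarrow> divs m P"
proof -
  assume "homp V m P"
  then obtain c where c: "\<And>x. P x = (\<Sum>\<alpha>\<in>mons V m. c \<alpha> * monv V \<alpha> x)" using homp_expand finV by blast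
  have "divs m (\<lambda>x. \<Sum>\<alpha>\<in>mons V m. c \<alpha> * monv V \<alpha> x)" by (intro divs_sum divs_scale divs_mon)
  moreover have "P = (\<lambda>x. \<Sum>\<alpha>\<in>mons V m. c \<alpha> * monv V \<alpha> x)" using c by auto
  ultimately show ?thesis by simp
qed

lemma monv_upd: "monv V \<alpha> (x(v0 := t)) = (\<Prod>v\<in>V - {v0}. x v ^ \<alpha> v) * t ^ \<alpha> v0"
proof -
  have "monv V \<alpha> (x(v0 := t)) = (x(v0 := t)) v0 ^ \<alpha> v0 * (\<Prod>v\<in>V - {v0}. (x(v0 := t)) v ^ \<alpha> v)"
    unfolding monv_def using finV v0 by (rule prod.remove)
  also have "(\<Prod>v\<in>V - {v0}. (x(v0 := t)) v ^ \<alpha> v) = (\<Prod>v\<in>V - {v0}. x v ^ \<alpha> v)" by (intro prod.cong) auto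
  finally show ?thesis by (simp add: mult.commute del: fun_upd_apply) simp
qed

text \<open>The leading coefficient in \<open>v0\<close> is a constant, so the degree drops on no
  line in direction \<open>v0\<close>.\<close>

lemma J_poly: "\<exists>p. degree p = e \<and> (\<forall>t. poly p t = J (x(v0 := t)))"
proof -
  let ?top = "\<lambda>v. if v = v0 then e else 0"
  obtain c where c: "\<And>x. J x = (\<Sum>\<alpha>\<in>mons V e. c \<alpha> * monv V \<alpha> x)" and c0: "c ?top \<noteq> 0" using J_expand by blast
  define p where "p = (\<Sum>\<alpha>\<in>mons V e. monom (c \<alpha> * (\<Prod>v\<in>V - {v0}. x v ^ \<alpha> v)) (\<alpha> v0))"
  have "poly p t = J (x(v0 := t))" for t
    by (simp add: p_def c poly_sum poly_monom monv_upd mult_ac)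
  moreover have "degree p \<le> e" unfolding p_def
  proof (rule degree_sum_le[OF finite_mons[OF finV]])
    fix \<alpha> assume "\<alpha> \<in> mons V e"
    then have "\<alpha> v0 \<le> e" using finV v0 by (auto simp: mons_def member_le_sum)
    then show "degree (monom (c \<alpha> * (\<Prod>v\<in>V - {v0}. x v ^ \<alpha> v)) (\<alpha> v0)) \<le> e"
      using degree_monom_le le_trans by blast
  qed
  moreover have "coeff p e \<noteq> 0"
  proof -
    have "coeff p e = (\<Sum>\<alpha>\<in>mons V e. if \<alpha> = ?top then c ?top else 0)"
      unfolding p_def coeff_sum
    proof (intro sum.cong refl)
      fix \<alpha> assume a: "\<alpha> \<in> mons V e"
      show "coeff (monom (c \<alpha> * (\<Prod>v\<in>V - {v0}. x v ^ \<alpha> v)) (\<alpha> v0)) e = (if \<alpha> = ?top then c ?top else 0)"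
      proof (cases "\<alpha> = ?top")
        case True
        have "(\<Prod>v\<in>V - {v0}. x v ^ ?top v) = 1" by (intro prod.neutral) auto
        then show ?thesis by (simp add: True)
      next
        case False
        then show ?thesis using mons_top[OF a False] by simp
      qed
    qed
    then show ?thesis using c0 mons_single[OF v0 finV, of e] finite_mons[OF finV] by simp
  qed
  ultimately show ?thesis using le_degree by (intro exI[of _ p]) (auto intro: antisym)
qed

text \<open>On a line in direction \<open>v0\<close> the right side has degree below
  \<open>e\<close>, while a nonzero multiple of \<open>J\<close> has degree at least
  \<open>e\<close>.\<close>

lemma red_unique:
  assumes S: "polyf V S" and A: "finite A" "\<And>\<alpha>. \<alpha> \<in> A \<Longrightarrow> mp_supp \<alpha> \<subseteq> V \<and> \<alpha> v0 < e"
    and eq: "\<And>x. J x * S x = (\<Sum>\<alpha>\<in>A. r \<alpha> * monv V \<alpha> x)"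
  shows "S x = 0" "\<alpha> \<in> A \<Longrightarrow> r \<alpha> = 0"
proof -
  have S0: "S x = 0" for x
  proof -
    obtain p where p: "degree p = e" "\<And>t. poly p t = J (x(v0 := t))" using J_poly by blast
    obtain q where q: "\<And>t. poly q t = S (x(v0 := t))" using polyf_upd[OF S] by blast
    define R where "R = (\<Sum>\<alpha>\<in>A. monom (r \<alpha> * (\<Prod>v\<in>V - {v0}. x v ^ \<alpha> v)) (\<alpha> v0))"
    have "poly (p * q) = poly R"
    proof
      fix t
      have "poly R t = (\<Sum>\<alpha>\<in>A. r \<alpha> * monv V \<alpha> (x(v0 := t)))"
        by (simp add: R_def poly_sum poly_monom monv_upd mult_ac)
      then show "poly (p * q) t = poly R t" using eq[of "x(v0 := t)"] p q by simp
    qed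
    then have pq: "p * q = R" using poly_eq_poly_eq_iff by blast
    have Rc: "coeff R k = 0" if "k \<ge> e" for k
      unfolding R_def coeff_sum using A(2) that by (intro sum.neutral) force
    have "q = 0"
    proof (rule ccontr)
      assume q0: "q \<noteq> 0"
      show False
      proof (cases "p = 0")
        \<comment> \<open>A zero restriction has degree 0, so \<open>e = 0\<close> and
          \<open>J\<close> would be a nonzero constant.\<close>
        case True
        then have "e = 0" "p = 0" using p by auto
        obtain c where c: "\<And>x. J x = (\<Sum>\<alpha>\<in>mons V e. c \<alpha> * monv V \<alpha> x)" and c0: "c (\<lambda>v. if v = v0 then e else 0) \<noteq> 0" using J_expand by blast
        have "J (x(v0 := 0)) = c (\<lambda>_. 0)" unfolding c \<open>e = 0\<close> by (simp add: mons_0[OF finV] monv_def)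
        moreover have "c (\<lambda>_. 0) \<noteq> 0" using c0 \<open>e = 0\<close> by (simp cong: if_cong)
        ultimately show False using p(2)[of 0] True by simp
      next
        case False
        then have "degree (p * q) \<ge> e" using q0 p by (simp add: degree_mult_eq)
        then have "coeff R (degree R) = 0" using Rc pq by simp
        then have "R = 0" by simp
        then show False using pq False q0 by simp
      qed
    qed
    then show ?thesis using q[of "x v0"] by simp
  qed
  show "S x = 0" by (rule S0)
  assume a: "\<alpha> \<in> A"
  have "(\<Sum>\<alpha>\<in>A. r \<alpha> * monv V \<alpha> x) = 0" for x using eq[of x] S0[of x] by simp
  then show "r \<alpha> = 0" using A a by (intro monv_indep[where c = r and A = A and \<alpha> = \<alpha>, OF finV A(1)]) auto
qed

lemma polyf_div:
  assumes P: "polyf V P"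
  shows "\<exists>S A r. polyf V S \<and> finite A \<and> (\<forall>\<alpha>\<in>A. mp_supp \<alpha> \<subseteq> V \<and> \<alpha> v0 < e) \<and>
    (\<forall>x. P x = J x * S x + (\<Sum>\<alpha>\<in>A. r \<alpha> * monv V \<alpha> x))"
proof -
  obtain K Q where Q: "\<And>m. homp V m (Q m)" "\<And>x. P x = (\<Sum>m<K. Q m x)"
    using polyf_graded[OF finV neV P] by blast
  have "\<forall>m. \<exists>S. \<exists>r. homp V (m - e) S \<and> (\<forall>x. Q m x = J x * S x + (\<Sum>\<beta>\<in>red V v0 e m. r \<beta> * monv V \<beta> x))"
    using divs_homp[OF Q(1)] unfolding divs_def by blast
  from choice[OF this] obtain S where "\<forall>m. \<exists>r. homp V (m - e) (S m) \<and> (\<forall>x. Q m x = J x * S m x + (\<Sum>\<beta>\<in>red V v0 e m. r \<beta> * monv V \<beta> x))" ..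
  from choice[OF this] obtain r where r: "\<And>m. homp V (m - e) (S m)"
    "\<And>m x. Q m x = J x * S m x + (\<Sum>\<beta>\<in>red V v0 e m. r m \<beta> * monv V \<beta> x)" by blast
  define A where "A = (\<Union>m<K. red V v0 e m)"
  have fr: "finite (red V v0 e m)" for m using finite_mons[OF finV] by (simp add: red_def)
  have dj: "disjoint_family_on (red V v0 e) {..<K}"
    by (auto simp: disjoint_family_on_def red_def mons_def)
  \<comment> \<open>The homogeneous parts contribute disjoint sets of monomials, so the total degree
    of \<open>\<alpha>\<close> tells which remainder supplies its coefficient.\<close>
  have "P x = J x * (\<Sum>m<K. S m x) + (\<Sum>\<alpha>\<in>A. r (\<Sum>v\<in>V. \<alpha> v) \<alpha> * monv V \<alpha> x)" for x
  proof -
    have "(\<Sum>\<alpha>\<in>A. r (\<Sum>v\<in>V. \<alpha> v) \<alpha> * monv V \<alpha> x) = (\<Sum>m<K. \<Sum>\<alpha>\<in>red V v0 e m. r (\<Sum>v\<in>V. \<alpha> v) \<alpha> * monv V \<alpha> x)"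
      unfolding A_def using fr dj by (intro sum.UNION_disjoint_family) auto
    also have "\<dots> = (\<Sum>m<K. \<Sum>\<alpha>\<in>red V v0 e m. r m \<alpha> * monv V \<alpha> x)"
      by (intro sum.cong refl) (auto simp: red_def mons_def)
    finally show ?thesis by (simp add: Q(2) r(2) sum.distrib sum_distrib_left)
  qed
  moreover have "polyf V (\<lambda>x. \<Sum>m<K. S m x)" by (intro polyf_sum homp_polyf[OF r(1)])
  moreover have "finite A" "\<forall>\<alpha>\<in>A. mp_supp \<alpha> \<subseteq> V \<and> \<alpha> v0 < e"
    using fr by (auto simp: A_def red_def mons_def)
  ultimately show ?thesis by (intro exI[of _ "\<lambda>x. \<Sum>m<K. S m x"] exI[of _ A] exI[of _ "\<lambda>\<alpha>. r (\<Sum>v\<in>V. \<alpha> v) \<alpha>"]) simp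
qed

text \<open>Division of a form yields a homogeneous quotient, and uniqueness of the remainder
  identifies it with the given quotient.\<close>

lemma dvdp_homp:
  assumes "dvdp V J P" "homp V m P"
  shows "\<exists>S. homp V (m - e) S \<and> (m < e \<longrightarrow> (\<forall>x. S x = 0)) \<and> (\<forall>x. P x = J x * S x)"
proof -
  obtain S0 where S0: "polyf V S0" "\<And>x. P x = J x * S0 x" using assms(1) by (auto simp: dvdp_def)
  obtain S r where S: "homp V (m - e) S" "m < e \<longrightarrow> (\<forall>x. S x = 0)"
    "\<And>x. P x = J x * S x + (\<Sum>\<beta>\<in>red V v0 e m. r \<beta> * monv V \<beta> x)"
    using divs_homp[OF assms(2)] unfolding divs_def by blast
  have "S0 x - S x = 0" for x
  proof (rule red_unique(1)[where S = "\<lambda>x. S0 x - S x" and A = "red V v0 e m" and r = r])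
    show "polyf V (\<lambda>x. S0 x - S x)" by (intro polyf_diff S0 homp_polyf[OF S(1)])
    show "J x * (S0 x - S x) = (\<Sum>\<alpha>\<in>red V v0 e m. r \<alpha> * monv V \<alpha> x)" for x
      using S0(2)[of x] S(3)[of x] by (simp add: algebra_simps)
    show "finite (red V v0 e m)" using finite_mons[OF finV] by (simp add: red_def)
  qed (auto simp: red_def mons_def)
  then have "P x = J x * S x" for x using S0(2)[of x] by simp
  then show ?thesis using S by (intro exI[of _ S]) simp
qed

end

declare One_nat_def [simp del]

subsection \<open>Irreducibility of smooth plane curves\<close>

text \<open>Only the second cofactor keeps its degree: it is the one that is counted modulo
  \<open>A\<close>.\<close>

lemma gid_two:
  assumes V: "finite V" "V \<noteq> {}"
  shows "gid V {(p, A), (q, B)} m P \<Longrightarrow> \<exists>U W. polyf V U \<and> homp V (m - q) W \<and> (\<forall>x. P x = A x * U x + B x * W x)"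
proof (induction rule: gid.induct)
  case (gid_zero m)
  show ?case by (intro exI[of _ "\<lambda>_. 0"]) (simp add: polyf_const homp_zero V)
next
  case (gid_gen a h b c)
  then consider "a = p" "h = A" | "a = q" "h = B" by auto
  then show ?case
  proof cases
    case 1
    then show ?thesis using homp_polyf[OF gid_gen(2)]
      by (intro exI[of _ c] exI[of _ "\<lambda>_. 0"]) (simp add: homp_zero V)
  next
    case 2
    then show ?thesis using gid_gen(2)
      by (intro exI[of _ "\<lambda>_. 0"] exI[of _ c]) (simp add: polyf_const)
  qed
next
  case (gid_add m P Q)
  then obtain U W U' W' where "polyf V U" "homp V (m - q) W" "\<forall>x. P x = A x * U x + B x * W x"
     "polyf V U'" "homp V (m - q) W'" "\<forall>x. Q x = A x * U' x + B x * W' x" by blast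
  then show ?case
    by (intro exI[of _ "\<lambda>x. U x + U' x"] exI[of _ "\<lambda>x. W x + W' x"]) (simp add: polyf_add homp_add algebra_simps)
qed

text \<open>Weak form of Bezout's theorem by counting: modulo \<open>A\<close> the forms of degree
  \<open>m\<close> have dimension \<open>card ?I\<close>, and the multiples of \<open>B\<close>
  account for at most \<open>card ?E\<close>, which is smaller.\<close>

lemma two_forms_not_primary:
  fixes A B :: "(nat \<Rightarrow> 'a::field_char_0) \<Rightarrow> 'a"
  assumes A: "homp {0,1,2} p A" and B: "homp {0,1,2} q B" and pq: "p \<ge> 1" "q \<ge> 1"
    and lead: "A (unitv 0) \<noteq> 0"
  shows "\<not> cert {0,1,2} {(p, A), (q, B)} N"
proof
  let ?V = "{0,1,2::nat}"
  assume c: "cert ?V {(p, A), (q, B)} N"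
  interpret A: monic_form ?V 0 p A using A lead by unfold_locales auto
  define m where "m = N + q"
  have cm: "cert ?V {(p, A), (q, B)} m" using cert_mono[OF _ c] by (simp add: m_def)
  let ?I = "red ?V 0 p m" and ?E = "red ?V 0 p (m - q)"
  have finI: "finite ?I" and finE: "finite ?E" using finite_mons[of ?V] by (auto simp: red_def)
  have "\<forall>\<alpha>. \<exists>U. \<exists>w. \<alpha> \<in> ?I \<longrightarrow> polyf ?V U \<and> (\<forall>x. monv ?V \<alpha> x = A x * U x + B x * (\<Sum>\<gamma>\<in>?E. w \<gamma> * monv ?V \<gamma> x))"
  proof
    fix \<alpha>
    show "\<exists>U. \<exists>w. \<alpha> \<in> ?I \<longrightarrow> polyf ?V U \<and> (\<forall>x. monv ?V \<alpha> x = A x * U x + B x * (\<Sum>\<gamma>\<in>?E. w \<gamma> * monv ?V \<gamma> x))"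
    proof (cases "\<alpha> \<in> ?I")
      case True
      then have "homp ?V m (monv ?V \<alpha> :: (nat \<Rightarrow> 'a) \<Rightarrow> 'a)" by (intro homp_mon) (auto simp: red_def)
      then have "gid ?V {(p, A), (q, B)} m (monv ?V \<alpha>)" using cm by (simp add: cert_def)
      from gid_two[OF _ _ this] obtain U W where UW: "polyf ?V U" "homp ?V (m - q) W" "\<And>x. monv ?V \<alpha> x = A x * U x + B x * W x" by auto
      obtain S r where S: "homp ?V (m - q - p) S" "\<And>x. W x = A x * S x + (\<Sum>\<beta>\<in>?E. r \<beta> * monv ?V \<beta> x)"
        using A.divs_homp[OF UW(2)] unfolding A.divs_def by blast
      have "polyf ?V (\<lambda>x. U x + B x * S x)"
        by (rule polyf_add[OF UW(1) polyf_mult[OF homp_polyf[OF B] homp_polyf[OF S(1)]]])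
      moreover have "monv ?V \<alpha> x = A x * (U x + B x * S x) + B x * (\<Sum>\<beta>\<in>?E. r \<beta> * monv ?V \<beta> x)" for x
        unfolding UW(3) S(2) by (simp add: distrib_left mult_ac)
      ultimately show ?thesis by (intro exI[of _ "\<lambda>x. U x + B x * S x"] exI[of _ r]) simp
    qed auto
  qed
  from choice[OF this] obtain U where "\<forall>\<alpha>. \<exists>w. \<alpha> \<in> ?I \<longrightarrow> polyf ?V (U \<alpha>) \<and> (\<forall>x. monv ?V \<alpha> x = A x * U \<alpha> x + B x * (\<Sum>\<gamma>\<in>?E. w \<gamma> * monv ?V \<gamma> x))" ..
  from choice[OF this] obtain w where "\<forall>\<alpha>. \<alpha> \<in> ?I \<longrightarrow> polyf ?V (U \<alpha>) \<and> (\<forall>x. monv ?V \<alpha> x = A x * U \<alpha> x + B x * (\<Sum>\<gamma>\<in>?E. w \<alpha> \<gamma> * monv ?V \<gamma> x))" ..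
  then have w: "\<And>\<alpha>. \<alpha> \<in> ?I \<Longrightarrow> polyf ?V (U \<alpha>)"
    "\<And>\<alpha> x. \<alpha> \<in> ?I \<Longrightarrow> monv ?V \<alpha> x = A x * U \<alpha> x + B x * (\<Sum>\<gamma>\<in>?E. w \<alpha> \<gamma> * monv ?V \<gamma> x)" by auto
  have "card ?E < card ?I"
  proof -
    \<comment> \<open>Multiplication by the \<open>q\<close>-th power of coordinate 1 embeds
      \<open>?E\<close> into \<open>?I\<close> and misses the pure power of coordinate 2.\<close>
    let ?f = "\<lambda>\<gamma>::nat \<Rightarrow> nat. \<gamma>(1 := \<gamma> 1 + q)" and ?t = "\<lambda>v::nat. if v = 2 then m else 0"
    have inj: "inj_on ?f ?E" by (rule inj_on_inverseI[where g = "\<lambda>\<gamma>. \<gamma>(1 := \<gamma> 1 - q)"]) auto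
    have "?f ` ?E \<subseteq> ?I" by (auto simp: red_def mons_def mp_supp_def m_def split: if_splits)
    moreover have "?t \<in> ?I" using pq by (auto simp: red_def mons_def mp_supp_def)
    moreover have "?t \<notin> ?f ` ?E"
    proof
      assume "?t \<in> ?f ` ?E"
      then obtain \<gamma> where "?t = ?f \<gamma>" by auto
      from fun_cong[OF this, of 1] show False using pq by simp
    qed
    ultimately have "?f ` ?E \<subset> ?I" by blast
    from psubset_card_mono[OF finI this] show ?thesis by (simp add: card_image[OF inj])
  qed
  from nontrivial_solution[OF finE finI this, of "\<lambda>\<gamma> \<alpha>. w \<alpha> \<gamma>"] obtain l where
    l: "\<exists>\<alpha>\<in>?I. l \<alpha> \<noteq> 0" "\<And>\<gamma>. \<gamma> \<in> ?E \<Longrightarrow> (\<Sum>\<alpha>\<in>?I. l \<alpha> * w \<alpha> \<gamma>) = 0" by auto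
  have "l \<alpha> = 0" if "\<alpha> \<in> ?I" for \<alpha>
  proof (rule A.red_unique(2)[where S = "\<lambda>x. \<Sum>\<alpha>\<in>?I. l \<alpha> * U \<alpha> x" and A = ?I and r = l])
    show "polyf ?V (\<lambda>x. \<Sum>\<alpha>\<in>?I. l \<alpha> * U \<alpha> x)" by (intro polyf_sum polyf_mult polyf_const w)
    fix x
    have "(\<Sum>\<alpha>\<in>?I. l \<alpha> * monv ?V \<alpha> x) = (\<Sum>\<alpha>\<in>?I. A x * (l \<alpha> * U \<alpha> x) + B x * (\<Sum>\<gamma>\<in>?E. l \<alpha> * w \<alpha> \<gamma> * monv ?V \<gamma> x))"
      by (intro sum.cong refl) (simp add: w(2) algebra_simps sum_distrib_left)
    also have "\<dots> = A x * (\<Sum>\<alpha>\<in>?I. l \<alpha> * U \<alpha> x) + B x * (\<Sum>\<alpha>\<in>?I. \<Sum>\<gamma>\<in>?E. l \<alpha> * w \<alpha> \<gamma> * monv ?V \<gamma> x)"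
      by (simp add: sum.distrib sum_distrib_left)
    also have "(\<Sum>\<alpha>\<in>?I. \<Sum>\<gamma>\<in>?E. l \<alpha> * w \<alpha> \<gamma> * monv ?V \<gamma> x) = (\<Sum>\<gamma>\<in>?E. (\<Sum>\<alpha>\<in>?I. l \<alpha> * w \<alpha> \<gamma>) * monv ?V \<gamma> x)"
      by (subst sum.swap) (simp add: sum_distrib_right)
    also have "\<dots> = 0" using l(2) by simp
    finally show "A x * (\<Sum>\<alpha>\<in>?I. l \<alpha> * U \<alpha> x) = (\<Sum>\<alpha>\<in>?I. l \<alpha> * monv ?V \<alpha> x)" by simp
  qed (use finI that in \<open>auto simp: red_def mons_def\<close>)
  then show False using l(1) by auto
qed

text \<open>The equations of the singular points of the plane curve \<open>G = 0\<close>.\<close>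

definition jets :: "nat \<Rightarrow> ((nat \<Rightarrow> 'a::field_char_0) \<Rightarrow> 'a) \<Rightarrow> (nat \<times> ((nat \<Rightarrow> 'a) \<Rightarrow> 'a)) set" where
  "jets e G = {(e, G), (e - 1, pd 0 G), (e - 1, pd 1 G), (e - 1, pd 2 G)}"

text \<open>By the product rule all derivatives of \<open>A B\<close> lie in the ideal
  (\<open>A\<close>, \<open>B\<close>), so the smoothness certificate would show that the two
  factors have no common zero.\<close>

lemma jets_no_factor:
  fixes G :: "(nat \<Rightarrow> 'a::field_char_0) \<Rightarrow> 'a"
  assumes c: "cert {0,1,2} (jets e G) N" and lead: "G (unitv 0) \<noteq> 0"
    and A: "homp {0,1,2} p A" and B: "homp {0,1,2} q B" and pq: "p \<ge> 1" "q \<ge> 1" "p + q = e"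
    and AB: "\<And>x. G x = A x * B x"
  shows False
proof -
  let ?V = "{0,1,2::nat}" and ?H = "{(p, A), (q, B)}"
  have "gid ?V ?H a h" if "(a, h) \<in> jets e G" for a h
  proof -
    have GG: "gid ?V ?H e G"
    proof -
      have "gid ?V ?H (p + q) (\<lambda>x. B x * A x)" by (rule gid_gen[OF _ B]) simp
      then show ?thesis by (rule gid_cong) (auto simp: AB pq)
    qed
    have PG: "gid ?V ?H (e - 1) (pd i G)" for i
    proof -
      have d: "pd i G x = pd i A x * B x + pd i B x * A x" for x
      proof -
        have "pd i G x = pd i (\<lambda>x. A x * B x) x" by (rule pd_cong) (rule AB)
        also have "\<dots> = pd i A x * B x + A x * pd i B x" by (rule pd_mult[OF homp_polyf[OF A] homp_polyf[OF B]])
        finally show ?thesis by (simp add: mult.commute)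
      qed
      have "gid ?V ?H (q + (p - 1)) (\<lambda>x. pd i A x * B x)"
        by (rule gid_gen[OF _ homp_pd[OF _ _ A]]) auto
      then have 1: "gid ?V ?H (e - 1) (\<lambda>x. pd i A x * B x)" by (rule gid_cong) (use pq in auto)
      have "gid ?V ?H (p + (q - 1)) (\<lambda>x. pd i B x * A x)"
        by (rule gid_gen[OF _ homp_pd[OF _ _ B]]) auto
      then have 2: "gid ?V ?H (e - 1) (\<lambda>x. pd i B x * A x)" by (rule gid_cong) (use pq in auto)
      from gid_add[OF 1 2] show ?thesis by (rule gid_cong) (auto simp: d)
    qed
    from that show ?thesis using GG PG by (auto simp: jets_def)
  qed
  from cert_trans[OF c this] have "cert ?V ?H N" .
  moreover have "A (unitv 0) \<noteq> 0" using lead AB by auto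
  ultimately show False using two_forms_not_primary[OF A B pq(1,2)] by blast
qed

section \<open>Total degree and homogenisation of bivariate polynomials\<close>

definition twt :: "'a::zero poly poly \<Rightarrow> nat" where
  "twt a = Max {i + degree (coeff a i) | i. coeff a i \<noteq> 0}"

lemma coeff_support_finite: "finite {i. coeff a i \<noteq> 0}"
proof -
  have "{i. coeff a i \<noteq> 0} \<subseteq> {..degree a}" using le_degree by blast
  then show ?thesis using finite_subset by blast
qed

lemma twt_le: "coeff a i \<noteq> 0 \<Longrightarrow> i + degree (coeff a i) \<le> twt a"
  unfolding twt_def using coeff_support_finite[of a] by (intro Max_ge) auto

text \<open>\<open>twt\<close> is the total degree of a polynomial in two variables, seen as a
  polynomial over polynomials. The largest outer exponent attaining it is singled out in order to
  isolate one monomial in a product.\<close>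

lemma twt_attained: "a \<noteq> 0 \<Longrightarrow> \<exists>i. coeff a i \<noteq> 0 \<and> i + degree (coeff a i) = twt a \<and>
   (\<forall>k>i. coeff a k \<noteq> 0 \<longrightarrow> k + degree (coeff a k) < twt a)"
proof -
  assume a: "a \<noteq> 0"
  let ?S = "{i + degree (coeff a i) | i. coeff a i \<noteq> 0}" and ?T = "{i. coeff a i \<noteq> 0 \<and> i + degree (coeff a i) = twt a}"
  have "finite ?S" using coeff_support_finite[of a] by auto
  moreover have "?S \<noteq> {}" using a by (auto simp: poly_eq_iff)
  ultimately have "twt a \<in> ?S" unfolding twt_def by (rule Max_in)
  then have ne: "?T \<noteq> {}" by auto
  have fin: "finite ?T" using coeff_support_finite[of a] by (rule rev_finite_subset) auto
  from Max_in[OF fin ne] have "Max ?T \<in> ?T" .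
  moreover have "k + degree (coeff a k) < twt a" if "k > Max ?T" "coeff a k \<noteq> 0" for k
    using twt_le[OF that(2)] Max_ge[OF fin, of k] that by fastforce
  ultimately show ?thesis by blast
qed

text \<open>Outer exponent \<open>i + j\<close> with inner degree \<open>?d\<close> receives a
  contribution from the extremal terms of \<open>a\<close> and \<open>b\<close> only, so nothing
  cancels there.\<close>

lemma twt_mult:
  fixes a b :: "'a::idom poly poly"
  assumes "a \<noteq> 0" "b \<noteq> 0"
  shows "\<exists>k. coeff (a * b) k \<noteq> 0 \<and> twt a + twt b \<le> k + degree (coeff (a * b) k)"
proof -
  obtain i where i: "coeff a i \<noteq> 0" "i + degree (coeff a i) = twt a"
    "\<And>k. k > i \<Longrightarrow> coeff a k \<noteq> 0 \<Longrightarrow> k + degree (coeff a k) < twt a" using twt_attained[OF assms(1)] by blast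
  obtain j where j: "coeff b j \<noteq> 0" "j + degree (coeff b j) = twt b"
    "\<And>k. k > j \<Longrightarrow> coeff b k \<noteq> 0 \<Longrightarrow> k + degree (coeff b k) < twt b" using twt_attained[OF assms(2)] by blast
  let ?d = "degree (coeff a i) + degree (coeff b j)"
  have "coeff (coeff (a * b) (i + j)) ?d = (\<Sum>k\<le>i + j. coeff (coeff a k * coeff b (i + j - k)) ?d)"
    by (simp add: coeff_mult coeff_sum)
  also have "\<dots> = (\<Sum>k\<le>i + j. if k = i then lead_coeff (coeff a i) * lead_coeff (coeff b j) else 0)"
  proof (intro sum.cong refl)
    fix k assume k: "k \<in> {..i + j}"
    show "coeff (coeff a k * coeff b (i + j - k)) ?d = (if k = i then lead_coeff (coeff a i) * lead_coeff (coeff b j) else 0)"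
    proof (cases "k = i")
      case True then show ?thesis by (simp add: coeff_mult_degree_sum)
    next
      case False
      have "coeff (coeff a k * coeff b (i + j - k)) ?d = 0"
      proof (cases "coeff a k = 0 \<or> coeff b (i + j - k) = 0")
        case False
        then have nz: "coeff a k \<noteq> 0" "coeff b (i + j - k) \<noteq> 0" by auto
        have "degree (coeff a k) + degree (coeff b (i + j - k)) < ?d"
        proof (cases "k > i")
          case True
          then show ?thesis using i(2) j(2) i(3)[OF True nz(1)] twt_le[OF nz(2)] k by simp
        next
          case f: False
          then have "i + j - k > j" using \<open>k \<noteq> i\<close> k by auto
          from j(3)[OF this nz(2)] show ?thesis using i(2) j(2) twt_le[OF nz(1)] k f by simp
        qed
        then show ?thesis using degree_mult_le[of "coeff a k" "coeff b (i + j - k)"]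
          by (intro coeff_eq_0) linarith
      qed auto
      then show ?thesis using False by simp
    qed
  qed
  also have "\<dots> = lead_coeff (coeff a i) * lead_coeff (coeff b j)" by simp
  finally have c: "coeff (coeff (a * b) (i + j)) ?d \<noteq> 0" using i j by simp
  then have "?d \<le> degree (coeff (a * b) (i + j))" by (rule le_degree)
  moreover have "coeff (a * b) (i + j) \<noteq> 0" using c by auto
  ultimately show ?thesis using i(2) j(2) by (intro exI[of _ "i + j"]) auto
qed

text \<open>Homogenisation in degree \<open>p\<close>: the outer variable becomes coordinate 0, the
  inner one coordinate 2, and coordinate 1 homogenises.\<close>

definition hz :: "nat \<Rightarrow> 'a::comm_ring_1 poly poly \<Rightarrow> (nat \<Rightarrow> 'a) \<Rightarrow> 'a" where
  "hz p a y = (\<Sum>i\<le>p. \<Sum>k\<le>p - i. coeff (coeff a i) k * (y 0 ^ i * y 2 ^ k * y 1 ^ (p - i - k)))"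

lemma homp_hz: "homp {0,1,2} p (hz p a)"
  unfolding hz_def[abs_def]
proof (intro homp_sum homp_scale)
  fix i k assume "i \<in> {..p}" "k \<in> {..p - i}"
  then have e: "i + k + (p - i - k) = p" by auto
  have "homp {0,1,2} (i + k + (p - i - k)) (\<lambda>y :: nat \<Rightarrow> 'a. y 0 ^ i * y 2 ^ k * y 1 ^ (p - i - k))"
    by (intro homp_mult homp_varpow) auto
  then show "homp {0,1,2} p (\<lambda>y :: nat \<Rightarrow> 'a. y 0 ^ i * y 2 ^ k * y 1 ^ (p - i - k))" unfolding e .
qed auto

lemma hz_eval:
  fixes a :: "'a::field poly poly"
  assumes p: "degree a \<le> p" and w: "twt a \<le> p" and y: "y 1 \<noteq> 0"
  shows "hz p a y = y 1 ^ p * poly (poly a [:y 0 / y 1:]) (y 2 / y 1)"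
proof -
  have "poly (poly a [:y 0 / y 1:]) (y 2 / y 1) = (\<Sum>i\<le>p. poly (coeff a i) (y 2 / y 1) * (y 0 / y 1) ^ i)"
  proof -
    have "poly a [:y 0 / y 1:] = (\<Sum>i\<le>degree a. coeff a i * [:y 0 / y 1:] ^ i)" by (rule poly_altdef)
    also have "\<dots> = (\<Sum>i\<le>p. coeff a i * [:y 0 / y 1:] ^ i)"
      using p by (intro sum.mono_neutral_left) (auto simp: coeff_eq_0)
    finally show ?thesis by (simp add: poly_sum)
  qed
  also have "\<dots> = (\<Sum>i\<le>p. \<Sum>k\<le>p - i. coeff (coeff a i) k * (y 2 / y 1) ^ k * (y 0 / y 1) ^ i)"
  proof (intro sum.cong refl)
    fix i assume i: "i \<in> {..p}"
    have "degree (coeff a i) \<le> p - i" using twt_le[of a i] w by (cases "coeff a i = 0") auto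
    then have "poly (coeff a i) (y 2 / y 1) = (\<Sum>k\<le>p - i. coeff (coeff a i) k * (y 2 / y 1) ^ k)"
      unfolding poly_altdef by (intro sum.mono_neutral_left) (auto simp: coeff_eq_0)
    then show "poly (coeff a i) (y 2 / y 1) * (y 0 / y 1) ^ i = (\<Sum>k\<le>p - i. coeff (coeff a i) k * (y 2 / y 1) ^ k * (y 0 / y 1) ^ i)"
      by (simp add: sum_distrib_right)
  qed
  also have "y 1 ^ p * \<dots> = hz p a y"
    unfolding hz_def sum_distrib_left
  proof (intro sum.cong refl)
    fix i k assume ik: "i \<in> {..p}" "k \<in> {..p - i}"
    then have "y 1 ^ p = y 1 ^ (p - i - k) * y 1 ^ k * y 1 ^ i" by (simp flip: power_add)
    then show "y 1 ^ p * (coeff (coeff a i) k * (y 2 / y 1) ^ k * (y 0 / y 1) ^ i) = coeff (coeff a i) k * (y 0 ^ i * y 2 ^ k * y 1 ^ (p - i - k))"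
      using y by (simp add: power_divide)
  qed
  finally show ?thesis by simp
qed

abbreviation pt3 :: "'a::comm_ring_1 \<Rightarrow> 'a \<Rightarrow> nat \<Rightarrow> 'a" where
  "pt3 x t \<equiv> (\<lambda>v. if v = 0 then x else if v = 1 then 1 else if v = 2 then t else 0)"

text \<open>In the chart where coordinate 1 equals 1, coordinate 0 is taken as the outer variable so
  that monicity of \<open>G\<close> becomes a constant leading coefficient.\<close>

lemma dehomogenize:
  fixes G :: "(nat \<Rightarrow> 'a::field_char_0) \<Rightarrow> 'a"
  assumes G: "homp {0,1,2} e G" and lead: "G (unitv 0) \<noteq> 0"
  shows "\<exists>j :: 'a poly poly. degree j = e \<and> (\<exists>c. c \<noteq> 0 \<and> lead_coeff j = [:c:]) \<and>
    (\<forall>i. coeff j i \<noteq> 0 \<longrightarrow> i + degree (coeff j i) \<le> e) \<and>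
    (\<forall>x t. poly (poly j [:x:]) t = G (pt3 x t))"
proof -
  let ?V = "{0,1,2::nat}"
  interpret monic_form ?V 0 e G using G lead by unfold_locales auto
  let ?top = "\<lambda>v::nat. if v = 0 then e else 0"
  obtain c where c: "\<And>x. G x = (\<Sum>\<alpha>\<in>mons ?V e. c \<alpha> * monv ?V \<alpha> x)" and c0: "c ?top \<noteq> 0" using J_expand by blast
  define j where "j = (\<Sum>\<alpha>\<in>mons ?V e. monom (monom (c \<alpha>) (\<alpha> 2)) (\<alpha> 0))"
  have sm: "\<alpha> 0 + \<alpha> 1 + \<alpha> 2 = e" if "\<alpha> \<in> mons ?V e" for \<alpha> using that by (simp add: mons_def)
  have cj: "coeff j i = (\<Sum>\<alpha>\<in>mons ?V e. if \<alpha> 0 = i then monom (c \<alpha>) (\<alpha> 2) else 0)" for i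
    by (simp add: j_def coeff_sum)
  have deg: "degree (coeff j i) \<le> e - i" for i unfolding cj
  proof (rule degree_sum_le[OF finite_mons])
    fix \<alpha> assume "\<alpha> \<in> mons ?V e"
    then show "degree (if \<alpha> 0 = i then monom (c \<alpha>) (\<alpha> 2) else 0) \<le> e - i"
      using sm[of \<alpha>] degree_monom_le[of "c \<alpha>" "\<alpha> 2"] by auto
  qed simp
  have z: "coeff j i = 0" if "i > e" for i unfolding cj using sm that by (intro sum.neutral) force
  have top: "coeff j e = [:c ?top:]"
  proof -
    have "coeff j e = (\<Sum>\<alpha>\<in>mons ?V e. if \<alpha> = ?top then [:c ?top:] else 0)" unfolding cj
    proof (intro sum.cong refl)
      fix \<alpha> assume a: "\<alpha> \<in> mons ?V e"
      show "(if \<alpha> 0 = e then monom (c \<alpha>) (\<alpha> 2) else 0) = (if \<alpha> = ?top then [:c ?top:] else 0)"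
        using mons_top[OF a] by (cases "\<alpha> = ?top") (auto simp: monom_0)
    qed
    then show ?thesis using mons_single[of 0 ?V e] finite_mons[of ?V e] by simp
  qed
  have "degree j = e"
  proof (rule antisym)
    show "degree j \<le> e" by (rule degree_le) (use z in auto)
    show "e \<le> degree j" using top c0 by (intro le_degree) auto
  qed
  moreover have "poly (poly j [:x:]) t = G (pt3 x t)" for x t
  proof -
    have "poly (poly j [:x:]) t = (\<Sum>\<alpha>\<in>mons ?V e. c \<alpha> * t ^ \<alpha> 2 * x ^ \<alpha> 0)"
      by (simp add: j_def poly_sum poly_monom)
    also have "\<dots> = (\<Sum>\<alpha>\<in>mons ?V e. c \<alpha> * monv ?V \<alpha> (pt3 x t))"
      by (intro sum.cong refl) (simp add: monv_def)
    finally show ?thesis by (simp add: c)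
  qed
  moreover have "i + degree (coeff j i) \<le> e" if "coeff j i \<noteq> 0" for i
    using deg[of i] z[of i] that by (cases "i > e") auto
  ultimately show ?thesis using top c0 by (intro exI[of _ j]) auto
qed

text \<open>The leading coefficients of two factors are units, so a non-unit factor has positive
  outer degree. The total degrees add up to at most \<open>e\<close>, which is the sum of the outer
  degrees; hence total and outer degree agree for each factor, and homogenising gives a forbidden
  factorisation of \<open>G\<close>.\<close>

lemma dehomogenize_irreducible:
  fixes G :: "(nat \<Rightarrow> 'a::field_char_0) \<Rightarrow> 'a" and j :: "'a poly poly"
  assumes G: "homp {0,1,2} e G" and lead: "G (unitv 0) \<noteq> 0" and e: "e \<ge> 1"
    and c: "cert {0,1,2} (jets e G) N"
    and j: "degree j = e" "c0 \<noteq> 0" "lead_coeff j = [:c0:]" "\<And>i. coeff j i \<noteq> 0 \<Longrightarrow> i + degree (coeff j i) \<le> e"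
     "\<And>x t. poly (poly j [:x:]) t = G (pt3 x t)"
  shows "irreducible j"
proof (rule irreducibleI)
  show "j \<noteq> 0" using j by auto
  show "\<not> j dvd 1" using j(1) e by (auto simp: poly_dvd_1)
  fix a b assume ab: "j = a * b"
  have nz: "a \<noteq> 0" "b \<noteq> 0" using ab \<open>j \<noteq> 0\<close> by auto
  have dab: "degree a + degree b = e" using nz ab j(1) by (simp add: degree_mult_eq)
  have lc: "lead_coeff a * lead_coeff b = [:c0:]" using j(3) unfolding ab by (simp add: lead_coeff_mult)
  have unit: "u dvd 1" if "u * v = [:c0:]" for u v :: "'a poly"
  proof
    have "u * (v * [:1 / c0:]) = [:c0:] * [:1 / c0:]" unfolding that[symmetric] by (simp only: mult.assoc)
    also have "\<dots> = [:1:]" using j(2) by simp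
    also have "\<dots> = 1" by (rule one_pCons[symmetric])
    finally show "1 = u * (v * [:1 / c0:])" by (rule sym)
  qed
  show "a dvd 1 \<or> b dvd 1"
  proof (rule ccontr)
    assume n: "\<not> ?thesis"
    have "degree a \<ge> 1"
    proof (rule ccontr)
      assume "\<not> ?thesis"
      then have "degree a = 0" by simp
      then obtain k where k: "a = [:k:]" by (rule degree_eq_zeroE)
      have "lead_coeff a dvd 1" using unit[OF lc] .
      then have "a dvd 1" using k by (simp add: const_poly_dvd_1)
      then show False using n by simp
    qed
    moreover have "degree b \<ge> 1"
    proof (rule ccontr)
      assume "\<not> ?thesis"
      then have "degree b = 0" by simp
      then obtain k where k: "b = [:k:]" by (rule degree_eq_zeroE)
      have "lead_coeff b dvd 1" using unit[of "lead_coeff b" "lead_coeff a"] lc by (simp add: mult.commute)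
      then have "b dvd 1" using k by (simp add: const_poly_dvd_1)
      then show False using n by simp
    qed
    moreover obtain k where k: "coeff (a * b) k \<noteq> 0" "twt a + twt b \<le> k + degree (coeff (a * b) k)"
      using twt_mult[OF nz] by blast
    have "twt a + twt b \<le> e" using k j(4)[of k] ab by simp
    moreover have "degree a \<le> twt a" "degree b \<le> twt b"
      using twt_le[of a "degree a"] twt_le[of b "degree b"] nz by auto
    ultimately have tw: "twt a \<le> degree a" "twt b \<le> degree b" and d1: "degree a \<ge> 1" "degree b \<ge> 1" using dab by auto
    let ?A = "hz (degree a) a" and ?B = "hz (degree b) b"
    \<comment> \<open>The chart sees only the points with \<open>y 1 \<noteq> 0\<close>; cancelling
      the factor \<open>y 1\<close> extends the identity to all points.\<close>
    have AB: "G y = ?A y * ?B y" for y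
    proof (rule polyf_cancel[where P = "\<lambda>y. y 1" and Q = G and R = "\<lambda>y. ?A y * ?B y" and V = "{0,1,2}" and ?x0.0 = "\<lambda>_. 1"])
      show "polyf {0,1,2} (\<lambda>y. ?A y * ?B y)" by (intro polyf_mult homp_polyf[OF homp_hz])
      fix y :: "nat \<Rightarrow> 'a"
      show "y 1 * G y = y 1 * (?A y * ?B y)"
      proof (cases "y 1 = 0")
        case False
        have "G y = G (\<lambda>v. y 1 * pt3 (y 0 / y 1) (y 2 / y 1) v)"
          by (rule homp_eval_cong[OF G]) (use False in auto)
        also have "\<dots> = y 1 ^ e * G (pt3 (y 0 / y 1) (y 2 / y 1))" by (rule homp_homogeneous[OF G])
        also have "\<dots> = y 1 ^ e * poly (poly (a * b) [:y 0 / y 1:]) (y 2 / y 1)" by (simp flip: j(5) add: ab)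
        also have "\<dots> = ?A y * ?B y"
          unfolding hz_eval[where y = y, OF order_refl tw(1) False] hz_eval[where y = y, OF order_refl tw(2) False] by (simp add: power_add flip: dab)
        finally show ?thesis by simp
      qed auto
    qed (auto intro: homp_polyf[OF G] polyf_var)
    show False by (rule jets_no_factor[OF c lead homp_hz homp_hz d1 dab AB])
  qed
qed

subsection \<open>The critical hypersurface is irreducible and reduced\<close>

lemma homp_mono: "homp V m P \<Longrightarrow> V \<subseteq> V' \<Longrightarrow> homp V' m P"
proof (induction rule: homp.induct)
  case (homp_const c) show ?case by (rule homp.homp_const)
next
  case (homp_var v) then show ?case by (intro homp.homp_var) auto
next
  case (homp_add m P Q) then show ?case by (intro homp.homp_add) auto
next
  case (homp_mult m P k Q) then show ?case by (intro homp.homp_mult) auto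
qed

lemma (in bihom) bh_compose:
  assumes "homp U m P" "\<And>v. v \<in> U \<Longrightarrow> bh W V 1 1 (F v)"
  shows "bh W V m m (\<lambda>w x. P (\<lambda>v. F v w x))"
  using assms(1)
proof (induction rule: homp.induct)
  case (homp_const c) show ?case by (rule bh_const)
next
  case (homp_var v) then show ?case by (rule assms(2))
next
  case (homp_add m P Q) show ?case by (rule bh_add[OF homp_add(3,4)])
next
  case (homp_mult m P k Q) show ?case by (rule bh_mult[OF homp_mult(3,4)])
qed

text \<open>Substituting zero for the coordinates from 3 on kills the added linear forms and
  commutes with the derivatives in the first three directions.\<close>

lemma cert_plane_restrict:
  fixes J :: "(nat \<Rightarrow> 'a::field_char_0) \<Rightarrow> 'a"
  assumes n: "n \<ge> 2" and J: "homp {0..n} e J"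
    and c: "cert {0..n} (jets e J \<union> {(1, \<lambda>x. x j) | j. j \<in> {3..n}}) N"
  shows "cert {0,1,2} (jets e (\<lambda>y. J (\<lambda>v. if v \<le> 2 then y v else 0))) N"
proof -
  let ?V = "{0,1,2::nat}"
  define F :: "nat \<Rightarrow> (nat \<Rightarrow> 'a) \<Rightarrow> 'a" where "F v = (\<lambda>y. if v \<le> 2 then y v else 0)" for v
  define G where "G = (\<lambda>y. J (\<lambda>v. F v y))"
  have F1: "homp ?V 1 (F v)" for v
  proof (cases "v \<le> 2")
    case True
    then have "v \<in> ?V" by auto
    then show ?thesis using True homp_var[of v ?V] by (simp add: F_def)
  next
    case False then show ?thesis using homp_zero[of ?V 1] by (simp add: F_def)
  qed
  have pdG: "pd i G y = pd i J (\<lambda>v. F v y)" if "i \<le> 2" for i y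
  proof -
    have "pd i G y = (\<Sum>v\<in>{0..n}. pd v J (\<lambda>v. F v y) * pd i (F v) y)"
      unfolding G_def by (rule pd_compose[OF _ homp_polyf[OF J] homp_polyf[OF F1]]) simp
    also have "\<dots> = (\<Sum>v\<in>{0..n}. if v = i then pd i J (\<lambda>v. F v y) else 0)"
    proof (intro sum.cong refl)
      fix v
      have "pd i (F v) y = (if v = i then 1 else 0)"
        using that by (cases "v \<le> 2") (auto simp: F_def pd_var)
      then show "pd v J (\<lambda>v. F v y) * pd i (F v) y = (if v = i then pd i J (\<lambda>v. F v y) else 0)" by simp
    qed
    finally show ?thesis using n that by simp
  qed
  have "cert ?V (jets e G) N"
    unfolding cert_def
  proof (intro allI impI)
    fix P :: "(nat \<Rightarrow> 'a) \<Rightarrow> 'a" assume P: "homp ?V N P"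
    then have "homp {0..n} N P" by (rule homp_mono) (use n in auto)
    then have "gid {0..n} (jets e J \<union> {(1, \<lambda>x. x j) | j. j \<in> {3..n}}) N P" using c by (simp add: cert_def)
    from gid_compose[where F = F and U = ?V and D = 1, OF this F1]
    have "gid ?V {(1 * a, \<lambda>x. h (\<lambda>v. F v x)) | a h. (a, h) \<in> jets e J \<union> {(1, \<lambda>x. x j) | j. j \<in> {3..n}}} (1 * N) (\<lambda>x. P (\<lambda>v. F v x))" .
    then have "gid ?V (jets e G) (1 * N) (\<lambda>x. P (\<lambda>v. F v x))"
    proof (rule gid_trans)
      fix a h assume "(a, h) \<in> {(1 * a, \<lambda>x. h (\<lambda>v. F v x)) | a h. (a, h) \<in> jets e J \<union> {(1, \<lambda>x. x j) | j. j \<in> {3..n}}}"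
      then obtain b k where bk: "(a, h) = (1 * b, \<lambda>x. k (\<lambda>v. F v x))" "(b, k) \<in> jets e J \<union> {(1, \<lambda>x. x j) | j. j \<in> {3..n}}"
        by (elim CollectE exE conjE) (rule that)
      have k: "h = (\<lambda>x. k (\<lambda>v. F v x))" using bk by simp
      have k2: "(a, k) \<in> jets e J \<or> (\<exists>j\<in>{3..n}. k = (\<lambda>x. x j))" using bk by auto
      from k2 show "gid ?V (jets e G) a h"
      proof
        assume "(a, k) \<in> jets e J"
        then have "a = e \<and> k = J \<or> (\<exists>i\<in>{0,1,2}. a = e - 1 \<and> k = pd i J)" by (auto simp: jets_def)
        then consider "a = e" "k = J" | i where "i \<in> {0,1,2}" "a = e - 1" "k = pd i J" by blast
        then have "(a, h) \<in> jets e G"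
        proof cases
          case 1 then show ?thesis by (simp add: k jets_def G_def)
        next
          case (2 i)
          have "h = pd i G" unfolding k 2(3) using pdG[of i] 2(1) by auto
          then show ?thesis using 2(1,2) by (auto simp: jets_def)
        qed
        then show ?thesis by (rule gid_in)
      next
        assume "\<exists>j\<in>{3..n}. k = (\<lambda>x. x j)"
        then have "h = (\<lambda>_. 0)" by (auto simp: k F_def)
        then show ?thesis by (simp add: gid_zero)
      qed
    qed
    moreover have "P (\<lambda>v. F v x) = P x" for x by (rule homp_eval_cong[OF P]) (auto simp: F_def)
    ultimately show "gid ?V (jets e G) N P" by simp
  qed
  then show ?thesis by (simp add: G_def F_def)
qed

section \<open>Points of irreducible plane curves over an algebraically closed field\<close>

lemma roots_dvd_power:
  fixes g w :: "'a::field_char_0 poly"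
  assumes ac: "alg_closed TYPE('a)"
  shows "g \<noteq> 0 \<Longrightarrow> (\<And>x. poly g x = 0 \<Longrightarrow> poly w x = 0) \<Longrightarrow> g dvd w ^ degree g"
proof (induction "degree g" arbitrary: g)
  case 0
  then show ?case by (metis dvd_trans is_unit_iff_degree one_dvd)
next
  case (Suc m)
  then obtain a where a: "poly g a = 0" using ac unfolding alg_closed_def by (metis Suc_le_eq zero_less_Suc One_nat_def)
  then obtain g' where g': "g = [:-a, 1:] * g'" by (auto simp: poly_eq_0_iff_dvd elim: dvdE)
  have nz: "g' \<noteq> 0" using Suc(3) g' by auto
  have d: "degree g = Suc (degree g')" using nz unfolding g' by (simp add: degree_mult_eq del: mult_pCons_left)
  have "g' dvd w ^ degree g'"
    using Suc(2) d nz Suc(4) by (intro Suc(1)) (auto simp: g')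
  moreover have "[:-a, 1:] dvd w" using Suc(4)[OF a] by (simp add: poly_eq_0_iff_dvd)
  ultimately have "[:-a, 1:] * g' dvd w * w ^ degree g'" by (rule mult_dvd_mono[rotated])
  then show ?case using d g' by simp
qed

lemma poly_map_poly_eval:
  fixes p :: "'a::comm_ring_1 poly poly"
  shows "poly (map_poly (\<lambda>c. poly c t) p) x = poly (poly p [:x:]) t"
  by (induction p) (auto simp: map_poly_pCons)

lemma eval2_eqI:
  fixes a b :: "'a::field_char_0 poly poly"
  assumes "\<And>x t. poly (poly a [:x:]) t = poly (poly b [:x:]) t"
  shows "a = b"
proof (rule ccontr)
  assume "a \<noteq> b"
  then have "finite {z. poly (a - b) z = 0}" by (intro poly_roots_finite) simp
  moreover have "(\<lambda>x. [:x:]) ` UNIV \<subseteq> {z. poly (a - b) z = 0}"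
  proof safe
    fix x :: 'a
    have "poly (poly a [:x:]) = poly (poly b [:x:])" using assms by auto
    then show "poly (a - b) [:x:] = 0" using poly_eq_poly_eq_iff by auto
  qed
  ultimately have "finite ((\<lambda>x::'a. [:x:]) ` UNIV)" by (rule rev_finite_subset)
  then have "finite (UNIV :: 'a set)" by (rule finite_imageD) (auto simp: inj_on_def)
  then show False using infinite_UNIV_char_0 by blast
qed

lemma polyf_uni2:
  fixes P :: "('v \<Rightarrow> 'a::comm_ring_1) \<Rightarrow> 'a"
  assumes "polyf V P" "\<And>v x t. v \<in> V \<Longrightarrow> poly (poly (cv v) [:x:]) t = F v x t"
  shows "\<exists>q. \<forall>x t. poly (poly q [:x:]) t = P (\<lambda>v. F v x t)"
  using assms(1)
proof (induction rule: polyf.induct)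
  case (polyf_const c) show ?case by (intro exI[of _ "[:[:c:]:]"]) simp
next
  case (polyf_var v) then show ?case using assms(2) by (intro exI[of _ "cv v"]) simp
next
  case (polyf_add P Q)
  then obtain p q where "\<forall>x t. poly (poly p [:x:]) t = P (\<lambda>v. F v x t)" "\<forall>x t. poly (poly q [:x:]) t = Q (\<lambda>v. F v x t)" by blast
  then show ?case by (intro exI[of _ "p + q"]) simp
next
  case (polyf_mult P Q)
  then obtain p q where "\<forall>x t. poly (poly p [:x:]) t = P (\<lambda>v. F v x t)" "\<forall>x t. poly (poly q [:x:]) t = Q (\<lambda>v. F v x t)" by blast
  then show ?case by (intro exI[of _ "p * q"]) simp
qed

text \<open>If \<open>w\<close> vanished on the curve, then on each fibre \<open>t\<close> the
  restriction of \<open>j\<close> would divide the power of \<open>w\<close> with exponent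
  \<open>degree j\<close>, the same exponent for all fibres. The pseudo-remainder of that power then
  vanishes on every fibre, hence identically, and primality gives \<open>j dvd w\<close>.\<close>

lemma irreducible_curve_point:
  fixes j w :: "'a::field_char_0 poly poly"
  assumes ac: "alg_closed TYPE('a)" and irr: "irreducible j" and d: "degree j \<ge> 1"
    and lc: "lead_coeff j = [:c0:]" "c0 \<noteq> 0" and nd: "\<not> j dvd w"
  shows "\<exists>x t. poly (poly j [:x:]) t = 0 \<and> poly (poly w [:x:]) t \<noteq> 0"
proof (rule ccontr)
  assume "\<not> ?thesis"
  then have z: "\<And>x t. poly (poly j [:x:]) t = 0 \<Longrightarrow> poly (poly w [:x:]) t = 0" by blast
  let ?e = "degree j" and ?ev = "\<lambda>t. map_poly (\<lambda>c. poly c t)"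
  have j0: "j \<noteq> 0" using d by auto
  obtain q r where qr: "pseudo_divmod (w ^ ?e) j = (q, r)" by (cases "pseudo_divmod (w ^ ?e) j")
  let ?k = "Suc (degree (w ^ ?e)) - ?e"
  have eq: "smult (lead_coeff j ^ ?k) (w ^ ?e) = j * q + r" and dr: "r = 0 \<or> degree r < ?e"
    using pseudo_divmod[OF j0 qr] by auto
  have "?ev t r = 0" for t
  proof -
    \<comment> \<open>The constant leading coefficient keeps the degree of \<open>j\<close> on every
      fibre.\<close>
    have degj: "degree (?ev t j) = ?e"
    proof (rule map_poly_degree_eq)
      show "poly (lead_coeff j) t \<noteq> 0" using lc by simp
    qed
    have jt0: "?ev t j \<noteq> 0" using degj d by auto
    have "?ev t j dvd ?ev t w ^ degree (?ev t j)"
      by (rule roots_dvd_power[OF ac jt0]) (use z in \<open>simp add: poly_map_poly_eval\<close>)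
    then have dv: "?ev t j dvd ?ev t w ^ ?e" unfolding degj .
    have "poly (smult (c0 ^ ?k) (?ev t w ^ ?e)) = poly (?ev t j * ?ev t q + ?ev t r)"
    proof
      fix x
      have "poly (poly (smult (lead_coeff j ^ ?k) (w ^ ?e)) [:x:]) t = poly (poly (j * q + r) [:x:]) t" unfolding eq ..
      then show "poly (smult (c0 ^ ?k) (?ev t w ^ ?e)) x = poly (?ev t j * ?ev t q + ?ev t r) x"
        by (simp add: poly_map_poly_eval lc)
    qed
    then have "smult (c0 ^ ?k) (?ev t w ^ ?e) = ?ev t j * ?ev t q + ?ev t r" using poly_eq_poly_eq_iff by blast
    then have "?ev t r = smult (c0 ^ ?k) (?ev t w ^ ?e) - ?ev t j * ?ev t q" by simp
    moreover have "?ev t j dvd smult (c0 ^ ?k) (?ev t w ^ ?e)" using dv by (rule dvd_smult)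
    ultimately have "?ev t j dvd ?ev t r" by simp
    show "?ev t r = 0"
    proof (rule ccontr)
      assume "?ev t r \<noteq> 0"
      then have "?e \<le> degree (?ev t r)" using dvd_imp_degree_le[OF \<open>?ev t j dvd ?ev t r\<close>] degj by simp
      also have "\<dots> \<le> degree r" by (rule map_poly_degree_leq)
      finally show False using dr \<open>?ev t r \<noteq> 0\<close> by auto
    qed
  qed
  then have "poly (poly r [:x:]) t = poly (poly 0 [:x:]) t" for x t
    by (metis poly_map_poly_eval map_poly_0)
  then have "r = 0" by (rule eval2_eqI)
  have eq2: "[:[:c0:] ^ ?k:] * w ^ ?e = smult (lead_coeff j ^ ?k) (w ^ ?e)" unfolding lc by simp
  have "j dvd [:[:c0:] ^ ?k:] * w ^ ?e" unfolding eq2 eq \<open>r = 0\<close> by simp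
  moreover have pj: "prime_elem j" using irr by (simp only: prime_elem_iff_irreducible)
  ultimately have "j dvd [:[:c0:] ^ ?k:] \<or> j dvd w ^ ?e" by (intro prime_elem_dvd_multD)
  moreover have "\<not> j dvd [:[:c0:] ^ ?k:]"
  proof
    assume "j dvd [:[:c0:] ^ ?k:]"
    then have "?e \<le> degree [:[:c0:] ^ ?k:]" using lc by (intro dvd_imp_degree_le) auto
    then show False using d by simp
  qed
  ultimately have "j dvd w ^ ?e" by blast
  then show False using nd prime_elem_dvd_power[OF pj] by blast
qed

text \<open>Bertini-type argument. \<open>P\<close> and \<open>Q\<close> are replaced by their
  nonzero normal forms modulo \<open>J\<close>. A general plane containing the direction of
  coordinate 0 meets the hypersurface in a smooth, hence irreducible curve \<open>j\<close>. Normal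
  forms keep degree below \<open>e\<close> in that direction, so \<open>j\<close> divides neither
  restriction, and some point of the curve avoids both.\<close>

lemma prime_hypersurface:
  fixes J P Q :: "(nat \<Rightarrow> 'a::field_char_0) \<Rightarrow> 'a"
  assumes ac: "alg_closed TYPE('a)" and n: "n \<ge> 2" and J: "homp {0..n} e J" and e: "e \<ge> 1"
    and lead: "J (unitv 0) \<noteq> 0"
    and c: "cert {0..n} (jets e J \<union> {(1, \<lambda>x. x j) | j. j \<in> {3..n}}) N"
    and P: "polyf {0..n} P" "\<not> dvdp {0..n} J P" and Q: "polyf {0..n} Q" "\<not> dvdp {0..n} J Q"
  shows "\<exists>x. J x = 0 \<and> P x \<noteq> 0 \<and> Q x \<noteq> 0"
proof -
  let ?V = "{0..n}" and ?U = "{0,1,2::nat}" and ?W = "{0,1::nat}"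
  interpret J: monic_form ?V 0 e J using J lead by unfold_locales auto
  interpret bihom ?W ?U by unfold_locales auto
  have rem: "\<exists>S A r z. polyf ?V S \<and> finite A \<and> (\<forall>\<alpha>\<in>A. mp_supp \<alpha> \<subseteq> ?V \<and> \<alpha> 0 < e) \<and>
    (\<forall>x. T x = J x * S x + (\<Sum>\<alpha>\<in>A. r \<alpha> * monv ?V \<alpha> x)) \<and> (\<Sum>\<alpha>\<in>A. r \<alpha> * monv ?V \<alpha> z) \<noteq> 0"
    if T: "polyf ?V T" "\<not> dvdp ?V J T" for T
  proof -
    obtain S A r where *: "polyf ?V S" "finite A" "\<forall>\<alpha>\<in>A. mp_supp \<alpha> \<subseteq> ?V \<and> \<alpha> 0 < e"
      "\<forall>x. T x = J x * S x + (\<Sum>\<alpha>\<in>A. r \<alpha> * monv ?V \<alpha> x)" using J.polyf_div[OF T(1)] by blast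
    have "\<exists>z. (\<Sum>\<alpha>\<in>A. r \<alpha> * monv ?V \<alpha> z) \<noteq> 0"
    proof (rule ccontr)
      assume "\<not> ?thesis"
      then have "\<forall>x. T x = J x * S x" using *(4) by simp
      then show False using T(2) *(1) by (auto simp: dvdp_def)
    qed
    then obtain z where "(\<Sum>\<alpha>\<in>A. r \<alpha> * monv ?V \<alpha> z) \<noteq> 0" ..
    with * show ?thesis by (intro exI[of _ S] exI[of _ A] exI[of _ r] exI[of _ z]) simp
  qed
  obtain S1 A1 r1 z1 where 1: "polyf ?V S1" "finite A1" "\<And>\<alpha>. \<alpha> \<in> A1 \<Longrightarrow> \<alpha> 0 < e"
    "\<And>x. P x = J x * S1 x + (\<Sum>\<alpha>\<in>A1. r1 \<alpha> * monv ?V \<alpha> x)" "(\<Sum>\<alpha>\<in>A1. r1 \<alpha> * monv ?V \<alpha> z1) \<noteq> 0" "\<And>\<alpha>. \<alpha> \<in> A1 \<Longrightarrow> mp_supp \<alpha> \<subseteq> ?V"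
    using rem[OF P] by blast
  obtain S2 A2 r2 z2 where 2: "polyf ?V S2" "finite A2" "\<And>\<alpha>. \<alpha> \<in> A2 \<Longrightarrow> \<alpha> 0 < e"
    "\<And>x. Q x = J x * S2 x + (\<Sum>\<alpha>\<in>A2. r2 \<alpha> * monv ?V \<alpha> x)" "(\<Sum>\<alpha>\<in>A2. r2 \<alpha> * monv ?V \<alpha> z2) \<noteq> 0" "\<And>\<alpha>. \<alpha> \<in> A2 \<Longrightarrow> mp_supp \<alpha> \<subseteq> ?V"
    using rem[OF Q] by blast
  define R1 where "R1 x = (\<Sum>\<alpha>\<in>A1. r1 \<alpha> * monv ?V \<alpha> x)" for x
  define R2 where "R2 x = (\<Sum>\<alpha>\<in>A2. r2 \<alpha> * monv ?V \<alpha> x)" for x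
  have pR: "polyf ?V R1" "polyf ?V R2"
    unfolding R1_def[abs_def] R2_def[abs_def] monv_def[abs_def]
    by (intro polyf_sum polyf_mult polyf_const polyf_prod polyf_power polyf_var; simp)+
  define u1 u2 where "u1 = z1(0 := 0)" and "u2 = z2(0 := 0)"
  \<comment> \<open>A family of planes. For \<open>\<tau> = (1, 0)\<close> it is the coordinate
    plane of the certificate. With the product of \<open>\<tau> 0\<close> and the first chart
    coordinate held at \<open>z1 0\<close> or \<open>z2 0\<close>, the chart points with
    \<open>t = 0\<close> and \<open>t = 1\<close> become \<open>z1\<close> and \<open>z2\<close> at
    \<open>\<tau> = (0, 1)\<close>.\<close>
  define Lin :: "nat \<Rightarrow> (nat \<Rightarrow> 'a) \<Rightarrow> (nat \<Rightarrow> 'a) \<Rightarrow> 'a" where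
    "Lin v \<tau> y = unitv 0 v * (\<tau> 0 * y 0) + (unitv 1 v * (\<tau> 0 * y 1) + (u1 v * (\<tau> 1 * y 1) +
       (unitv 2 v * (\<tau> 0 * y 2) + (u2 v - u1 v) * (\<tau> 1 * y 2))))" for v \<tau> y
  have t11: "bh ?W ?U 1 1 (\<lambda>\<tau> y. \<tau> i * y j)" if "i \<in> ?W" "j \<in> ?U" for i j
    using bh_mult[OF bh_param[OF homp_var[OF that(1)]] bh_form[OF homp_var[OF that(2)]]] by simp
  have L11: "bh ?W ?U 1 1 (Lin v)" for v
    unfolding Lin_def[abs_def] by (intro bh_add bh_scale t11) auto
  define \<Theta> where "\<Theta> \<tau> y = J (\<lambda>v. Lin v \<tau> y)" for \<tau> y
  have bT: "bh ?W ?U e e \<Theta>" unfolding \<Theta>_def[abs_def] by (rule bh_compose[OF J L11])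
  define h where "h i = (if i = 0 then \<Theta> else (\<lambda>\<tau>. pd (i - 1) (\<Theta> \<tau>)))" for i :: nat
  define a where "a i = (if i = 0 then e else e - 1)" for i :: nat
  have jeq: "{(a i, h i \<tau>) | i. i \<in> {0..3}} = jets e (\<Theta> \<tau>)" for \<tau>
  proof -
    have "{0..3::nat} = {0,1,2,3}" by auto
    then have "{(a i, h i \<tau>) | i. i \<in> {0..3}} = {(a 0, h 0 \<tau>), (a 1, h 1 \<tau>), (a 2, h 2 \<tau>), (a 3, h 3 \<tau>)}" by auto
    then show ?thesis by (simp add: a_def h_def jets_def One_nat_def)
  qed
  have "cert ?U (jets e (\<Theta> (unitv 0))) N"
  proof -
    have "\<Theta> (unitv 0) = (\<lambda>y. J (\<lambda>v. if v \<le> 2 then y v else 0))"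
    proof
      fix y :: "nat \<Rightarrow> 'a"
      have "Lin v (unitv 0) y = (if v \<le> 2 then y v else 0)" for v
        by (cases "v = 0"; cases "v = 1"; cases "v = 2") (auto simp: Lin_def unitv_def)
      then show "\<Theta> (unitv 0) y = J (\<lambda>v. if v \<le> 2 then y v else 0)" by (simp add: \<Theta>_def)
    qed
    then show ?thesis using cert_plane_restrict[OF n J c] by simp
  qed
  then have c3: "cert ?U {(a i, h i (unitv 0)) | i. i \<in> {0..3}} N" unfolding jeq .
  have bhi: "bh ?W ?U e (a i) (h i)" for i
    using bT bh_pd[OF bT, of "i - 1"] by (cases "i = 0") (simp_all add: a_def h_def)
  from cert_open[where a = a and h = h and I = "{0..3}" and e = e, OF bhi c3] obtain e' \<Gamma> where G: "homp ?W e' \<Gamma>" "\<Gamma> (unitv 0) \<noteq> 0"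
    "\<And>\<tau>. \<Gamma> \<tau> \<noteq> 0 \<Longrightarrow> cert ?U (jets e (\<Theta> \<tau>)) N"
    unfolding jeq by blast
  \<comment> \<open>The normal form at such a chart point, with the quotient
    \<open>z1 0 / \<tau> 0\<close> already cleared: the expression is polynomial in
    \<open>\<tau>\<close> and meaningful at \<open>(0, 1)\<close>, where it is nonzero.\<close>
  define f1 where "f1 \<tau> = R1 (\<lambda>v. z1 0 * unitv 0 v + (unitv 1 v * \<tau> 0 + u1 v * \<tau> 1))" for \<tau> :: "nat \<Rightarrow> 'a"
  define f2 where "f2 \<tau> = R2 (\<lambda>v. z2 0 * unitv 0 v + ((unitv 1 v + unitv 2 v) * \<tau> 0 + u2 v * \<tau> 1))" for \<tau> :: "nat \<Rightarrow> 'a"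
  have pf: "polyf ?W f1" "polyf ?W f2"
    unfolding f1_def[abs_def] f2_def[abs_def]
    by (intro polyf_compose[OF pR(1)] polyf_compose[OF pR(2)] polyf_add polyf_mult polyf_const polyf_var; simp)+
  define fs where "fs i = (if i = 0 then \<Gamma> else if i = 1 then (\<lambda>\<tau>. \<tau> 0) else if i = 2 then f1 else f2)" for i :: nat
  have "\<exists>\<tau>. \<forall>i\<in>{0..3}. fs i \<tau> \<noteq> 0"
  proof (rule common_nonzero_point[where V = ?W])
    have "polyf ?W (\<lambda>\<tau> :: nat \<Rightarrow> 'a. \<tau> 0)" by (rule polyf_var) simp
    then show "polyf ?W (fs i)" for i
      using pf homp_polyf[OF G(1)] by (simp add: fs_def)
    have z: "f1 (unitv 1) \<noteq> 0" "f2 (unitv 1) \<noteq> 0"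
    proof -
      have "(\<lambda>v. z1 0 * unitv 0 v + (unitv 1 v * unitv 1 (0::nat) + u1 v * unitv 1 (1::nat))) = z1"
           "(\<lambda>v. z2 0 * unitv 0 v + ((unitv 1 v + unitv 2 v) * unitv 1 (0::nat) + u2 v * unitv 1 (1::nat))) = z2"
        by (auto simp: unitv_def u1_def u2_def fun_eq_iff)
      then show "f1 (unitv 1) \<noteq> 0" "f2 (unitv 1) \<noteq> 0"
        unfolding f1_def f2_def using 1(5) 2(5) by (simp_all add: R1_def R2_def)
    qed
    have "(unitv 0 :: nat \<Rightarrow> 'a) 0 \<noteq> 0" by (simp add: unitv_def)
    then show "\<exists>x. fs i x \<noteq> 0" for i
      using z G(2) by (cases "i = 0"; cases "i = 1"; cases "i = 2") (auto simp: fs_def)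
  qed simp
  then obtain \<tau> where "\<forall>i\<in>{0..3}. fs i \<tau> \<noteq> 0" ..
  then have t: "fs i \<tau> \<noteq> 0" if "i \<le> 3" for i using that by simp
  have t0: "\<tau> 0 \<noteq> 0" and tG: "\<Gamma> \<tau> \<noteq> 0" and tf: "f1 \<tau> \<noteq> 0" "f2 \<tau> \<noteq> 0"
    using t[of 1] t[of 0] t[of 2] t[of 3] by (auto simp: fs_def)
  define G where "G = \<Theta> \<tau>"
  have hG: "homp ?U e G" unfolding G_def by (rule bh_homp[OF bT])
  have cG: "cert ?U (jets e G) N" unfolding G_def by (rule G(3)[OF tG])
  have "G (unitv 0) = J (\<lambda>v. \<tau> 0 * unitv 0 v)"
    unfolding G_def \<Theta>_def by (rule arg_cong[where f = J]) (auto simp: Lin_def unitv_def)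
  then have lG: "G (unitv 0) \<noteq> 0" using homp_homogeneous[OF J, of "\<tau> 0" "unitv 0"] t0 lead by simp
  obtain j c0 where j: "degree j = e" "c0 \<noteq> 0" "lead_coeff j = [:c0:]"
     "\<And>i. coeff j i \<noteq> 0 \<Longrightarrow> i + degree (coeff j i) \<le> e" "\<And>x t. poly (poly j [:x:]) t = G (pt3 x t)"
    using dehomogenize[OF hG lG] by blast
  have irr: "irreducible j" by (rule dehomogenize_irreducible[OF hG lG e cG j])
  define pt where "pt x t v = Lin v \<tau> (pt3 x t)" for x t v
  have jJ: "poly (poly j [:x:]) t = J (pt x t)" for x t by (simp add: j(5) G_def \<Theta>_def pt_def[abs_def])
  define cv where "cv v = [:[:unitv 1 v * \<tau> 0 + u1 v * \<tau> 1, unitv 2 v * \<tau> 0 + (u2 v - u1 v) * \<tau> 1:], [:unitv 0 v * \<tau> 0:]:]" for v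
  have cvp: "poly (poly (cv v) [:x:]) t = pt x t v" for v x t
    by (simp add: cv_def pt_def Lin_def algebra_simps)
  have ex: "\<exists>q. \<forall>x t. poly (poly q [:x:]) t = T (pt x t)" if "polyf ?V T" for T
    using polyf_uni2[where F = "\<lambda>v x t. pt x t v" and cv = cv, OF that cvp] by simp
  \<comment> \<open>Only coordinate 0 of \<open>cv\<close> involves the outer variable, with degree
    at most 1. A restricted normal form therefore has degree below \<open>e\<close>, and since it is
    nonzero at one point it is no multiple of \<open>j\<close>.\<close>
  have key: "\<not> j dvd p" if p: "\<And>x t. poly (poly p [:x:]) t = T (pt x t)"
    and S: "polyf ?V S" and A: "finite A" "\<And>\<alpha>. \<alpha> \<in> A \<Longrightarrow> \<alpha> 0 < e"
    and TS: "\<And>x. T x = J x * S x + (\<Sum>\<alpha>\<in>A. r \<alpha> * monv ?V \<alpha> x)"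
    and nz: "(\<Sum>\<alpha>\<in>A. r \<alpha> * monv ?V \<alpha> (pt x0 t0)) \<noteq> 0" for p T S A r x0 t0
  proof
    assume jp: "j dvd p"
    obtain s where s: "\<And>x t. poly (poly s [:x:]) t = S (pt x t)" using ex[OF S] by blast
    define R where "R = (\<Sum>\<alpha>\<in>A. [:[:r \<alpha>:]:] * (\<Prod>v\<in>?V. cv v ^ \<alpha> v))"
    have Rp: "poly (poly R [:x:]) t = (\<Sum>\<alpha>\<in>A. r \<alpha> * monv ?V \<alpha> (pt x t))" for x t
      by (simp add: R_def poly_sum poly_prod monv_def cvp)
    have "p = j * s + R"
      by (rule eval2_eqI) (simp add: p s Rp jJ TS)
    then have "j dvd R" using jp by (simp add: dvd_add_right_iff)
    have "degree R < e"
    proof -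
      have "degree R \<le> e - 1" unfolding R_def
      proof (rule degree_sum_le[OF A(1)])
        fix \<alpha> assume a: "\<alpha> \<in> A"
        have "degree ([:[:r \<alpha>:]:] * (\<Prod>v\<in>?V. cv v ^ \<alpha> v)) \<le> degree [:[:r \<alpha>:]:] + degree (\<Prod>v\<in>?V. cv v ^ \<alpha> v)"
          by (rule degree_mult_le)
        also have "\<dots> = degree (\<Prod>v\<in>?V. cv v ^ \<alpha> v)" by simp
        also have "\<dots> \<le> (\<Sum>v\<in>?V. degree (cv v ^ \<alpha> v))" using degree_prod_sum_le[of ?V "\<lambda>v. cv v ^ \<alpha> v"] by (simp add: o_def)
        also have "\<dots> \<le> (\<Sum>v\<in>?V. if v = 0 then \<alpha> 0 else 0)"
        proof (rule sum_mono)
          fix v assume "v \<in> ?V"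
          have "degree (cv v) \<le> (if v = 0 then 1 else 0)" by (auto simp: cv_def unitv_def)
          then have "degree (cv v) * \<alpha> v \<le> (if v = 0 then 1 else 0) * \<alpha> v" by (rule mult_le_mono1)
          from le_trans[OF degree_power_le this] show "degree (cv v ^ \<alpha> v) \<le> (if v = 0 then \<alpha> 0 else 0)"
            by (cases "v = 0") simp_all
        qed
        also have "\<dots> = \<alpha> 0" by simp
        also have "\<dots> \<le> e - 1" using A(2)[OF a] by simp
        finally show "degree ([:[:r \<alpha>:]:] * (\<Prod>v\<in>?V. cv v ^ \<alpha> v)) \<le> e - 1" .
      qed
      then show ?thesis using e by simp
    qed
    then have "R = 0" using dvd_imp_degree_le[OF \<open>j dvd R\<close>] j(1) by (cases "R = 0") auto
    then show False using nz Rp[of x0 t0] by simp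
  qed
  obtain p where p: "\<And>x t. poly (poly p [:x:]) t = P (pt x t)" using ex[OF P(1)] by blast
  obtain q where q: "\<And>x t. poly (poly q [:x:]) t = Q (pt x t)" using ex[OF Q(1)] by blast
  have "\<not> j dvd p"
  proof (rule key[of p P S1 A1 r1 "z1 0 / \<tau> 0" 0])
    show "poly (poly p [:x:]) t = P (pt x t)" for x t by (rule p)
    show "polyf ?V S1" "finite A1" by (rule 1(1), rule 1(2))
    show "\<alpha> 0 < e" if "\<alpha> \<in> A1" for \<alpha> by (rule 1(3)[OF that])
    show "P x = J x * S1 x + (\<Sum>\<alpha>\<in>A1. r1 \<alpha> * monv ?V \<alpha> x)" for x by (rule 1(4))
    have "pt (z1 0 / \<tau> 0) 0 = (\<lambda>v. z1 0 * unitv 0 v + (unitv 1 v * \<tau> 0 + u1 v * \<tau> 1))"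
      using t0 by (auto simp: pt_def Lin_def)
    then show "(\<Sum>\<alpha>\<in>A1. r1 \<alpha> * monv ?V \<alpha> (pt (z1 0 / \<tau> 0) 0)) \<noteq> 0" using tf(1) by (simp add: f1_def R1_def)
  qed
  moreover have "\<not> j dvd q"
  proof (rule key[of q Q S2 A2 r2 "z2 0 / \<tau> 0" 1])
    show "poly (poly q [:x:]) t = Q (pt x t)" for x t by (rule q)
    show "polyf ?V S2" "finite A2" by (rule 2(1), rule 2(2))
    show "\<alpha> 0 < e" if "\<alpha> \<in> A2" for \<alpha> by (rule 2(3)[OF that])
    show "Q x = J x * S2 x + (\<Sum>\<alpha>\<in>A2. r2 \<alpha> * monv ?V \<alpha> x)" for x by (rule 2(4))
    have "pt (z2 0 / \<tau> 0) 1 = (\<lambda>v. z2 0 * unitv 0 v + ((unitv 1 v + unitv 2 v) * \<tau> 0 + u2 v * \<tau> 1))"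
      using t0 by (auto simp: pt_def Lin_def algebra_simps)
    then show "(\<Sum>\<alpha>\<in>A2. r2 \<alpha> * monv ?V \<alpha> (pt (z2 0 / \<tau> 0) 1)) \<noteq> 0" using tf(2) by (simp add: f2_def R2_def)
  qed
  moreover have pj: "prime_elem j" using irr by (simp only: prime_elem_iff_irreducible)
  ultimately have "\<not> j dvd p * q" by (simp only: prime_elem_dvd_mult_iff[OF pj]) simp
  from irreducible_curve_point[OF ac irr _ j(3,2) this] obtain x t where
    "poly (poly j [:x:]) t = 0" "poly (poly (p * q) [:x:]) t \<noteq> 0" using e j(1) by auto
  then have "J (pt x t) = 0" "P (pt x t) \<noteq> 0" "Q (pt x t) \<noteq> 0" by (auto simp: jJ p q)
  then show ?thesis by (intro exI[of _ "pt x t"]) simp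
qed

subsection \<open>Iterates of a good map\<close>

text \<open>\<open>fm\<close>, \<open>J\<close> and \<open>e\<close> are parameters tied down by
  equations, so that the locale can be interpreted directly with \<open>map_apply\<close> and the
  generic Jacobian determinant. \<open>c1\<close> expresses the absence of base points,
  \<open>c2\<close> smoothness of the plane section.\<close>

locale good_map =
  fixes n d :: nat and f :: "nat \<Rightarrow> (nat \<Rightarrow> 'a::field_char_0) \<Rightarrow> 'a" and N1 N0 :: nat
    and fm :: "(nat \<Rightarrow> 'a) \<Rightarrow> nat \<Rightarrow> 'a" and J :: "(nat \<Rightarrow> 'a) \<Rightarrow> 'a" and e :: nat
  assumes ac: "alg_closed TYPE('a)" and d3: "d \<ge> 3" and n2: "n \<ge> 2"
    and f: "\<And>i. i \<le> n \<Longrightarrow> homp {0..n} d (f i)"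
    and c1: "cert {0..n} {(d, f i) | i. i \<in> {0..n}} N1"
    and fm_def: "fm = (\<lambda>x i. if i \<le> n then f i x else 0)"
    and J_def: "J = (\<lambda>x. det (mat (n + 1) (n + 1) (\<lambda>(i, j). pd j (f i) x)))"
    and e_def: "e = (n + 1) * (d - 1)"
    and lead: "J (unitv 0) \<noteq> 0"
    and c2: "cert {0..n} (jets e J \<union> {(1, \<lambda>x. x j) | j. j \<in> {3..n}}) N0"
begin

abbreviation "V \<equiv> {0..n}"

lemma V: "finite V" "V \<noteq> {}" by auto

lemma homp_J: "homp V e J"
  unfolding J_def e_def
proof (rule homp_det[OF V])
  fix i j assume "i < n + 1" "j < n + 1"
  then have "i \<le> n" by simp
  from homp_pd[OF V f[OF this]] show "homp V (d - 1) (\<lambda>x. pd j (f i) x)" .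
qed

lemma e_ge: "e \<ge> 1" "e > n + 1"
proof -
  have "(n + 1) * 2 \<le> e" unfolding e_def using d3 by (intro mult_le_mono2) simp
  then show "e \<ge> 1" "e > n + 1" using n2 by auto
qed

sublocale M: monic_form V 0 e J
  using homp_J lead by unfold_locales auto

definition van :: "((nat \<Rightarrow> 'a) \<Rightarrow> 'a) \<Rightarrow> bool" where
  "van P \<longleftrightarrow> (\<forall>x. J x = 0 \<longrightarrow> P x = 0)"

lemma dvdp_van: "dvdp V J P \<Longrightarrow> van P"
  by (auto simp: dvdp_def van_def)

lemma not_dvd_one: "\<not> dvdp V J (\<lambda>_. 1)"
proof
  assume "dvdp V J (\<lambda>_. 1)"
  then obtain S where S: "\<And>x. 1 = J x * S x" unfolding dvdp_def by blast
  have "J (\<lambda>_. 0) = 0" using e_ge by (intro homp_zero_at[OF homp_J]) auto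
  then show False using S[of "\<lambda>_. 0"] by simp
qed

text \<open>Nullstellensatz for \<open>J\<close>, from \<open>prime_hypersurface\<close> with the
  constant 1 as second form. Vanishing on the hypersurface and divisibility by \<open>J\<close>
  become interchangeable.\<close>

lemma van_dvdp: "polyf V P \<Longrightarrow> van P \<Longrightarrow> dvdp V J P"
proof (rule ccontr)
  assume P: "polyf V P" "van P" "\<not> dvdp V J P"
  from prime_hypersurface[OF ac n2 homp_J e_ge(1) lead c2 P(1,3) polyf_const not_dvd_one]
  show False using P(2) by (auto simp: van_def)
qed

lemma van_mult: "polyf V P \<Longrightarrow> polyf V Q \<Longrightarrow> van (\<lambda>x. P x * Q x) \<Longrightarrow> van P \<or> van Q"
proof (rule ccontr)
  assume P: "polyf V P" and Q: "polyf V Q" and PQ: "van (\<lambda>x. P x * Q x)" and n: "\<not> (van P \<or> van Q)"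
  have "\<not> dvdp V J P" "\<not> dvdp V J Q" using n dvdp_van by blast+
  from prime_hypersurface[OF ac n2 homp_J e_ge(1) lead c2 P this(1) Q this(2)]
  show False using PQ by (auto simp: van_def)
qed

lemma van_power: "polyf V P \<Longrightarrow> van (\<lambda>x. P x ^ k) \<Longrightarrow> van P"
  by (auto simp: van_def)

lemma van_prod:
  "finite I \<Longrightarrow> (\<And>i. i \<in> I \<Longrightarrow> polyf V (P i)) \<Longrightarrow> van (\<lambda>x. \<Prod>i\<in>I. P i x) \<Longrightarrow> \<exists>i\<in>I. van (P i)"
proof (induction I rule: finite_induct)
  case empty
  then show ?case using not_dvd_one van_dvdp[OF polyf_const] by simp
next
  case (insert i I)
  have "van (\<lambda>x. P i x * (\<Prod>i\<in>I. P i x))" using insert by simp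
  from van_mult[OF _ _ this] insert show ?case by (auto intro: polyf_prod)
qed

lemma fm_comp: "v \<in> V \<Longrightarrow> (\<lambda>x. fm x v) = f v"
  by (auto simp: fm_def)

lemma homp_iter: "i \<in> V \<Longrightarrow> homp V (d ^ k) (\<lambda>x. (fm ^^ k) x i)"
proof (induction k arbitrary: i)
  case 0
  then show ?case using homp_var[of i V] by simp
next
  case (Suc k)
  have h: "homp V (d ^ k * d) (\<lambda>x. f i (\<lambda>v. (fm ^^ k) x v))"
  proof (rule homp_compose[where F = "\<lambda>v x. (fm ^^ k) x v" and V = V])
    show "homp V d (f i)" using Suc.prems by (intro f) simp
    show "homp V (d ^ k) (\<lambda>x. (fm ^^ k) x v)" if "v \<in> V" for v using that by (rule Suc.IH)
  qed
  have eq: "(\<lambda>x. (fm ^^ Suc k) x i) = (\<lambda>x. f i (\<lambda>v. (fm ^^ k) x v))"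
    using Suc.prems by (auto simp: fm_def)
  show ?case unfolding eq power_Suc2 by (rule h)
qed

lemma polyf_iter: "i \<in> V \<Longrightarrow> polyf V (\<lambda>x. (fm ^^ k) x i)"
  by (rule homp_polyf[OF homp_iter])

lemma homp_comp_iter: "homp V m P \<Longrightarrow> homp V (d ^ k * m) (\<lambda>x. P ((fm ^^ k) x))"
  by (rule homp_compose[where F = "\<lambda>v x. (fm ^^ k) x v"]) (auto intro: homp_iter)

lemma polyf_comp_iter: "polyf V P \<Longrightarrow> polyf V (\<lambda>x. P ((fm ^^ k) x))"
  by (rule polyf_compose[where F = "\<lambda>v x. (fm ^^ k) x v"]) (auto intro: polyf_iter)

lemma cert_iter:
  assumes "cert V H N"
  shows "\<exists>N'. cert V {(d ^ k * a, \<lambda>x. h ((fm ^^ k) x)) | a h. (a, h) \<in> H} N'"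
proof (induction k)
  case 0
  have "{(d ^ 0 * a, \<lambda>x. h ((fm ^^ 0) x)) | a h. (a, h) \<in> H} = H" by auto
  then show ?case using assms by auto
next
  case (Suc k)
  let ?H = "{(d ^ k * a, \<lambda>x. h ((fm ^^ k) x)) | a h. (a, h) \<in> H}"
  from Suc obtain N' where c: "cert V ?H N'" by blast
  have F: "\<And>v. v \<in> V \<Longrightarrow> homp V d (\<lambda>x. fm x v)" using f by (simp add: fm_comp)
  have "{(d, \<lambda>x. fm x v) | v. v \<in> V} = {(d, f i) | i. i \<in> V}" 
    by (rule Collect_cong, rule ex_cong1) (use fm_comp in auto)
  then have "cert V {(d, \<lambda>x. fm x v) | v. v \<in> V} N1" using c1 by simp
  from cert_compose[where F = "\<lambda>v x. fm x v", OF V V F this c]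
  have "cert V {(d * a, \<lambda>x. h (fm x)) | a h. (a, h) \<in> ?H} (N' * N1)" by simp
  then have "cert V {(d ^ Suc k * a, \<lambda>x. h ((fm ^^ Suc k) x)) | a h. (a, h) \<in> H} (N' * N1)"
  proof (rule cert_trans)
    fix a h assume "(a, h) \<in> {(d * a, \<lambda>x. h (fm x)) | a h. (a, h) \<in> ?H}"
    then obtain a' h' a'' h'' where 1: "(a, h) = (d * a', \<lambda>x. h' (fm x))"
       and 2: "(a', h') = (d ^ k * a'', \<lambda>x. h'' ((fm ^^ k) x))" "(a'', h'') \<in> H" by (elim CollectE exE conjE) (rule that)
    have "(a, h) = (d ^ Suc k * a'', \<lambda>x. h'' ((fm ^^ Suc k) x))" using 1 2(1) by (auto simp: funpow_swap1)
    then have "(a, h) \<in> {(d ^ Suc k * a, \<lambda>x. h ((fm ^^ Suc k) x)) | a h. (a, h) \<in> H}" using 2(2) by blast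
    then show "gid V {(d ^ Suc k * a, \<lambda>x. h ((fm ^^ Suc k) x)) | a h. (a, h) \<in> H} a h" by (rule gid_in)
  qed
  then show ?case by blast
qed

definition Mt :: "nat \<Rightarrow> (nat \<Rightarrow> 'a) \<Rightarrow> 'a mat" where
  "Mt k x = mat (n + 1) (n + 1) (\<lambda>(i, j). pd j (\<lambda>x. (fm ^^ k) x i) x)"

lemma Mt_carrier: "Mt k x \<in> carrier_mat (n + 1) (n + 1)" by (simp add: Mt_def)

lemma pd_iter_chain:
  assumes "polyf V P"
  shows "pd j (\<lambda>x. P ((fm ^^ k) x)) x = (\<Sum>v\<in>V. pd v P ((fm ^^ k) x) * pd j (\<lambda>x. (fm ^^ k) x v) x)"
  using pd_compose[where F = "\<lambda>v x. (fm ^^ k) x v" and U = V, OF V(1) assms polyf_iter] by simp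

lemma V_less: "V = {0..<n + 1}" by auto

lemma Mt_Suc: "Mt (Suc k) x = Mt k (fm x) * Mt 1 x"
proof (rule eq_matI)
  fix i j assume "i < dim_row (Mt k (fm x) * Mt 1 x)" "j < dim_col (Mt k (fm x) * Mt 1 x)"
  then have ij: "i < n + 1" "j < n + 1" by (auto simp: Mt_def)
  have "Mt (Suc k) x $$ (i, j) = pd j (\<lambda>x. (fm ^^ Suc k) x i) x" using ij by (simp add: Mt_def)
  also have "\<dots> = pd j (\<lambda>x. (fm ^^ k) ((fm ^^ 1) x) i) x"
    by (rule pd_cong) (simp add: funpow_swap1 One_nat_def)
  also have "\<dots> = (\<Sum>v\<in>V. pd v (\<lambda>x. (fm ^^ k) x i) ((fm ^^ 1) x) * pd j (\<lambda>x. (fm ^^ 1) x v) x)"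
    using ij by (intro pd_iter_chain polyf_iter) auto
  also have "\<dots> = (Mt k (fm x) * Mt 1 x) $$ (i, j)"
    using ij unfolding V_less by (simp add: Mt_def scalar_prod_def One_nat_def)
  finally show "Mt (Suc k) x $$ (i, j) = (Mt k (fm x) * Mt 1 x) $$ (i, j)" .
qed (auto simp: Mt_def)

text \<open>Chain rule along the orbit; the factor with \<open>i = 0\<close> is \<open>J\<close>
  itself.\<close>

lemma det_Mt: "det (Mt k x) = (\<Prod>i<k. J ((fm ^^ i) x))"
proof (induction k arbitrary: x)
  case 0
  have "Mt 0 x = 1\<^sub>m (n + 1)" by (rule eq_matI) (auto simp: Mt_def pd_var)
  then show ?case by simp
next
  case (Suc k)
  have "Mt 1 x = mat (n + 1) (n + 1) (\<lambda>(i, j). pd j (f i) x)"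
    by (rule eq_matI) (auto simp: Mt_def fm_comp One_nat_def)
  then have "det (Mt 1 x) = J x" by (simp add: J_def)
  then have "det (Mt (Suc k) x) = (\<Prod>i<k. J ((fm ^^ i) (fm x))) * J x"
    unfolding Mt_Suc det_mult[OF Mt_carrier Mt_carrier] Suc by simp
  then show ?case by (simp add: prod.lessThan_Suc_shift funpow_swap1 mult.commute del: prod.lessThan_Suc)
qed

lemma homp_adj:
  assumes ij: "i \<le> n" "j \<le> n"
  shows "homp V (n * (d ^ k - 1)) (\<lambda>x. adj_mat (Mt k x) $$ (i, j))"
proof -
  \<comment> \<open>Position \<open>a\<close> of a minor with index \<open>b\<close> deleted comes
    from position \<open>?p a b\<close> of the full matrix.\<close>
  let ?p = "\<lambda>a b. if a < b then a else Suc a"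
  have eq: "adj_mat (Mt k x) $$ (i, j) = (-1) ^ (j + i) * det (mat n n (\<lambda>(a, b). pd (?p b i) (\<lambda>x. (fm ^^ k) x (?p a j)) x))" for x
  proof -
    have "mat_delete (Mt k x) j i = mat n n (\<lambda>(a, b). pd (?p b i) (\<lambda>x. (fm ^^ k) x (?p a j)) x)"
      by (rule eq_matI) (auto simp: mat_delete_def Mt_def)
    then show ?thesis using ij by (simp add: adj_mat_def cofactor_def Mt_def)
  qed
  show ?thesis unfolding eq
  proof (rule homp_scale, rule homp_det[OF V])
    fix a b assume "a < n" "b < n"
    then have "?p a j \<in> V" by auto
    from homp_pd[OF V homp_iter[OF this]] show "homp V (d ^ k - 1) (\<lambda>x. pd (?p b i) (\<lambda>x. (fm ^^ k) x (?p a j)) x)" .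
  qed
qed

end

section \<open>Integrality over the components of a finite map, and derivations\<close>

lemma gid_indexed:
  assumes V: "finite V" "V \<noteq> {}" and I: "finite I"
  shows "gid V {(a i, h i) | i. i \<in> I} m P \<Longrightarrow>
    \<exists>c. (\<forall>i\<in>I. homp V (m - a i) (c i) \<and> (m < a i \<longrightarrow> (\<forall>x. c i x = 0))) \<and> (\<forall>x. P x = (\<Sum>i\<in>I. c i x * h i x))"
proof (induction rule: gid.induct)
  case (gid_zero m)
  show ?case by (intro exI[of _ "\<lambda>_ _. 0"]) (auto simp: homp_zero V)
next
  case (gid_gen a' h' b c)
  then obtain i where i: "i \<in> I" "a' = a i" "h' = h i" by auto
  define cc where "cc k = (if k = i then c else (\<lambda>_. 0))" for k
  have "(\<Sum>k\<in>I. cc k x * h k x) = (\<Sum>k\<in>I. if k = i then c x * h i x else 0)" for x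
    by (intro sum.cong) (auto simp: cc_def)
  then have "c x * h' x = (\<Sum>k\<in>I. cc k x * h k x)" for x using i I by simp
  moreover have "homp V (a' + b - a k) (cc k) \<and> (a' + b < a k \<longrightarrow> (\<forall>x. cc k x = 0))" for k
    using gid_gen(2) i by (auto simp: cc_def homp_zero V)
  ultimately show ?case by (intro exI[of _ cc]) simp
next
  case (gid_add m P Q)
  then obtain c c' where
    c: "\<forall>i\<in>I. homp V (m - a i) (c i) \<and> (m < a i \<longrightarrow> (\<forall>x. c i x = 0))" "\<forall>x. P x = (\<Sum>i\<in>I. c i x * h i x)"
    "\<forall>i\<in>I. homp V (m - a i) (c' i) \<and> (m < a i \<longrightarrow> (\<forall>x. c' i x = 0))" "\<forall>x. Q x = (\<Sum>i\<in>I. c' i x * h i x)" by blast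
  have "homp V (m - a i) (\<lambda>x. c i x + c' i x)" if "i \<in> I" for i
    using c that by (intro homp_add) auto
  then show ?case using c
    by (intro exI[of _ "\<lambda>i x. c i x + c' i x"]) (auto simp: distrib_right sum.distrib)
qed

definition polycoef :: "'v set \<Rightarrow> (('v \<Rightarrow> 'a::comm_ring_1) \<Rightarrow> 'a poly) \<Rightarrow> bool" where
  "polycoef V q \<longleftrightarrow> (\<forall>k. polyf V (\<lambda>y. coeff (q y) k))"

lemma polycoef_mult: "polycoef V p \<Longrightarrow> polycoef V q \<Longrightarrow> polycoef V (\<lambda>y. p y * q y)"
  unfolding polycoef_def coeff_mult
proof (intro allI polyf_sum)
  fix k i assume "\<forall>k. polyf V (\<lambda>y. coeff (p y) k)" "\<forall>k. polyf V (\<lambda>y. coeff (q y) k)"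
  then show "polyf V (\<lambda>y. coeff (p y) i * coeff (q y) (k - i))" by (intro polyf_mult) auto
qed

lemma polycoef_const: "polycoef V (\<lambda>_. c)"
  unfolding polycoef_def by (intro allI polyf_const)

lemma polycoef_sum: "(\<And>i. i \<in> I \<Longrightarrow> polycoef V (q i)) \<Longrightarrow> polycoef V (\<lambda>y. \<Sum>i\<in>I. q i y)"
  unfolding polycoef_def coeff_sum by (intro allI polyf_sum) auto

lemma polycoef_prod: "(\<And>i. i \<in> I \<Longrightarrow> polycoef V (q i)) \<Longrightarrow> polycoef V (\<lambda>y. \<Prod>i\<in>I. q i y)"
proof (induction I rule: infinite_finite_induct)
  case (insert i I)
  have "polycoef V (\<lambda>y. q i y * (\<Prod>i\<in>I. q i y))" using insert by (intro polycoef_mult) auto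
  then show ?case using insert(1,2) by simp
qed (auto simp: polycoef_const)

lemma polycoef_char_poly:
  fixes S :: "('v \<Rightarrow> 'a::comm_ring_1) \<Rightarrow> nat \<Rightarrow> nat \<Rightarrow> 'a"
  assumes "\<And>i j. polyf V (\<lambda>y. S y i j)"
  shows "polycoef V (\<lambda>y. char_poly (mat K K (\<lambda>(i, j). S y i j)))"
proof -
  let ?A = "\<lambda>y. mat K K (\<lambda>(i, j). S y i j)"
  have entry: "polycoef V (\<lambda>y. (if i = j then [:0, 1:] else 0) + [:- S y i j:])" for i j
    unfolding polycoef_def
  proof
    fix k
    have "(\<lambda>y. coeff ((if i = j then [:0, 1:] else 0) + [:- S y i j:]) k) =
      (\<lambda>y. coeff (if i = j then [:0, 1:] else 0) k + (if k = 0 then -1 else 0) * S y i j)"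
      by (auto simp: coeff_pCons split: nat.splits)
    then show "polyf V (\<lambda>y. coeff ((if i = j then [:0, 1:] else 0) + [:- S y i j:]) k)"
      using assms by (simp only:) (intro polyf_add polyf_mult polyf_const)
  qed
  have eq: "char_poly (?A y) = (\<Sum>p\<in>{p. p permutes {0..<K}}. signof p * (\<Prod>i=0..<K. (if i = p i then [:0, 1:] else 0) + [:- S y i (p i):]))" for y
  proof -
    have "char_poly (?A y) = (\<Sum>p\<in>{p. p permutes {0..<K}}. signof p * (\<Prod>i=0..<K. char_poly_matrix (?A y) $$ (i, p i)))"
      unfolding char_poly_def by (rule det_def') (auto simp: char_poly_matrix_def)
    also have "\<dots> = (\<Sum>p\<in>{p. p permutes {0..<K}}. signof p * (\<Prod>i=0..<K. (if i = p i then [:0, 1:] else 0) + [:- S y i (p i):]))"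
    proof (intro sum.cong refl arg_cong2[where f = "(*)"] prod.cong)
      fix p i assume "p \<in> {p. p permutes {0..<K}}" "i \<in> {0..<K}"
      then show "char_poly_matrix (?A y) $$ (i, p i) = (if i = p i then [:0, 1:] else 0) + [:- S y i (p i):]"
        using permutes_in_image[of p "{0..<K}" i] by (auto simp: char_poly_matrix_def)
    qed
    finally show ?thesis .
  qed
  show ?thesis unfolding eq
    by (rule polycoef_sum, rule polycoef_mult[OF polycoef_const], rule polycoef_prod, rule entry)
qed

context good_map
begin

text \<open>Graded Nakayama: a form of degree at least \<open>N\<close> is a combination of the
  \<open>F x v\<close> with cofactors of smaller degree, so the monomials of degree below
  \<open>N\<close> generate all forms over the polynomials in \<open>F\<close>.\<close>

lemma module_span:
  fixes F :: "(nat \<Rightarrow> 'a) \<Rightarrow> nat \<Rightarrow> 'a"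
  assumes F: "\<And>v. v \<in> V \<Longrightarrow> homp V D (\<lambda>x. F x v)" and D: "D \<ge> 1"
    and c: "cert V {(D, \<lambda>x. F x v) | v. v \<in> V} N" and N: "N \<ge> 1"
  shows "homp V m P \<Longrightarrow> \<exists>s. (\<forall>\<gamma>. polyf V (s \<gamma>)) \<and> (\<forall>x. P x = (\<Sum>\<gamma>\<in>(\<Union>k<N. mons V k). s \<gamma> (F x) * monv V \<gamma> x))"
proof (induction m arbitrary: P rule: less_induct)
  case (less m)
  let ?G = "\<Union>k<N. mons V k"
  have finG: "finite ?G" using finite_mons[OF V(1)] by auto
  show ?case
  proof (cases "m < N")
    case True
    obtain c where c: "\<And>x. P x = (\<Sum>\<alpha>\<in>mons V m. c \<alpha> * monv V \<alpha> x)" using homp_expand[OF less.prems V(1)] by blast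
    have "P x = (\<Sum>\<gamma>\<in>?G. (if \<gamma> \<in> mons V m then c \<gamma> else 0) * monv V \<gamma> x)" for x
      unfolding c using True finG by (intro sum.mono_neutral_cong_left) auto
    then show ?thesis by (intro exI[of _ "\<lambda>\<gamma> _. if \<gamma> \<in> mons V m then c \<gamma> else 0"]) (auto simp: polyf_const)
  next
    case False
    then have "cert V {(D, \<lambda>x. F x v) | v. v \<in> V} m" using cert_mono[OF V(1) c] by simp
    then have "gid V {(D, \<lambda>x. F x v) | v. v \<in> V} m P" using less.prems by (simp add: cert_def)
    from gid_indexed[where a = "\<lambda>_. D" and h = "\<lambda>v x. F x v", OF V V(1) this]
    obtain cc where cc: "\<And>v. v \<in> V \<Longrightarrow> homp V (m - D) (cc v)" "\<And>x. P x = (\<Sum>v\<in>V. cc v x * F x v)" by blast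
    have "\<forall>v. \<exists>s. v \<in> V \<longrightarrow> (\<forall>\<gamma>. polyf V (s \<gamma>)) \<and> (\<forall>x. cc v x = (\<Sum>\<gamma>\<in>?G. s \<gamma> (F x) * monv V \<gamma> x))"
    proof
      fix v
      have "m - D < m" using False N D by auto
      from less.IH[OF this] show "\<exists>s. v \<in> V \<longrightarrow> (\<forall>\<gamma>. polyf V (s \<gamma>)) \<and> (\<forall>x. cc v x = (\<Sum>\<gamma>\<in>?G. s \<gamma> (F x) * monv V \<gamma> x))"
        using cc(1) by blast
    qed
    from choice[OF this] obtain s where "\<forall>v. v \<in> V \<longrightarrow> (\<forall>\<gamma>. polyf V (s v \<gamma>)) \<and> (\<forall>x. cc v x = (\<Sum>\<gamma>\<in>?G. s v \<gamma> (F x) * monv V \<gamma> x))" ..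
    then have s: "\<And>v \<gamma>. v \<in> V \<Longrightarrow> polyf V (s v \<gamma>)" "\<And>v x. v \<in> V \<Longrightarrow> cc v x = (\<Sum>\<gamma>\<in>?G. s v \<gamma> (F x) * monv V \<gamma> x)" by auto
    define t where "t \<gamma> = (\<lambda>y. \<Sum>v\<in>V. s v \<gamma> y * y v)" for \<gamma>
    have "polyf V (t \<gamma>)" for \<gamma> unfolding t_def
      by (intro polyf_sum polyf_mult s polyf_var)
    moreover have "P x = (\<Sum>\<gamma>\<in>?G. t \<gamma> (F x) * monv V \<gamma> x)" for x
    proof -
      have "P x = (\<Sum>v\<in>V. \<Sum>\<gamma>\<in>?G. s v \<gamma> (F x) * F x v * monv V \<gamma> x)"
        unfolding cc(2) by (intro sum.cong refl) (simp add: s(2) sum_distrib_left sum_distrib_right mult_ac)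
      also have "\<dots> = (\<Sum>\<gamma>\<in>?G. t \<gamma> (F x) * monv V \<gamma> x)"
        unfolding t_def sum_distrib_right by (rule sum.swap)
      finally show ?thesis .
    qed
    ultimately show ?thesis by (intro exI[of _ t]) simp
  qed
qed

text \<open>Determinant trick: multiplication by coordinate \<open>l\<close> acts on the generating
  monomials through a matrix over the polynomials in \<open>F\<close>. At each point the vector of
  monomials is an eigenvector with eigenvalue \<open>x l\<close>, so the characteristic polynomial
  is a monic relation.\<close>

lemma integral_relation:
  fixes F :: "(nat \<Rightarrow> 'a) \<Rightarrow> nat \<Rightarrow> 'a"
  assumes F: "\<And>v. v \<in> V \<Longrightarrow> homp V D (\<lambda>x. F x v)" and D: "D \<ge> 1"
    and c: "cert V {(D, \<lambda>x. F x v) | v. v \<in> V} N" and l: "l \<in> V"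
  shows "\<exists>K s. (\<forall>k. polyf V (s k)) \<and> (\<forall>x. (\<Sum>k\<le>K. s k (F x) * x l ^ k) = 0) \<and> s K = (\<lambda>_. 1)"
proof -
  \<comment> \<open>Raising the degree by one ensures that the constant monomial is among the
    generators; it makes the eigenvector nonzero.\<close>
  have c': "cert V {(D, \<lambda>x. F x v) | v. v \<in> V} (N + 1)" by (rule cert_mono[OF V(1) c]) simp
  let ?G = "\<Union>k<N + 1. mons V k"
  have finG: "finite ?G" using finite_mons[OF V(1)] by auto
  let ?K = "card ?G"
  obtain en where en: "bij_betw en {0..<?K} ?G" using ex_bij_betw_nat_finite[OF finG] by blast
  have "\<forall>i. \<exists>s. i < ?K \<longrightarrow> (\<forall>\<gamma>. polyf V (s \<gamma>)) \<and> (\<forall>x. x l * monv V (en i) x = (\<Sum>\<gamma>\<in>?G. s \<gamma> (F x) * monv V \<gamma> x))"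
  proof
    fix i
    show "\<exists>s. i < ?K \<longrightarrow> (\<forall>\<gamma>. polyf V (s \<gamma>)) \<and> (\<forall>x. x l * monv V (en i) x = (\<Sum>\<gamma>\<in>?G. s \<gamma> (F x) * monv V \<gamma> x))"
    proof (cases "i < ?K")
      case True
      then have "en i \<in> ?G" using en by (auto simp: bij_betw_def)
      then obtain k where k: "en i \<in> mons V k" by auto
      have "homp V (1 + k) (\<lambda>x :: nat \<Rightarrow> 'a. x l * monv V (en i) x)"
        by (rule homp_mult[OF homp_var[OF l] homp_mon[OF V(1) k]])
      from module_span[OF F D c' _ this] show ?thesis by auto
    qed auto
  qed
  from choice[OF this] obtain s where "\<forall>i. i < ?K \<longrightarrow> (\<forall>\<gamma>. polyf V (s i \<gamma>)) \<and> (\<forall>x. x l * monv V (en i) x = (\<Sum>\<gamma>\<in>?G. s i \<gamma> (F x) * monv V \<gamma> x))" ..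
  then have s: "\<And>i \<gamma>. i < ?K \<Longrightarrow> polyf V (s i \<gamma>)" "\<And>i x. i < ?K \<Longrightarrow> x l * monv V (en i) x = (\<Sum>\<gamma>\<in>?G. s i \<gamma> (F x) * monv V \<gamma> x)" by auto
  define S where "S y i j = (if i < ?K then s i (en j) y else 0)" for y i j
  have pS: "polyf V (\<lambda>y. S y i j)" for i j
    using s(1)[of i "en j"] by (cases "i < ?K") (simp_all add: S_def polyf_const)
  let ?A = "\<lambda>y. mat ?K ?K (\<lambda>(i, j). S y i j)"
  have ca: "?A y \<in> carrier_mat ?K ?K" for y by auto
  define r where "r k = (\<lambda>y. coeff (char_poly (?A y)) k)" for k
  have pr: "polyf V (r k)" for k
    using polycoef_char_poly[of V S ?K, OF pS] unfolding polycoef_def r_def by simp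
  have top: "r ?K = (\<lambda>_. 1)" using degree_monic_char_poly[OF ca] by (auto simp: r_def)
  have zero: "(\<Sum>k\<le>?K. r k (F x) * x l ^ k) = 0" for x
  proof -
    have sumen: "(\<Sum>\<gamma>\<in>?G. g \<gamma>) = (\<Sum>j\<in>{0..<?K}. g (en j))" for g :: "(nat \<Rightarrow> nat) \<Rightarrow> 'a"
      by (rule sum.reindex_bij_betw[OF en, symmetric])
    let ?w = "vec ?K (\<lambda>j. monv V (en j) x)"
    have "eigenvector (?A (F x)) ?w (x l)"
      unfolding eigenvector_def
    proof (intro conjI)
      show "?w \<in> carrier_vec (dim_row (?A (F x)))" by simp
      have "(\<lambda>_. 0) \<in> ?G" using mons_0[OF V(1)] by auto
      then have "(\<lambda>_. 0) \<in> en ` {0..<?K}" using en by (simp add: bij_betw_def)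
      then obtain j where j: "j < ?K" "en j = (\<lambda>_. 0)" by auto
      then have w1: "?w $ j = 1" by (simp add: monv_def)
      show "?w \<noteq> 0\<^sub>v (dim_row (?A (F x)))"
      proof
        assume "?w = 0\<^sub>v (dim_row (?A (F x)))"
        then have "?w $ j = 0\<^sub>v (dim_row (?A (F x))) $ j" by (rule arg_cong)
        also have "\<dots> = 0" using j(1) by simp
        finally show False using w1 by simp
      qed
      show "?A (F x) *\<^sub>v ?w = x l \<cdot>\<^sub>v ?w"
      proof (rule eq_vecI)
        fix i assume "i < dim_vec (x l \<cdot>\<^sub>v ?w)"
        then have i: "i < ?K" by simp
        then have "(?A (F x) *\<^sub>v ?w) $ i = (\<Sum>j\<in>{0..<?K}. s i (en j) (F x) * monv V (en j) x)"
          by (simp add: scalar_prod_def S_def)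
        also have "\<dots> = x l * monv V (en i) x" unfolding s(2)[OF i] sumen ..
        finally show "(?A (F x) *\<^sub>v ?w) $ i = (x l \<cdot>\<^sub>v ?w) $ i" using i by simp
      qed simp
    qed
    then have "eigenvalue (?A (F x)) (x l)" unfolding eigenvalue_def by blast
    then have "poly (char_poly (?A (F x))) (x l) = 0" using eigenvalue_root_char_poly[OF ca] by blast
    moreover have "poly (char_poly (?A (F x))) (x l) = (\<Sum>k\<le>?K. r k (F x) * x l ^ k)"
      using degree_monic_char_poly[OF ca] by (simp add: poly_altdef r_def)
    ultimately show ?thesis by simp
  qed
  show ?thesis using pr top zero by (intro exI[of _ ?K] exI[of _ r]) simp
qed

text \<open>A derivation along the hypersurface that kills the components of a finite map vanishes: the
  coordinates are algebraic over the image and the characteristic is zero.\<close>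
lemma derivation_vanishes:
  fixes w :: "nat \<Rightarrow> (nat \<Rightarrow> 'a) \<Rightarrow> 'a"
  assumes F: "\<And>v. v \<in> V \<Longrightarrow> homp V D (\<lambda>x. F x v)" and D: "D \<ge> 1"
    and c: "cert V {(D, \<lambda>x. F x v) | v. v \<in> V} N" and l: "l \<in> V"
    and w: "\<And>v. v \<in> V \<Longrightarrow> polyf V (w v)"
    and kF: "\<And>m. m \<in> V \<Longrightarrow> van (\<lambda>x. \<Sum>v\<in>V. w v x * pd v (\<lambda>x. F x m) x)"
    and kJ: "van (\<lambda>x. \<Sum>v\<in>V. w v x * pd v J x)"
  shows "van (w l)"
proof (rule ccontr)
  assume nv: "\<not> van (w l)"
  \<comment> \<open>Relations of degree \<open>r\<close> for coordinate \<open>l\<close> over the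
    image that hold on the hypersurface and whose leading coefficient does not vanish on it. A
    minimal \<open>r\<close> is taken.\<close>
  define Q where "Q r \<longleftrightarrow> (\<exists>s. (\<forall>k. polyf V (s k)) \<and> van (\<lambda>x. \<Sum>k\<le>r. s k (F x) * x l ^ k) \<and> \<not> van (\<lambda>x. s r (F x)))" for r :: nat
  have pF: "polyf V (\<lambda>x. F x v)" if "v \<in> V" for v using homp_polyf[OF F[OF that]] .
  have psF: "polyf V (\<lambda>x. s (F x))" if "polyf V s" for s
    by (rule polyf_compose[where F = "\<lambda>v x. F x v", OF that pF])
  obtain K s where "\<forall>k. polyf V (s k)" "\<forall>x. (\<Sum>k\<le>K. s k (F x) * x l ^ k) = 0" "s K = (\<lambda>_. 1)"
    using integral_relation[OF F D c l] by blast
  then have "Q K" unfolding Q_def using not_dvd_one van_dvdp[OF polyf_const]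
    by (intro exI[of _ s]) (auto simp: van_def)
  define r where "r = (LEAST r. Q r)"
  have "Q r" unfolding r_def using \<open>Q K\<close> by (rule LeastI)
  then obtain s where s: "\<And>k. polyf V (s k)" "van (\<lambda>x. \<Sum>k\<le>r. s k (F x) * x l ^ k)" "\<not> van (\<lambda>x. s r (F x))"
    unfolding Q_def by blast
  have r0: "r \<noteq> 0"
  proof
    assume "r = 0"
    then have "van (\<lambda>x. s r (F x))" using s(2) by simp
    then show False using s(3) by simp
  qed
  define T where "T = (\<lambda>x. \<Sum>k\<le>r. s k (F x) * x l ^ k)"
  have pl: "polyf V (\<lambda>x :: nat \<Rightarrow> 'a. x l)" by (rule polyf_var[OF l])
  have pT: "polyf V T" unfolding T_def by (intro polyf_sum polyf_mult psF s polyf_power pl)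
  obtain S where S: "polyf V S" "\<And>x. T x = J x * S x"
    using van_dvdp[OF pT] s(2) unfolding T_def dvdp_def by blast
  \<comment> \<open>The derivative of the relation with respect to coordinate \<open>l\<close>. The
    derivation kills the coefficients, which are functions of \<open>F\<close>, so applied to
    \<open>T\<close> it leaves only \<open>U\<close> times \<open>w l\<close> on the
    hypersurface.\<close>
  define U where "U = (\<lambda>x. \<Sum>k\<le>r. s k (F x) * (of_nat k * x l ^ (k - 1)))"
  have "van (\<lambda>x. U x * w l x)"
    unfolding van_def
  proof (intro allI impI)
    fix x assume Jx: "J x = 0"
    have 1: "(\<Sum>v\<in>V. w v x * pd v T x) = 0"
    proof -
      have "pd v T x = pd v J x * S x + J x * pd v S x" for v
      proof -
        have "pd v T x = pd v (\<lambda>x. J x * S x) x" by (rule pd_cong) (rule S(2))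
        then show ?thesis using pd_mult[OF homp_polyf[OF homp_J] S(1)] by simp
      qed
      then have "(\<Sum>v\<in>V. w v x * pd v T x) = (\<Sum>v\<in>V. w v x * pd v J x) * S x"
        using Jx by (simp add: sum_distrib_right sum_distrib_left mult_ac)
      then show ?thesis using kJ Jx by (simp add: van_def)
    qed
    have pdT: "pd v T x = (\<Sum>k\<le>r. (\<Sum>m\<in>V. pd m (s k) (F x) * pd v (\<lambda>x. F x m) x) * x l ^ k +
        s k (F x) * (of_nat k * x l ^ (k - 1) * (if l = v then 1 else 0)))" for v
    proof -
      have "pd v T x = (\<Sum>k\<le>r. pd v (\<lambda>x. s k (F x) * x l ^ k) x)"
        unfolding T_def by (rule pd_sum[where V = V]) (intro polyf_mult psF s polyf_power pl)
      also have "\<dots> = (\<Sum>k\<le>r. pd v (\<lambda>x. s k (F x)) x * x l ^ k + s k (F x) * pd v (\<lambda>x. x l ^ k) x)"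
        by (intro sum.cong refl pd_mult[where V = V] psF s polyf_power pl)
      also have "\<dots> = (\<Sum>k\<le>r. (\<Sum>m\<in>V. pd m (s k) (F x) * pd v (\<lambda>x. F x m) x) * x l ^ k +
        s k (F x) * (of_nat k * x l ^ (k - 1) * (if l = v then 1 else 0)))"
      proof (intro sum.cong refl)
        fix k
        have "pd v (\<lambda>x. s k (F x)) x = (\<Sum>m\<in>V. pd m (s k) (F x) * pd v (\<lambda>x. F x m) x)"
          using pd_compose[where F = "\<lambda>v x. F x v" and U = V, OF V(1) s(1) pF] by simp
        moreover have "pd v (\<lambda>x :: nat \<Rightarrow> 'a. x l ^ k) x = of_nat k * x l ^ (k - 1) * (if l = v then 1 else 0)"
          using pd_power[OF pl, of v k x] by (simp add: pd_var)
        ultimately show "pd v (\<lambda>x. s k (F x)) x * x l ^ k + s k (F x) * pd v (\<lambda>x. x l ^ k) x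
          = (\<Sum>m\<in>V. pd m (s k) (F x) * pd v (\<lambda>x. F x m) x) * x l ^ k + s k (F x) * (of_nat k * x l ^ (k - 1) * (if l = v then 1 else 0))"
          by (simp only:)
      qed
      finally show ?thesis .
    qed
    have kF0: "(\<Sum>v\<in>V. w v x * pd v (\<lambda>x. F x m) x) = 0" if "m \<in> V" for m
      using kF[OF that] Jx by (simp add: van_def)
    have "(\<Sum>v\<in>V. w v x * pd v T x) = (\<Sum>v\<in>V. \<Sum>k\<le>r. \<Sum>m\<in>V. pd m (s k) (F x) * x l ^ k * (w v x * pd v (\<lambda>x. F x m) x))
      + (\<Sum>v\<in>V. \<Sum>k\<le>r. if v = l then s k (F x) * (of_nat k * x l ^ (k - 1)) * w l x else 0)"
      unfolding pdT sum.distrib[symmetric] sum_distrib_left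
      by (intro sum.cong refl) (auto simp: sum_distrib_left sum_distrib_right distrib_left mult_ac intro!: sum.cong)
    also have "(\<Sum>v\<in>V. \<Sum>k\<le>r. \<Sum>m\<in>V. pd m (s k) (F x) * x l ^ k * (w v x * pd v (\<lambda>x. F x m) x))
      = (\<Sum>k\<le>r. \<Sum>m\<in>V. pd m (s k) (F x) * x l ^ k * (\<Sum>v\<in>V. w v x * pd v (\<lambda>x. F x m) x))"
    proof -
      have "(\<Sum>v\<in>V. \<Sum>k\<le>r. \<Sum>m\<in>V. pd m (s k) (F x) * x l ^ k * (w v x * pd v (\<lambda>x. F x m) x))
        = (\<Sum>k\<le>r. \<Sum>v\<in>V. \<Sum>m\<in>V. pd m (s k) (F x) * x l ^ k * (w v x * pd v (\<lambda>x. F x m) x))"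
        by (rule sum.swap)
      also have "\<dots> = (\<Sum>k\<le>r. \<Sum>m\<in>V. \<Sum>v\<in>V. pd m (s k) (F x) * x l ^ k * (w v x * pd v (\<lambda>x. F x m) x))"
        by (intro sum.cong refl sum.swap)
      finally show ?thesis by (simp add: sum_distrib_left)
    qed
    also have "\<dots> = 0" by (intro sum.neutral ballI) (simp add: kF0)
    also have "(\<Sum>v\<in>V. \<Sum>k\<le>r. if v = l then s k (F x) * (of_nat k * x l ^ (k - 1)) * w l x else 0) = U x * w l x"
    proof -
      have "(\<Sum>v\<in>V. \<Sum>k\<le>r. if v = l then s k (F x) * (of_nat k * x l ^ (k - 1)) * w l x else 0)
        = (\<Sum>v\<in>V. if v = l then (\<Sum>k\<le>r. s k (F x) * (of_nat k * x l ^ (k - 1)) * w l x) else 0)"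
        by (intro sum.cong) auto
      also have "\<dots> = (\<Sum>k\<le>r. s k (F x) * (of_nat k * x l ^ (k - 1)) * w l x)" using l V(1) by simp
      finally show ?thesis by (simp add: U_def sum_distrib_right)
    qed
    finally show "U x * w l x = 0" using 1 by simp
  qed
  moreover have pU: "polyf V U" unfolding U_def
    by (rule polyf_sum) (rule polyf_mult[OF psF[OF s(1)] polyf_mult[OF polyf_const polyf_power[OF pl]]])
  ultimately have "van U" using van_mult[OF pU w[OF l]] nv by blast
  obtain r' where r': "r = Suc r'" using r0 by (cases r) auto
  \<comment> \<open>\<open>U\<close> is a relation of degree \<open>r - 1\<close> whose leading
    coefficient is \<open>r\<close> times the old one, nonzero in characteristic zero; this
    contradicts minimality.\<close>
  have "Q r'" unfolding Q_def
  proof (intro exI[of _ "\<lambda>k y. of_nat (Suc k) * s (Suc k) y"] conjI allI)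
    show "polyf V (\<lambda>y. of_nat (Suc k) * s (Suc k) y)" for k by (rule polyf_mult[OF polyf_const s(1)])
    have "U x = (\<Sum>k\<le>r'. of_nat (Suc k) * s (Suc k) (F x) * x l ^ k)" for x
      unfolding U_def r' sum.atMost_Suc_shift by (simp add: mult_ac del: of_nat_Suc)
    then show "van (\<lambda>x. \<Sum>k\<le>r'. of_nat (Suc k) * s (Suc k) (F x) * x l ^ k)" using \<open>van U\<close> by (simp add: van_def)
    show "\<not> van (\<lambda>x. of_nat (Suc r') * s (Suc r') (F x))"
    proof
      assume "van (\<lambda>x. of_nat (Suc r') * s (Suc r') (F x))"
      then have "van (\<lambda>x. s r (F x))" unfolding van_def r' by (simp del: of_nat_Suc)
      then show False using s(3) by simp
    qed
  qed
  then have "r \<le> r'" unfolding r_def by (rule Least_le)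
  then show False using r' by simp
qed

end

subsection \<open>Monomial counts\<close>

text \<open>Exponents of the products \<open>x\<^sup>\<gamma> F\<^sub>3\<^sup>b\<^sup>3 \<cdots> F\<^sub>n\<^sup>b\<^sup>n\<close> of degree \<open>m\<close> that span the forms of degree \<open>m\<close> modulo \<open>J\<close> and
  the \<open>\<partial>\<^sub>iJ \<circ> F\<close>.\<close>

definition tmons :: "nat \<Rightarrow> nat \<Rightarrow> nat \<Rightarrow> nat \<Rightarrow> ((nat \<Rightarrow> nat) \<times> (nat \<Rightarrow> nat)) set" where
  "tmons n N D m = {(\<gamma>, b). \<exists>s k. s < N \<and> \<gamma> \<in> mons {0..n} s \<and> b \<in> mons {3..n} k \<and> s + D * k = m}"

lemma finite_tmons: "D \<ge> 1 \<Longrightarrow> finite (tmons n N D m)"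
proof -
  assume D: "D \<ge> 1"
  have "tmons n N D m \<subseteq> (\<Union>s<N. mons {0..n} s) \<times> (\<Union>k\<le>m. mons {3..n} k)"
  proof
    fix p assume "p \<in> tmons n N D m"
    then obtain s k where "s < N" "fst p \<in> mons {0..n} s" "snd p \<in> mons {3..n} k" "s + D * k = m"
      by (auto simp: tmons_def)
    moreover have "k \<le> D * k" using D by simp
    then have "k \<le> m" using calculation(4) by linarith
    ultimately show "p \<in> (\<Union>s<N. mons {0..n} s) \<times> (\<Union>k\<le>m. mons {3..n} k)" by (cases p) auto
  qed
  then show ?thesis by (rule finite_subset) (auto intro: finite_mons)
qed

text \<open>As functions of \<open>m\<close> the left side grows like the power
  \<open>n - 3\<close>, the right side like the power \<open>n - 2\<close>. An explicit injection
  that misses one element takes the place of asymptotic estimates.\<close>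

lemma card_tmons_less:
  assumes n: "n \<ge> 2" and D: "D \<ge> 2"
  shows "\<exists>m0. \<forall>m\<ge>m0. card (tmons n N D m) < card {\<alpha>\<in>mons {0..n} m. \<alpha> 0 = 0 \<and> \<alpha> n = 0}"
proof -
  let ?X = "\<lambda>m. {\<alpha>\<in>mons {0..n} m. \<alpha> 0 = 0 \<and> \<alpha> n = 0}"
  have finX: "finite (?X m)" for m using finite_mons[of "{0..n}" m] by simp
  show ?thesis
  proof (cases "n = 2")
    case True
    \<comment> \<open>For \<open>n = 2\<close> there are no coordinates from 3 on, so
      \<open>tmons\<close> is empty from degree \<open>N\<close> on.\<close>
    have "card (tmons n N D m) < card (?X m)" if "m \<ge> N" for m
    proof -
      have "tmons n N D m = {}" using that True by (auto simp: tmons_def mons_def)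
      moreover have "(\<lambda>v. if v = 1 then m else 0) \<in> ?X m"
        using True by (auto simp: mons_def mp_supp_def)
      then have "card (?X m) > 0" using finX card_gt_0_iff by blast
      ultimately show ?thesis by simp
    qed
    then show ?thesis by blast
  next
    case False
    then have n3: "n \<ge> 3" using n by simp
    let ?G = "\<Union>s<N. mons {0..n} s"
    have finG: "finite ?G" by (auto intro: finite_mons)
    let ?C = "card ?G"
    obtain g where g: "bij_betw g ?G {0..<?C}" using ex_bij_betw_finite_nat[OF finG] by blast
    have gC: "g \<gamma> < ?C" if "\<gamma> \<in> ?G" for \<gamma> using bij_betw_apply[OF g that] by simp
    have ginj: "\<gamma> = \<gamma>'" if "\<gamma> \<in> ?G" "\<gamma>' \<in> ?G" "g \<gamma> = g \<gamma>'" for \<gamma> \<gamma>'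
      using bij_betw_imp_inj_on[OF g] that by (auto dest: inj_onD)
    \<comment> \<open>One half of \<open>m\<close> bounds the number attached to
      \<open>\<gamma>\<close>, the other half the sum of the exponents in \<open>b\<close>, which is
      at most \<open>m / D\<close>.\<close>
    have "card (tmons n N D m) < card (?X m)" if m: "m \<ge> 2 * ?C" for m
    proof -
      \<comment> \<open>The number of \<open>\<gamma>\<close> becomes exponent 2, the exponents of
        \<open>b\<close> from 4 on move one place down, and coordinate 1 fills up the degree. The
        exponent of \<open>b\<close> at 3 is recovered from the degree.\<close>
      define \<phi> where "\<phi> p = (\<lambda>v. if v = 1 then m - g (fst p) - (\<Sum>j\<in>{4..n}. snd p j) else if v = 2 then g (fst p)
         else if 3 \<le> v \<and> v < n then snd p (v + 1) else 0)" for p :: "(nat \<Rightarrow> nat) \<times> (nat \<Rightarrow> nat)"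
      \<comment> \<open>\<open>?C\<close> is a value that the numbering \<open>g\<close> does not
        take.\<close>
      define \<psi> where "\<psi> = (\<lambda>v::nat. if v = 1 then m - ?C else if v = 2 then ?C else 0)"
      have sumX: "(\<Sum>v\<in>{0..n}. \<alpha> v) = \<alpha> 1 + \<alpha> 2 + (\<Sum>v\<in>{3..<n}. \<alpha> v)" if "\<alpha> 0 = 0" "\<alpha> n = 0" for \<alpha> :: "nat \<Rightarrow> nat"
      proof -
        have "(\<Sum>v\<in>{0..n}. \<alpha> v) = (\<Sum>v\<in>insert 1 (insert 2 {3..<n}). \<alpha> v)"
        proof (rule sum.mono_neutral_right)
          show "\<forall>i\<in>{0..n} - insert 1 (insert 2 {3..<n}). \<alpha> i = 0"
          proof
            fix i assume "i \<in> {0..n} - insert 1 (insert 2 {3..<n})"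
            then have "i = 0 \<or> i = n" by auto
            then show "\<alpha> i = 0" using that by auto
          qed
        qed (use n3 in auto)
        then show ?thesis by simp
      qed
      have info: "fst p \<in> ?G \<and> (\<Sum>j\<in>{3..n}. snd p j) = (m - (\<Sum>v\<in>{0..n}. fst p v)) div D \<and>
          g (fst p) + (\<Sum>j\<in>{4..n}. snd p j) \<le> m \<and> mp_supp (snd p) \<subseteq> {3..n}" if "p \<in> tmons n N D m" for p
      proof -
        from that obtain s k where sk: "s < N" "fst p \<in> mons {0..n} s" "snd p \<in> mons {3..n} k" "s + D * k = m"
          by (auto simp: tmons_def)
        have G: "fst p \<in> ?G" using sk by auto
        have b: "(\<Sum>j\<in>{3..n}. snd p j) = k" "(\<Sum>v\<in>{0..n}. fst p v) = s" "mp_supp (snd p) \<subseteq> {3..n}" using sk by (auto simp: mons_def)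
        have "k = (m - s) div D" using sk(4) D by auto
        moreover have "(\<Sum>j\<in>{4..n}. snd p j) \<le> k" unfolding b(1)[symmetric] by (intro sum_mono2) auto
        moreover have "2 * k \<le> D * k" using D by simp
        then have "2 * k \<le> m" using sk(4) by linarith
        ultimately show ?thesis using G b gC[OF G] m by auto
      qed
      have "\<phi> ` tmons n N D m \<subseteq> ?X m"
      proof
        fix \<alpha> assume "\<alpha> \<in> \<phi> ` tmons n N D m"
        then obtain p where p: "p \<in> tmons n N D m" "\<alpha> = \<phi> p" by auto
        have z: "\<phi> p 0 = 0" "\<phi> p n = 0" using n3 by (auto simp: \<phi>_def)
        have sh: "(\<Sum>v\<in>{3..<n}. snd p (v + 1)) = (\<Sum>j\<in>{4..n}. snd p j)"
          by (rule sum.reindex_bij_witness[where i = "\<lambda>j. j - 1" and j = "\<lambda>v. v + 1"]) auto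
        have "(\<Sum>v\<in>{3..<n}. \<phi> p v) = (\<Sum>v\<in>{3..<n}. snd p (v + 1))"
          by (intro sum.cong) (auto simp: \<phi>_def)
        then have "(\<Sum>v\<in>{0..n}. \<phi> p v) = m"
          using sumX[of "\<phi> p", OF z] sh info[OF p(1)] by (simp add: \<phi>_def)
        moreover have "mp_supp (\<phi> p) \<subseteq> {0..n}" using n3 by (auto simp: mp_supp_def \<phi>_def split: if_splits)
        ultimately show "\<alpha> \<in> ?X m" using z p(2) by (simp add: mons_def)
      qed
      moreover have "\<psi> \<in> ?X m"
      proof -
        have z: "\<psi> 0 = 0" "\<psi> n = 0" using n3 by (auto simp: \<psi>_def)
        have "(\<Sum>v\<in>{3..<n}. \<psi> v) = 0" by (intro sum.neutral) (auto simp: \<psi>_def)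
        then have "(\<Sum>v\<in>{0..n}. \<psi> v) = m" using sumX[of \<psi>, OF z] m by (simp add: \<psi>_def)
        moreover have "mp_supp \<psi> \<subseteq> {0..n}" using n3 by (auto simp: mp_supp_def \<psi>_def split: if_splits)
        ultimately show ?thesis using z by (simp add: mons_def)
      qed
      moreover have "\<psi> \<notin> \<phi> ` tmons n N D m"
      proof
        assume "\<psi> \<in> \<phi> ` tmons n N D m"
        then obtain p where p: "p \<in> tmons n N D m" "\<psi> = \<phi> p" by auto
        from fun_cong[OF p(2), of 2] have "?C = g (fst p)" by (simp add: \<psi>_def \<phi>_def)
        then show False using gC[of "fst p"] info[OF p(1)] by simp
      qed
      ultimately have "\<phi> ` tmons n N D m \<subset> ?X m" by blast
      then have lt: "card (\<phi> ` tmons n N D m) < card (?X m)" by (rule psubset_card_mono[OF finX])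
      have "inj_on \<phi> (tmons n N D m)"
      proof (rule inj_onI)
        fix p q assume p: "p \<in> tmons n N D m" and q: "q \<in> tmons n N D m" and eq: "\<phi> p = \<phi> q"
        have "g (fst p) = g (fst q)" using fun_cong[OF eq, of 2] by (simp add: \<phi>_def)
        then have f: "fst p = fst q" using ginj info[OF p] info[OF q] by blast
        have hi: "snd p j = snd q j" if "4 \<le> j" "j \<le> n" for j
        proof -
          obtain i where i: "j = i + 1" "3 \<le> i" "i < n" using \<open>4 \<le> j\<close> \<open>j \<le> n\<close> by (intro that[of "j - 1"]) auto
          then have "\<phi> r i = snd r (i + 1)" for r by (simp add: \<phi>_def)
          then show ?thesis using fun_cong[OF eq, of i] i(1) by simp
        qed
        have "(\<Sum>j\<in>{3..n}. snd p j) = (\<Sum>j\<in>{3..n}. snd q j)" using info[OF p] info[OF q] f by simp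
        moreover have "{3..n} = insert 3 {4..n}" using n3 by auto
        moreover have "(\<Sum>j\<in>{4..n}. snd p j) = (\<Sum>j\<in>{4..n}. snd q j)" using hi by (intro sum.cong) auto
        ultimately have s3: "snd p 3 = snd q 3" by simp
        have "snd p j = snd q j" for j
        proof -
          consider "j = 3" | "4 \<le> j \<and> j \<le> n" | "j \<notin> {3..n}" by fastforce
          then show ?thesis
          proof cases
            case 1 then show ?thesis using s3 by simp
          next
            case 2 then show ?thesis using hi by simp
          next
            case 3
            have "mp_supp (snd p) \<subseteq> {3..n}" "mp_supp (snd q) \<subseteq> {3..n}" using info[OF p] info[OF q] by auto
            then have "snd p j = 0" "snd q j = 0" using 3 by (auto simp: mp_supp_def)
            then show ?thesis by simp
          qed
        qed
        then have "snd p = snd q" by auto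
        with f show "p = q" by (simp add: prod_eq_iff)
      qed
      from card_image[OF this] lt show ?thesis by simp
    qed
    then show ?thesis by blast
  qed
qed

text \<open>Multiplication by the power \<open>\<delta>\<close> of coordinate \<open>n\<close>
  embeds the normal forms of degree \<open>m - \<delta>\<close>; its image misses those that contain
  neither coordinate 0 nor coordinate \<open>n\<close>.\<close>

lemma card_red_ge:
  fixes n :: nat
  assumes n: "n \<ge> 1" and \<delta>: "\<delta> \<ge> 1" "\<delta> \<le> m" and e: "e \<ge> 1"
  shows "card (red {0..n} 0 e (m - \<delta>)) + card {\<alpha>\<in>mons {0..n} m. \<alpha> 0 = 0 \<and> \<alpha> n = 0} \<le> card (red {0..n} 0 e m)"
proof -
  let ?f = "\<lambda>\<gamma>::nat \<Rightarrow> nat. \<gamma>(n := \<gamma> n + \<delta>)" and ?R = "red {0..n} 0 e (m - \<delta>)" and ?X = "{\<alpha>\<in>mons {0..n} m. \<alpha> 0 = 0 \<and> \<alpha> n = 0}"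
  have fin: "finite (red {0..n} 0 e k)" for k using finite_mons[of "{0..n}"] by (simp add: red_def)
  have inj: "inj_on ?f ?R" by (rule inj_on_inverseI[where g = "\<lambda>\<gamma>. \<gamma>(n := \<gamma> n - \<delta>)"]) auto
  have "?f ` ?R \<subseteq> red {0..n} 0 e m"
  proof
    fix \<alpha> assume "\<alpha> \<in> ?f ` ?R"
    then obtain \<gamma> where g: "\<gamma> \<in> ?R" "\<alpha> = ?f \<gamma>" by auto
    have "(\<Sum>v\<in>{0..n}. \<alpha> v) = (\<Sum>v\<in>{0..n}. \<gamma> v) + \<delta>"
    proof -
      have "(\<Sum>v\<in>{0..n} - {n}. \<alpha> v) = (\<Sum>v\<in>{0..n} - {n}. \<gamma> v)" using g by (intro sum.cong) auto
      then show ?thesis using g by (simp add: sum.remove[of "{0..n}" n])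
    qed
    then show "\<alpha> \<in> red {0..n} 0 e m" using g \<delta> n by (auto simp: red_def mons_def mp_supp_def split: if_splits)
  qed
  moreover have "?X \<subseteq> red {0..n} 0 e m" using e by (auto simp: red_def)
  moreover have "?f ` ?R \<inter> ?X = {}" using \<delta> by auto
  moreover have "finite ?X" using finite_mons[of "{0..n}" m] by simp
  ultimately have "card (?f ` ?R) + card ?X \<le> card (red {0..n} 0 e m)"
    using card_Un_disjoint[of "?f ` ?R" ?X] card_mono[OF fin, of "?f ` ?R \<union> ?X" m] fin by simp
  then show ?thesis by (simp add: card_image[OF inj])
qed

subsection \<open>A good map has no periodic critical locus\<close>

locale periodic_map = good_map +
  fixes k :: nat
  assumes k1: "k \<ge> 1"
    and per: "\<And>x. J x = 0 \<Longrightarrow> J ((fm ^^ k) x) = 0"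
    and min: "\<And>i. 0 < i \<Longrightarrow> i < k \<Longrightarrow> \<exists>x. J x = 0 \<and> J ((fm ^^ i) x) \<noteq> 0"
begin

abbreviation "F \<equiv> fm ^^ k"
abbreviation "D \<equiv> d ^ k"

lemma D3: "D \<ge> 3"
proof -
  have "d ^ 1 \<le> d ^ k" using d3 k1 by (intro power_increasing) auto
  then show ?thesis using d3 by simp
qed

text \<open>The Jacobian determinant of \<open>F\<close> with its factor \<open>J\<close> removed;
  minimality of \<open>k\<close> keeps it from vanishing on the hypersurface.\<close>

definition Mm :: "(nat \<Rightarrow> 'a) \<Rightarrow> 'a" where "Mm x = (\<Prod>i\<in>{1..<k}. J ((fm ^^ i) x))"

text \<open>The derivative of \<open>J\<close> along the \<open>i\<close>-th column of the adjugate
  of the Jacobian matrix of \<open>F\<close>.\<close>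

definition al :: "nat \<Rightarrow> (nat \<Rightarrow> 'a) \<Rightarrow> 'a" where
  "al i x = (\<Sum>j\<in>V. pd j J x * adj_mat (Mt k x) $$ (j, i))"

lemma polyf_J: "polyf V J" by (rule homp_polyf[OF homp_J])

lemma polyf_Mm: "polyf V Mm"
  unfolding Mm_def[abs_def] by (rule polyf_prod) (rule polyf_comp_iter[OF polyf_J])

lemma not_van_Mm: "\<not> van Mm"
proof
  assume "van Mm"
  then have "van (\<lambda>x. \<Prod>i\<in>{1..<k}. J ((fm ^^ i) x))" by (simp add: Mm_def[abs_def])
  from van_prod[OF _ _ this] obtain i where i: "i \<in> {1..<k}" "van (\<lambda>x. J ((fm ^^ i) x))"
    using polyf_comp_iter[OF polyf_J] by auto
  then have "0 < i" "i < k" by auto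
  from min[OF this] i(2) show False by (auto simp: van_def)
qed

lemma det_J_Mm: "det (Mt k x) = J x * Mm x"
proof -
  have "{..<k} = insert 0 {1..<k}" using k1 by auto
  then show ?thesis by (simp add: det_Mt Mm_def)
qed

lemma homp_adj_entry: "j \<in> V \<Longrightarrow> i \<in> V \<Longrightarrow> homp V (n * (D - 1)) (\<lambda>x. adj_mat (Mt k x) $$ (j, i))"
  by (rule homp_adj) auto

lemma polyf_adj_entry: "j \<in> V \<Longrightarrow> i \<in> V \<Longrightarrow> polyf V (\<lambda>x. adj_mat (Mt k x) $$ (j, i))"
  by (rule homp_polyf[OF homp_adj_entry])

lemma homp_al: "i \<in> V \<Longrightarrow> homp V (e - 1 + n * (D - 1)) (al i)"
  unfolding al_def[abs_def]
  by (rule homp_sum[OF V]) (rule homp_mult[OF homp_pd[OF V homp_J] homp_adj_entry])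

lemma Mt_adj: "i \<in> V \<Longrightarrow> l \<in> V \<Longrightarrow>
  (\<Sum>j\<in>V. pd j (\<lambda>x. F x l) x * adj_mat (Mt k x) $$ (j, i)) = (if l = i then J x * Mm x else 0)"
proof -
  assume i: "i \<in> V" and l: "l \<in> V"
  note adj = adj_mat[OF Mt_carrier[of k x]]
  have "(Mt k x * adj_mat (Mt k x)) $$ (l, i) = (\<Sum>j\<in>V. pd j (\<lambda>x. F x l) x * adj_mat (Mt k x) $$ (j, i))"
    using i l adj(1) unfolding V_less by (auto simp: Mt_def scalar_prod_def intro!: sum.cong)
  moreover have "(Mt k x * adj_mat (Mt k x)) $$ (l, i) = (if l = i then J x * Mm x else 0)"
    unfolding adj(2) det_J_Mm using i l by auto
  ultimately show ?thesis by simp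
qed

lemma adj_identity:
  assumes H: "polyf V H" "\<And>x. J (F x) = J x * H x" and i: "i \<in> V"
  shows "J x * Mm x * pd i J (F x) = H x * al i x + J x * (\<Sum>j\<in>V. pd j H x * adj_mat (Mt k x) $$ (j, i))"
proof -
  let ?A = "adj_mat (Mt k x)"
  have row: "(\<Sum>l\<in>V. pd l J (F x) * pd j (\<lambda>x. F x l) x) = pd j J x * H x + J x * pd j H x" for j
  proof -
    have "(\<Sum>l\<in>V. pd l J (F x) * pd j (\<lambda>x. F x l) x) = pd j (\<lambda>x. J (F x)) x"
      by (rule pd_iter_chain[OF polyf_J, symmetric])
    also have "\<dots> = pd j (\<lambda>x. J x * H x) x" by (rule pd_cong) (rule H(2))
    also have "\<dots> = pd j J x * H x + J x * pd j H x" by (rule pd_mult[OF polyf_J H(1)])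
    finally show ?thesis .
  qed
  have "(\<Sum>j\<in>V. (\<Sum>l\<in>V. pd l J (F x) * pd j (\<lambda>x. F x l) x) * ?A $$ (j, i))
     = (\<Sum>l\<in>V. pd l J (F x) * (\<Sum>j\<in>V. pd j (\<lambda>x. F x l) x * ?A $$ (j, i)))"
    unfolding sum_distrib_right sum_distrib_left by (subst sum.swap) (simp add: mult.assoc)
  also have "\<dots> = (\<Sum>l\<in>V. if l = i then pd i J (F x) * (J x * Mm x) else 0)"
    by (intro sum.cong refl) (simp add: Mt_adj[OF i])
  also have "\<dots> = pd i J (F x) * (J x * Mm x)" using i V(1) by simp
  finally have "J x * Mm x * pd i J (F x) = (\<Sum>j\<in>V. (pd j J x * H x + J x * pd j H x) * ?A $$ (j, i))"
    unfolding row by (simp add: mult_ac)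
  also have "\<dots> = H x * al i x + J x * (\<Sum>j\<in>V. pd j H x * ?A $$ (j, i))"
    unfolding al_def sum_distrib_left sum.distrib[symmetric] by (intro sum.cong refl) (simp add: algebra_simps)
  finally show ?thesis .
qed

text \<open>If all columns were tangent, \<open>derivation_vanishes\<close> would make every entry
  of the adjugate divisible by \<open>J\<close>. Taking determinants of the Jacobian matrix times
  its adjugate then shows that \<open>J\<close> divides a power of \<open>Mm\<close>, against
  \<open>not_van_Mm\<close>.\<close>

lemma al_not_all_van: "\<exists>i\<in>V. \<not> van (al i)"
proof (rule ccontr)
  assume "\<not> ?thesis"
  then have va: "\<And>i. i \<in> V \<Longrightarrow> van (al i)" by blast
  have "cert V {(1, \<lambda>x :: nat \<Rightarrow> 'a. x v) | v. v \<in> V} 1"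
  proof (rule cert_monI[OF V(1)])
    fix \<alpha> assume "\<alpha> \<in> mons V 1"
    then have s: "(\<Sum>v\<in>V. \<alpha> v) = 1" and sp: "mp_supp \<alpha> \<subseteq> V" by (auto simp: mons_def)
    from s obtain v where v0: "v \<in> V" "\<alpha> v = 1" "\<forall>u\<in>V. v \<noteq> u \<longrightarrow> \<alpha> u = 0"
      unfolding sum_eq_1_iff[OF V(1)] by (elim bexE conjE) (rule that)
    then have v: "v \<in> V" "\<alpha> v = 1" "\<And>u. u \<in> V \<Longrightarrow> u \<noteq> v \<Longrightarrow> \<alpha> u = 0" by auto
    have \<alpha>: "\<alpha> = (\<lambda>u. if u = v then 1 else 0)"
      using v sp by (auto simp: fun_eq_iff mp_supp_def)
    have "monv V \<alpha> = (\<lambda>x :: nat \<Rightarrow> 'a. x v)"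
      unfolding \<alpha> using v(1) V(1) by (intro ext) (simp add: monv_single)
    then show "gid V {(1, \<lambda>x :: nat \<Rightarrow> 'a. x v) | v. v \<in> V} 1 (monv V \<alpha>)" using v(1) by (intro gid_in) auto
  qed
  from cert_iter[OF this, of k] obtain N' where
    c: "cert V {(D * a, \<lambda>x. h (F x)) | a h. (a, h) \<in> {(1, \<lambda>x :: nat \<Rightarrow> 'a. x v) | v. v \<in> V}} N'" by blast
  have cF: "cert V {(D, \<lambda>x. F x v) | v. v \<in> V} N'"
  proof (rule cert_trans[OF c])
    fix a h assume "(a, h) \<in> {(D * a, \<lambda>x. h (F x)) | a h. (a, h) \<in> {(1, \<lambda>x :: nat \<Rightarrow> 'a. x v) | v. v \<in> V}}"
    then have "(a, h) \<in> {(D, \<lambda>x. F x v) | v. v \<in> V}" by auto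
    then show "gid V {(D, \<lambda>x. F x v) | v. v \<in> V} a h" by (rule gid_in)
  qed
  have vA: "van (\<lambda>x. adj_mat (Mt k x) $$ (l, i))" if l: "l \<in> V" and i: "i \<in> V" for l i
  proof (rule derivation_vanishes[where F = F and D = D and w = "\<lambda>v x. adj_mat (Mt k x) $$ (v, i)", OF homp_iter _ cF l])
    show "D \<ge> 1" using D3 by simp
    show "polyf V (\<lambda>x. adj_mat (Mt k x) $$ (v, i))" if "v \<in> V" for v using that i by (rule polyf_adj_entry)
    show "van (\<lambda>x. \<Sum>v\<in>V. adj_mat (Mt k x) $$ (v, i) * pd v (\<lambda>x. F x m) x)" if "m \<in> V" for m
      using Mt_adj[OF i that] by (simp add: van_def mult.commute)
    show "van (\<lambda>x. \<Sum>v\<in>V. adj_mat (Mt k x) $$ (v, i) * pd v J x)"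
      using va[OF i] by (simp add: van_def al_def mult.commute)
  qed
  define B where "B l i = (SOME B. polyf V B \<and> (\<forall>x. adj_mat (Mt k x) $$ (l, i) = J x * B x))" for l i
  have B': "polyf V (B l i) \<and> (\<forall>x. adj_mat (Mt k x) $$ (l, i) = J x * B l i x)" if "l \<in> V" "i \<in> V" for l i
    using someI_ex[OF van_dvdp[OF polyf_adj_entry[OF that] vA[OF that], unfolded dvdp_def]] unfolding B_def .
  then have B: "\<And>l i. l \<in> V \<Longrightarrow> i \<in> V \<Longrightarrow> polyf V (B l i)"
    "\<And>l i x. l \<in> V \<Longrightarrow> i \<in> V \<Longrightarrow> adj_mat (Mt k x) $$ (l, i) = J x * B l i x" by auto
  let ?B = "\<lambda>x. mat (n + 1) (n + 1) (\<lambda>(l, i). B l i x)"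
  have pB: "polyf V (\<lambda>x. det (?B x))" by (rule polyf_det) (auto intro: B(1))
  have key: "J x ^ (n + 1) * (J x * (Mm x * det (?B x))) = J x ^ (n + 1) * (Mm x ^ (n + 1))" for x
  proof -
    note adj = adj_mat[OF Mt_carrier[of k x]]
    have "adj_mat (Mt k x) = J x \<cdot>\<^sub>m ?B x"
      by (rule eq_matI) (use adj(1) B(2) in auto)
    then have dA: "det (adj_mat (Mt k x)) = J x ^ (n + 1) * det (?B x)" by simp
    have "det (Mt k x) * det (adj_mat (Mt k x)) = det (Mt k x * adj_mat (Mt k x))"
      by (rule det_mult[OF Mt_carrier adj(1), symmetric])
    also have "\<dots> = det (Mt k x) ^ (n + 1)" unfolding adj(2) by simp
    finally show ?thesis unfolding dA det_J_Mm by (simp add: power_mult_distrib mult_ac)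
  qed
  have "J x * (Mm x * det (?B x)) = Mm x ^ (n + 1)" for x
  proof (rule polyf_cancel[where P = "\<lambda>x. J x ^ (n + 1)" and V = V and Q = "\<lambda>x. J x * (Mm x * det (?B x))" and R = "\<lambda>x. Mm x ^ (n + 1)"])
    show "polyf V (\<lambda>x. J x ^ (n + 1))" by (rule polyf_power[OF polyf_J])
    show "polyf V (\<lambda>x. J x * (Mm x * det (?B x)))" by (rule polyf_mult[OF polyf_J polyf_mult[OF polyf_Mm pB]])
    show "polyf V (\<lambda>x. Mm x ^ (n + 1))" by (rule polyf_power[OF polyf_Mm])
    show "J x ^ (n + 1) * (J x * (Mm x * det (?B x))) = J x ^ (n + 1) * (Mm x ^ (n + 1))" for x by (rule key)
    show "J (unitv 0) ^ (n + 1) \<noteq> 0" using lead by simp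
  qed
  then have "van (\<lambda>x. Mm x ^ (n + 1))" unfolding van_def by (metis mult_zero_left)
  then have "van Mm" by (rule van_power[OF polyf_Mm])
  then show False using not_van_Mm by simp
qed

text \<open>On \<open>J = 0\<close> the identity reads \<open>H x * al i x = 0\<close>; some
  \<open>al i\<close> does not vanish there, so by primality \<open>H\<close> is divisible by
  \<open>J\<close>.\<close>

lemma square_divides: "\<exists>H'. homp V (D * e - e - e) H' \<and> (\<forall>x. J (F x) = J x * (J x * H' x))"
proof -
  have hJF: "homp V (D * e) (\<lambda>x. J (F x))" by (rule homp_comp_iter[OF homp_J])
  have "van (\<lambda>x. J (F x))" using per by (simp add: van_def)
  then have "dvdp V J (\<lambda>x. J (F x))" by (rule van_dvdp[OF homp_polyf[OF hJF]])
  from M.dvdp_homp[OF this hJF] obtain H where H: "homp V (D * e - e) H" "\<And>x. J (F x) = J x * H x" by blast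
  have "van H"
  proof (rule ccontr)
    assume nH: "\<not> van H"
    obtain i where i: "i \<in> V" "\<not> van (al i)" using al_not_all_van by blast
    have "van (\<lambda>x. H x * al i x)" unfolding van_def
    proof (intro allI impI)
      fix x assume "J x = 0"
      then show "H x * al i x = 0"
        using adj_identity[OF homp_polyf[OF H(1)] H(2) i(1), of x] by simp
    qed
    from van_mult[OF homp_polyf[OF H(1)] homp_polyf[OF homp_al[OF i(1)]] this] nH i(2) show False by simp
  qed
  from M.dvdp_homp[OF van_dvdp[OF homp_polyf[OF H(1)] this] H(1)] obtain H' where
    "homp V (D * e - e - e) H'" "\<And>x. H x = J x * H' x" by blast
  then show ?thesis using H(2) by auto
qed

text \<open>With \<open>H = J H'\<close> one more factor \<open>J\<close> can be cancelled. One
  \<open>al i\<close> comes from \<open>H\<close> itself, the other from differentiating the factor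
  \<open>J\<close> of \<open>H\<close>; hence the coefficient 2.\<close>

lemma adj_identity2:
  assumes H': "polyf V H'" "\<And>x. J (F x) = J x * (J x * H' x)" and i: "i \<in> V"
  shows "Mm x * pd i J (F x) = H' x * (2 * al i x) + J x * (\<Sum>j\<in>V. pd j H' x * adj_mat (Mt k x) $$ (j, i))"
proof (rule polyf_cancel[where P = J and V = V and Q = "\<lambda>x. Mm x * pd i J (F x)" and
    R = "\<lambda>x. H' x * (2 * al i x) + J x * (\<Sum>j\<in>V. pd j H' x * adj_mat (Mt k x) $$ (j, i))"])
  let ?\<eta> = "\<lambda>x. \<Sum>j\<in>V. pd j H' x * adj_mat (Mt k x) $$ (j, i)"
  show "polyf V J" by (rule polyf_J)
  show "polyf V (\<lambda>x. Mm x * pd i J (F x))" by (rule polyf_mult[OF polyf_Mm polyf_comp_iter[OF polyf_pd[OF polyf_J]]])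
  have "polyf V ?\<eta>" by (rule polyf_sum) (rule polyf_mult[OF polyf_pd[OF H'(1)] polyf_adj_entry[OF _ i]])
  then show "polyf V (\<lambda>x. H' x * (2 * al i x) + J x * ?\<eta> x)"
    by (intro polyf_add[OF polyf_mult[OF H'(1) polyf_mult[OF polyf_const homp_polyf[OF homp_al[OF i]]]] polyf_mult[OF polyf_J]])
  show "J (unitv 0) \<noteq> 0" by (rule lead)
  fix x
  have pH: "polyf V (\<lambda>x. J x * H' x)" by (rule polyf_mult[OF polyf_J H'(1)])
  have "J x * Mm x * pd i J (F x) = J x * H' x * al i x + J x * (\<Sum>j\<in>V. pd j (\<lambda>x. J x * H' x) x * adj_mat (Mt k x) $$ (j, i))"
    by (rule adj_identity[OF pH H'(2) i])
  also have "(\<Sum>j\<in>V. pd j (\<lambda>x. J x * H' x) x * adj_mat (Mt k x) $$ (j, i)) = H' x * al i x + J x * ?\<eta> x"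
    unfolding al_def sum_distrib_left sum.distrib[symmetric] pd_mult[OF polyf_J H'(1)]
    by (intro sum.cong refl) (simp add: algebra_simps)
  finally show "J x * (Mm x * pd i J (F x)) = J x * (H' x * (2 * al i x) + J x * ?\<eta> x)"
    by (simp add: algebra_simps)
qed

end

section \<open>The counting argument\<close>

lemma tmonsI: "s < N \<Longrightarrow> \<gamma> \<in> mons {0..n} s \<Longrightarrow> b \<in> mons {3..n} k \<Longrightarrow> s + D * k = m \<Longrightarrow> (\<gamma>, b) \<in> tmons n N D m"
  unfolding tmons_def by blast

context periodic_map
begin

text \<open>The amount by which the degree of \<open>al i\<close> lies below that of the derivatives
  of \<open>J\<close> composed with \<open>F\<close>. It is positive because
  \<open>e > n + 1\<close>.\<close>

abbreviation "del \<equiv> (D - 1) * (e - (n + 1))"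

definition Gset :: "(nat \<times> ((nat \<Rightarrow> 'a) \<Rightarrow> 'a)) set" where
  "Gset = insert (e, J) {(D * (e - 1), \<lambda>x. pd i J (F x)) | i. i \<in> {0, 1, 2}}"

lemma deg_identity: "D * (e - 1) = del + (e - 1 + n * (D - 1))"
proof -
  obtain D' where D': "D = Suc D'" using D3 by (cases D) auto
  obtain e' where e': "e = n + 1 + e'" using e_ge(2) by (metis less_imp_add_positive)
  show ?thesis unfolding D' e' by (simp add: algebra_simps)
qed

text \<open>Multiplication by \<open>Mm\<close> sends the ideal of \<open>Gset\<close> into
  (\<open>J\<close>, \<open>H'\<close>). The cofactor of \<open>H'\<close> keeps its degree in the
  statement because its normal forms are counted later.\<close>

lemma gid_Gset:
  assumes H': "homp V h' H'" "\<And>x. J (F x) = J x * (J x * H' x)" and g: "gid V Gset m P"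
  shows "\<exists>u w. homp V (m - del) u \<and> polyf V w \<and> (\<forall>x. Mm x * P x = H' x * u x + J x * w x)"
  using g
proof induction
  case (gid_zero m)
  show ?case by (intro exI[of _ "\<lambda>_. 0"] conjI homp_zero[OF V] polyf_const) simp
next
  case (gid_gen a h b c)
  from gid_gen(1) consider "a = e" "h = J" | i where "i \<in> {0, 1, 2}" "a = D * (e - 1)" "h = (\<lambda>x. pd i J (F x))"
    unfolding Gset_def by blast
  then show ?case
  proof cases
    case 1
    show ?thesis
    proof (rule exI[of _ "\<lambda>_. 0"], rule exI[of _ "\<lambda>x. Mm x * c x"], intro conjI homp_zero[OF V])
      show "polyf V (\<lambda>x. Mm x * c x)" by (rule polyf_mult[OF polyf_Mm homp_polyf[OF gid_gen(2)]])
      show "\<forall>x. Mm x * (c x * h x) = H' x * 0 + J x * (Mm x * c x)" using 1 by (simp add: mult_ac)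
    qed
  next
    case 2
    have i: "i \<in> V" using 2(1) n2 by auto
    let ?\<eta> = "\<lambda>x. \<Sum>j\<in>V. pd j H' x * adj_mat (Mt k x) $$ (j, i)"
    have p\<eta>: "polyf V ?\<eta>"
      by (rule polyf_sum) (rule polyf_mult[OF polyf_pd[OF homp_polyf[OF H'(1)]] polyf_adj_entry[OF _ i]])
    show ?thesis
    proof (rule exI[of _ "\<lambda>x. c x * (2 * al i x)"], rule exI[of _ "\<lambda>x. c x * ?\<eta> x"], intro conjI)
      show "polyf V (\<lambda>x. c x * ?\<eta> x)" by (rule polyf_mult[OF homp_polyf[OF gid_gen(2)] p\<eta>])
      have "homp V (b + (e - 1 + n * (D - 1))) (\<lambda>x. c x * (2 * al i x))"
        by (rule homp_mult[OF gid_gen(2) homp_scale[OF homp_al[OF i]]])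
      then show "homp V (a + b - del) (\<lambda>x. c x * (2 * al i x))"
        by (rule homp_cong_deg) (use 2(2) deg_identity in simp)
      show "\<forall>x. Mm x * (c x * h x) = H' x * (c x * (2 * al i x)) + J x * (c x * ?\<eta> x)"
      proof
        fix x
        have "Mm x * (c x * h x) = c x * (Mm x * pd i J (F x))" using 2(3) by (simp add: mult_ac)
        also have "\<dots> = H' x * (c x * (2 * al i x)) + J x * (c x * ?\<eta> x)"
          unfolding adj_identity2[OF homp_polyf[OF H'(1)] H'(2) i, of x] by (simp add: algebra_simps)
        finally show "Mm x * (c x * h x) = H' x * (c x * (2 * al i x)) + J x * (c x * ?\<eta> x)" .
      qed
    qed
  qed
next
  case (gid_add m P Q)
  from gid_add.IH obtain u w u' w' where
    u: "homp V (m - del) u" "polyf V w" "\<forall>x. Mm x * P x = H' x * u x + J x * w x" and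
    u': "homp V (m - del) u'" "polyf V w'" "\<forall>x. Mm x * Q x = H' x * u' x + J x * w' x"
    by (elim exE conjE) (rule that)
  show ?case
    by (rule exI[of _ "\<lambda>x. u x + u' x"], rule exI[of _ "\<lambda>x. w x + w' x"], intro conjI homp_add[OF u(1) u'(1)]
       polyf_add[OF u(2) u'(2)]) (use u(3) u'(3) in \<open>simp add: algebra_simps\<close>)
qed

definition tmv :: "(nat \<Rightarrow> nat) \<times> (nat \<Rightarrow> nat) \<Rightarrow> (nat \<Rightarrow> 'a) \<Rightarrow> 'a" where
  "tmv p x = monv V (fst p) x * monv {3..n} (snd p) (F x)"

definition spn :: "nat \<Rightarrow> nat \<Rightarrow> ((nat \<Rightarrow> 'a) \<Rightarrow> 'a) \<Rightarrow> bool" where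
  "spn N m P \<longleftrightarrow> (\<exists>a t. gid V Gset m a \<and> (\<forall>x. P x = a x + (\<Sum>p\<in>tmons n N D m. t p * tmv p x)))"

lemma spn_gid: "gid V Gset m P \<Longrightarrow> spn N m P"
  unfolding spn_def by (intro exI[of _ P] exI[of _ "\<lambda>_. 0"]) simp

lemma spn_add: "spn N m P \<Longrightarrow> spn N m Q \<Longrightarrow> spn N m (\<lambda>x. P x + Q x)"
  unfolding spn_def
proof (elim exE conjE)
  fix a t a' t'
  assume *: "gid V Gset m a" "\<forall>x. P x = a x + (\<Sum>p\<in>tmons n N D m. t p * tmv p x)"
    "gid V Gset m a'" "\<forall>x. Q x = a' x + (\<Sum>p\<in>tmons n N D m. t' p * tmv p x)"
  show "\<exists>a t. gid V Gset m a \<and> (\<forall>x. P x + Q x = a x + (\<Sum>p\<in>tmons n N D m. t p * tmv p x))"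
    by (intro exI[of _ "\<lambda>x. a x + a' x"] exI[of _ "\<lambda>p. t p + t' p"] conjI gid_add[OF *(1,3)])
      (simp add: *(2,4) distrib_right sum.distrib)
qed

lemma spn_scale: "spn N m P \<Longrightarrow> spn N m (\<lambda>x. c * P x)"
  unfolding spn_def
proof (elim exE conjE)
  fix a t
  assume *: "gid V Gset m a" "\<forall>x. P x = a x + (\<Sum>p\<in>tmons n N D m. t p * tmv p x)"
  show "\<exists>a t. gid V Gset m a \<and> (\<forall>x. c * P x = a x + (\<Sum>p\<in>tmons n N D m. t p * tmv p x))"
    by (intro exI[of _ "\<lambda>x. c * a x"] exI[of _ "\<lambda>p. c * t p"] conjI gid_scale[OF *(1)])
      (simp add: *(2) distrib_left sum_distrib_left mult.assoc)
qed

lemma spn_sum: "(\<And>i. i \<in> I \<Longrightarrow> spn N m (P i)) \<Longrightarrow> spn N m (\<lambda>x. \<Sum>i\<in>I. P i x)"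
proof (induction I rule: infinite_finite_induct)
  case (insert i I)
  have "spn N m (\<lambda>x. P i x + (\<Sum>i\<in>I. P i x))"
    by (rule spn_add[OF insert(4) insert(3)]) (use insert(4) in auto)
  then show ?case using insert(1,2) by simp
qed (simp_all add: spn_gid[OF gid_zero])

lemma D_ge1: "D \<ge> 1" using D3 by simp

lemma spn_tmv: "p \<in> tmons n N D m \<Longrightarrow> spn N m (tmv p)"
  unfolding spn_def
proof (rule exI[of _ "\<lambda>_. 0"], rule exI[of _ "\<lambda>q. if q = p then 1 else 0"], intro conjI gid_zero allI)
  fix x assume p: "p \<in> tmons n N D m"
  have "(\<Sum>q\<in>tmons n N D m. (if q = p then 1 else 0) * tmv q x) = (\<Sum>q\<in>tmons n N D m. if q = p then tmv q x else 0)"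
    by (intro sum.cong) auto
  then show "tmv p x = 0 + (\<Sum>q\<in>tmons n N D m. (if q = p then 1 else 0) * tmv q x)"
    using p finite_tmons[OF D_ge1, of n N m] by simp
qed

lemma tmv_shift:
  assumes j: "j \<in> {3..n}" and p: "p \<in> tmons n N D m"
  shows "spn N (D + m) (\<lambda>x. tmv p x * F x j)"
proof -
  let ?q = "(fst p, \<lambda>v. snd p v + (if v = j then 1 else 0))"
  from p obtain s k' where s: "s < N" "fst p \<in> mons {0..n} s" "snd p \<in> mons {3..n} k'" "s + D * k' = m"
    unfolding tmons_def by (auto simp: case_prod_beta)
  have "(\<lambda>v. snd p v + (if v = j then 1 else 0)) \<in> mons {3..n} (k' + 1)"
    by (rule mons_add[OF s(3) mons_single[OF j]]) simp
  then have q: "?q \<in> tmons n N D (D + m)"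
    by (rule tmonsI[OF s(1,2)]) (use s(4) in \<open>simp add: distrib_left\<close>)
  have eq: "tmv ?q = (\<lambda>x. tmv p x * F x j)"
  proof
    fix x
    have "monv {3..n} (\<lambda>v. if v = j then 1 else 0) (F x) = F x j ^ 1" by (rule monv_single[OF j]) simp
    then show "tmv ?q x = tmv p x * F x j" unfolding tmv_def by (simp add: monv_add mult.assoc)
  qed
  show ?thesis using spn_tmv[OF q] unfolding eq .
qed

lemma spn_mult_F:
  assumes j: "j \<in> {3..n}" and P: "spn N m P"
  shows "spn N (D + m) (\<lambda>x. P x * F x j)"
proof -
  from P obtain a t where a: "gid V Gset m a" "\<forall>x. P x = a x + (\<Sum>p\<in>tmons n N D m. t p * tmv p x)"
    unfolding spn_def by (elim exE conjE) (rule that)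
  have j': "j \<in> V" using j by auto
  have "gid V Gset (m + D) (\<lambda>x. F x j * a x)" by (rule gid_mult[OF a(1) homp_iter[OF j']])
  then have 1: "spn N (D + m) (\<lambda>x. F x j * a x)" by (intro spn_gid) (simp add: add.commute)
  have 2: "spn N (D + m) (\<lambda>x. \<Sum>p\<in>tmons n N D m. t p * (tmv p x * F x j))"
    by (rule spn_sum) (rule spn_scale[OF tmv_shift[OF j]])
  have "(\<lambda>x. P x * F x j) = (\<lambda>x. F x j * a x + (\<Sum>p\<in>tmons n N D m. t p * (tmv p x * F x j)))"
    using a(2) by (simp add: algebra_simps sum_distrib_left sum_distrib_right)
  then show ?thesis using spn_add[OF 1 2] by simp
qed

text \<open>Graded Nakayama again, now over the polynomials in the components \<open>F x j\<close>
  with \<open>j\<close> from 3 to \<open>n\<close>: from degree \<open>N\<close> on, a form lies in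
  the ideal of \<open>Gset\<close> up to multiples of these components with cofactors of smaller
  degree.\<close>

lemma spn_all:
  assumes c: "cert V (Gset \<union> {(D, \<lambda>x. F x j) | j. j \<in> {3..n}}) N"
  shows "homp V m P \<Longrightarrow> spn N m P"
proof (induction m arbitrary: P rule: less_induct)
  case (less m)
  show ?case
  proof (cases "m < N")
    case True
    from homp_expand[OF less(2) V(1)] obtain c where c: "\<forall>x. P x = (\<Sum>\<alpha>\<in>mons V m. c \<alpha> * monv V \<alpha> x)" ..
    have "spn N m (\<lambda>x. \<Sum>\<alpha>\<in>mons V m. c \<alpha> * tmv (\<alpha>, \<lambda>_. 0) x)"
    proof (rule spn_sum, rule spn_scale, rule spn_tmv)
      fix \<alpha> assume "\<alpha> \<in> mons V m"
      moreover have "(\<lambda>_. 0) \<in> mons {3..n} 0" by (simp add: mons_0)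
      ultimately show "(\<alpha>, \<lambda>_. 0) \<in> tmons n N D m" by (intro tmonsI[OF True, where k = 0]) auto
    qed
    moreover have "(\<lambda>x. \<Sum>\<alpha>\<in>mons V m. c \<alpha> * tmv (\<alpha>, \<lambda>_. 0) x) = P"
      using c by (auto simp: tmv_def monv_def)
    ultimately show ?thesis by simp
  next
    case False
    have "cert V (Gset \<union> {(D, \<lambda>x. F x j) | j. j \<in> {3..n}}) m" by (rule cert_mono[OF V(1) c]) (use False in simp)
    then have "gid V (Gset \<union> {(D, \<lambda>x. F x j) | j. j \<in> {3..n}}) m P" using less(2) unfolding cert_def by simp
    then show ?thesis using less(1)
    proof induction
      case (gid_zero m)
      show ?case by (rule spn_gid[OF gid.gid_zero])
    next
      case (gid_gen a h b c)
      from gid_gen(1) consider "(a, h) \<in> Gset" | j where "j \<in> {3..n}" "a = D" "h = (\<lambda>x. F x j)" by blast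
      then show ?case
      proof cases
        case 1
        show ?thesis by (rule spn_gid[OF gid.gid_gen[OF 1 gid_gen(2)]])
      next
        case 2
        have "spn N b c" by (rule gid_gen(3)[OF _ gid_gen(2)]) (use 2(2) D3 in linarith)
        from spn_mult_F[OF 2(1) this] show ?thesis using 2 by simp
      qed
    next
      case (gid_add m P Q)
      show ?case by (rule spn_add[OF gid_add.IH(1)[OF gid_add.prems] gid_add.IH(2)[OF gid_add.prems]])
    qed
  qed
qed

text \<open>The pulled back smoothness certificate involves the derivatives composed with
  \<open>F\<close>, the components \<open>F x j\<close>, and \<open>J\<close> composed with
  \<open>F\<close>; the last is a multiple of \<open>J\<close> and may be replaced by it.\<close>

lemma cert_Gset:
  assumes H': "homp V h' H'" "\<And>x. J (F x) = J x * (J x * H' x)" "h' + e + e = D * e"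
  shows "\<exists>N. cert V (Gset \<union> {(D, \<lambda>x. F x j) | j. j \<in> {3..n}}) N"
proof -
  let ?H = "jets e J \<union> {(1, \<lambda>x. x j) | j. j \<in> {3..n}}"
  from cert_iter[OF c2, of k] obtain N where
    N: "cert V {(D * a, \<lambda>x. h (F x)) | a h. (a, h) \<in> ?H} N" ..
  have "cert V (Gset \<union> {(D, \<lambda>x. F x j) | j. j \<in> {3..n}}) N"
  proof (rule cert_trans[OF N])
    fix a h assume "(a, h) \<in> {(D * a, \<lambda>x. h (F x)) | a h. (a, h) \<in> ?H}"
    then obtain a' h' where ah: "a = D * a'" "h = (\<lambda>x. h' (F x))" "(a', h') \<in> ?H"
      by (elim CollectE exE conjE Pair_inject) (rule that)
    from ah(3) consider "a' = e" "h' = J" | i where "i \<in> {0, 1, 2}" "a' = e - 1" "h' = pd i J"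
      | j where "j \<in> {3..n}" "a' = 1" "h' = (\<lambda>x. x j)" unfolding jets_def by blast
    then show "gid V (Gset \<union> {(D, \<lambda>x. F x j) | j. j \<in> {3..n}}) a h"
    proof cases
      case 1
      have "gid V (Gset \<union> {(D, \<lambda>x. F x j) | j. j \<in> {3..n}}) e J" by (rule gid_in) (simp add: Gset_def)
      from gid_mult[OF this homp_mult[OF homp_J H'(1)]] show ?thesis
        by (rule gid_cong) (use ah 1 H'(2,3) in \<open>simp_all add: mult_ac add_ac\<close>)
    next
      case 2
      show ?thesis by (rule gid_in) (use ah 2 in \<open>auto simp: Gset_def\<close>)
    next
      case 3
      show ?thesis by (rule gid_in) (use ah 3 in auto)
    qed
  qed
  then show ?thesis ..
qed

text \<open>The unknowns are coefficients on the normal forms of degree \<open>m\<close>; the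
  equations kill the part along the products \<open>tmv\<close> and the normal form of the cofactor
  of \<open>H'\<close>. Unknowns outnumber equations, so some nonzero normal form \<open>?p\<close>
  has \<open>Mm ?p\<close> in (\<open>J\<close>), against primality.\<close>

lemma periodic_False: False
proof -
  from square_divides obtain H' where H': "homp V (D * e - e - e) H'" "\<forall>x. J (F x) = J x * (J x * H' x)" by (elim exE conjE) (rule that)
  have "D * e - e - e + e + e = D * e"
  proof -
    have "e + e \<le> D * e" using mult_le_mono1[of 2 D e] D3 by linarith
    then show ?thesis by (simp only: diff_diff_left add.assoc le_add_diff_inverse2)
  qed
  from cert_Gset[OF H'(1) H'(2)[rule_format] this] obtain N where N: "cert V (Gset \<union> {(D, \<lambda>x. F x j) | j. j \<in> {3..n}}) N" ..
  have "D \<ge> 2" using D3 by simp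
  from card_tmons_less[OF n2 this, of N] obtain m0 where
    m0: "\<forall>m\<ge>m0. card (tmons n N D m) < card {\<alpha>\<in>mons {0..n} m. \<alpha> 0 = 0 \<and> \<alpha> n = 0}" ..
  \<comment> \<open>At least \<open>m0\<close>, so that the count applies, and at least
    \<open>del\<close>, so that \<open>m - del\<close> is a true difference.\<close>
  define m where "m = max m0 del"
  have del1: "del \<ge> 1"
  proof -
    have "1 * 1 \<le> del" using D3 e_ge(2) by (intro mult_le_mono) auto
    then show ?thesis by simp
  qed
  have m: "m0 \<le> m" "del \<le> m" by (auto simp: m_def)
  let ?R = "red V 0 e m" and ?R' = "red V 0 e (m - del)" and ?T = "tmons n N D m"
  have finR: "finite (red V 0 e m)" for m using finite_mons[OF V(1)] by (simp add: red_def)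
  have finT: "finite ?T" by (rule finite_tmons[OF D_ge1])
  have "card ?T < card {\<alpha>\<in>mons {0..n} m. \<alpha> 0 = 0 \<and> \<alpha> n = 0}" using m0 m by blast
  moreover have "card ?R' + card {\<alpha>\<in>mons {0..n} m. \<alpha> 0 = 0 \<and> \<alpha> n = 0} \<le> card ?R"
    using n2 by (intro card_red_ge del1 m(2) e_ge(1)) simp
  \<comment> \<open>The disjoint sum indexes the equations: one for each normal form of the cofactor
    and one for each product \<open>tmv\<close>.\<close>
  ultimately have "card (?R' <+> ?T) < card ?R" by (simp add: card_Plus finR finT)
  note lin = nontrivial_solution[OF finite_Plus[OF finR finT] finR this]
  have "\<exists>S r t w. polyf V S \<and> polyf V w \<and> (\<forall>x. Mm x * (monv V \<alpha> x - (\<Sum>p\<in>?T. t p * tmv p x))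
       = J x * (H' x * S x + w x) + H' x * (\<Sum>\<beta>\<in>?R'. r \<beta> * monv V \<beta> x))" if "\<alpha> \<in> ?R" for \<alpha>
  proof -
    have "homp V m (monv V \<alpha> :: (nat \<Rightarrow> 'a) \<Rightarrow> 'a)" using that by (intro homp_mon V) (simp add: red_def)
    from spn_all[OF N this] obtain a t where a: "gid V Gset m a"
      "\<forall>x. monv V \<alpha> x = a x + (\<Sum>p\<in>?T. t p * tmv p x)" unfolding spn_def by (elim exE conjE) (rule that)
    from gid_Gset[OF H'(1) H'(2)[rule_format] a(1)] obtain u w where
      u: "homp V (m - del) u" "polyf V w" "\<forall>x. Mm x * a x = H' x * u x + J x * w x" by (elim exE conjE) (rule that)
    from M.divs_homp[OF u(1)] obtain S r where S: "homp V (m - del - e) S"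
      "\<forall>x. u x = J x * S x + (\<Sum>\<beta>\<in>?R'. r \<beta> * monv V \<beta> x)" unfolding M.divs_def by (elim exE conjE) (rule that)
    show ?thesis
    proof (rule exI[of _ S], rule exI[of _ r], rule exI[of _ t], rule exI[of _ w], intro conjI homp_polyf[OF S(1)] u(2) allI)
      fix x
      have "Mm x * (monv V \<alpha> x - (\<Sum>p\<in>?T. t p * tmv p x)) = Mm x * a x" using a(2) by simp
      also have "\<dots> = H' x * (J x * S x + (\<Sum>\<beta>\<in>?R'. r \<beta> * monv V \<beta> x)) + J x * w x"
        using u(3) S(2) by simp
      also have "\<dots> = J x * (H' x * S x + w x) + H' x * (\<Sum>\<beta>\<in>?R'. r \<beta> * monv V \<beta> x)"
        by (simp add: algebra_simps)
      finally show "Mm x * (monv V \<alpha> x - (\<Sum>p\<in>?T. t p * tmv p x))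
       = J x * (H' x * S x + w x) + H' x * (\<Sum>\<beta>\<in>?R'. r \<beta> * monv V \<beta> x)" .
    qed
  qed
  \<comment> \<open>The four witnesses are packed into one tuple so that a single choice serves all
    of them.\<close>
  then have "\<forall>\<alpha>\<in>?R. \<exists>q. polyf V (fst q) \<and> polyf V (snd (snd (snd q))) \<and> (\<forall>x. Mm x * (monv V \<alpha> x - (\<Sum>p\<in>?T. fst (snd (snd q)) p * tmv p x))
       = J x * (H' x * fst q x + snd (snd (snd q)) x) + H' x * (\<Sum>\<beta>\<in>?R'. fst (snd q) \<beta> * monv V \<beta> x))"
    unfolding split_paired_Ex fst_conv snd_conv by (rule ballI)
  from bchoice[OF this] obtain q where q: "\<forall>\<alpha>\<in>?R. polyf V (fst (q \<alpha>)) \<and> polyf V (snd (snd (snd (q \<alpha>)))) \<and> (\<forall>x. Mm x * (monv V \<alpha> x - (\<Sum>p\<in>?T. fst (snd (snd (q \<alpha>))) p * tmv p x))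
       = J x * (H' x * fst (q \<alpha>) x + snd (snd (snd (q \<alpha>))) x) + H' x * (\<Sum>\<beta>\<in>?R'. fst (snd (q \<alpha>)) \<beta> * monv V \<beta> x))" ..
  define S where "S \<alpha> = fst (q \<alpha>)" for \<alpha>
  define r where "r \<alpha> = fst (snd (q \<alpha>))" for \<alpha>
  define t where "t \<alpha> = fst (snd (snd (q \<alpha>)))" for \<alpha>
  define w where "w \<alpha> = snd (snd (snd (q \<alpha>)))" for \<alpha>
  have q1: "polyf V (S \<alpha>)" "polyf V (w \<alpha>)" if "\<alpha> \<in> ?R" for \<alpha> using q that unfolding S_def w_def by auto
  have q2: "Mm x * monv V \<alpha> x = Mm x * (\<Sum>p\<in>?T. t \<alpha> p * tmv p x) + J x * (H' x * S \<alpha> x + w \<alpha> x)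
      + H' x * (\<Sum>\<beta>\<in>?R'. r \<alpha> \<beta> * monv V \<beta> x)" if "\<alpha> \<in> ?R" for \<alpha> x
  proof -
    have "Mm x * (monv V \<alpha> x - (\<Sum>p\<in>?T. t \<alpha> p * tmv p x)) = J x * (H' x * S \<alpha> x + w \<alpha> x)
      + H' x * (\<Sum>\<beta>\<in>?R'. r \<alpha> \<beta> * monv V \<beta> x)" using q that unfolding S_def w_def r_def t_def by simp
    then show ?thesis unfolding right_diff_distrib diff_eq_eq by (simp only: add_ac)
  qed
  from lin[of "\<lambda>E \<alpha>. case E of Inl \<beta> \<Rightarrow> r \<alpha> \<beta> | Inr p \<Rightarrow> t \<alpha> p"] obtain l where
    l: "\<exists>\<alpha>\<in>?R. l \<alpha> \<noteq> 0" "\<forall>E\<in>?R' <+> ?T. (\<Sum>\<alpha>\<in>?R. l \<alpha> * (case E of Inl \<beta> \<Rightarrow> r \<alpha> \<beta> | Inr p \<Rightarrow> t \<alpha> p)) = 0"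
    by (elim exE conjE) (rule that)
  have l1: "(\<Sum>\<alpha>\<in>?R. l \<alpha> * r \<alpha> \<beta>) = 0" if "\<beta> \<in> ?R'" for \<beta> using l(2)[rule_format, OF InlI[OF that]] by simp
  have l2: "(\<Sum>\<alpha>\<in>?R. l \<alpha> * t \<alpha> p) = 0" if "p \<in> ?T" for p using l(2)[rule_format, OF InrI[OF that]] by simp
  let ?p = "\<lambda>x :: nat \<Rightarrow> 'a. \<Sum>\<alpha>\<in>?R. l \<alpha> * monv V \<alpha> x"
  have z: "(\<Sum>\<alpha>\<in>?R. l \<alpha> * (\<Sum>i\<in>I. g \<alpha> i * h i)) = 0" if "\<And>i. i \<in> I \<Longrightarrow> (\<Sum>\<alpha>\<in>?R. l \<alpha> * g \<alpha> i) = 0"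
    for I :: "'b set" and g and h :: "'b \<Rightarrow> 'a"
  proof -
    have "(\<Sum>\<alpha>\<in>?R. l \<alpha> * (\<Sum>i\<in>I. g \<alpha> i * h i)) = (\<Sum>i\<in>I. (\<Sum>\<alpha>\<in>?R. l \<alpha> * g \<alpha> i) * h i)"
      unfolding sum_distrib_left sum_distrib_right by (subst sum.swap) (simp add: mult.assoc)
    then show ?thesis using that by simp
  qed
  have key: "Mm x * ?p x = J x * (\<Sum>\<alpha>\<in>?R. l \<alpha> * (H' x * S \<alpha> x + w \<alpha> x))" for x
  proof -
    have "Mm x * ?p x = (\<Sum>\<alpha>\<in>?R. l \<alpha> * (Mm x * monv V \<alpha> x))"
      by (simp add: sum_distrib_left mult_ac)
    also have "\<dots> = (\<Sum>\<alpha>\<in>?R. Mm x * (l \<alpha> * (\<Sum>p\<in>?T. t \<alpha> p * tmv p x)) + J x * (l \<alpha> * (H' x * S \<alpha> x + w \<alpha> x))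
      + H' x * (l \<alpha> * (\<Sum>\<beta>\<in>?R'. r \<alpha> \<beta> * monv V \<beta> x)))"
      by (intro sum.cong refl) (simp add: q2 distrib_left mult.left_commute mult.assoc)
    also have "\<dots> = Mm x * (\<Sum>\<alpha>\<in>?R. l \<alpha> * (\<Sum>p\<in>?T. t \<alpha> p * tmv p x)) + J x * (\<Sum>\<alpha>\<in>?R. l \<alpha> * (H' x * S \<alpha> x + w \<alpha> x))
      + H' x * (\<Sum>\<alpha>\<in>?R. l \<alpha> * (\<Sum>\<beta>\<in>?R'. r \<alpha> \<beta> * monv V \<beta> x))"
      unfolding sum_distrib_left sum.distrib ..
    finally show ?thesis
      using z[of ?T t "\<lambda>p. tmv p x", OF l2] z[of ?R' r "\<lambda>\<beta>. monv V \<beta> x", OF l1] by simp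
  qed
  have pp: "polyf V ?p"
    by (rule polyf_sum, rule polyf_mult[OF polyf_const homp_polyf[OF homp_mon[OF V(1), where m = m]]]) (simp add: red_def)
  have "van (\<lambda>x. Mm x * ?p x)" unfolding van_def key by simp
  with van_mult[OF polyf_Mm pp] not_van_Mm have "van ?p" by blast
  from van_dvdp[OF pp this] obtain Q where Q: "polyf V Q" "\<forall>x. ?p x = J x * Q x" unfolding dvdp_def by (elim exE conjE) (rule that)
  have "l \<alpha> = 0" if "\<alpha> \<in> ?R" for \<alpha>
    by (rule M.red_unique(2)[OF Q(1) finR[of m] _ _ that, of l]) (use Q(2) in \<open>auto simp: red_def mons_def\<close>)
  with l(1) show False by blast
qed

end

lemma (in good_map) not_periodic:
  assumes "k \<ge> 1"
  shows "\<exists>x. J x = 0 \<and> J ((fm ^^ k) x) \<noteq> 0"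
proof (rule ccontr)
  let ?P = "\<lambda>k. k \<ge> 1 \<and> (\<forall>x. J x = 0 \<longrightarrow> J ((fm ^^ k) x) = 0)"
  assume "\<not> ?thesis"
  then have P: "?P k" using assms by blast
  define k0 where "k0 = (LEAST k. ?P k)"
  have k0: "?P k0" unfolding k0_def by (rule LeastI[of ?P, OF P])
  have least: "\<not> ?P i" if "i < k0" for i using that unfolding k0_def by (rule not_less_Least)
  interpret periodic_map n d f N1 N0 fm J e k0
  proof (unfold_locales)
    show "1 \<le> k0" using k0 by blast
    show "J ((fm ^^ k0) x) = 0" if "J x = 0" for x using k0 that by blast
    show "\<exists>x. J x = 0 \<and> J ((fm ^^ i) x) \<noteq> 0" if "0 < i" "i < k0" for i
      using least[OF that(2)] that(1) by auto
  qed
  show False by (rule periodic_False)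
qed

subsection \<open>Smooth members of a pencil of plane curves\<close>

lemma homp_comp_zero:
  assumes V: "finite V" "V \<noteq> {}"
  shows "homp V m P \<Longrightarrow> homp V m (\<lambda>x. P (\<lambda>v. if v \<in> Z then 0 else x v))"
proof -
  assume P: "homp V m P"
  have "homp V (1 * m) (\<lambda>x. P (\<lambda>v. if v \<in> Z then 0 else x v))"
  proof (rule homp_compose[where F = "\<lambda>v x. if v \<in> Z then 0 else x v", OF P])
    fix v assume "v \<in> V"
    then show "homp V 1 (\<lambda>x. if v \<in> Z then 0 else x v)"
      using homp_var[of v V] homp_zero[OF V, of 1] by (cases "v \<in> Z") simp_all
  qed
  then show ?thesis by simp
qed

text \<open>For a product with restricted factors \<open>P'\<close> and \<open>Q'\<close> the
  identity \<open>P Q - P' Q' = Q (P - P') + P' (Q - Q')\<close> carries the induction.\<close>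

lemma gid_vanishing_coords:
  assumes V: "finite V" "V \<noteq> {}"
  shows "homp V m P \<Longrightarrow> gid V {(1, \<lambda>x. x v) | v. v \<in> Z} m (\<lambda>x. P x - P (\<lambda>v. if v \<in> Z then 0 else x v))"
proof (induction rule: homp.induct)
  case (homp_const c)
  show ?case using gid_zero[of V _ 0] by simp
next
  case (homp_var v)
  show ?case
  proof (cases "v \<in> Z")
    case True
    then have "(1, \<lambda>x. x v) \<in> {(1, \<lambda>x. x v) | v. v \<in> Z}" by blast
    from gid_in[OF this, of V] True show ?thesis by simp
  next
    case False
    then show ?thesis using gid_zero[of V _ 1] by simp
  qed
next
  case (homp_add m P Q)
  show ?case by (rule gid_cong[OF gid_add[OF homp_add.IH]]) simp_all
next
  case (homp_mult m P k Q)
  let ?r = "\<lambda>x v. if v \<in> Z then 0 else x v"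
  have 1: "gid V {(1, \<lambda>x. x v) | v. v \<in> Z} (m + k) (\<lambda>x. Q x * (P x - P (?r x)))"
    by (rule gid_mult[OF homp_mult.IH(1) homp_mult.hyps(2)])
  have 2: "gid V {(1, \<lambda>x. x v) | v. v \<in> Z} (k + m) (\<lambda>x. P (?r x) * (Q x - Q (?r x)))"
    by (rule gid_mult[OF homp_mult.IH(2) homp_comp_zero[OF V homp_mult.hyps(1)]])
  have 3: "gid V {(1, \<lambda>x. x v) | v. v \<in> Z} (m + k) (\<lambda>x. P (?r x) * (Q x - Q (?r x)))"
    using 2 by (simp add: add.commute)
  show ?case by (rule gid_cong[OF gid_add[OF 1 3]]) (simp_all add: algebra_simps)
qed

text \<open>Pigeonhole: a monomial whose exponents all stay below their bounds has smaller
  degree.\<close>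

lemma cert_powers:
  assumes V: "finite V" "V \<noteq> {}"
  shows "cert V {(m v, \<lambda>x :: 'v \<Rightarrow> 'a::comm_ring_1. x v ^ m v) | v. v \<in> V} (\<Sum>v\<in>V. m v)"
proof (rule cert_monI[OF V(1)])
  fix \<alpha> assume a: "\<alpha> \<in> mons V (\<Sum>v\<in>V. m v)"
  have "\<exists>v\<in>V. m v \<le> \<alpha> v"
  proof (rule ccontr)
    assume "\<not> ?thesis"
    then have "(\<Sum>v\<in>V. \<alpha> v) < (\<Sum>v\<in>V. m v)" using V by (intro sum_strict_mono) auto
    then show False using a by (simp add: mons_def)
  qed
  then obtain v where v: "v \<in> V" "m v \<le> \<alpha> v" by blast
  let ?\<beta> = "\<alpha>(v := \<alpha> v - m v)" and ?s = "\<lambda>u. if u = v then m v else 0"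
  have \<alpha>: "\<alpha> = (\<lambda>u. ?s u + ?\<beta> u)" using v by auto
  have "(\<Sum>u\<in>V. \<alpha> u) = (\<Sum>u\<in>V. ?s u + ?\<beta> u)" using \<alpha> by metis
  also have "\<dots> = m v + (\<Sum>u\<in>V. ?\<beta> u)" using v(1) V(1) by (simp add: sum.distrib)
  finally have d: "m v + (\<Sum>u\<in>V. ?\<beta> u) = (\<Sum>v\<in>V. m v)" using a by (simp add: mons_def)
  have "?\<beta> \<in> mons V (\<Sum>u\<in>V. ?\<beta> u)" using a v(1) by (auto simp: mons_def mp_supp_def split: if_splits)
  from gid_gen[OF _ homp_mon[OF V(1) this], of "m v" "\<lambda>x :: 'v \<Rightarrow> 'a. x v ^ m v" "{(m v, \<lambda>x :: 'v \<Rightarrow> 'a. x v ^ m v) | v. v \<in> V}"] v(1)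
  have "gid V {(m v, \<lambda>x :: 'v \<Rightarrow> 'a. x v ^ m v) | v. v \<in> V} (m v + (\<Sum>u\<in>V. ?\<beta> u)) (\<lambda>x. monv V ?\<beta> x * x v ^ m v)" by blast
  then show "gid V {(m v, \<lambda>x :: 'v \<Rightarrow> 'a. x v ^ m v) | v. v \<in> V} (\<Sum>v\<in>V. m v) (monv V \<alpha>)"
  proof (rule gid_cong)
    fix x :: "'v \<Rightarrow> 'a"
    have "monv V \<alpha> x = monv V (\<lambda>u. ?s u + ?\<beta> u) x" using \<alpha> by metis
    also have "\<dots> = x v ^ m v * monv V ?\<beta> x" using v(1) V(1) by (simp only: monv_add monv_single)
    finally show "monv V ?\<beta> x * x v ^ m v = monv V \<alpha> x" by (simp add: mult.commute)
  qed (rule d)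
qed

text \<open>Binary forms that are linear in the \<open>c\<close>-th powers of coordinates 0 and 1.
  On the line \<open>x 2 = 0\<close> both \<open>K\<close> and \<open>E\<close> of the pencil split
  into such factors, up to sign.\<close>

definition lam :: "nat \<Rightarrow> 'a \<Rightarrow> (nat \<Rightarrow> 'a::comm_ring_1) \<Rightarrow> 'a" where
  "lam c t x = x 0 ^ c - t * x 1 ^ c"

lemma homp_lam: "{0,1} \<subseteq> V \<Longrightarrow> homp V c (lam c t)"
  unfolding lam_def[abs_def] by (rule homp_diff[OF homp_varpow homp_scale[OF homp_varpow]]) auto

lemma homp_lam_prod: "{0,1} \<subseteq> V \<Longrightarrow> finite L \<Longrightarrow> homp V (c * card L) (\<lambda>x. \<Prod>l\<in>L. lam c (t l) x)"
proof -
  assume V: "{0,1} \<subseteq> V" and L: "finite L"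
  have "homp V (sum (\<lambda>_. c) L) (\<lambda>x. \<Prod>l\<in>L. lam c (t l) x)" by (rule homp_prod[OF L homp_lam[OF V]])
  then show ?thesis by (simp add: mult.commute)
qed

text \<open>Modulo \<open>lam c t\<close> the \<open>c\<close>-th power of coordinate 0 equals
  \<open>t\<close> times that of coordinate 1, so the factor for \<open>j\<close> becomes
  \<open>t - u j\<close> times the latter.\<close>

lemma lam_prod_cong:
  fixes t :: "'a::comm_ring_1"
  assumes V: "{0,1} \<subseteq> V" and L: "finite L"
  shows "gid V {(c, lam c t)} (c * card L) (\<lambda>x. (\<Prod>j\<in>L. lam c (u j) x) - (\<Prod>j\<in>L. t - u j) * (x 1 ^ c) ^ card L)"
  using L
proof induction
  case empty
  show ?case using gid_zero[of V _ 0] by simp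
next
  case (insert i L)
  have 1: "gid V {(c, lam c t)} (c + c * card L) (\<lambda>x. (\<Prod>j\<in>L. lam c (u j) x) * lam c t x)"
    by (rule gid_gen[OF _ homp_lam_prod[OF V insert(1)]]) simp
  have x1: "homp V c (\<lambda>x. (t - u i) * x 1 ^ c)" by (rule homp_scale[OF homp_varpow]) (use V in auto)
  have 2: "gid V {(c, lam c t)} (c * card L + c) (\<lambda>x. ((t - u i) * x 1 ^ c) * ((\<Prod>j\<in>L. lam c (u j) x) - (\<Prod>j\<in>L. t - u j) * (x 1 ^ c) ^ card L))"
    by (rule gid_mult[OF insert.IH x1])
  have 3: "gid V {(c, lam c t)} (c + c * card L) (\<lambda>x. ((t - u i) * x 1 ^ c) * ((\<Prod>j\<in>L. lam c (u j) x) - (\<Prod>j\<in>L. t - u j) * (x 1 ^ c) ^ card L))"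
    using 2 by (simp add: add.commute)
  show ?case
  proof (rule gid_cong[OF gid_add[OF 1 3]])
    fix x :: "nat \<Rightarrow> 'a"
    have l: "lam c (u i) x = lam c t x + (t - u i) * x 1 ^ c" by (simp add: lam_def algebra_simps)
    show "(\<Prod>j\<in>L. lam c (u j) x) * lam c t x + ((t - u i) * x 1 ^ c) * ((\<Prod>j\<in>L. lam c (u j) x) - (\<Prod>j\<in>L. t - u j) * (x 1 ^ c) ^ card L)
      = (\<Prod>j\<in>insert i L. lam c (u j) x) - (\<Prod>j\<in>insert i L. t - u j) * (x 1 ^ c) ^ card (insert i L)"
      using insert(1,2) by (simp add: l algebra_simps)
  qed (use insert(1,2) in simp)
qed

text \<open>Modulo these forms coordinate 2 is zero and coordinate 1 is nilpotent, and then
  \<open>lam c t\<close> makes coordinate 0 nilpotent.\<close>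

lemma cert_line_node:
  fixes t :: "'a::comm_ring_1"
  assumes c: "c \<ge> 1"
  shows "\<exists>N. cert {0,1,2} {(1, \<lambda>x. x 2), (M, \<lambda>x. x 1 ^ M), (c, lam c t)} N"
proof -
  let ?V = "{0,1,2::nat}" and ?H = "{(1, \<lambda>x :: nat \<Rightarrow> 'a. x 2), (M, \<lambda>x. x 1 ^ M), (c, lam c t)}"
  define m where "m v = (if v = 0 then c * M else if v = 1 then M else (1::nat))" for v :: nat
  have pw: "gid ?V ?H (c * j) (\<lambda>x. (x 0 ^ c) ^ j - (t * x 1 ^ c) ^ j)" for j
  proof (induction j)
    case 0
    show ?case using gid_zero[of ?V ?H 0] by simp
  next
    case (Suc j)
    have 1: "gid ?V ?H (c * j + c) (\<lambda>x. x 0 ^ c * ((x 0 ^ c) ^ j - (t * x 1 ^ c) ^ j))"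
      by (rule gid_mult[OF Suc homp_varpow]) simp
    have "homp ?V (j * c) (\<lambda>x. (t * x 1 ^ c) ^ j)" by (rule homp_power[OF homp_scale[OF homp_varpow]]) simp
    from gid_gen[OF _ this, of c "lam c t" ?H]
    have 2: "gid ?V ?H (c * j + c) (\<lambda>x. (t * x 1 ^ c) ^ j * lam c t x)" by (simp add: add.commute mult.commute)
    show ?case by (rule gid_cong[OF gid_add[OF 1 2]]) (simp_all add: lam_def algebra_simps)
  qed
  have "cert ?V ?H (\<Sum>v\<in>?V. m v)"
  proof (rule cert_trans[OF cert_powers])
    fix a h assume "(a, h) \<in> {(m v, \<lambda>x :: nat \<Rightarrow> 'a. x v ^ m v) | v. v \<in> ?V}"
    then consider "a = c * M" "h = (\<lambda>x. x 0 ^ (c * M))" | "a = M" "h = (\<lambda>x. x 1 ^ M)" | "a = 1" "h = (\<lambda>x. x 2)"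
      by (auto simp: m_def)
    then show "gid ?V ?H a h"
    proof cases
      case 1
      have "homp ?V (c * M - M) (\<lambda>x :: nat \<Rightarrow> 'a. t ^ M * x 1 ^ (c * M - M))" by (rule homp_scale[OF homp_varpow]) simp
      from gid_gen[OF _ this, of M "\<lambda>x. x 1 ^ M" ?H]
      have "gid ?V ?H (M + (c * M - M)) (\<lambda>x. t ^ M * x 1 ^ (c * M - M) * x 1 ^ M)" by simp
      then have 2: "gid ?V ?H (c * M) (\<lambda>x. (t * x 1 ^ c) ^ M)"
      proof (rule gid_cong)
        show e: "M + (c * M - M) = c * M" using c by (cases c) auto
        fix x :: "nat \<Rightarrow> 'a"
        have "x 1 ^ (c * M - M) * x 1 ^ M = x 1 ^ (c * M)" using e by (simp add: power_add[symmetric] add.commute)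
        then show "t ^ M * x 1 ^ (c * M - M) * x 1 ^ M = (t * x 1 ^ c) ^ M"
          by (simp add: power_mult_distrib power_mult mult.assoc)
      qed
      show ?thesis by (rule gid_cong[OF gid_add[OF pw[of M] 2]]) (simp_all add: 1 power_mult)
    next
      case 2
      show ?thesis by (rule gid_in) (simp add: 2)
    next
      case 3
      show ?thesis by (rule gid_in) (simp add: 3)
    qed
  qed auto
  then show ?thesis ..
qed

lemma pd_lam: "c \<ge> 1 \<Longrightarrow> pd 1 (lam c t) x = - (t * (of_nat c * x 1 ^ (c - 1)))"
proof -
  have v: "polyf UNIV (\<lambda>x :: nat \<Rightarrow> 'a. x i)" for i by (rule polyf_var) simp
  have "pd 1 (lam c t) x = pd 1 (\<lambda>x. x 0 ^ c) x - pd 1 (\<lambda>x. t * x 1 ^ c) x"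
    unfolding lam_def[abs_def] by (rule pd_diff[OF polyf_power[OF v] polyf_mult[OF polyf_const polyf_power[OF v]]])
  also have "pd 1 (\<lambda>x. t * x 1 ^ c) x = t * pd 1 (\<lambda>x. x 1 ^ c) x" by (rule pd_scale[OF polyf_power[OF v]])
  finally show ?thesis by (simp add: pd_power[OF v] pd_var)
qed

text \<open>Modulo \<open>lam c (t l)\<close> and up to a constant, \<open>G\<close> is a power of
  coordinate 1. The constant contains the differences \<open>t l - t j\<close>, the value
  \<open>t l\<close>, the exponent \<open>c\<close> and \<open>sg\<close>, which is why the
  parameters have to be distinct and \<open>t l\<close> nonzero.\<close>

lemma cert_node:
  fixes t :: "'i \<Rightarrow> 'a::field_char_0"
  assumes c: "c \<ge> 1" and L: "finite L" "inj_on t L" and l: "l \<in> L" "t l \<noteq> 0"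
    and S: "homp {0,1,2} s R"
    and G: "\<And>x. G x = R x * lam c (t l) x + sg * (\<Prod>j\<in>L - {l}. lam c (t j) x) * pd 1 (lam c (t l)) x"
    and sg: "sg \<noteq> 0" and s: "s + c = c * card L - 1"
  shows "\<exists>N. cert {0,1,2} ({(1, \<lambda>x. x 2), (c * card L - 1, G)} \<union> {(c, lam c (t l))}) N"
proof -
  let ?V = "{0,1,2::nat}" and ?H = "{(1, \<lambda>x. x 2), (c * card L - 1, G)} \<union> {(c, lam c (t l))}"
  have V01: "{0,1} \<subseteq> ?V" by auto
  define m where "m = card (L - {l})"
  have cm: "card L = Suc m" using L(1) l(1) unfolding m_def by (metis card.remove card_Diff_singleton)
  define C where "C = (\<Prod>j\<in>L - {l}. t l - t j)"
  have C: "C \<noteq> 0" unfolding C_def using L l by (auto simp: inj_on_def)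
  define q where "q = sg * - (t l * of_nat c)"
  have q: "q \<noteq> 0" using sg l c by (simp add: q_def)
  have dg: "c * m + (c - 1) = c * card L - 1" using cm c by (cases c) auto
  have "gid ?V {(c, lam c (t l))} (c * m) (\<lambda>x. (\<Prod>j\<in>L - {l}. lam c (t j) x) - C * (x 1 ^ c) ^ m)"
    unfolding C_def m_def by (rule lam_prod_cong[OF V01]) (use L in simp)
  then have "gid ?V ?H (c * m) (\<lambda>x. (\<Prod>j\<in>L - {l}. lam c (t j) x) - C * (x 1 ^ c) ^ m)" by (rule gid_mono) auto
  from gid_mult[OF this homp_scale[OF homp_varpow[of 1 ?V "c - 1"], of q]]
  have 1: "gid ?V ?H (c * card L - 1) (\<lambda>x. (q * x 1 ^ (c - 1)) * ((\<Prod>j\<in>L - {l}. lam c (t j) x) - C * (x 1 ^ c) ^ m))"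
    unfolding dg by simp
  have 2: "gid ?V ?H (c * card L - 1) G" by (rule gid_in) simp
  have "gid ?V ?H (c + s) (\<lambda>x. R x * lam c (t l) x)" by (rule gid_gen[OF _ S]) simp
  then have 3: "gid ?V ?H (c * card L - 1) (\<lambda>x. R x * lam c (t l) x)" using s by (simp add: add.commute)
  have 4: "gid ?V ?H (c * card L - 1) (\<lambda>x. 1 / (q * C) * (G x - R x * lam c (t l) x - (q * x 1 ^ (c - 1)) * ((\<Prod>j\<in>L - {l}. lam c (t j) x) - C * (x 1 ^ c) ^ m)))"
    by (rule gid_scale[OF gid_diff[OF gid_diff[OF 2 3] 1]])
  have 5: "gid ?V ?H (c * card L - 1) (\<lambda>x. x 1 ^ (c * card L - 1))"
  proof (rule gid_cong[OF 4 _ refl])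
    fix x :: "nat \<Rightarrow> 'a"
    have "G x - R x * lam c (t l) x = (q * x 1 ^ (c - 1)) * (\<Prod>j\<in>L - {l}. lam c (t j) x)"
      unfolding G pd_lam[OF c] q_def by (simp add: algebra_simps)
    then have "G x - R x * lam c (t l) x - (q * x 1 ^ (c - 1)) * ((\<Prod>j\<in>L - {l}. lam c (t j) x) - C * (x 1 ^ c) ^ m)
      = q * C * (x 1 ^ (c - 1) * (x 1 ^ c) ^ m)" by (simp add: algebra_simps)
    also have "x 1 ^ (c - 1) * (x 1 ^ c) ^ m = x 1 ^ (c * card L - 1)"
      unfolding dg[symmetric] by (simp add: power_add power_mult)
    finally show "1 / (q * C) * (G x - R x * lam c (t l) x - (q * x 1 ^ (c - 1)) * ((\<Prod>j\<in>L - {l}. lam c (t j) x) - C * (x 1 ^ c) ^ m))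
       = x 1 ^ (c * card L - 1)" using q C by simp
  qed
  from cert_line_node[OF c, of "c * card L - 1" "t l"] obtain N where
    N: "cert ?V {(1, \<lambda>x. x 2), (c * card L - 1, \<lambda>x. x 1 ^ (c * card L - 1)), (c, lam c (t l))} N" ..
  have "cert ?V ?H N"
  proof (rule cert_trans[OF N])
    fix a h assume "(a, h) \<in> {(1, \<lambda>x. x 2), (c * card L - 1, \<lambda>x. x 1 ^ (c * card L - 1)), (c, lam c (t l))}"
    then consider "a = 1" "h = (\<lambda>x. x 2)" | "a = c * card L - 1" "h = (\<lambda>x. x 1 ^ (c * card L - 1))" | "a = c" "h = lam c (t l)"
      by auto
    then show "gid ?V ?H a h" using 5 by cases (auto intro: gid_in)
  qed
  then show ?thesis ..
qed

text \<open>Modulo the factor \<open>lam c (t l)\<close> of \<open>p\<close>, only the term that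
  differentiates this factor survives in \<open>G\<close>. The sign \<open>sg\<close> allows the
  roles of \<open>p\<close> and \<open>q\<close> to be exchanged.\<close>

lemma cert_factor_node:
  fixes t :: "'i \<Rightarrow> 'a::field_char_0"
  assumes c: "c \<ge> 1" and L: "finite A" "finite B" "A \<inter> B = {}" "inj_on t (A \<union> B)" and l: "l \<in> A" "t l \<noteq> 0"
    and two: "card A \<ge> 2" "card B \<ge> 2"
    and p: "\<And>x. p x = (\<Prod>l\<in>A. lam c (t l) x)" and q: "\<And>x. q x = (\<Prod>l\<in>B. lam c (t l) x)"
    and G: "\<And>x. G x = sg * (q x * pd 1 p x - p x * pd 1 q x)" and sg: "sg \<noteq> 0"
  shows "\<exists>N. cert {0,1,2} ({(1, \<lambda>x. x 2), (c * card (A \<union> B) - 1, G)} \<union> {(c, lam c (t l))}) N"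
proof -
  let ?V = "{0,1,2::nat}"
  have V01: "{0,1} \<subseteq> ?V" and fV: "finite ?V" "?V \<noteq> {}" by auto
  define p' where "p' = (\<lambda>x. \<Prod>l\<in>A - {l}. lam c (t l) x)"
  have pe: "p x = lam c (t l) x * p' x" for x unfolding p p'_def by (rule prod.remove[OF L(1) l(1)])
  have hp': "homp ?V (c * (card A - 1)) p'" using homp_lam_prod[OF V01, of "A - {l}" c t] L(1) l(1) unfolding p'_def by simp
  have hq: "homp ?V (c * card B) q" using homp_lam_prod[OF V01 L(2), of c t] q[abs_def] by simp
  have pdp: "pd 1 p x = pd 1 (lam c (t l)) x * p' x + lam c (t l) x * pd 1 p' x" for x
  proof -
    have "pd 1 p x = pd 1 (\<lambda>x. lam c (t l) x * p' x) x" by (rule pd_cong) (rule pe)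
    also have "\<dots> = pd 1 (lam c (t l)) x * p' x + lam c (t l) x * pd 1 p' x"
      by (rule pd_mult[OF homp_polyf[OF homp_lam[OF V01]] homp_polyf[OF hp']])
    finally show ?thesis .
  qed
  have cL: "card (A \<union> B) = card A + card B" using L by (simp add: card_Un_disjoint)
  have ge: "c * (card A - 1) \<ge> 1" "c * card B \<ge> 1"
    using mult_le_mono[of 1 c 1 "card A - 1"] mult_le_mono[of 1 c 1 "card B"] c two by auto
  then have e1: "c * card B + (c * (card A - 1) - 1) = c * (card A - 1) + (c * card B - 1)" by linarith
  define R where "R = (\<lambda>x. sg * (q x * pd 1 p' x - p' x * pd 1 q x))"
  have R: "homp ?V (c * card B + (c * (card A - 1) - 1)) R" unfolding R_def
    by (rule homp_scale[OF homp_diff[OF homp_mult[OF hq homp_pd[OF fV hp']] homp_cong_deg[OF homp_mult[OF hp' homp_pd[OF fV hq]] e1[symmetric]]]])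
  have fL: "finite (A \<union> B)" and lL: "l \<in> A \<union> B" using L l by auto
  show ?thesis
  proof (rule cert_node[OF c fL L(4) lL l(2) R, of G sg])
    show "G x = R x * lam c (t l) x + sg * (\<Prod>j\<in>(A \<union> B) - {l}. lam c (t j) x) * pd 1 (lam c (t l)) x" for x
    proof -
      have "(A \<union> B) - {l} = (A - {l}) \<union> B" using L(3) l(1) by auto
      then have "(\<Prod>j\<in>(A \<union> B) - {l}. lam c (t j) x) = (\<Prod>j\<in>(A - {l}) \<union> B. lam c (t j) x)" by simp
      also have "\<dots> = p' x * q x" unfolding p'_def q using L by (intro prod.union_disjoint) auto
      finally show ?thesis unfolding G pe[of x] pdp[of x] R_def by (simp add: algebra_simps)
    qed
    have "c * card (A \<union> B) = c * card B + c * (card A - 1) + c" unfolding cL using two by (cases "card A") (auto simp: algebra_simps)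
    then show "c * card B + (c * (card A - 1) - 1) + c = c * card (A \<union> B) - 1" using ge by linarith
  qed (rule sg)
qed

text \<open>\<open>G\<close> is of Wronskian type: at a zero of \<open>p q\<close> on the line
  exactly one of the distinct factors vanishes, and there \<open>G\<close> does not. The
  certificates at the single factors are multiplied together by \<open>cert_prod\<close>.\<close>

lemma cert_squarefree:
  fixes t :: "'i \<Rightarrow> 'a::field_char_0"
  assumes c: "c \<ge> 1" and L: "finite A" "finite B" "A \<inter> B = {}" "inj_on t (A \<union> B)" "\<And>l. l \<in> A \<union> B \<Longrightarrow> t l \<noteq> 0"
    and two: "card A \<ge> 2" "card B \<ge> 2"
    and p: "\<And>x. p x = (\<Prod>l\<in>A. lam c (t l) x)" and q: "\<And>x. q x = (\<Prod>l\<in>B. lam c (t l) x)"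
    and G: "\<And>x. G x = q x * pd 1 p x - p x * pd 1 q x"
  shows "\<exists>N. cert {0,1,2} {(1, \<lambda>x. x 2), (c * card (A \<union> B) - 1, G), (c * card (A \<union> B), \<lambda>x. p x * q x)} N"
proof -
  let ?V = "{0,1,2::nat}" and ?L = "A \<union> B"
  let ?S = "{(1, \<lambda>x. x 2), (c * card ?L - 1, G)}"
  have V01: "{0,1} \<subseteq> ?V" and fV: "finite ?V" "?V \<noteq> {}" by auto
  have node: "\<exists>N. cert ?V (?S \<union> {(c, lam c (t l))}) N" if l: "l \<in> ?L" for l
  proof (cases "l \<in> A")
    case True
    show ?thesis by (rule cert_factor_node[OF c L(1-4) True L(5)[OF l] two p q, of G 1]) (use G in auto)
  next
    case False
    then have l': "l \<in> B" using l by simp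
    have "\<exists>N. cert ?V ({(1, \<lambda>x. x 2), (c * card (B \<union> A) - 1, G)} \<union> {(c, lam c (t l))}) N"
      by (rule cert_factor_node[OF c L(2,1) _ _ l' L(5)[OF l] two(2,1) q p, of G "- 1"]) (use G L in \<open>auto simp: Un_commute\<close>)
    then show ?thesis by (simp only: Un_commute[of B A])
  qed
  have hq: "homp ?V (c * card B) q" using homp_lam_prod[OF V01 L(2), of c t] q[abs_def] by simp
  have hp: "homp ?V (c * card A) p" using homp_lam_prod[OF V01 L(1), of c t] p[abs_def] by simp
  have cL: "card ?L = card A + card B" using L by (simp add: card_Un_disjoint)
  have ge: "c * card A \<ge> 1" "c * card B \<ge> 1"
    using mult_le_mono[of 1 c 1 "card A"] mult_le_mono[of 1 c 1 "card B"] c two by auto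
  have hG: "homp ?V (c * card ?L - 1) G"
  proof -
    have d: "c * card B + (c * card A - 1) = c * card ?L - 1" "c * card A + (c * card B - 1) = c * card ?L - 1"
      using ge unfolding cL distrib_left by linarith+
    have "homp ?V (c * card ?L - 1) (\<lambda>x. q x * pd 1 p x - p x * pd 1 q x)"
      by (rule homp_diff[OF homp_cong_deg[OF homp_mult[OF hq homp_pd[OF fV hp]] d(1)] homp_cong_deg[OF homp_mult[OF hp homp_pd[OF fV hq]] d(2)]])
    then show ?thesis using G[abs_def] by simp
  qed
  have hS: "homp ?V a h" if "(a, h) \<in> ?S" for a h
  proof -
    have x2: "homp ?V 1 (\<lambda>x :: nat \<Rightarrow> 'a. x 2)" by (rule homp_var) simp
    from that consider "a = 1" "h = (\<lambda>x. x 2)" | "a = c * card ?L - 1" "h = G" by auto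
    then show ?thesis using x2 hG by cases simp_all
  qed
  have "\<exists>N. cert ?V (?S \<union> {(c * card L', \<lambda>x. \<Prod>l\<in>L'. lam c (t l) x)}) N" if "finite L'" "L' \<subseteq> ?L" for L'
    using that
  proof induction
    case empty
    have "cert ?V (?S \<union> {(0, \<lambda>x. 1)}) 0" unfolding cert_def
    proof (intro allI impI)
      fix P :: "(nat \<Rightarrow> 'a) \<Rightarrow> 'a" assume "homp ?V 0 P"
      from gid_gen[OF _ this, of 0 "\<lambda>x. 1" "?S \<union> {(0, \<lambda>x. 1)}"] show "gid ?V (?S \<union> {(0, \<lambda>x. 1)}) 0 P" by simp
    qed
    then show ?case by auto
  next
    case (insert l L')
    from insert.IH insert.prems obtain N where N: "cert ?V (?S \<union> {(c * card L', \<lambda>x. \<Prod>l\<in>L'. lam c (t l) x)}) N" by auto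
    from node[of l] insert.prems obtain M where M: "cert ?V (?S \<union> {(c, lam c (t l))}) M" by auto
    have "cert ?V (?S \<union> {(a + b, \<lambda>x. h x * g x) | a h b g. (a, h) \<in> {(c, lam c (t l))} \<and> (b, g) \<in> {(c * card L', \<lambda>x. \<Prod>l\<in>L'. lam c (t l) x)}}) (M + N)"
    proof (rule cert_prod[OF M N hS _ _ fV])
      show "homp ?V a h" if "(a, h) \<in> {(c, lam c (t l))}" for a h using that homp_lam[OF V01, of c "t l"] by simp
      show "homp ?V a h" if "(a, h) \<in> {(c * card L', \<lambda>x. \<Prod>l\<in>L'. lam c (t l) x)}" for a h
        using that homp_lam_prod[OF V01 insert(1), of c t] by simp
    qed
    moreover have "{(a + b, \<lambda>x. h x * g x) | a h b g. (a, h) \<in> {(c, lam c (t l))} \<and> (b, g) \<in> {(c * card L', \<lambda>x. \<Prod>l\<in>L'. lam c (t l) x)}}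
      = {(c * card (insert l L'), \<lambda>x. \<Prod>l\<in>insert l L'. lam c (t l) x)}"
      using insert(1,2) by auto
    ultimately show ?case by auto
  qed
  from this[of ?L] L(1,2) obtain N where N: "cert ?V (?S \<union> {(c * card ?L, \<lambda>x. \<Prod>l\<in>?L. lam c (t l) x)}) N" by auto
  have "(\<lambda>x. \<Prod>l\<in>?L. lam c (t l) x) = (\<lambda>x. p x * q x)"
    unfolding p q using L by (intro ext prod.union_disjoint) auto
  with N have "cert ?V (?S \<union> {(c * card ?L, \<lambda>x. p x * q x)}) N" by simp
  moreover have "?S \<union> {(c * card ?L, \<lambda>x. p x * q x)} = {(1, \<lambda>x. x 2), (c * card ?L - 1, G), (c * card ?L, \<lambda>x. p x * q x)}" by auto
  ultimately show ?thesis by auto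
qed

section \<open>Reduction to the line \<open>x 2 = 0\<close> and the pencil argument\<close>

lemma pd_comp_zero:
  fixes P :: "('v \<Rightarrow> 'a::field_char_0) \<Rightarrow> 'a"
  assumes V: "finite V" "j \<in> V" "j \<notin> Z" and P: "polyf V P"
  shows "pd j (\<lambda>x. P (\<lambda>v. if v \<in> Z then 0 else x v)) x = pd j P (\<lambda>v. if v \<in> Z then 0 else x v)"
proof -
  have F: "polyf V (\<lambda>x :: 'v \<Rightarrow> 'a. if v \<in> Z then 0 else x v)" if "v \<in> V" for v
    using polyf_var[OF that] polyf_const[of V 0] by (cases "v \<in> Z") simp_all
  have "pd j (\<lambda>x. P (\<lambda>v. if v \<in> Z then 0 else x v)) x
    = (\<Sum>v\<in>V. pd v P (\<lambda>v. if v \<in> Z then 0 else x v) * pd j (\<lambda>x. if v \<in> Z then 0 else x v) x)"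
    by (rule pd_compose[where F = "\<lambda>v x. if v \<in> Z then 0 else x v", OF V(1) P F])
  also have "\<dots> = (\<Sum>v\<in>V. if v = j then pd j P (\<lambda>v. if v \<in> Z then 0 else x v) else 0)"
  proof (intro sum.cong refl)
    fix v
    have "pd j (\<lambda>x :: 'v \<Rightarrow> 'a. if v \<in> Z then 0 else x v) x = (if v = j then 1 else 0)"
      using V(3) by (cases "v \<in> Z") (auto simp: pd_var)
    then show "pd v P (\<lambda>v. if v \<in> Z then 0 else x v) * pd j (\<lambda>x. if v \<in> Z then 0 else x v) x
      = (if v = j then pd j P (\<lambda>v. if v \<in> Z then 0 else x v) else 0)" by simp
  qed
  finally show ?thesis using V by simp
qed

lemma gid_split_linear:
  assumes V: "finite V" "V \<noteq> {}" and H: "gid V (insert (1, h) H) m P"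
  shows "\<exists>Q. homp V (m - 1) Q \<and> gid V H m (\<lambda>x. P x - h x * Q x)"
  using H
proof induction
  case (gid_zero m)
  show ?case by (rule exI[of _ "\<lambda>_. 0"]) (use gid.gid_zero[of V H m] in \<open>simp add: homp_zero[OF V]\<close>)
next
  case (gid_gen a h' b c)
  show ?case
  proof (cases "(a, h') \<in> H")
    case True
    show ?thesis by (rule exI[of _ "\<lambda>_. 0"]) (use gid.gid_gen[OF True gid_gen(2)] in \<open>simp add: homp_zero[OF V]\<close>)
  next
    case False
    then have "a = 1" "h' = h" using gid_gen(1) by auto
    then show ?thesis by (intro exI[of _ c]) (use gid_gen(2) gid.gid_zero[of V H "1 + b"] in \<open>simp add: mult.commute\<close>)
  qed
next
  case (gid_add m P Q)
  from gid_add.IH obtain R S where R: "homp V (m - 1) R" "gid V H m (\<lambda>x. P x - h x * R x)"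
    and S: "homp V (m - 1) S" "gid V H m (\<lambda>x. Q x - h x * S x)" by (elim exE conjE) (rule that)
  show ?case
    by (rule exI[of _ "\<lambda>x. R x + S x"], rule conjI[OF homp_add[OF R(1) S(1)]], rule gid_cong[OF gid.gid_add[OF R(2) S(2)]])
      (simp_all add: algebra_simps)
qed

text \<open>If \<open>H\<close> and the linear form \<open>h\<close> have no common zero, then
  modulo \<open>H\<close> alone a factor \<open>h\<close> can be split off from a form of large
  degree again and again; what remains has the fixed degree \<open>M\<close>.\<close>

lemma gid_power_linear:
  assumes V: "finite V" "V \<noteq> {}" and c: "cert V (insert (1, h) H) (Suc M)" and h: "homp V 1 h"
  shows "homp V (M + j) P \<Longrightarrow> \<exists>Q. homp V M Q \<and> gid V H (M + j) (\<lambda>x. P x - h x ^ j * Q x)"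
proof (induction j arbitrary: P)
  case 0
  then show ?case by (intro exI[of _ P]) (use gid_zero[of V H M] in simp)
next
  case (Suc j)
  have "cert V (insert (1, h) H) (M + Suc j)" by (rule cert_mono[OF V(1) c]) simp
  then have "gid V (insert (1, h) H) (M + Suc j) P" using Suc.prems by (simp add: cert_def)
  from gid_split_linear[OF V this] obtain R where R: "homp V (M + j) R" "gid V H (M + Suc j) (\<lambda>x. P x - h x * R x)"
    by (auto simp: One_nat_def)
  from Suc.IH[OF R(1)] obtain Q where Q: "homp V M Q" "gid V H (M + j) (\<lambda>x. R x - h x ^ j * Q x)" by blast
  from gid_mult[OF Q(2) h] have Q': "gid V H (M + Suc j) (\<lambda>x. h x * (R x - h x ^ j * Q x))" by (simp add: One_nat_def)
  show ?case
    by (rule exI[of _ Q], rule conjI[OF Q(1)], rule gid_cong[OF gid_add[OF R(2) Q']]) (simp_all add: algebra_simps)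
qed

text \<open>For \<open>s \<noteq> 0\<close> the forms \<open>g1, g2\<close> lie in the ideal of singular points of \<open>x\<^sub>2\<^sup>N K + s E\<close>, and they do not depend on
  \<open>s\<close>. Modulo them every form of large degree is divisible by a high power of \<open>x\<^sub>2\<close>, which by Euler's formula
  is \<open>s\<close> times a fixed form. Hence a matrix \<open>1 - s C\<close> maps the monomials into the ideal, and it is invertible
  for all but finitely many \<open>s\<close>.\<close>

lemma pencil_smooth:
  fixes E \<kappa> :: "(nat \<Rightarrow> 'a::field_char_0) \<Rightarrow> 'a"
  assumes c: "c \<ge> 1" and E: "homp {0,1,2} e E" and e: "e = N + 2 * c" and \<kappa>: "homp {0,1} (2 * c) \<kappa>"
    and K: "\<And>x. K x = x 2 ^ (2 * c) - \<kappa> x"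
    and g1: "\<And>x. g1 x = K x * pd 1 E x - E x * pd 1 K x"
    and g2: "\<And>x. g2 x = x 2 * (K x * pd 2 E x - E x * pd 2 K x) - of_nat N * (E x * K x)"
    and cM: "cert {0,1,2} {(1, \<lambda>x. x 2), (e + 2 * c - 1, g1), (e + 2 * c, g2)} M"
  shows "\<exists>s m. s \<noteq> 0 \<and> cert {0,1,2} (jets e (\<lambda>x. x 2 ^ N * K x + s * E x)) m"
proof -
  let ?V = "{0,1,2::nat}" and ?H = "{(e + 2 * c - 1, g1), (e + 2 * c, g2)}"
  have V: "finite ?V" "?V \<noteq> {}" by auto
  have x2: "homp ?V 1 (\<lambda>x :: nat \<Rightarrow> 'a. x 2)" and x1: "homp ?V 1 (\<lambda>x :: nat \<Rightarrow> 'a. x 1)"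
    and x0: "homp ?V 1 (\<lambda>x :: nat \<Rightarrow> 'a. x 0)" by (rule homp_var; simp)+
  have \<kappa>V: "homp ?V (2 * c) \<kappa>" by (rule homp_mono[OF \<kappa>]) auto
  have hK: "homp ?V (2 * c) K" unfolding K[abs_def] by (rule homp_diff[OF homp_varpow \<kappa>V]) simp
  have pE: "polyf ?V E" and pK: "polyf ?V K" by (rule homp_polyf[OF E], rule homp_polyf[OF hK])
  have e1: "e \<ge> 1" "2 * c \<ge> 1" using e c by auto
  \<comment> \<open>Chosen so that subtracting Euler's formula in coordinates 0 and 1 turns the
    member of the pencil into the \<open>e\<close>-th power of coordinate 2 minus \<open>s\<close>
    times \<open>r\<close>; the factor \<open>1 / (2 c)\<close> matches the degree of
    \<open>\<kappa>\<close>.\<close>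
  define r where "r = (\<lambda>x. 1 / of_nat (2 * c) * (x 0 * pd 0 E x + x 1 * pd 1 E x) - E x)"
  have d1: "1 + (e - 1) = e" using e1 by simp
  have hr: "homp ?V e r" unfolding r_def
    by (intro homp_diff[OF homp_scale[OF homp_add[OF homp_cong_deg[OF homp_mult[OF x0 homp_pd[OF V E]] d1] homp_cong_deg[OF homp_mult[OF x1 homp_pd[OF V E]] d1]]] E])
  have cM': "cert ?V (insert (1, \<lambda>x. x 2) ?H) (Suc M)" by (rule cert_mono[OF V(1) cM]) simp
  define m where "m = M + e"
  have "\<forall>\<alpha>\<in>mons ?V m. \<exists>Q. homp ?V M Q \<and> gid ?V ?H m (\<lambda>x. monv ?V \<alpha> x - x 2 ^ e * Q x)"
    using gid_power_linear[OF V cM' x2, of e] homp_mon[OF V(1)] unfolding m_def by blast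
  from bchoice[OF this] obtain Q where Q: "\<forall>\<alpha>\<in>mons ?V m. homp ?V M (Q \<alpha>) \<and> gid ?V ?H m (\<lambda>x. monv ?V \<alpha> x - x 2 ^ e * Q \<alpha> x)" ..
  let ?W = "{0,1::nat}"
  interpret bihom ?W ?V by unfold_locales auto
  \<comment> \<open>The system \<open>1 - s C\<close> made homogeneous in two parameters with
    \<open>s = w 1 / w 0\<close>; at \<open>unitv 0\<close> it consists of the monomials
    themselves.\<close>
  define h where "h \<alpha> w x = w 0 * monv ?V \<alpha> x + w 1 * (- 1 * (r x * Q \<alpha> x))" for \<alpha> :: "nat \<Rightarrow> nat" and w x :: "nat \<Rightarrow> 'a"
  have bhh: "bh ?W ?V 1 m (h \<alpha>)" if "\<alpha> \<in> mons ?V m" for \<alpha>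
  proof -
    have w: "homp ?W 1 (\<lambda>w :: nat \<Rightarrow> 'a. w 0)" "homp ?W 1 (\<lambda>w :: nat \<Rightarrow> 'a. w 1)" by (rule homp_var; simp)+
    have "bh ?W ?V (1 + 0) (0 + m) (\<lambda>w x. w 0 * monv ?V \<alpha> x :: 'a)"
      by (rule bh_mult[OF bh_param[OF w(1)] bh_form[OF homp_mon[OF V(1) that]]])
    moreover have "homp ?V (e + M) (\<lambda>x. r x * Q \<alpha> x)" by (rule homp_mult[OF hr]) (use Q that in simp)
    then have rq: "homp ?V m (\<lambda>x. - 1 * (r x * Q \<alpha> x))" unfolding m_def by (subst add.commute) (rule homp_scale)
    have "bh ?W ?V (1 + 0) (0 + m) (\<lambda>w x. w 1 * (- 1 * (r x * Q \<alpha> x)))"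
      by (rule bh_mult[OF bh_param[OF w(2)] bh_form[OF rq]])
    ultimately show ?thesis unfolding h_def[abs_def] by (intro bh_add) simp_all
  qed
  have "cert ?V {(m, h \<alpha> (unitv 0)) | \<alpha>. \<alpha> \<in> mons ?V m} m"
  proof (rule cert_monI[OF V(1)])
    fix \<alpha> assume a: "\<alpha> \<in> mons ?V m"
    have "h \<alpha> (unitv 0) = monv ?V \<alpha>" by (simp add: h_def unitv_def fun_eq_iff)
    then show "gid ?V {(m, h \<alpha> (unitv 0)) | \<alpha>. \<alpha> \<in> mons ?V m} m (monv ?V \<alpha>)"
      by (intro gid_in CollectI exI[of _ \<alpha>]) (simp add: a)
  qed
  from cert_open[where a = "\<lambda>_. m" and h = h and I = "mons ?V m", OF _ this, of 1] bhh
  have "\<exists>e' \<Gamma>. homp ?W e' \<Gamma> \<and> \<Gamma> (unitv 0) \<noteq> 0 \<and> (\<forall>w. \<Gamma> w \<noteq> 0 \<longrightarrow> cert ?V {(m, h \<alpha> w) | \<alpha>. \<alpha> \<in> mons ?V m} m)" .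
  then obtain e' \<Gamma> where
    \<Gamma>: "homp ?W e' \<Gamma>" "\<Gamma> (unitv 0) \<noteq> 0" "\<forall>w. \<Gamma> w \<noteq> 0 \<longrightarrow> cert ?V {(m, h \<alpha> w) | \<alpha>. \<alpha> \<in> mons ?V m} m"
    by (elim exE conjE) (rule that)
  \<comment> \<open>The parameter has to make \<open>s\<close> defined, \<open>s\<close> nonzero and
    the system invertible.\<close>
  define fs where "fs i = (if i = 0 then (\<lambda>w. w 0) else if i = 1 then (\<lambda>w. w 1) else \<Gamma>)" for i :: nat
  have "\<exists>w. \<forall>i\<in>{0,1,2}. fs i w \<noteq> 0"
  proof (rule common_nonzero_point[where V = ?W])
    have "polyf ?W (\<lambda>w :: nat \<Rightarrow> 'a. w 0)" "polyf ?W (\<lambda>w :: nat \<Rightarrow> 'a. w 1)" by (rule polyf_var; simp)+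
    then show "polyf ?W (fs i)" for i using homp_polyf[OF \<Gamma>(1)] by (simp add: fs_def)
    have "\<exists>w :: nat \<Rightarrow> 'a. w 0 \<noteq> 0" "\<exists>w :: nat \<Rightarrow> 'a. w 1 \<noteq> 0" by (rule exI[of _ "\<lambda>_. 1"], simp)+
    then show "\<exists>w. fs i w \<noteq> 0" for i using \<Gamma>(2) by (auto simp: fs_def)
  qed simp
  then obtain w where w: "w 0 \<noteq> 0" "w 1 \<noteq> 0" "\<Gamma> w \<noteq> 0" by (auto simp: fs_def)
  define s where "s = w 1 / w 0"
  have s: "s \<noteq> 0" using w by (simp add: s_def)
  define \<Phi> where "\<Phi> = (\<lambda>x. x 2 ^ N * K x + s * E x)"
  have \<Phi>x: "\<Phi> x = x 2 ^ N * K x + s * E x" for x by (simp add: \<Phi>_def)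
  have h\<Phi>: "homp ?V e \<Phi>" unfolding \<Phi>_def
    by (rule homp_add[OF homp_cong_deg[OF homp_mult[OF homp_varpow hK]] homp_scale[OF E]]) (simp_all add: e)
  have pxN: "polyf ?V (\<lambda>x :: nat \<Rightarrow> 'a. x 2 ^ k)" for k by (rule homp_polyf[OF homp_varpow]) simp
  have pd\<Phi>: "pd i \<Phi> x = pd i (\<lambda>x. x 2 ^ N) x * K x + x 2 ^ N * pd i K x + s * pd i E x" for i x
    unfolding \<Phi>_def pd_add[OF polyf_mult[OF pxN pK] polyf_mult[OF polyf_const pE]] pd_mult[OF pxN pK] pd_scale[OF pE] by simp
  have pdx: "pd i (\<lambda>x :: nat \<Rightarrow> 'a. x 2 ^ k) x = of_nat k * x 2 ^ (k - 1) * (if 2 = i then 1 else 0)" for i k x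
    unfolding pd_power[OF homp_polyf[OF x2]] pd_var ..
  have pdx2: "x 2 * pd 2 (\<lambda>x :: nat \<Rightarrow> 'a. x 2 ^ k) x = of_nat k * x 2 ^ k" for k x
    unfolding pdx by (cases k) simp_all
  have j0: "gid ?V (jets e \<Phi>) e \<Phi>" and jd: "i \<in> {0,1,2} \<Longrightarrow> gid ?V (jets e \<Phi>) (e - 1) (pd i \<Phi>)" for i
    by (rule gid_in; auto simp: jets_def)+
  \<comment> \<open>Eliminating \<open>x 2 ^ N\<close> between the member and its derivative leaves
    \<open>s\<close> times \<open>g1\<close>, since that power has derivative zero in direction
    1.\<close>
  have gg1: "gid ?V (jets e \<Phi>) (e + 2 * c - 1) g1"
  proof -
    have 1: "gid ?V (jets e \<Phi>) (e + 2 * c - 1) (\<lambda>x. K x * pd 1 \<Phi> x)"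
      by (rule gid_cong[OF gid_mult[OF jd[of 1] hK]]) (use e1 in auto)
    have 2: "gid ?V (jets e \<Phi>) (e + 2 * c - 1) (\<lambda>x. pd 1 K x * \<Phi> x)"
      by (rule gid_cong[OF gid_mult[OF j0 homp_pd[OF V hK]]]) (use e1 in auto)
    show ?thesis
      by (rule gid_cong[OF gid_scale[OF gid_diff[OF 1 2], of "1 / s"]])
        (use s in \<open>simp_all add: pd\<Phi> pdx g1 \<Phi>x field_simps\<close>)
  qed
  \<comment> \<open>The same elimination in direction 2. Multiplying by \<open>x 2\<close> turns the
    derivative of \<open>x 2 ^ N\<close> into a multiple of that power, which accounts for the
    summand with \<open>of_nat N\<close> in \<open>g2\<close>.\<close>
  have gg2: "gid ?V (jets e \<Phi>) (e + 2 * c) g2"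
  proof -
    have 1: "gid ?V (jets e \<Phi>) (e + 2 * c) (\<lambda>x. (x 2 * K x) * pd 2 \<Phi> x)"
      by (rule gid_cong[OF gid_mult[OF jd[of 2] homp_mult[OF x2 hK]]]) (use e1 in auto)
    have "homp ?V (2 * c) (\<lambda>x. x 2 * pd 2 K x)" by (rule homp_cong_deg[OF homp_mult[OF x2 homp_pd[OF V hK]]]) (use e1 in simp)
    then have 2: "gid ?V (jets e \<Phi>) (e + 2 * c) (\<lambda>x. (of_nat N * K x + x 2 * pd 2 K x) * \<Phi> x)"
      by (intro gid_mult[OF j0 homp_add[OF homp_scale[OF hK]]])
    show ?thesis
    proof (rule gid_cong[OF gid_scale[OF gid_diff[OF 1 2], of "1 / s"] _ refl])
      fix x :: "nat \<Rightarrow> 'a"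
      have "(x 2 * K x) * pd 2 \<Phi> x = K x * (x 2 * pd 2 (\<lambda>x. x 2 ^ N) x) * K x + x 2 * K x * (x 2 ^ N * pd 2 K x + s * pd 2 E x)"
        unfolding pd\<Phi> by (simp add: algebra_simps)
      then have "(x 2 * K x) * pd 2 \<Phi> x - (of_nat N * K x + x 2 * pd 2 K x) * \<Phi> x = s * g2 x"
        unfolding pdx2 g2 \<Phi>x by (simp add: algebra_simps)
      then show "1 / s * ((x 2 * K x) * pd 2 \<Phi> x - (of_nat N * K x + x 2 * pd 2 K x) * \<Phi> x) = g2 x" using s by simp
    qed
  qed
  \<comment> \<open>Euler's formula in the two variables of \<open>\<kappa>\<close>\<close>
  have xe: "gid ?V (jets e \<Phi>) e (\<lambda>x. x 2 ^ e - s * r x)"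
  proof -
    have 1: "gid ?V (jets e \<Phi>) e (\<lambda>x. x 0 * pd 0 \<Phi> x)" by (rule gid_cong[OF gid_mult[OF jd[of 0] x0]]) (use e1 in auto)
    have 2: "gid ?V (jets e \<Phi>) e (\<lambda>x. x 1 * pd 1 \<Phi> x)" by (rule gid_cong[OF gid_mult[OF jd[of 1] x1]]) (use e1 in auto)
    show ?thesis
    proof (rule gid_cong[OF gid_diff[OF j0 gid_scale[OF gid_add[OF 1 2], of "1 / of_nat (2 * c)"]] _ refl])
      fix x :: "nat \<Rightarrow> 'a"
      have pdK: "pd i K x = - pd i \<kappa> x" if "i \<noteq> 2" for i
        unfolding K[abs_def] pd_diff[OF pxN homp_polyf[OF \<kappa>V]] pdx using that by simp
      have "(\<Sum>v\<in>?W. x v * pd v \<kappa> x) = of_nat (2 * c) * \<kappa> x" by (rule euler[OF _ \<kappa>]) simp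
      then have eu: "x 0 * pd 0 \<kappa> x + x 1 * pd 1 \<kappa> x = of_nat (2 * c) * \<kappa> x" by simp
      have "x 0 * pd 0 \<Phi> x + x 1 * pd 1 \<Phi> x = - (x 2 ^ N * (x 0 * pd 0 \<kappa> x + x 1 * pd 1 \<kappa> x)) + s * (x 0 * pd 0 E x + x 1 * pd 1 E x)"
        unfolding pd\<Phi> pdx by (simp add: pdK algebra_simps)
      then have A: "1 / of_nat (2 * c) * (x 0 * pd 0 \<Phi> x + x 1 * pd 1 \<Phi> x)
        = - (x 2 ^ N * \<kappa> x) + s * (1 / of_nat (2 * c) * (x 0 * pd 0 E x + x 1 * pd 1 E x))"
        unfolding eu using c by (simp add: field_simps)
      show "\<Phi> x - 1 / of_nat (2 * c) * (x 0 * pd 0 \<Phi> x + x 1 * pd 1 \<Phi> x) = x 2 ^ e - s * r x"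
        unfolding A unfolding \<Phi>x r_def K e power_add by (simp only: algebra_simps add_minus_cancel minus_add_cancel)
    qed
  qed
  have "cert ?V (jets e \<Phi>) m"
  proof (rule cert_trans[OF \<Gamma>(3)[rule_format, OF w(3)]])
    fix a h' assume "(a, h') \<in> {(m, h \<alpha> w) | \<alpha>. \<alpha> \<in> mons ?V m}"
    then obtain \<alpha> where \<alpha>: "a = m" "h' = h \<alpha> w" "\<alpha> \<in> mons ?V m" by blast
    from Q \<alpha>(3) have Q1: "homp ?V M (Q \<alpha>)" and Q2: "gid ?V ?H m (\<lambda>x. monv ?V \<alpha> x - x 2 ^ e * Q \<alpha> x)" by auto
    have 1: "gid ?V (jets e \<Phi>) m (\<lambda>x. monv ?V \<alpha> x - x 2 ^ e * Q \<alpha> x)"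
      by (rule gid_trans[OF Q2]) (use gg1 gg2 in auto)
    have 2: "gid ?V (jets e \<Phi>) m (\<lambda>x. Q \<alpha> x * (x 2 ^ e - s * r x))"
      by (rule gid_cong[OF gid_mult[OF xe Q1]]) (auto simp: m_def)
    have "gid ?V (jets e \<Phi>) m (h \<alpha> w)"
    proof (rule gid_cong[OF gid_scale[OF gid_add[OF 1 2], of "w 0"] _ refl])
      fix x :: "nat \<Rightarrow> 'a"
      have "w 1 = w 0 * s" using w by (simp add: s_def)
      then show "w 0 * (monv ?V \<alpha> x - x 2 ^ e * Q \<alpha> x + Q \<alpha> x * (x 2 ^ e - s * r x)) = h \<alpha> w x"
        by (simp add: h_def algebra_simps)
    qed
    then show "gid ?V (jets e \<Phi>) a h'" using \<alpha> by simp
  qed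
  then show ?thesis using s unfolding \<Phi>_def by blast
qed

text \<open>On the line \<open>x 2 = 0\<close> the forms \<open>g1\<close> and \<open>g2\<close>
  become, up to nonzero constants, the form \<open>G\<close> and the product \<open>p q\<close> of
  \<open>cert_squarefree\<close>, so distinct nonzero parameters suffice.\<close>

lemma pencil_smooth_distinct:
  fixes E :: "(nat \<Rightarrow> 'a::field_char_0) \<Rightarrow> 'a" and t :: "'i \<Rightarrow> 'a"
  assumes c: "c \<ge> 1" and L: "finite A" "finite B" "A \<inter> B = {}" "inj_on t (A \<union> B)" "\<And>l. l \<in> A \<union> B \<Longrightarrow> t l \<noteq> 0"
    and two: "card A \<ge> 2" "card B = 2" and N: "N \<ge> 1"
    and E: "homp {0,1,2} e E" and e: "e = N + 2 * c" "e = c * card A"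
    and E0: "\<And>x. x 2 = 0 \<Longrightarrow> E x = (\<Prod>l\<in>A. lam c (t l) x)"
    and K: "\<And>x. K x = x 2 ^ (2 * c) - (\<Prod>l\<in>B. lam c (t l) x)"
  shows "\<exists>s m. s \<noteq> 0 \<and> cert {0,1,2} (jets e (\<lambda>x. x 2 ^ N * K x + s * E x)) m"
proof -
  let ?V = "{0,1,2::nat}" and ?r = "\<lambda>x v. if v \<in> {2} then 0 else x v"
  have V: "finite ?V" "?V \<noteq> {}" by auto
  define p where "p = (\<lambda>x. \<Prod>l\<in>A. lam c (t l) x)"
  define q where "q = (\<lambda>x. \<Prod>l\<in>B. lam c (t l) x)"
  define g1 where "g1 = (\<lambda>x. K x * pd 1 E x - E x * pd 1 K x)"
  define g2 where "g2 = (\<lambda>x. x 2 * (K x * pd 2 E x - E x * pd 2 K x) - of_nat N * (E x * K x))"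
  define G where "G = (\<lambda>x. q x * pd 1 p x - p x * pd 1 q x)"
  have q: "homp {0,1} (2 * c) q" using homp_lam_prod[of "{0,1}" B c t] L(2) two(2) by (simp add: q_def mult.commute)
  have qV: "homp ?V (2 * c) q" by (rule homp_mono[OF q]) auto
  have hK: "homp ?V (2 * c) K" unfolding K[abs_def] by (rule homp_diff[OF homp_varpow qV[unfolded q_def]]) simp
  have x2: "homp ?V 1 (\<lambda>x :: nat \<Rightarrow> 'a. x 2)" by (rule homp_var) simp
  have e1: "e \<ge> 1" "2 * c \<ge> 1" using e(1) c by auto
  have hg1: "homp ?V (e + 2 * c - 1) g1" unfolding g1_def
    by (rule homp_diff[OF homp_cong_deg[OF homp_mult[OF hK homp_pd[OF V E]]] homp_cong_deg[OF homp_mult[OF E homp_pd[OF V hK]]]]) (use e1 in auto)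
  have "homp ?V (e + 2 * c - 1) (\<lambda>x. K x * pd 2 E x - E x * pd 2 K x)"
    by (rule homp_diff[OF homp_cong_deg[OF homp_mult[OF hK homp_pd[OF V E]]] homp_cong_deg[OF homp_mult[OF E homp_pd[OF V hK]]]]) (use e1 in auto)
  then have hg2: "homp ?V (e + 2 * c) g2" unfolding g2_def
    by (intro homp_diff[OF homp_cong_deg[OF homp_mult[OF x2]] homp_scale[OF homp_mult[OF E hK]]]) (use e1 in auto)
  have lamr: "lam c a (?r x) = lam c a x" for a x by (simp add: lam_def)
  have Er: "E (?r x) = p x" for x
  proof -
    have "E (?r x) = (\<Prod>l\<in>A. lam c (t l) (?r x))" by (rule E0) simp
    then show ?thesis unfolding lamr by (simp add: p_def)
  qed
  have Kr: "K (?r x) = - q x" for x unfolding K lamr using c by (simp add: q_def)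
  have pdE: "pd 1 E (?r x) = pd 1 p x" for x
  proof -
    have "pd 1 (\<lambda>x. E (?r x)) x = pd 1 E (?r x)" by (rule pd_comp_zero[OF V(1) _ _ homp_polyf[OF E]]) auto
    then show ?thesis unfolding Er[abs_def] by simp
  qed
  have pdK: "pd 1 K (?r x) = - pd 1 q x" for x
  proof -
    have "pd 1 (\<lambda>x. K (?r x)) x = pd 1 K (?r x)" by (rule pd_comp_zero[OF V(1) _ _ homp_polyf[OF hK]]) auto
    moreover have "pd 1 (\<lambda>x. K (?r x)) x = pd 1 (\<lambda>x. - 1 * q x) x" by (rule pd_cong) (subst Kr, simp)
    ultimately show ?thesis using pd_scale[OF homp_polyf[OF q], of 1 "- 1" x] by simp
  qed
  have g1r: "g1 (?r x) = - G x" for x unfolding g1_def G_def Er Kr pdE pdK by (simp add: algebra_simps)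
  have g2r: "g2 (?r x) = of_nat N * (p x * q x)" for x unfolding g2_def Er Kr by simp
  have cL: "c * card (A \<union> B) = e + 2 * c" using L two e(2) by (simp add: card_Un_disjoint distrib_left mult.commute)
  from cert_squarefree[OF c L two(1) _ fun_cong[OF p_def] fun_cong[OF q_def] fun_cong[OF G_def]] two(2)
  obtain M where M: "cert ?V {(1, \<lambda>x. x 2), (e + 2 * c - 1, G), (e + 2 * c, \<lambda>x. p x * q x)} M" unfolding cL by auto
  let ?H = "{(1, \<lambda>x :: nat \<Rightarrow> 'a. x 2), (e + 2 * c - 1, g1), (e + 2 * c, g2)}"
  have van: "gid ?V ?H k (\<lambda>x. P x - P (?r x))" if "homp ?V k P" for k P
    by (rule gid_mono[OF gid_vanishing_coords[OF V that, of "{2}"]]) auto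
  have "cert ?V ?H M"
  proof (rule cert_trans[OF M])
    fix a h assume "(a, h) \<in> {(1, \<lambda>x. x 2), (e + 2 * c - 1, G), (e + 2 * c, \<lambda>x. p x * q x)}"
    then consider "a = 1" "h = (\<lambda>x. x 2)" | "a = e + 2 * c - 1" "h = G" | "a = e + 2 * c" "h = (\<lambda>x. p x * q x)" by auto
    then show "gid ?V ?H a h"
    proof cases
      case 1
      then show ?thesis by (intro gid_in) simp
    next
      case 2
      have g: "gid ?V ?H (e + 2 * c - 1) g1" by (rule gid_in) simp
      show ?thesis unfolding 2 by (rule gid_cong[OF gid_diff[OF van[OF hg1] g]]) (simp_all add: g1r[unfolded singleton_iff])
    next
      case 3
      have g: "gid ?V ?H (e + 2 * c) g2" by (rule gid_in) simp
      show ?thesis unfolding 3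
        by (rule gid_cong[OF gid_scale[OF gid_diff[OF g van[OF hg2]], of "1 / of_nat N"]]) (use N in \<open>simp_all add: g2r[unfolded singleton_iff]\<close>)
    qed
  qed
  from pencil_smooth[OF c E e(1) q _ fun_cong[OF g1_def] fun_cong[OF g2_def] this] show ?thesis
    by (simp add: K q_def)
qed

text \<open>Converse of \<open>cert_plane_restrict\<close>: modulo the coordinates from 3 on each
  form equals its restriction to the plane, and the restricted jets of \<open>J\<close> are
  \<open>b\<close> times those of \<open>\<Phi>\<close>.\<close>

lemma cert_plane_lift:
  fixes J :: "(nat \<Rightarrow> 'a::field_char_0) \<Rightarrow> 'a"
  assumes n: "n \<ge> 2" and J: "homp {0..n} e J" and b: "b \<noteq> 0"
    and res: "\<And>x. J (\<lambda>v. if v \<in> {3..n} then 0 else x v) = b * \<Phi> x"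
    and \<Phi>: "homp {0,1,2} e \<Phi>"
    and c: "cert {0,1,2} (jets e \<Phi>) N"
  shows "cert {0..n} (jets e J \<union> {(1, \<lambda>x. x j) | j. j \<in> {3..n}}) N"
proof -
  let ?V = "{0..n}" and ?U = "{0,1,2::nat}" and ?r = "\<lambda>x v. if v \<in> {3..n} then 0 else x v"
  let ?H = "jets e J \<union> {(1, \<lambda>x :: nat \<Rightarrow> 'a. x j) | j. j \<in> {3..n}}"
  have V: "finite ?V" "?V \<noteq> {}" by auto
  have UV: "?U \<subseteq> ?V" using n by auto
  have van: "gid ?V ?H k (\<lambda>x. P x - P (?r x))" if "homp ?V k P" for k P
    by (rule gid_mono[OF gid_vanishing_coords[OF V that, of "{3..n}"]]) auto
  have r1: "gid ?V ?H k (\<lambda>x. P (?r x))" if "homp ?V k P" "gid ?V ?H k P" for k P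
    by (rule gid_cong[OF gid_diff[OF that(2) van[OF that(1)]]]) simp_all
  have gU: "gid ?V H k P" if "gid ?U H k P" for H k and P :: "(nat \<Rightarrow> 'a) \<Rightarrow> 'a"
    using that
  proof induction
    case (gid_zero m) show ?case by (rule gid.gid_zero)
  next
    case (gid_gen a h b c) show ?case by (rule gid.gid_gen[OF gid_gen(1) homp_mono[OF gid_gen(2) UV]])
  next
    case (gid_add m P Q) show ?case by (rule gid.gid_add[OF gid_add.IH])
  qed
  have g0: "gid ?V ?H e \<Phi>"
  proof (rule gid_cong[OF gid_scale[OF r1[OF J], of "1 / b"] _ refl])
    show "gid ?V ?H e J" by (rule gid_in) (simp add: jets_def)
    show "1 / b * J (?r x) = \<Phi> x" for x unfolding res using b by simp
  qed
  have gd: "gid ?V ?H (e - 1) (pd i \<Phi>)" if i: "i \<in> ?U" for i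
  proof (rule gid_cong[OF gid_scale[OF r1[OF homp_pd[OF V J, of i]], of "1 / b"] _ refl])
    show "gid ?V ?H (e - 1) (pd i J)" by (rule gid_in) (use i in \<open>auto simp: jets_def\<close>)
    fix x
    have "pd i J (?r x) = pd i (\<lambda>x. J (?r x)) x"
      by (rule pd_comp_zero[OF V(1) _ _ homp_polyf[OF J], symmetric]) (use i n in auto)
    also have "\<dots> = pd i (\<lambda>x. b * \<Phi> x) x" by (rule pd_cong) (rule res)
    also have "\<dots> = b * pd i \<Phi> x" by (rule pd_scale[OF homp_polyf[OF \<Phi>]])
    finally show "1 / b * pd i J (?r x) = pd i \<Phi> x" using b by simp
  qed
  show ?thesis unfolding cert_def
  proof (intro allI impI)
    fix P :: "(nat \<Rightarrow> 'a) \<Rightarrow> 'a" assume P: "homp ?V N P"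
    have "homp ?U (1 * N) (\<lambda>x. P (\<lambda>v. ?r (\<lambda>v. if v \<le> 2 then x v else 0) v))"
    proof (rule homp_compose[where F = "\<lambda>v x. ?r (\<lambda>v. if v \<le> 2 then x v else 0) v", OF P])
      fix v assume v: "v \<in> ?V"
      show "homp ?U 1 (\<lambda>x :: nat \<Rightarrow> 'a. ?r (\<lambda>v. if v \<le> 2 then x v else 0) v)"
      proof (cases "v \<le> 2")
        case True
        then have "v \<in> ?U" by auto
        from homp_var[OF this] True show ?thesis by simp
      next
        case False
        then show ?thesis using v homp_zero[of ?U 1] by simp
      qed
    qed
    moreover have "P (\<lambda>v. ?r (\<lambda>v. if v \<le> 2 then x v else 0) v) = P (?r x)" for x
      by (rule homp_eval_cong[OF P]) auto
    ultimately have "homp ?U N (\<lambda>x. P (?r x))" by simp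
    then have "gid ?U (jets e \<Phi>) N (\<lambda>x. P (?r x))" using c by (simp add: cert_def)
    from gU[OF this] have "gid ?V ?H N (\<lambda>x. P (?r x))"
    proof (rule gid_trans)
      fix a h assume "(a, h) \<in> jets e \<Phi>"
      then consider "a = e" "h = \<Phi>" | i where "i \<in> ?U" "a = e - 1" "h = pd i \<Phi>" unfolding jets_def by blast
      then show "gid ?V ?H a h" using g0 gd by cases simp_all
    qed
    from gid_add[OF van[OF P] this] show "gid ?V ?H N P" by (rule gid_cong) simp_all
  qed
qed

subsection \<open>A map whose critical locus meets a plane in a smooth curve\<close>

lemma det_mat_3:
  fixes M :: "nat \<Rightarrow> nat \<Rightarrow> 'a::comm_ring_1"
  shows "det (mat 3 3 (\<lambda>(i, j). M i j)) = M 2 0 * (M 0 1 * M 1 2 - M 0 2 * M 1 1)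
    - M 2 1 * (M 0 0 * M 1 2 - M 0 2 * M 1 0) + M 2 2 * (M 0 0 * M 1 1 - M 0 1 * M 1 0)"
proof -
  have d1: "det (mat 1 1 f) = f (0, 0)" for f :: "nat \<times> nat \<Rightarrow> 'a"
    by (subst det_single) auto
  have s2: "{..<2} = {0, 1::nat}" and s3: "{..<3} = {0, 1, 2::nat}" by auto
  have d2: "det (mat 2 2 f) = f (0, 0) * f (1, 1) - f (0, 1) * f (1, 0)" for f :: "nat \<times> nat \<Rightarrow> 'a"
    by (subst laplace_expansion_row[of _ 2 0])
      (auto simp: s2 cofactor_def mat_delete_def d1 One_nat_def[symmetric])
  show ?thesis
    by (subst laplace_expansion_row[of _ 3 2])
      (auto simp: s3 cofactor_def mat_delete_def d2 One_nat_def[symmetric] algebra_simps)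
qed

text \<open>\<open>X\<close>, \<open>Z\<close>, \<open>Y\<close> stand for the \<open>c\<close>-th
  powers of coordinates 0, 1, 2 and \<open>C\<close> for \<open>c\<close>. In the part with
  \<open>M\<close> the terms \<open>X Y\<close> and \<open>Z Y\<close> cancel because
  \<open>1 + b = C^2\<close>; in the remaining quadratic form in \<open>X\<close> and
  \<open>Z\<close> the value \<open>k\<close> arises as the middle coefficient.\<close>

lemma example_det_identity:
  fixes C x0 x1 x2 a0 a1 a2 X Y Z b k :: "'a::comm_ring_1"
  assumes X: "X = x0 * a0" and Z: "Z = x1 * a1" and Y: "Y = x2 * a2" and b: "b = C^2 - 1" and k: "k = C^3 - C^2 + 2"
  shows "(M * Y + P * (s * (C + 1) * (X + Z))) * ((C + 1) * (X + b * Z + Y) * ((C + 1) * (X + b * Z + b * Y))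
      - (C + 1) * (C * x1 * a2) * ((C + 1) * (b * C * x2 * a1)))
    - P * (s * (C + 1) * (C * x0 * a1)) * ((C + 1) * (C * x1 * a0) * ((C + 1) * (X + b * Z + b * Y))
      - (C + 1) * (C * x1 * a2) * ((C + 1) * (C * x2 * a0)))
    + M * (C * x0 * a2) * ((C + 1) * (C * x1 * a0) * ((C + 1) * (b * C * x2 * a1))
      - (C + 1) * (X + b * Z + Y) * ((C + 1) * (C * x2 * a0)))
    = (C + 1)^2 * b * (M * Y * (Y^2 - (X^2 - k * X * Z - b * Z^2)))
    + (C + 1)^3 * s * (P * ((X + Z) * ((X + b * Z + Y) * (X + b * Z + b * Y) - b * C^2 * Z * Y)
      - C^2 * X * Z * (X + b * Z + b * Y) + C^3 * X * Z * Y))" (is "?L = ?R")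
proof -
  let ?A = "X + b * Z"
  have "?L = (C + 1)^2 * ((M * Y + P * s * (C + 1) * (X + Z)) * ((?A + Y) * (?A + b * Y) - b * C^2 * (Z * Y))
     - P * s * (C + 1) * (C^2 * (X * Z) * (?A + b * Y) - C^3 * ((X * Z) * Y))
     + M * (C^3 * b * (X * Z) * Y - C^2 * (X * Y) * (?A + Y)))"
    unfolding X Y Z by (simp add: algebra_simps power2_eq_square power3_eq_cube)
  also have "\<dots> = (C + 1)^2 * ((M * Y * ((?A + Y) * (?A + b * Y) - b * C^2 * (Z * Y)) + M * (C^3 * b * (X * Z) * Y - C^2 * (X * Y) * (?A + Y)))
     + P * s * (C + 1) * ((X + Z) * ((?A + Y) * (?A + b * Y) - b * C^2 * (Z * Y)) - (C^2 * (X * Z) * (?A + b * Y) - C^3 * ((X * Z) * Y))))"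
  proof -
    have "(m + q * w) * T - q * S + r = (m * T + r) + q * (w * T - S)" for m q w T S r :: 'a
      by (simp add: algebra_simps)
    then show ?thesis by (simp only: )
  qed
  also have "M * Y * ((?A + Y) * (?A + b * Y) - b * C^2 * (Z * Y)) + M * (C^3 * b * (X * Z) * Y - C^2 * (X * Y) * (?A + Y))
     = M * (b * (Y * (Y^2 - (X^2 - k * X * Z - b * Z^2))))"
  proof -
    have "Y * ((?A + Y) * (?A + b * Y) - b * C^2 * (Z * Y)) + (C^3 * b * (X * Z) * Y - C^2 * (X * Y) * (?A + Y))
     = b * (Y * (Y^2 - (X^2 - k * X * Z - b * Z^2)))"
      unfolding b k by (simp add: algebra_simps power2_eq_square power3_eq_cube)
    then show ?thesis by (simp only: mult.assoc distrib_left[symmetric])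
  qed
  finally have "?L = (C + 1)^2 * (M * (b * (Y * (Y^2 - (X^2 - k * X * Z - b * Z^2))))
     + P * s * (C + 1) * ((X + Z) * ((?A + Y) * (?A + b * Y) - b * C^2 * (Z * Y)) - (C^2 * (X * Z) * (?A + b * Y) - C^3 * ((X * Z) * Y))))" .
  also have "\<dots> = (C + 1)^2 * b * (M * Y * (Y^2 - (X^2 - k * X * Z - b * Z^2)))
    + (C + 1)^3 * s * (P * ((X + Z) * ((?A + Y) * (?A + b * Y) - b * C^2 * (Z * Y)) - C^2 * (X * Z) * (?A + b * Y) + C^3 * ((X * Z) * Y)))"
  proof -
    have "D^2 * (M * (b * (Y * Q)) + P * s * D * (T - (u - v))) = D^2 * b * (M * Y * Q) + D^3 * s * (P * (T - u + v))" for D Q T u v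
      by (simp add: algebra_simps power2_eq_square power3_eq_cube)
    then show ?thesis .
  qed
  also have "\<dots> = ?R" by (simp only: mult.assoc)
  finally show ?thesis .
qed

lemma prod_list_diag: "A \<in> carrier_mat m m \<Longrightarrow> prod_list (diag_mat A) = (\<Prod>i\<in>{0..<m}. A $$ (i, i))"
  by (simp add: diag_mat_def prod.list_conv_set_nth)

text \<open>Adding multiples of the rows below to the third row clears it right of the third column.\<close>

lemma det_bordered:
  fixes A :: "nat \<Rightarrow> nat \<Rightarrow> 'a::idom" and u :: "nat \<Rightarrow> 'a" and Y :: 'a
  assumes n: "n \<ge> 2" and A1: "\<And>i j. i < 2 \<Longrightarrow> 3 \<le> j \<Longrightarrow> j \<le> n \<Longrightarrow> A i j = 0"
    and A2: "\<And>i j. 2 \<le> i \<Longrightarrow> i \<le> n \<Longrightarrow> 3 \<le> j \<Longrightarrow> j \<le> n \<Longrightarrow> A i j = (if j = i then Y else if j = i + 1 then - u j else 0)"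
  shows "Y ^ (n - 2) * det (mat (n + 1) (n + 1) (\<lambda>(i, j). A i j))
    = Y ^ (n - 2) * det (mat 3 3 (\<lambda>(i, j). if i < 2 then A i j else \<Sum>l\<in>{2..n}. Y ^ (n - l) * (\<Prod>m\<in>{3..l}. u m) * A l j))"
proof -
  \<comment> \<open>The multipliers telescope: in column \<open>j\<close> the entry \<open>Y\<close>
    of row \<open>j\<close> and the entry \<open>- u j\<close> of row \<open>j - 1\<close> cancel
    because \<open>w j * Y = w (j - 1) * u j\<close>.\<close>
  define w where "w l = Y ^ (n - l) * (\<Prod>m\<in>{3..l}. u m)" for l
  \<comment> \<open>The row operation as a matrix of determinant \<open>Y ^ (n - 2)\<close>, which
    is the weight on both sides.\<close>
  define E where "E = mat (n + 1) (n + 1) (\<lambda>(i, j). if i = 2 then (if 2 \<le> j then w j else 0) else if i = j then 1 else 0)"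
  let ?A = "mat (n + 1) (n + 1) (\<lambda>(i, j). A i j)"
  define B where "B i j = (if i < 2 then A i j else \<Sum>l\<in>{2..n}. w l * A l j)" for i j
  define A3 where "A3 = mat (n - 2) 3 (\<lambda>(i, j). A (i + 3) j)"
  define A4 where "A4 = mat (n - 2) (n - 2) (\<lambda>(i, j). A (i + 3) (j + 3))"
  have row: "(\<Sum>l\<in>{2..n}. w l * A l j) = 0" if j: "3 \<le> j" "j \<le> n" for j
  proof -
    have "(\<Sum>l\<in>{2..n}. w l * A l j) = (\<Sum>l\<in>{j - 1, j}. w l * A l j)"
      using j by (intro sum.mono_neutral_right) (auto simp: A2)
    also have "\<dots> = w (j - 1) * A (j - 1) j + w j * A j j" using j by simp
    also have "A (j - 1) j = - u j" using j by (subst A2) auto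
    also have "A j j = Y" using j by (simp add: A2)
    finally have s: "(\<Sum>l\<in>{2..n}. w l * A l j) = w (j - 1) * - u j + w j * Y" .
    have "{3..j} = insert j {3..j - 1}" using j by auto
    then have "(\<Prod>m\<in>{3..j}. u m) = u j * (\<Prod>m\<in>{3..j - 1}. u m)" using j by simp
    moreover have "Y ^ (n - (j - 1)) = Y ^ (n - j) * Y"
    proof -
      have "n - (j - 1) = Suc (n - j)" using j by linarith
      then show ?thesis by simp
    qed
    ultimately have "w j * Y = w (j - 1) * u j" unfolding w_def by (simp add: mult_ac)
    then show ?thesis unfolding s by simp
  qed
  have EA: "E * ?A = four_block_mat (mat 3 3 (\<lambda>(i, j). B i j)) (0\<^sub>m 3 (n - 2)) A3 A4"
  proof (rule eq_matI)
    fix i j assume "i < dim_row (four_block_mat (mat 3 3 (\<lambda>(i, j). B i j)) (0\<^sub>m 3 (n - 2)) A3 A4)"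
      "j < dim_col (four_block_mat (mat 3 3 (\<lambda>(i, j). B i j)) (0\<^sub>m 3 (n - 2)) A3 A4)"
    then have ij: "i < n + 1" "j < n + 1" using n by (auto simp: A3_def A4_def)
    have "(E * ?A) $$ (i, j) = (\<Sum>l\<in>{0..<n + 1}. E $$ (i, l) * A l j)"
      using ij by (simp add: E_def scalar_prod_def)
    also have "\<dots> = (if i = 2 then B 2 j else A i j)"
    proof (cases "i = 2")
      case True
      have "(\<Sum>l\<in>{0..<n + 1}. E $$ (i, l) * A l j) = (\<Sum>l\<in>{2..n}. w l * A l j)"
        using True n by (intro sum.mono_neutral_cong_right) (auto simp: E_def)
      then show ?thesis using True by (simp add: B_def)
    next
      case False
      have "(\<Sum>l\<in>{0..<n + 1}. E $$ (i, l) * A l j) = (\<Sum>l\<in>{0..<n + 1}. if l = i then A i j else 0)"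
        using False ij by (intro sum.cong) (auto simp: E_def)
      then show ?thesis using False ij by simp
    qed
    also have "\<dots> = four_block_mat (mat 3 3 (\<lambda>(i, j). B i j)) (0\<^sub>m 3 (n - 2)) A3 A4 $$ (i, j)"
    proof -
      consider "i < 2" | "i = 2" | "i \<ge> 3" by linarith
      then show ?thesis using ij n row[of j] A1[of i j] by cases (auto simp: A3_def A4_def B_def)
    qed
    finally show "(E * ?A) $$ (i, j) = four_block_mat (mat 3 3 (\<lambda>(i, j). B i j)) (0\<^sub>m 3 (n - 2)) A3 A4 $$ (i, j)" .
  qed (use n in \<open>auto simp: E_def A3_def A4_def\<close>)
  have cE: "E \<in> carrier_mat (n + 1) (n + 1)" by (simp add: E_def)
  have "det E = prod_list (diag_mat E)"
    by (rule det_upper_triangular[OF _ cE]) (auto simp: E_def upper_triangular_def)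
  also have "\<dots> = (\<Prod>i\<in>{0..<n + 1}. if i = 2 then Y ^ (n - 2) else 1)"
    unfolding prod_list_diag[OF cE] by (rule prod.cong) (auto simp: E_def w_def)
  also have "\<dots> = Y ^ (n - 2)" using n by simp
  finally have dE: "det E = Y ^ (n - 2)" .
  have c4: "A4 \<in> carrier_mat (n - 2) (n - 2)" by (simp add: A4_def)
  have "det A4 = prod_list (diag_mat A4)"
    by (rule det_upper_triangular[OF _ c4]) (auto simp: A4_def upper_triangular_def A2)
  also have "\<dots> = Y ^ (n - 2)" unfolding prod_list_diag[OF c4] by (simp add: A4_def A2)
  finally have d4: "det A4 = Y ^ (n - 2)" .
  have "Y ^ (n - 2) * det ?A = det (E * ?A)" using det_mult[OF cE, of ?A] by (simp add: dE)
  also have "\<dots> = det (mat 3 3 (\<lambda>(i, j). B i j)) * det A4"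
    unfolding EA by (rule det_four_block_mat_upper_right_zero[OF _ refl _ c4]) (auto simp: A3_def)
  finally show ?thesis unfolding d4 B_def w_def by (simp add: mult.commute)
qed

text \<open>On the plane \<open>x\<^sub>3 = \<dots> = x\<^sub>n = 0\<close> the map \<open>fx\<close> below has Jacobian determinant
  \<open>x\<^sub>2\<^sup>N K + s E\<close> up to constants, where \<open>K\<close> is \<open>x\<^sub>2\<^bsup>2c\<^esup>\<close> plus a form in \<open>x\<^sub>0, x\<^sub>1\<close> only: the value \<open>b = c\<^sup>2 - 1\<close> cancels the
  mixed terms. The parameters \<open>\<theta>\<close> are chosen so large that \<open>E\<close> and \<open>K\<close> have distinct zeros on \<open>x\<^sub>2 = 0\<close>.\<close>

locale example_map =
  fixes n c :: nat and s :: "'a::field_char_0"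
  assumes n: "n \<ge> 2" and c: "c \<ge> 2"
begin

abbreviation "bn \<equiv> c ^ 2 - 1"
abbreviation "kn \<equiv> c ^ 3 - c ^ 2 + 2"
definition b :: 'a where "b = of_nat bn"
definition k :: 'a where "k = of_nat kn"
definition \<theta> :: "nat \<Rightarrow> 'a" where "\<theta> j = of_nat (kn + bn + j)"

text \<open>Written out with indices as subscripts: f_0 = (c+1) x_1 x_0^c + b x_1^(c+1) + (c+1) x_1
  x_2^c and f_1 = (c+1) x_2 x_0^c + b (c+1) x_2 x_1^c + b x_2^(c+1). For 2 <= i < n, f_i = x_i'
  x_2^c - x_(i+1) (x_0^c - \<theta>_(i+1) x_1^c), where i' = 0 if i = 2 and i' = i otherwise.
  Finally f_n = x_n' x_2^c + s x_0 (x_0^c + (c+1) x_1^c).\<close>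

definition va :: "nat \<Rightarrow> nat \<Rightarrow> nat" where
  "va i l = (if i = 0 then 1 else if i = 1 then 2 else if l = 2 then (if i = 2 then 0 else i)
     else if i < n then i + 1 else 0)"

definition ca :: "nat \<Rightarrow> nat \<Rightarrow> 'a" where
  "ca i l = (if i = 0 then (if l = 1 then b else of_nat c + 1)
     else if i = 1 then (if l = 0 then of_nat c + 1 else if l = 1 then b * (of_nat c + 1) else b)
     else if l = 2 then 1 else if i < n then (if l = 0 then - 1 else \<theta> (i + 1))
     else if l = 0 then s else s * (of_nat c + 1))"

definition fx :: "nat \<Rightarrow> (nat \<Rightarrow> 'a) \<Rightarrow> 'a" where
  "fx i x = (\<Sum>l\<in>{0,1,2}. ca i l * (x (va i l) * x l ^ c))"

lemma b_eq: "b = of_nat c ^ 2 - 1" and k_eq: "k = of_nat c ^ 3 - of_nat c ^ 2 + 2" and b_nz: "b \<noteq> 0"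
proof -
  have 1: "1 \<le> c ^ 2" "c ^ 2 \<le> c ^ 3" using c by (auto intro: power_increasing)
  show "b = of_nat c ^ 2 - 1" unfolding b_def using 1 by (simp add: of_nat_diff)
  show "k = of_nat c ^ 3 - of_nat c ^ 2 + 2" unfolding k_def using 1 by (simp add: of_nat_diff)
  have "2 ^ 2 \<le> c ^ 2" using c by (intro power_mono) auto
  then have "bn \<noteq> 0" by simp
  then show "b \<noteq> 0" unfolding b_def of_nat_eq_0_iff .
qed

lemma homp_fx: "i \<le> n \<Longrightarrow> homp {0..n} (c + 1) (fx i)"
proof -
  assume i: "i \<le> n"
  show ?thesis unfolding fx_def[abs_def]
  proof (rule homp_sum)
    fix l :: nat assume l: "l \<in> {0,1,2}"
    have "va i l \<in> {0..n}" "l \<in> {0..n}" using i l n by (auto simp: va_def)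
    then have "homp {0..n} (1 + c) (\<lambda>x. x (va i l) * x l ^ c :: 'a)" by (intro homp_mult[OF homp_var homp_varpow])
    then show "homp {0..n} (c + 1) (\<lambda>x. ca i l * (x (va i l) * x l ^ c))" by (intro homp_scale) (simp add: add.commute)
  qed auto
qed

lemma pd_fx: "pd j (fx i) x = (\<Sum>l\<in>{0,1,2}. ca i l * ((if va i l = j then 1 else 0) * x l ^ c
    + x (va i l) * (of_nat c * x l ^ (c - 1) * (if l = j then 1 else 0))))"
proof -
  have v: "polyf UNIV (\<lambda>x :: nat \<Rightarrow> 'a. x i)" for i by (rule polyf_var) simp
  have m: "polyf UNIV (\<lambda>x :: nat \<Rightarrow> 'a. x i * x l ^ c)" for i l by (rule polyf_mult[OF v polyf_power[OF v]])
  have "pd j (fx i) x = (\<Sum>l\<in>{0,1,2}. pd j (\<lambda>x. ca i l * (x (va i l) * x l ^ c)) x)"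
    unfolding fx_def[abs_def] by (rule pd_sum[of _ UNIV]) (rule polyf_mult[OF polyf_const m])
  then show ?thesis unfolding pd_scale[OF m] pd_mult[OF v polyf_power[OF v]] pd_power[OF v] pd_var .
qed

definition J where "J = (\<lambda>x. det (mat (n + 1) (n + 1) (\<lambda>(i, j). pd j (fx i) x)))"

text \<open>The cofactor of the \<open>\<theta>\<close>-factors in the second part of the
  determinant. On \<open>x 2 = 0\<close> it becomes \<open>(X + b Z)(X^2 + b Z^2)\<close>, the
  source of the parameters \<open>- b\<close> and plus or minus a square root of
  \<open>- b\<close>.\<close>

definition K2 :: "(nat \<Rightarrow> 'a) \<Rightarrow> 'a" where
  "K2 x = (let X = x 0 ^ c; Z = x 1 ^ c; Y = x 2 ^ c; A = X + b * Z in
     (X + Z) * ((A + Y) * (A + b * Y) - b * of_nat c ^ 2 * Z * Y)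
     - of_nat c ^ 2 * X * Z * (A + b * Y) + of_nat c ^ 3 * X * Z * Y)"

definition K :: "(nat \<Rightarrow> 'a) \<Rightarrow> 'a" where
  "K x = x 2 ^ (2 * c) - ((x 0 ^ c) ^ 2 - k * x 0 ^ c * x 1 ^ c - b * (x 1 ^ c) ^ 2)"

text \<open>\<open>det_bordered\<close> gives the determinant only up to a power of
  \<open>x 2 ^ c\<close>, which \<open>J_plane\<close> cancels afterwards.\<close>

lemma J_plane_weighted:
  assumes x: "\<And>v. v \<in> {3..n} \<Longrightarrow> x v = 0"
  shows "(x 2 ^ c) ^ (n - 2) * J x = (x 2 ^ c) ^ (n - 2) *
    ((of_nat c + 1) ^ 2 * b * (x 2 ^ (c * (n - 1)) * K x) + (of_nat c + 1) ^ 3 * s * ((\<Prod>j\<in>{3..n}. lam c (\<theta> j) x) * K2 x))"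
proof -
  let ?A = "\<lambda>i j. pd j (fx i) x" and ?Y = "x 2 ^ c" and ?u = "\<lambda>j. lam c (\<theta> j) x"
  have e1: "?Y ^ (n - 2) * J x = ?Y ^ (n - 2) * det (mat 3 3 (\<lambda>(i, j). if i < 2 then ?A i j else \<Sum>l\<in>{2..n}. ?Y ^ (n - l) * (\<Prod>m\<in>{3..l}. ?u m) * ?A l j))"
    unfolding J_def
  proof (rule det_bordered[OF n])
    show "?A i j = 0" if "i < 2" "3 \<le> j" "j \<le> n" for i j
      unfolding pd_fx using that by (auto simp: va_def)
    show "?A i j = (if j = i then ?Y else if j = i + 1 then - ?u j else 0)" if "2 \<le> i" "i \<le> n" "3 \<le> j" "j \<le> n" for i j
      unfolding pd_fx using that by (auto simp: va_def ca_def lam_def)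
  qed
  define a0 where "a0 = x 0 ^ (c - 1)"
  define a1 where "a1 = x 1 ^ (c - 1)"
  define a2 where "a2 = x 2 ^ (c - 1)"
  have pw: "y ^ c = y * y ^ (c - 1)" for y :: 'a using c by (cases c) auto
  have X: "x 0 ^ c = x 0 * a0" "x 1 ^ c = x 1 * a1" "x 2 ^ c = x 2 * a2" unfolding a0_def a1_def a2_def by (rule pw)+
  define C where "C = (of_nat c :: 'a)"
  \<comment> \<open>On the plane, among the rows from 2 on, only rows 2 and \<open>n\<close> have
    nonzero entries in the first three columns: \<open>y\<close> comes from the term
    \<open>x 0 * x 2 ^ c\<close> of row 2, \<open>q\<close> from the terms with \<open>s\<close> in
    row \<open>n\<close>.\<close>
  define q where "q j = (if j = 0 then x 0 ^ c + x 1 ^ c else if j = 1 then C * x 0 * a1 else (0::'a))" for j :: nat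
  define y where "y j = (if j = 0 then x 2 ^ c else if j = 1 then 0 else C * x 0 * a2)" for j :: nat
  have row2: "(\<Sum>l\<in>{2..n}. ?Y ^ (n - l) * (\<Prod>m\<in>{3..l}. ?u m) * ?A l j) = ?Y ^ (n - 2) * y j + (\<Prod>m\<in>{3..n}. ?u m) * (s * (C + 1) * q j)"
    if j: "j < 3" for j
  proof -
    have Al: "?A l j = (if l = 2 then y j else 0) + (if l = n then s * (C + 1) * q j else 0)" if l: "l \<in> {2..n}" for l
    proof -
      have j': "j = 0 \<or> j = 1 \<or> j = 2" using j by linarith
      show ?thesis unfolding pd_fx using l x[of l] x[of "l + 1"] j'
        by (auto simp: va_def ca_def y_def q_def a0_def[symmetric] a1_def[symmetric] a2_def[symmetric] C_def X algebra_simps)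
    qed
    have "(\<Sum>l\<in>{2..n}. ?Y ^ (n - l) * (\<Prod>m\<in>{3..l}. ?u m) * ?A l j)
      = (\<Sum>l\<in>{2..n}. (if l = 2 then ?Y ^ (n - 2) * y j else 0) + (if l = n then (\<Prod>m\<in>{3..n}. ?u m) * (s * (C + 1) * q j) else 0))"
      by (intro sum.cong refl) (simp add: Al distrib_left)
    then show ?thesis using n by (simp add: sum.distrib)
  qed
  have r0: "?A 0 0 = (C + 1) * (C * x 1 * a0)" "?A 0 1 = (C + 1) * (x 0 * a0 + b * (x 1 * a1) + x 2 * a2)" "?A 0 2 = (C + 1) * (C * x 1 * a2)"
    unfolding pd_fx by (auto simp: va_def ca_def X a0_def[symmetric] a1_def[symmetric] a2_def[symmetric] C_def[symmetric] algebra_simps)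
  have r1: "?A 1 0 = (C + 1) * (C * x 2 * a0)" "?A 1 1 = (C + 1) * (b * C * x 2 * a1)" "?A 1 2 = (C + 1) * (x 0 * a0 + b * (x 1 * a1) + b * (x 2 * a2))"
    unfolding pd_fx by (auto simp: va_def ca_def X a0_def[symmetric] a1_def[symmetric] a2_def[symmetric] C_def[symmetric] algebra_simps)
  define P where "P = (\<Prod>m\<in>{3..n}. ?u m)"
  define Yn where "Yn = ?Y ^ (n - 2)"
  have KY: "?Y ^ (n - 2) * ?Y = x 2 ^ (c * (n - 1))"
    using n by (simp add: power_mult power_Suc2[symmetric] Suc_diff_Suc numeral_2_eq_2 One_nat_def del: power_Suc)
  have Y2: "x 2 ^ (2 * c) = (x 2 * a2) ^ 2" unfolding X(3)[symmetric] by (simp add: power_mult[symmetric] mult.commute)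
  have bC: "b = C ^ 2 - 1" "k = C ^ 3 - C ^ 2 + 2" using b_eq k_eq by (simp_all add: C_def)
  have "det (mat 3 3 (\<lambda>(i, j). if i < 2 then ?A i j else \<Sum>l\<in>{2..n}. ?Y ^ (n - l) * (\<Prod>m\<in>{3..l}. ?u m) * ?A l j))
     = (C + 1) ^ 2 * b * (Yn * (x 2 * a2) * K x) + (C + 1) ^ 3 * s * (P * K2 x)"
  proof -
    have s0: "(\<Sum>l\<in>{2..n}. ?Y ^ (n - l) * (\<Prod>m\<in>{3..l}. ?u m) * ?A l 0) = Yn * (x 2 * a2) + P * (s * (C + 1) * (x 0 * a0 + x 1 * a1))"
      using row2[of 0] by (simp add: q_def y_def Yn_def P_def X)
    have s1: "(\<Sum>l\<in>{2..n}. ?Y ^ (n - l) * (\<Prod>m\<in>{3..l}. ?u m) * ?A l 1) = P * (s * (C + 1) * (C * x 0 * a1))"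
      using row2[of 1] by (simp add: q_def y_def P_def)
    have s2: "(\<Sum>l\<in>{2..n}. ?Y ^ (n - l) * (\<Prod>m\<in>{3..l}. ?u m) * ?A l 2) = Yn * (C * x 0 * a2)"
      using row2[of 2] by (simp add: q_def y_def Yn_def)
    have "det (mat 3 3 (\<lambda>(i, j). if i < 2 then ?A i j else \<Sum>l\<in>{2..n}. ?Y ^ (n - l) * (\<Prod>m\<in>{3..l}. ?u m) * ?A l j))
     = (Yn * (x 2 * a2) + P * (s * (C + 1) * (x 0 * a0 + x 1 * a1))) * (?A 0 1 * ?A 1 2 - ?A 0 2 * ?A 1 1)
      - P * (s * (C + 1) * (C * x 0 * a1)) * (?A 0 0 * ?A 1 2 - ?A 0 2 * ?A 1 0)
      + Yn * (C * x 0 * a2) * (?A 0 0 * ?A 1 1 - ?A 0 1 * ?A 1 0)"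
    proof -
      define B where "B i j = (if i < 2 then ?A i j else \<Sum>l\<in>{2..n}. ?Y ^ (n - l) * (\<Prod>m\<in>{3..l}. ?u m) * ?A l j)" for i j
      have B: "B 0 j = ?A 0 j" "B 1 j = ?A 1 j" "B 2 j = (\<Sum>l\<in>{2..n}. ?Y ^ (n - l) * (\<Prod>m\<in>{3..l}. ?u m) * ?A l j)" for j
        by (simp_all add: B_def)
      show ?thesis using det_mat_3[of B] unfolding B s0 s1 s2 unfolding B_def .
    qed
    also have "\<dots> = (C + 1) ^ 2 * b * (Yn * (x 2 * a2) * K x) + (C + 1) ^ 3 * s * (P * K2 x)"
      unfolding r0 r1 K_def K2_def Let_def C_def[symmetric] Y2 X
      by (rule example_det_identity[OF refl refl refl bC])
    finally show ?thesis .
  qed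
  then show ?thesis unfolding e1 P_def KY[symmetric] Yn_def X(3)[symmetric] C_def by simp
qed

lemma homp_J: "homp {0..n} ((n + 1) * c) J"
  unfolding J_def
proof (rule homp_det)
  fix i j assume "i < n + 1" "j < n + 1"
  then have "homp {0..n} (c + 1 - 1) (pd j (fx i))" by (intro homp_pd homp_fx) auto
  then show "homp {0..n} c (pd j (fx i))" by simp
qed auto

lemma J_plane:
  "J (\<lambda>v. if v \<in> {3..n} then 0 else x v)
    = (of_nat c + 1) ^ 2 * b * (x 2 ^ (c * (n - 1)) * K x) + (of_nat c + 1) ^ 3 * s * ((\<Prod>j\<in>{3..n}. lam c (\<theta> j) x) * K2 x)"
proof -
  let ?V = "{0..n}" and ?r = "\<lambda>(x :: nat \<Rightarrow> 'a) v. if v \<in> {3..n} then 0 else x v"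
  let ?R = "\<lambda>x. (of_nat c + 1) ^ 2 * b * (x 2 ^ (c * (n - 1)) * K x) + (of_nat c + 1) ^ 3 * s * ((\<Prod>j\<in>{3..n}. lam c (\<theta> j) x) * K2 x)"
  have p2: "polyf ?V (\<lambda>x :: nat \<Rightarrow> 'a. x v ^ m)" if "v \<in> {0,1,2}" for v m
    by (rule homp_polyf[OF homp_varpow]) (use that n in auto)
  have pK: "polyf ?V K" unfolding K_def[abs_def] by (intro polyf_diff polyf_mult polyf_const p2 polyf_power) auto
  have pK2: "polyf ?V K2" unfolding K2_def[abs_def] Let_def
    by (intro polyf_diff polyf_add polyf_mult polyf_const p2) auto
  have pl: "polyf ?V (\<lambda>x. \<Prod>j\<in>{3..n}. lam c (\<theta> j) x)"
    by (rule polyf_prod) (rule homp_polyf[OF homp_lam], use n in auto)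
  show ?thesis
  proof (rule polyf_cancel[where P = "\<lambda>x. (x 2 ^ c) ^ (n - 2)" and V = ?V and Q = "\<lambda>x. J (?r x)" and R = ?R])
    show "polyf ?V (\<lambda>x :: nat \<Rightarrow> 'a. (x 2 ^ c) ^ (n - 2))" by (rule polyf_power[OF p2]) simp
    show "polyf ?V (\<lambda>x. J (?r x))" by (rule homp_polyf[OF homp_comp_zero[OF _ _ homp_J]]) auto
    show "polyf ?V ?R"
      by (rule polyf_add[OF polyf_mult[OF polyf_const polyf_mult[OF p2 pK]] polyf_mult[OF polyf_const polyf_mult[OF pl pK2]]]) simp
    show "((\<lambda>_. 1 :: 'a) 2 ^ c) ^ (n - 2) \<noteq> 0" by simp
    fix x :: "nat \<Rightarrow> 'a"
    have r: "?r x 2 = x 2" "lam c t (?r x) = lam c t x" "K (?r x) = K x" "K2 (?r x) = K2 x" for t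
      by (simp_all add: lam_def K_def K2_def)
    from J_plane_weighted[of "?r x"] show "(x 2 ^ c) ^ (n - 2) * J (?r x) = (x 2 ^ c) ^ (n - 2) * ?R x"
      unfolding r by simp
  qed
qed

end

section \<open>Distinct roots on the line \<open>x 2 = 0\<close>\<close>

context example_map
begin

text \<open>Indices up to \<open>n\<close> list the parameters of the factors of \<open>E\<close> on
  \<open>x 2 = 0\<close>, the last two those of \<open>K\<close>. The intended \<open>r\<close> is a
  square root of \<open>- b\<close>, and \<open>t1\<close>, \<open>k - t1\<close> are the zeros of
  \<open>q^2 - k q - b\<close>.\<close>

definition root :: "'a \<Rightarrow> 'a \<Rightarrow> nat \<Rightarrow> 'a" where
  "root r t1 j = (if j = 0 then - b else if j = 1 then r else if j = 2 then - r
     else if j \<le> n then \<theta> j else if j = n + 1 then t1 else k - t1)"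

lemma bn_pos: "bn > 0"
proof -
  have "2 ^ 2 \<le> c ^ 2" using c by (intro power_mono) auto
  then show ?thesis by simp
qed

lemma discriminant_nz: "k ^ 2 + 4 * b \<noteq> 0"
proof
  assume "k ^ 2 + 4 * b = 0"
  then have "of_nat (kn ^ 2 + 4 * bn) = (0::'a)" unfolding k_def b_def
    by (simp only: of_nat_add of_nat_mult of_nat_power of_nat_numeral)
  then have "kn ^ 2 + 4 * bn = 0" unfolding of_nat_eq_0_iff .
  then show False by simp
qed

text \<open>All constants are images of natural numbers, so in characteristic zero a coincidence
  becomes a false equation between naturals; the case \<open>q^2 = - b\<close> passes through the
  discriminant. For \<open>\<theta> j\<close>, which is \<open>k + b + j\<close>, the product of
  \<open>\<theta> j\<close> and \<open>\<theta> j - k\<close> exceeds \<open>b\<close>.\<close>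

lemma quadratic_roots_avoid:
  assumes q: "q ^ 2 - k * q - b = 0"
  shows "q ^ 2 \<noteq> - b" "q \<noteq> - b" "q \<noteq> \<theta> j"
proof -
  show "q ^ 2 \<noteq> - b"
  proof
    assume h: "q ^ 2 = - b"
    have "k * q = q ^ 2 - b" using q by (simp add: eq_diff_eq diff_eq_eq add.commute)
    then have "(k * q) ^ 2 = (q ^ 2 - b) ^ 2" by simp
    then have "b * (k ^ 2 + 4 * b) = 0" unfolding power_mult_distrib h
      by (simp add: power2_eq_square algebra_simps eq_neg_iff_add_eq_0 neg_eq_iff_add_eq_0)
    then show False using b_nz discriminant_nz by simp
  qed
  show "q \<noteq> - b"
  proof
    assume h: "q = - b"
    have "b * (b + k - 1) = 0" using q unfolding h by (simp add: power2_eq_square algebra_simps)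
    then have "b + k = 1" using b_nz by simp
    then have "of_nat (bn + kn) = (of_nat 1::'a)" unfolding k_def b_def by (simp only: of_nat_add of_nat_1)
    then have "bn + kn = 1" unfolding of_nat_eq_iff .
    then show False by simp
  qed
  show "q \<noteq> \<theta> j"
  proof
    assume h: "q = \<theta> j"
    have "\<theta> j - k = b + of_nat j" unfolding \<theta>_def k_def b_def by (simp only: of_nat_add) simp
    then have m: "b + of_nat j = q - k" using h by simp
    have "q * (b + of_nat j) = b" using q unfolding m by (simp add: power2_eq_square algebra_simps)
    then have "of_nat ((kn + bn + j) * (bn + j)) = (of_nat bn :: 'a)" unfolding h \<theta>_def b_def by (simp only: of_nat_add of_nat_mult)
    then have e: "(kn + bn + j) * (bn + j) = bn" unfolding of_nat_eq_iff .
    have "2 * (bn + j) \<le> (kn + bn + j) * (bn + j)" by (rule mult_le_mono1) simp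
    then have "2 * (bn + j) \<le> bn" unfolding e .
    moreover have "\<not> 2 * (B + j) \<le> B" if "0 < B" for B :: nat using that by presburger
    ultimately show False using bn_pos by blast
  qed
qed

lemma theta_avoid: "\<theta> j \<noteq> - b" "(\<theta> j) ^ 2 \<noteq> - b" "\<theta> j \<noteq> 0"
proof -
  show "\<theta> j \<noteq> 0" unfolding \<theta>_def of_nat_eq_0_iff by simp
  have "of_nat (kn + bn + j + bn) \<noteq> (0::'a)" "of_nat ((kn + bn + j) ^ 2 + bn) \<noteq> (0::'a)"
    unfolding of_nat_eq_0_iff using bn_pos by simp_all
  then show "\<theta> j \<noteq> - b" "(\<theta> j) ^ 2 \<noteq> - b"
    unfolding \<theta>_def b_def eq_neg_iff_add_eq_0 of_nat_add of_nat_power by simp_all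
qed

lemma minus_b_square: "(- b) ^ 2 \<noteq> - b"
proof
  assume "(- b) ^ 2 = - b"
  then have "b * (b + 1) = 0" by (simp add: power2_eq_square algebra_simps eq_neg_iff_add_eq_0 neg_eq_iff_add_eq_0)
  then have "b + 1 = 0" using b_nz by simp
  then have "of_nat (bn + 1) = (0::'a)" unfolding b_def by (simp only: of_nat_add of_nat_1)
  then show False unfolding of_nat_eq_0_iff by simp
qed

text \<open>The quadratic \<open>q^2 - k q - b\<close> separates \<open>?B\<close> from
  \<open>?A\<close>; within \<open>?A\<close>, the values \<open>r\<close> and \<open>- r\<close>
  differ from the rest by their square.\<close>

lemma roots_distinct:
  assumes r: "r ^ 2 = - b" and t1: "t1 ^ 2 = k * t1 + b"
  shows "inj_on (root r t1) ({0..n} \<union> {n + 1, n + 2})" "l \<in> {0..n} \<union> {n + 1, n + 2} \<Longrightarrow> root r t1 l \<noteq> 0"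
proof -
  let ?A = "{0..n}" and ?B = "{n + 1, n + 2}"
  define t where "t = root r t1"
  note t_def = t_def[unfolded root_def[abs_def]]
  note q1 = quadratic_roots_avoid and th = theta_avoid and bb = minus_b_square
  have rnz: "r \<noteq> 0" using r b_nz by auto
  have qt: "t1 ^ 2 - k * t1 - b = 0" "(k - t1) ^ 2 - k * (k - t1) - b = 0"
    using t1 by (simp_all add: power2_eq_square algebra_simps)
  have t12: "t1 \<noteq> k - t1"
  proof
    assume "t1 = k - t1"
    then have h: "k = 2 * t1" by (simp add: algebra_simps)
    have "b = t1 ^ 2 - k * t1" using t1 by simp
    then have "k ^ 2 + 4 * b = 0" unfolding h by (simp add: power2_eq_square algebra_simps)
    then show False using discriminant_nz by simp
  qed
  have sqr: "t j ^ 2 = - b" if "j = 1 \<or> j = 2" for j using that r by (auto simp: t_def)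
  have t0: "t 0 = - b" and tth: "3 \<le> j \<Longrightarrow> j \<le> n \<Longrightarrow> t j = \<theta> j" for j by (simp_all add: t_def)
  have tA: "t j ^ 2 - k * t j - b \<noteq> 0" if j: "j \<in> ?A" for j
  proof -
    have "j \<le> n" using j by simp
    moreover consider "j = 0" | "j = 1 \<or> j = 2" | "3 \<le> j" by linarith
    ultimately consider "j = 0" | "j = 1 \<or> j = 2" | "3 \<le> j" "j \<le> n" by metis
    then show ?thesis using q1[of "t j"] sqr t0 tth by cases metis+
  qed
  have tB: "t j ^ 2 - k * t j - b = 0" if "j \<in> ?B" for j using that qt n by (auto simp: t_def)
  have inj: "inj_on t (?A \<union> ?B)"
  proof (rule linorder_inj_onI')
    fix i j assume i: "i \<in> ?A \<union> ?B" and j: "j \<in> ?A \<union> ?B" and ij: "i < j"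
    show "t i \<noteq> t j"
    proof (cases "j \<in> ?B")
      case True
      show ?thesis
      proof (cases "i \<in> ?B")
        case False
        then have "i \<in> ?A" using i by blast
        then show ?thesis using tA tB[OF True] by metis
      next
        case i': True
        then have "i = n + 1" "j = n + 2" using True ij by auto
        then show ?thesis using t12 n by (simp add: t_def)
      qed
    next
      case False
      then have jA: "j \<in> ?A" using j by blast
      consider "i = 0" "j = 1 \<or> j = 2" | "i = 0" "3 \<le> j" "j \<le> n" | "i = 1" "j = 2" | "i = 1 \<or> i = 2" "3 \<le> j" "j \<le> n" | "3 \<le> i" "3 \<le> j" "i \<le> n" "j \<le> n"
      proof -
        have "j \<le> n" using jA by simp
        then have "(i = 0 \<and> (j = 1 \<or> j = 2)) \<or> (i = 0 \<and> 3 \<le> j \<and> j \<le> n) \<or> (i = 1 \<and> j = 2)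
          \<or> ((i = 1 \<or> i = 2) \<and> 3 \<le> j \<and> j \<le> n) \<or> (3 \<le> i \<and> 3 \<le> j \<and> i \<le> n \<and> j \<le> n)"
          using ij by presburger
        then show ?thesis using that by blast
      qed
      then show ?thesis
      proof cases
        case 1 then show ?thesis using sqr[of j] bb t0 by metis
      next
        case 2 then show ?thesis using th(1)[of j] t0 tth by metis
      next
        case 3 then show ?thesis using rnz by (simp add: t_def)
      next
        case 4 then show ?thesis using sqr[of i] th(2)[of j] tth by metis
      next
        case 5 then show ?thesis using ij unfolding tth[OF 5(1,3)] tth[OF 5(2,4)] \<theta>_def of_nat_eq_iff by simp
      qed
    qed
  qed
  have tnz: "t l \<noteq> 0" if l: "l \<in> ?A \<union> ?B" for l
  proof -
    consider "l = 0" | "l = 1 \<or> l = 2" | "3 \<le> l" "l \<le> n" | "l \<in> ?B"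
    proof (cases "l \<in> ?B")
      case False
      then have "l \<le> n" using l by auto
      moreover consider "l = 0" | "l = 1 \<or> l = 2" | "3 \<le> l" by linarith
      ultimately show ?thesis using that by metis
    qed (use that in blast)
    then show ?thesis
    proof cases
      case 1 then show ?thesis using t0 b_nz by simp
    next
      case 2 then show ?thesis using sqr[of l] b_nz by auto
    next
      case 3 then show ?thesis using tth th(3) by simp
    next
      case 4 then show ?thesis using tB[OF 4] b_nz by auto
    qed
  qed
  from inj tnz show "inj_on (root r t1) (?A \<union> ?B)" "l \<in> ?A \<union> ?B \<Longrightarrow> root r t1 l \<noteq> 0"
    unfolding root_def[abs_def] t_def by simp_all
qed

end

text \<open>The condition on \<open>f 0\<close> at \<open>unitv 1\<close> supplies a parameter form
  that is nonzero at this witness; it later equalises parameter degrees.\<close>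

lemma smooth_critical_section_exists:
  fixes n c :: nat
  assumes ac: "alg_closed TYPE('a::field_char_0)" and n: "n \<ge> 2" and c: "c \<ge> 2"
  shows "\<exists>(f :: nat \<Rightarrow> (nat \<Rightarrow> 'a) \<Rightarrow> 'a) N. (\<forall>i\<le>n. homp {0..n} (c + 1) (f i)) \<and> f 0 (unitv 1) \<noteq> 0 \<and>
    cert {0..n} (jets ((n + 1) * c) (\<lambda>x. det (mat (n + 1) (n + 1) (\<lambda>(i, j). pd j (f i) x)))
      \<union> {(1, \<lambda>x. x j) | j. j \<in> {3..n}}) N"
proof -
  \<comment> \<open>\<open>b\<close>, \<open>k\<close>, \<open>\<theta>\<close>, \<open>K\<close>
    and \<open>K2\<close> do not involve \<open>s\<close>, so they are obtained with
    \<open>s = 0\<close> before the pencil parameter is known.\<close>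
  interpret z: example_map n c "0 :: 'a" by unfold_locales (rule n, rule c)
  let ?b = "z.b" and ?k = "z.k"
  have "degree [:?b, 0, 1:] \<ge> 1" "degree [:- ?b, - ?k, 1:] \<ge> 1" by (auto simp: One_nat_def)
  then obtain r t1 where "poly [:?b, 0, 1:] r = 0" "poly [:- ?b, - ?k, 1:] t1 = 0"
    using ac unfolding alg_closed_def by meson
  then have r: "r ^ 2 = - ?b" and t1: "t1 ^ 2 = ?k * t1 + ?b"
    by (simp_all add: power2_eq_square algebra_simps eq_neg_iff_add_eq_0)
  define t where "t = z.root r t1"
  let ?A = "{0..n}" and ?B = "{n + 1, n + 2}"
  have inj: "inj_on t (?A \<union> ?B)" and tnz: "l \<in> ?A \<union> ?B \<Longrightarrow> t l \<noteq> 0" for l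
    unfolding t_def by (rule z.roots_distinct[OF r t1]; assumption?)+
  note t_def = t_def[unfolded z.root_def[abs_def]]
  have tth: "3 \<le> j \<Longrightarrow> j \<le> n \<Longrightarrow> t j = z.\<theta> j" for j by (simp add: t_def)
  define E where "E = (\<lambda>x. (\<Prod>j\<in>{3..n}. lam c (z.\<theta> j) x) * z.K2 x)"
  let ?V = "{0,1,2::nat}"
  have hX: "homp ?V c (\<lambda>x :: nat \<Rightarrow> 'a. x v ^ c)" if "v \<in> ?V" for v by (rule homp_varpow[OF that])
  have hK2: "homp ?V (c + (c + c)) z.K2"
  proof -
    have X: "homp ?V c (\<lambda>x :: nat \<Rightarrow> 'a. x 0 ^ c)" and Z: "homp ?V c (\<lambda>x :: nat \<Rightarrow> 'a. x 1 ^ c)" and Y: "homp ?V c (\<lambda>x :: nat \<Rightarrow> 'a. x 2 ^ c)"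
      by (rule hX; simp)+
    note A = homp_add[OF X homp_scale[OF Z, of ?b]]
    note AY = homp_add[OF A Y] and AbY = homp_add[OF A homp_scale[OF Y, of ?b]]
    have "homp ?V (c + c + c) (\<lambda>x :: nat \<Rightarrow> 'a. of_nat c ^ 2 * x 0 ^ c * x 1 ^ c * (x 0 ^ c + ?b * x 1 ^ c + ?b * x 2 ^ c))"
      "homp ?V (c + c + c) (\<lambda>x :: nat \<Rightarrow> 'a. of_nat c ^ 3 * x 0 ^ c * x 1 ^ c * x 2 ^ c)"
      by (rule homp_mult[OF homp_mult[OF homp_scale[OF X] Z] AbY], rule homp_mult[OF homp_mult[OF homp_scale[OF X] Z] Y])
    then show ?thesis unfolding z.K2_def[abs_def] Let_def
      by (intro homp_add[OF homp_diff[OF homp_mult[OF homp_add[OF X Z] homp_diff[OF homp_mult[OF AY AbY] homp_mult[OF homp_scale[OF Z] Y]]]]])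
        (simp_all add: add.assoc)
  qed
  have hE: "homp ?V ((n + 1) * c) E"
  proof -
    have "homp ?V (c * card {3..n} + (c + (c + c))) E" unfolding E_def
      by (rule homp_mult[OF homp_lam_prod hK2]) auto
    moreover have "c * card {3..n} + (c + (c + c)) = (n + 1) * c"
    proof -
      obtain m where "n = m + 2" using n by (metis le_add_diff_inverse2)
      then show ?thesis by (simp add: algebra_simps)
    qed
    ultimately show ?thesis by simp
  qed
  have E0: "E x = (\<Prod>l\<in>?A. lam c (t l) x)" if x: "x 2 = 0" for x
  proof -
    let ?X = "x 0 ^ c" and ?Z = "x 1 ^ c"
    have "?A = insert 0 (insert 1 (insert 2 {3..n}))" using n by auto
    then have "(\<Prod>l\<in>?A. lam c (t l) x) = lam c (t 0) x * (lam c (t 1) x * (lam c (t 2) x * (\<Prod>l\<in>{3..n}. lam c (t l) x)))"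
      by simp
    also have "(\<Prod>l\<in>{3..n}. lam c (t l) x) = (\<Prod>j\<in>{3..n}. lam c (z.\<theta> j) x)"
      by (rule prod.cong) (auto simp: tth)
    also have "lam c (t 0) x * (lam c (t 1) x * (lam c (t 2) x * (\<Prod>j\<in>{3..n}. lam c (z.\<theta> j) x)))
      = (\<Prod>j\<in>{3..n}. lam c (z.\<theta> j) x) * ((?X + ?b * ?Z) * (?X ^ 2 - r ^ 2 * ?Z ^ 2))"
      by (simp add: t_def lam_def power2_eq_square algebra_simps)
    also have "(?X + ?b * ?Z) * (?X ^ 2 - r ^ 2 * ?Z ^ 2) = z.K2 x"
    proof -
      have "x 2 ^ c = 0" using x c by simp
      then have "z.K2 x = (?X + ?Z) * ((?X + ?b * ?Z) * (?X + ?b * ?Z)) - of_nat c ^ 2 * ?X * ?Z * (?X + ?b * ?Z)"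
        unfolding z.K2_def Let_def by (simp only: mult_zero_right add_0_right diff_0_right)
      also have "\<dots> = (?X + ?b * ?Z) * (?X ^ 2 + ?b * ?Z ^ 2)" unfolding z.b_eq
        by (simp add: power2_eq_square algebra_simps)
      finally show ?thesis unfolding r by simp
    qed
    finally show ?thesis by (simp add: E_def)
  qed
  have K: "z.K x = x 2 ^ (2 * c) - (\<Prod>l\<in>?B. lam c (t l) x)" for x
  proof -
    have "(\<Prod>l\<in>?B. lam c (t l) x) = lam c t1 x * lam c (?k - t1) x" using n by (simp add: t_def)
    also have "\<dots> = (x 0 ^ c) ^ 2 - ?k * x 0 ^ c * x 1 ^ c + (?k * t1 - t1 ^ 2) * (x 1 ^ c) ^ 2"
      by (simp add: lam_def power2_eq_square algebra_simps)
    finally show ?thesis unfolding t1 z.K_def by simp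
  qed
  have "\<exists>s m. s \<noteq> 0 \<and> cert ?V (jets ((n + 1) * c) (\<lambda>x. x 2 ^ (c * (n - 1)) * z.K x + s * E x)) m"
  proof (rule pencil_smooth_distinct[where A = ?A and B = ?B and t = t and c = c, OF _ _ _ _ inj tnz _ _ _ hE _ _ E0 K])
    show "1 \<le> c * (n - 1)" using mult_le_mono[of 1 c 1 "n - 1"] c n by simp
    show "(n + 1) * c = c * (n - 1) + 2 * c"
    proof -
      obtain m where "n = m + 1" using n by (metis add.commute le_add_diff_inverse one_le_numeral order_trans)
      then show ?thesis by (simp add: algebra_simps)
    qed
  qed (use c n in \<open>auto simp: mult.commute distrib_left\<close>)
  then obtain s0 m where s0: "s0 \<noteq> 0" and m: "cert ?V (jets ((n + 1) * c) (\<lambda>x. x 2 ^ (c * (n - 1)) * z.K x + s0 * E x)) m" by blast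
  have c1: "of_nat c + 1 \<noteq> (0::'a)" using of_nat_neq_0[of c, where 'a = 'a] by (simp add: add.commute)
  \<comment> \<open>This \<open>s\<close> turns the factor \<open>(c + 1)^3 s\<close> of the second
    summand of the determinant into \<open>s0\<close> times the factor of the first.\<close>
  interpret y: example_map n c "s0 * ?b / (of_nat c + 1)" by unfold_locales (rule n, rule c)
  have "cert {0..n} (jets ((n + 1) * c) y.J \<union> {(1, \<lambda>x. x j) | j. j \<in> {3..n}}) m"
  proof (rule cert_plane_lift[OF n y.homp_J _ _ _ m])
    show "(of_nat c + 1) ^ 2 * ?b \<noteq> 0" using c1 z.b_nz by simp
    show "y.J (\<lambda>v. if v \<in> {3..n} then 0 else x v) = (of_nat c + 1) ^ 2 * ?b * (x 2 ^ (c * (n - 1)) * z.K x + s0 * E x)" for x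
    proof -
      have "(of_nat c + 1) ^ 3 * (s0 * ?b / (of_nat c + 1)) = (of_nat c + 1) ^ 2 * ?b * s0"
        using c1 by (simp add: power3_eq_cube power2_eq_square)
      then show ?thesis unfolding y.J_plane E_def by (simp add: distrib_left mult.assoc)
    qed
    have hK: "homp ?V (2 * c) z.K"
    proof -
      have "homp ?V (c * card ?B) (\<lambda>x. \<Prod>l\<in>?B. lam c (t l) x)" by (rule homp_lam_prod) auto
      then have "homp ?V (2 * c) (\<lambda>x. \<Prod>l\<in>?B. lam c (t l) x)" by (rule homp_cong_deg) simp
      then show ?thesis unfolding K[abs_def] by (intro homp_diff[OF homp_varpow]) auto
    qed
    have "homp ?V (c * (n - 1) + 2 * c) (\<lambda>x :: nat \<Rightarrow> 'a. x 2 ^ (c * (n - 1)) * z.K x)"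
      by (rule homp_mult[OF homp_varpow hK]) simp
    moreover have "c * (n - 1) + 2 * c = (n + 1) * c"
    proof -
      obtain m where "n = m + 1" using n by (metis add.commute le_add_diff_inverse one_le_numeral order_trans)
      then show ?thesis by (simp add: algebra_simps)
    qed
    ultimately show "homp ?V ((n + 1) * c) (\<lambda>x. x 2 ^ (c * (n - 1)) * z.K x + s0 * E x)"
      using homp_add[OF _ homp_scale[OF hE]] by simp
  qed
  moreover have "y.fx 0 (unitv 1) \<noteq> 0"
  proof -
    have "(0::'a) ^ c = 0 ^ Suc (c - 1)" using c by simp
    then have "(0::'a) ^ c = 0" by (simp only: power_Suc mult_zero_left)
    then show ?thesis using z.b_nz by (simp add: y.fx_def y.va_def y.ca_def unitv_def zero_power)
  qed
  ultimately show ?thesis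
    unfolding y.J_def using y.homp_fx by (intro exI[of _ y.fx] exI[of _ m] conjI allI impI)
qed

subsection \<open>The closed set\<close>

lemma gid_vanish: "gid V H m P \<Longrightarrow> (\<And>a h. (a, h) \<in> H \<Longrightarrow> h x = 0) \<Longrightarrow> P x = 0"
proof (induction rule: gid.induct)
  case (gid_gen a h b c)
  have "h x = 0" by (rule gid_gen.prems[OF gid_gen.hyps(1)])
  then show ?case by simp
qed simp_all

text \<open>A power of each coordinate lies in the ideal, hence vanishes at every common
  zero.\<close>

lemma cert_no_common_zero:
  fixes x :: "'v \<Rightarrow> 'a::field"
  assumes "cert V H N" "\<And>a h. (a, h) \<in> H \<Longrightarrow> h x = 0" "v \<in> V"
  shows "x v = 0"
proof -
  have "homp V N (\<lambda>x :: 'v \<Rightarrow> 'a. x v ^ N)" by (rule homp_varpow[OF assms(3)])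
  then have "gid V H N (\<lambda>x. x v ^ N)" using assms(1) by (simp add: cert_def)
  from gid_vanish[OF this assms(2)] have "x v ^ N = 0" .
  then show ?thesis by (simp add: power_eq_0_iff)
qed

text \<open>The universal map: its coefficients are the parameter \<open>w\<close>, so conditions on
  maps become conditions on points of the coefficient space.\<close>

definition genf :: "nat \<Rightarrow> nat \<Rightarrow> nat \<Rightarrow> (nat \<times> (nat \<Rightarrow> nat) \<Rightarrow> 'a) \<Rightarrow> (nat \<Rightarrow> 'a::comm_ring_1) \<Rightarrow> 'a" where
  "genf n d i w x = (\<Sum>\<alpha>\<in>mons {0..n} d. w (i, \<alpha>) * monv {0..n} \<alpha> x)"

definition genJ :: "nat \<Rightarrow> nat \<Rightarrow> (nat \<times> (nat \<Rightarrow> nat) \<Rightarrow> 'a) \<Rightarrow> (nat \<Rightarrow> 'a::field_char_0) \<Rightarrow> 'a" where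
  "genJ n d w x = det (mat (n + 1) (n + 1) (\<lambda>(i, j). pd j (genf n d i w) x))"

lemma coeff_index_iff: "(i, \<alpha>) \<in> coeff_index n d \<longleftrightarrow> i \<le> n \<and> \<alpha> \<in> mons {0..n} d"
  by (simp add: coeff_index_def monoms_deg_eq)

lemma finite_coeff_index: "finite (coeff_index n d)"
proof -
  have "coeff_index n d \<subseteq> {0..n} \<times> mons {0..n} d" by (auto simp: coeff_index_iff)
  then show ?thesis by (rule finite_subset) (simp add: finite_mons)
qed

lemma coeff_index_nonempty: "coeff_index n d \<noteq> {}"
proof -
  have "(\<lambda>u. if u = 0 then d else 0) \<in> mons {0..n} d" by (rule mons_single) auto
  then have "(0, \<lambda>u. if u = 0 then d else 0) \<in> coeff_index n d" by (simp add: coeff_index_iff)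
  then show ?thesis by blast
qed

lemma bihom_coeff: "bihom (coeff_index n d) {0..n}"
  by unfold_locales (auto simp: finite_coeff_index coeff_index_nonempty)

lemma bh_genf: "i \<le> n \<Longrightarrow> bh (coeff_index n d) {0..n} 1 d (genf n d i :: _ \<Rightarrow> _ \<Rightarrow> 'a::comm_ring_1)"
  unfolding bh_def
proof (intro exI[of _ "\<lambda>\<beta> w. if \<beta> \<in> mons {0..n} d then w (i, \<beta>) else 0"] conjI allI)
  fix \<beta> assume i: "i \<le> n"
  show "homp (coeff_index n d) 1 (\<lambda>w :: _ \<Rightarrow> 'a. if \<beta> \<in> mons {0..n} d then w (i, \<beta>) else 0)"
  proof (cases "\<beta> \<in> mons {0..n} d")
    case True
    then have "(i, \<beta>) \<in> coeff_index n d" using i by (simp add: coeff_index_iff)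
    from homp_var[OF this] show ?thesis using True by simp
  next
    case False
    then show ?thesis using homp_zero[OF finite_coeff_index coeff_index_nonempty] by simp
  qed
qed (simp add: genf_def)

lemma bh_genJ: "bh (coeff_index n d) {0..n} (n + 1) ((n + 1) * (d - 1)) (genJ n d :: _ \<Rightarrow> _ \<Rightarrow> 'a::field_char_0)"
proof -
  interpret bihom "coeff_index n d" "{0..n}" by (rule bihom_coeff)
  have "bh (coeff_index n d) {0..n} ((n + 1) * 1) ((n + 1) * (d - 1))
     (\<lambda>w x. det (mat (n + 1) (n + 1) (\<lambda>(i, j). pd j (genf n d i w) x :: 'a)))"
    by (rule bh_det) (rule bh_pd[OF bh_genf], simp)
  then show ?thesis unfolding genJ_def[abs_def] by simp
qed

lemma genf_surj:
  assumes f: "\<And>i. i \<le> n \<Longrightarrow> homp {0..n} d (f i)"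
  shows "\<exists>w. \<forall>i\<le>n. genf n d i w = f i"
proof -
  have "\<forall>i. \<exists>c. i \<le> n \<longrightarrow> (\<forall>x. f i x = (\<Sum>\<alpha>\<in>mons {0..n} d. c \<alpha> * monv {0..n} \<alpha> x))"
    using homp_expand[OF f] by blast
  from choice[OF this] obtain c where c: "\<forall>i. i \<le> n \<longrightarrow> (\<forall>x. f i x = (\<Sum>\<alpha>\<in>mons {0..n} d. c i \<alpha> * monv {0..n} \<alpha> x))" ..
  show ?thesis by (rule exI[of _ "\<lambda>(i, \<alpha>). c i \<alpha>"]) (use c in \<open>auto simp: genf_def fun_eq_iff\<close>)
qed

lemma genJ_eq:
  assumes "\<And>i. i \<le> n \<Longrightarrow> genf n d i w = f i"
  shows "genJ n d w x = det (mat (n + 1) (n + 1) (\<lambda>(i, j). pd j (f i) x))"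
  unfolding genJ_def using assms by (intro arg_cong[of _ _ det] cong_mat) auto

text \<open>The power map, whose components are pure powers of the coordinates, is the
  witness.\<close>

lemma open_base_point_free:
  "\<exists>e \<Gamma> N w. homp (coeff_index n d) e \<Gamma> \<and> \<Gamma> w \<noteq> 0 \<and>
    (\<forall>w. \<Gamma> w \<noteq> 0 \<longrightarrow> cert {0..n} {(d, genf n d i w :: (nat \<Rightarrow> 'a::field_char_0) \<Rightarrow> 'a) | i. i \<in> {0..n}} N)"
proof -
  interpret bihom "coeff_index n d" "{0..n}" by (rule bihom_coeff)
  have "homp {0..n} d (\<lambda>x :: nat \<Rightarrow> 'a. x i ^ d)" if "i \<le> n" for i by (rule homp_varpow) (use that in simp)
  from genf_surj[of n d "\<lambda>i x. x i ^ d", OF this] obtain w :: "nat \<times> (nat \<Rightarrow> nat) \<Rightarrow> 'a" where w: "\<forall>i\<le>n. genf n d i w = (\<lambda>x. x i ^ d)" ..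
  have "cert {0..n} {(d, \<lambda>x :: nat \<Rightarrow> 'a. x v ^ d) | v. v \<in> {0..n}} (\<Sum>v\<in>{0..n}. d)" by (rule cert_powers) auto
  moreover have "{(d, \<lambda>x :: nat \<Rightarrow> 'a. x v ^ d) | v. v \<in> {0..n}} = {(d, genf n d i w) | i. i \<in> {0..n}}" using w by force
  ultimately have c: "cert {0..n} {(d, genf n d i w) | i. i \<in> {0..n}} (\<Sum>v\<in>{0..n}. d)" by simp
  have b: "bh (coeff_index n d) {0..n} 1 d (genf n d i :: _ \<Rightarrow> _ \<Rightarrow> 'a)" if "i \<in> {0..n}" for i by (rule bh_genf) (use that in simp)
  from cert_open[where a = "\<lambda>_. d" and h = "genf n d" and I = "{0..n}", OF _ c, of 1] b
  have "\<exists>e' \<Gamma>. homp (coeff_index n d) e' \<Gamma> \<and> \<Gamma> w \<noteq> 0 \<and> (\<forall>w. \<Gamma> w \<noteq> 0 \<longrightarrow> cert {0..n} {(d, genf n d i w) | i. i \<in> {0..n}} (\<Sum>v\<in>{0..n}. d))" .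
  then show ?thesis by blast
qed

lemma open_smooth_section:
  fixes n d :: nat
  assumes ac: "alg_closed TYPE('a::field_char_0)" and n: "n \<ge> 2" and d: "d \<ge> 3"
  shows "\<exists>e \<Gamma> N w. homp (coeff_index n d) e \<Gamma> \<and> \<Gamma> w \<noteq> 0 \<and>
    (\<forall>w. \<Gamma> w \<noteq> 0 \<longrightarrow> cert {0..n} (jets ((n + 1) * (d - 1)) (genJ n d w :: (nat \<Rightarrow> 'a) \<Rightarrow> 'a) \<union> {(1, \<lambda>x. x j) | j. j \<in> {3..n}}) N)"
proof -
  let ?e = "(n + 1) * (d - 1)" and ?W = "coeff_index n d" and ?V = "{0..n}"
  interpret bihom ?W ?V by (rule bihom_coeff)
  have "d - 1 \<ge> 2" "d - 1 + 1 = d" using d by auto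
  from smooth_critical_section_exists[OF ac n this(1), unfolded this(2)] obtain f :: "nat \<Rightarrow> (nat \<Rightarrow> 'a) \<Rightarrow> 'a" and N where
    f: "\<forall>i\<le>n. homp ?V d (f i)" and f0: "f 0 (unitv 1) \<noteq> 0" and
    N: "cert ?V (jets ?e (\<lambda>x. det (mat (n + 1) (n + 1) (\<lambda>(i, j). pd j (f i) x))) \<union> {(1, \<lambda>x. x j) | j. j \<in> {3..n}}) N"
    by (elim exE conjE) (rule that)
  from genf_surj[of n d f] f obtain w1 where w1: "\<forall>i\<le>n. genf n d i w1 = f i" by blast
  have J1: "genJ n d w1 = (\<lambda>x. det (mat (n + 1) (n + 1) (\<lambda>(i, j). pd j (f i) x)))"
    by (rule ext, rule genJ_eq) (use w1 in blast)
  \<comment> \<open>A form of parameter degree \<open>n + 1\<close>, the degree of the Jacobian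
    determinant in the coefficients, that is nonzero at \<open>w1\<close>.\<close>
  define \<rho> where "\<rho> w = genf n d 0 w (unitv 1 :: nat \<Rightarrow> 'a) ^ (n + 1)" for w
  have \<rho>1: "\<rho> w1 \<noteq> 0" using w1 f0 by (simp add: \<rho>_def)
  have h\<rho>: "homp ?W ((n + 1) * 1) \<rho>" unfolding \<rho>_def[abs_def] by (rule homp_power[OF bh_eval[OF bh_genf]]) simp
  define a where "a i = (if i = 0 then ?e else if i \<le> 3 then ?e - 1 else 1)" for i :: nat
  define h where "h i w = (if i = 0 then genJ n d w else if i \<le> 3 then pd (i - 1) (genJ n d w) else (\<lambda>x. \<rho> w * x (i - 1)))" for i w
  \<comment> \<open>the factor \<open>\<rho>\<close> gives all generators the same parameter degree\<close>
  have b: "bh ?W ?V (n + 1) (a i) (h i)" if i: "i \<in> {0..n + 1}" for i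
  proof -
    consider "i = 0" | "1 \<le> i \<and> i \<le> 3" | "4 \<le> i" by linarith
    then show ?thesis
    proof cases
      case 1
      then show ?thesis using bh_genJ[of n d] by (simp add: a_def h_def[abs_def])
    next
      case 2
      then show ?thesis using bh_pd[OF bh_genJ[of n d], of "i - 1"] by (simp add: a_def h_def[abs_def])
    next
      case 3
      have "homp ?V 1 (\<lambda>x :: nat \<Rightarrow> 'a. x (i - 1))" by (rule homp_var) (use i in auto)
      from bh_mult[OF bh_param[OF h\<rho>] bh_form[OF this]]
      have "bh ?W ?V (n + 1) 1 (\<lambda>w x. \<rho> w * x (i - 1))" by simp
      then show ?thesis using 3 by (simp add: a_def h_def[abs_def])
    qed
  qed
  have gens: "(a', h') \<in> {(a i, h i w) | i. i \<in> {0..n + 1}} \<longleftrightarrow>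
     (a', h') \<in> jets ?e (genJ n d w) \<or> (\<exists>j\<in>{3..n}. a' = 1 \<and> h' = (\<lambda>x. \<rho> w * x j))" (is "?L \<longleftrightarrow> ?R") for a' h' w
  proof
    assume ?L
    then obtain i where i: "i \<in> {0..n + 1}" "a' = a i" "h' = h i w" by blast
    consider "i = 0" | "i = 1" | "i = 2" | "i = 3" | "4 \<le> i" by linarith
    then show ?R
    proof cases
      case 5
      then have "i - 1 \<in> {3..n}" using i(1) by auto
      moreover have "a' = 1" "h' = (\<lambda>x. \<rho> w * x (i - 1))" using i 5 by (auto simp: a_def h_def)
      ultimately show ?thesis by blast
    qed (use i in \<open>auto simp: a_def h_def jets_def One_nat_def[symmetric]\<close>)
  next
    assume ?R
    then consider "a' = ?e" "h' = genJ n d w" | "a' = ?e - 1" "h' = pd 0 (genJ n d w)" | "a' = ?e - 1" "h' = pd 1 (genJ n d w)"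
      | "a' = ?e - 1" "h' = pd 2 (genJ n d w)" | j where "j \<in> {3..n}" "a' = 1" "h' = (\<lambda>x. \<rho> w * x j)"
      unfolding jets_def by blast
    then show ?L
    proof cases
      case 1 then show ?thesis by (intro CollectI exI[of _ 0]) (simp add: a_def h_def)
    next
      case 2 then show ?thesis by (intro CollectI exI[of _ 1]) (simp add: a_def h_def)
    next
      case 3 then show ?thesis using n by (intro CollectI exI[of _ 2]) (simp add: a_def h_def One_nat_def[symmetric])
    next
      case 4 then show ?thesis using n by (intro CollectI exI[of _ 3]) (simp add: a_def h_def)
    next
      case 5 then show ?thesis by (intro CollectI exI[of _ "j + 1"]) (auto simp: a_def h_def)
    qed
  qed
  have "cert ?V {(a i, h i w1) | i. i \<in> {0..n + 1}} N"
  proof (rule cert_trans[OF N[folded J1]])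
    fix a' h' assume "(a', h') \<in> jets ?e (genJ n d w1) \<union> {(1, \<lambda>x. x j) | j. j \<in> {3..n}}"
    then consider "(a', h') \<in> jets ?e (genJ n d w1)" | j where "j \<in> {3..n}" "a' = 1" "h' = (\<lambda>x. x j)" by blast
    then show "gid ?V {(a i, h i w1) | i. i \<in> {0..n + 1}} a' h'"
    proof cases
      case 1
      then show ?thesis by (intro gid_in iffD2[OF gens] disjI1)
    next
      case 2
      have "(1, \<lambda>x. \<rho> w1 * x j) \<in> {(a i, h i w1) | i. i \<in> {0..n + 1}}" unfolding gens using 2(1) by blast
      from gid_scale[OF gid_in[OF this], of ?V "1 / \<rho> w1"] show ?thesis
        by (rule gid_cong) (use 2 \<rho>1 in auto)
    qed
  qed
  from cert_open[where a = a and h = h and I = "{0..n + 1}", OF _ this, of "n + 1"] b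
  have "\<exists>e' \<Gamma>. homp ?W e' \<Gamma> \<and> \<Gamma> w1 \<noteq> 0 \<and> (\<forall>w. \<Gamma> w \<noteq> 0 \<longrightarrow> cert ?V {(a i, h i w) | i. i \<in> {0..n + 1}} N)" .
  then obtain e' \<Gamma> where \<Gamma>: "homp ?W e' \<Gamma>" "\<Gamma> w1 \<noteq> 0" "\<forall>w. \<Gamma> w \<noteq> 0 \<longrightarrow> cert ?V {(a i, h i w) | i. i \<in> {0..n + 1}} N"
    by (elim exE conjE) (rule that)
  have "cert ?V (jets ?e (genJ n d w) \<union> {(1, \<lambda>x. x j) | j. j \<in> {3..n}}) N" if "\<Gamma> w \<noteq> 0" for w
  proof (rule cert_trans[OF \<Gamma>(3)[rule_format, OF that]])
    let ?H = "jets ?e (genJ n d w) \<union> {(1, \<lambda>x :: nat \<Rightarrow> 'a. x j) | j. j \<in> {3..n}}"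
    fix a' h' assume "(a', h') \<in> {(a i, h i w) | i. i \<in> {0..n + 1}}"
    then consider "(a', h') \<in> jets ?e (genJ n d w)" | j where "j \<in> {3..n}" "a' = 1" "h' = (\<lambda>x. \<rho> w * x j)"
      unfolding gens by blast
    then show "gid ?V ?H a' h'"
    proof cases
      case 1
      then show ?thesis by (intro gid_in) simp
    next
      case 2
      have "(1, \<lambda>x. x j) \<in> ?H" using 2(1) by blast
      from gid_scale[OF gid_in[OF this], of ?V "\<rho> w"] show ?thesis using 2 by simp
    qed
  qed
  then show ?thesis using \<Gamma>(1,2) by blast
qed

text \<open>The witness has components \<open>x i * x 0 ^ (d - 1)\<close>; its Jacobian matrix at
  the first unit vector is diagonal with entries d, 1, ..., 1.\<close>

lemma open_leading_coeff:
  fixes n d :: nat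
  assumes d: "d \<ge> 1"
  shows "\<exists>w. genJ n d w (unitv 0) \<noteq> (0 :: 'a::field_char_0)"
proof -
  have v: "polyf UNIV (\<lambda>x :: nat \<Rightarrow> 'a. x i)" for i by (rule polyf_var) simp
  have "homp {0..n} d (\<lambda>x :: nat \<Rightarrow> 'a. x i * x 0 ^ (d - 1))" if "i \<le> n" for i
    by (rule homp_cong_deg[OF homp_mult[OF homp_var homp_varpow]]) (use that d in auto)
  from genf_surj[of n d "\<lambda>i x. x i * x 0 ^ (d - 1)", OF this] obtain w :: "nat \<times> (nat \<Rightarrow> nat) \<Rightarrow> 'a" where
    w: "\<forall>i\<le>n. genf n d i w = (\<lambda>x. x i * x 0 ^ (d - 1))" ..
  let ?M = "mat (n + 1) (n + 1) (\<lambda>(i, j). pd j (\<lambda>x :: nat \<Rightarrow> 'a. x i * x 0 ^ (d - 1)) (unitv 0))"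
  have e: "pd j (\<lambda>x :: nat \<Rightarrow> 'a. x i * x 0 ^ (d - 1)) (unitv 0)
    = (if i = j then 1 else 0) + (if i = 0 \<and> j = 0 then of_nat (d - 1) else 0)" for i j
    unfolding pd_mult[OF v polyf_power[OF v]] pd_power[OF v] pd_var by (auto simp: unitv_def)
  have M: "?M \<in> carrier_mat (n + 1) (n + 1)" by simp
  have "det ?M = prod_list (diag_mat ?M)"
    by (rule det_upper_triangular[OF _ M]) (auto simp: upper_triangular_def e)
  also have "\<dots> = (\<Prod>i\<in>{0..<n + 1}. if i = 0 then of_nat (1 + (d - 1)) else 1)"
    unfolding prod_list_diag[OF M] by (rule prod.cong) (auto simp: e)
  also have "\<dots> \<noteq> 0" by (simp add: prod_zero_iff del: of_nat_add)
  finally have "det ?M \<noteq> 0" .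
  then have "genJ n d w (unitv 0) \<noteq> 0" using genJ_eq[of n d w "\<lambda>i x. x i * x 0 ^ (d - 1)" "unitv 0"] w by simp
  then show ?thesis by (intro exI[of _ w])
qed

lemma End_maps_genf:
  fixes g :: "nat \<Rightarrow> (nat, 'a::field_char_0) mpol"
  assumes g: "g \<in> End_maps n d" and i: "i \<le> n"
  shows "genf n d i (coeff_vec g) = mp_eval (g i)" "homp {0..n} d (mp_eval (g i))" "mp_monoms (g i) \<subseteq> mons {0..n} d"
proof -
  have h: "mp_homog d (g i)" "mp_vars_in {0..n} (g i)" using g i by (auto simp: End_maps_def)
  show m: "mp_monoms (g i) \<subseteq> mons {0..n} d" by (rule mp_homog_mons[OF _ h]) simp
  show "genf n d i (coeff_vec g) = mp_eval (g i)"
    unfolding mp_eval_expand[OF finite_atLeastAtMost m, abs_def] genf_def[abs_def] coeff_vec_def by simp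
  show "homp {0..n} d (mp_eval (g i))" by (rule homp_mp_eval[OF _ _ h]) auto
qed

text \<open>Translates between \<open>crit_locus\<close>, which consists of nonzero vectors
  supported on coordinates up to \<open>n\<close>, and the full zero set of \<open>J\<close> used in
  the locale.\<close>

lemma good_not_post_crit_periodic:
  fixes g :: "nat \<Rightarrow> (nat, 'a::field_char_0) mpol"
  assumes ac: "alg_closed TYPE('a)" and d: "d \<ge> 3" and n: "n \<ge> 2" and g: "g \<in> End_maps n d"
    and c1: "cert {0..n} {(d, genf n d i (coeff_vec g)) | i. i \<in> {0..n}} N1"
    and c2: "cert {0..n} (jets ((n + 1) * (d - 1)) (genJ n d (coeff_vec g)) \<union> {(1, \<lambda>x. x j) | j. j \<in> {3..n}}) N0"
    and lead: "genJ n d (coeff_vec g) (unitv 0) \<noteq> 0"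
  shows "\<not> post_crit_periodic n g"
proof
  assume "post_crit_periodic n g"
  then obtain k where k: "k \<ge> 1" "(map_apply n g ^^ k) ` crit_locus n g \<subseteq> crit_locus n g"
    unfolding post_crit_periodic_def by blast
  let ?f = "\<lambda>i. genf n d i (coeff_vec g)" and ?J = "genJ n d (coeff_vec g)" and ?e = "(n + 1) * (d - 1)"
  interpret good_map n d ?f N1 N0 "map_apply n g" ?J ?e
  proof
    show "homp {0..n} d (?f i)" if "i \<le> n" for i using End_maps_genf(1,2)[OF g that] by simp
    show "map_apply n g = (\<lambda>x i. if i \<le> n then ?f i x else 0)"
      using End_maps_genf(1)[OF g] by (auto simp: map_apply_def fun_eq_iff)
    show "?J = (\<lambda>x. det (mat (n + 1) (n + 1) (\<lambda>(i, j). pd j (?f i) x)))" by (simp add: genJ_def[abs_def])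
  qed (rule ac d n c1 refl lead c2)+
  have jac: "jac_det n g x = ?J x" for x
  proof -
    have "jac_det n g x = det (mat (n + 1) (n + 1) (\<lambda>(i, j). pd j (?f i) x))"
      unfolding jac_det_def
    proof (intro arg_cong[of _ _ det] cong_mat refl)
      fix i j assume "i < n + 1" "j < n + 1"
      then have ij: "i \<le> n" "j \<in> {0..n}" by auto
      have "mp_monoms (g i) \<subseteq> mons {0..n} (Suc (d - 1))" using End_maps_genf(3)[OF g ij(1)] d by simp
      from mp_eval_pderiv[OF _ ij(2) this, of x]
      show "(case (i, j) of (i, j) \<Rightarrow> mp_eval (mp_pderiv j (g i)) x) = (case (i, j) of (i, j) \<Rightarrow> pd j (?f i) x)"
        using End_maps_genf(1)[OF g ij(1)] by simp
    qed
    then show ?thesis by (simp add: genJ_def)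
  qed
  from not_periodic[OF k(1)] obtain x where x: "?J x = 0" "?J ((map_apply n g ^^ k) x) \<noteq> 0" by blast
  \<comment> \<open>Coordinates beyond \<open>n\<close> are cut off; neither \<open>J\<close> nor
    its composition with the iterate sees them.\<close>
  define y where "y v = (if v \<le> n then x v else 0)" for v
  have J1: "?J y = ?J x" by (rule homp_eval_cong[OF homp_J]) (auto simp: y_def)
  have hJk: "homp {0..n} (d ^ k * ?e) (\<lambda>x. ?J ((map_apply n g ^^ k) x))" by (rule homp_comp_iter[OF homp_J])
  have J2: "?J ((map_apply n g ^^ k) y) = ?J ((map_apply n g ^^ k) x)"
    by (rule homp_eval_cong[OF hJk]) (auto simp: y_def)
  \<comment> \<open>The composed form has positive degree and would vanish at the origin, but it is
    nonzero at \<open>y\<close>.\<close>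
  have "\<exists>j\<le>n. y j \<noteq> 0"
  proof (rule ccontr)
    assume "\<not> ?thesis"
    then have "?J ((map_apply n g ^^ k) y) = 0" by (intro homp_zero_at[OF hJk]) (use d e_ge in auto)
    then show False using J2 x(2) by simp
  qed
  then have "y \<in> crit_locus n g" using J1 x(1) by (auto simp: crit_locus_def vec_n_def jac y_def)
  then have "(map_apply n g ^^ k) y \<in> crit_locus n g" using k(2) by blast
  then show False using J2 x(2) by (auto simp: crit_locus_def jac)
qed

theorem theorem16:
  fixes n d :: nat
  assumes "alg_closed TYPE('a::field_char_0)"
    and "d \<ge> 3" and "n \<ge> 2"
  shows "\<exists>Z. zariski_closed_End n d Z \<and> Z \<subset> (End_maps n d :: (nat \<Rightarrow> (nat, 'a) mpol) set)
            \<and> {f \<in> End_maps n d. post_crit_periodic n f} \<subseteq> Z"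
proof -
  let ?W = "coeff_index n d" and ?V = "{0..n}" and ?e = "(n + 1) * (d - 1)"
  interpret bihom ?W ?V by (rule bihom_coeff)
  from open_base_point_free[of n d, where 'a = 'a] obtain e1 \<Gamma>1 N1 and w1 :: "nat \<times> (nat \<Rightarrow> nat) \<Rightarrow> 'a" where
    1: "homp ?W e1 \<Gamma>1" "\<Gamma>1 w1 \<noteq> 0" "\<forall>w. \<Gamma>1 w \<noteq> 0 \<longrightarrow> cert ?V {(d, genf n d i w) | i. i \<in> ?V} N1"
    by (elim exE conjE) (rule that)
  from open_smooth_section[OF assms(1,3,2)] obtain e2 \<Gamma>2 N2 and w2 :: "nat \<times> (nat \<Rightarrow> nat) \<Rightarrow> 'a" where
    2: "homp ?W e2 \<Gamma>2" "\<Gamma>2 w2 \<noteq> 0"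
      "\<forall>w. \<Gamma>2 w \<noteq> 0 \<longrightarrow> cert ?V (jets ?e (genJ n d w) \<union> {(1, \<lambda>x. x j) | j. j \<in> {3..n}}) N2"
    by (elim exE conjE) (rule that)
  define \<Gamma>3 where "\<Gamma>3 w = genJ n d w (unitv 0 :: nat \<Rightarrow> 'a)" for w
  have 3: "homp ?W (n + 1) \<Gamma>3" unfolding \<Gamma>3_def[abs_def] by (rule bh_eval[OF bh_genJ])
  from open_leading_coeff[of d n, where 'a = 'a] assms(2) obtain w3 where w3: "\<Gamma>3 w3 \<noteq> 0" unfolding \<Gamma>3_def by auto
  \<comment> \<open>A single polynomial defines the closed set: off its zeros all three open
    conditions hold.\<close>
  have "homp ?W (e1 + (e2 + (n + 1))) (\<lambda>w. \<Gamma>1 w * (\<Gamma>2 w * \<Gamma>3 w))" by (rule homp_mult[OF 1(1) homp_mult[OF 2(1) 3]])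
  from homp_imp_mpol[OF this finite_coeff_index] obtain G where
    G: "mp_homog (e1 + (e2 + (n + 1))) G" "mp_vars_in ?W G" "mp_eval G = (\<lambda>w. \<Gamma>1 w * (\<Gamma>2 w * \<Gamma>3 w))"
    by (elim exE conjE) (rule that)
  define Z where "Z = {f \<in> (End_maps n d :: (nat \<Rightarrow> (nat, 'a) mpol) set). mp_eval G (coeff_vec f) = 0}"
  have "zariski_closed_End n d Z" unfolding zariski_closed_End_def
    by (rule exI[of _ "{G}"]) (use G in \<open>auto simp: Z_def\<close>)
  moreover have "{f \<in> End_maps n d. post_crit_periodic n f} \<subseteq> Z"
  proof
    fix f assume f: "f \<in> {f \<in> (End_maps n d :: (nat \<Rightarrow> (nat, 'a) mpol) set). post_crit_periodic n f}"
    show "f \<in> Z"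
    proof (rule ccontr)
      assume "f \<notin> Z"
      then have "\<Gamma>1 (coeff_vec f) \<noteq> 0" "\<Gamma>2 (coeff_vec f) \<noteq> 0" "\<Gamma>3 (coeff_vec f) \<noteq> 0" using f by (auto simp: Z_def G(3))
      from good_not_post_crit_periodic[OF assms(1-3) _ 1(3)[rule_format, OF this(1)] 2(3)[rule_format, OF this(2)] this(3)[unfolded \<Gamma>3_def]] f
      show False by simp
    qed
  qed
  moreover have "\<exists>f \<in> End_maps n d. f \<notin> Z"
  proof -
    \<comment> \<open>The three conditions have different witnesses; a common point of the three
      open sets shows that the closed set is proper.\<close>
    define fs where "fs i = (if i = 0 then \<Gamma>1 else if i = 1 then \<Gamma>2 else \<Gamma>3)" for i :: nat
    have "\<exists>w. \<forall>i\<in>{0,1,2}. fs i w \<noteq> 0"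
    proof (rule common_nonzero_point[where V = ?W])
      show "polyf ?W (fs i)" for i using homp_polyf[OF 1(1)] homp_polyf[OF 2(1)] homp_polyf[OF 3] by (simp add: fs_def)
      show "\<exists>w. fs i w \<noteq> 0" for i using 1(2) 2(2) w3 by (auto simp: fs_def)
    qed simp
    then obtain w where w: "\<Gamma>1 w \<noteq> 0" "\<Gamma>2 w \<noteq> 0" "\<Gamma>3 w \<noteq> 0" by (auto simp: fs_def)
    define f where "f i \<alpha> = (if i \<le> n \<and> \<alpha> \<in> mons ?V d then w (i, \<alpha>) else 0)" for i \<alpha>
    have cw: "\<Gamma> (coeff_vec f) = \<Gamma> w" if "homp ?W e \<Gamma>" for e \<Gamma>
      by (rule homp_eval_cong[OF that]) (auto simp: coeff_vec_def f_def coeff_index_iff)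
    have hom: "mp_homog d (f i)" "mp_vars_in ?V (f i)" for i
    proof -
      have m: "mp_monoms (f i) \<subseteq> mons ?V d" by (auto simp: mp_monoms_def f_def)
      then have s: "mp_supp \<alpha> \<subseteq> ?V" "(\<Sum>v\<in>?V. \<alpha> v) = d" if "\<alpha> \<in> mp_monoms (f i)" for \<alpha>
        using that by (auto simp: mons_def)
      show "mp_vars_in ?V (f i)" using s(1) by (simp add: mp_vars_in_def)
      show "mp_homog d (f i)" unfolding mp_homog_def is_mpoly_def
      proof (intro conjI ballI)
        show "finite (mp_monoms (f i))" by (rule finite_subset[OF m]) (simp add: finite_mons)
        fix \<alpha> assume a: "\<alpha> \<in> mp_monoms (f i)"
        show "finite (mp_supp \<alpha>)" by (rule finite_subset[OF s(1)[OF a]]) simp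
        show "(\<Sum>v\<in>mp_supp \<alpha>. \<alpha> v) = d" using deg_supp[OF _ s(1)[OF a]] s(2)[OF a] by simp
      qed
    qed
    have ev: "mp_eval (f i) = genf n d i w" if "i \<le> n" for i
    proof -
      have m: "mp_monoms (f i) \<subseteq> mons ?V d" by (auto simp: mp_monoms_def f_def)
      show ?thesis unfolding mp_eval_expand[OF finite_atLeastAtMost m, abs_def] genf_def[abs_def]
        using that by (simp add: f_def)
    qed
    \<comment> \<open>Absence of base points comes from the certificate attached to
      \<open>\<Gamma>1\<close>.\<close>
    have "f \<in> End_maps n d" unfolding End_maps_def
    proof (intro CollectI conjI allI impI)
      show "mp_homog d (f i)" "mp_vars_in ?V (f i)" for i by (rule hom)+
      show "f i = (\<lambda>_. 0)" if "n < i" for i using that by (auto simp: f_def)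
      fix x :: "nat \<Rightarrow> 'a" and j assume x: "vec_n n x \<and> (\<forall>i\<le>n. mp_eval (f i) x = 0)" and j: "j \<le> n"
      show "x j = 0"
      proof (rule cert_no_common_zero[OF 1(3)[rule_format, OF w(1)]])
        fix a h assume "(a, h) \<in> {(d, genf n d i w) | i. i \<in> ?V}"
        then obtain i where "i \<le> n" "h = genf n d i w" by auto
        then show "h x = 0" using x ev by auto
      qed (use j in simp)
    qed
    moreover have "mp_eval G (coeff_vec f) \<noteq> 0" unfolding G(3) cw[OF 1(1)] cw[OF 2(1)] cw[OF 3] using w by simp
    ultimately show ?thesis unfolding Z_def by blast
  qed
  moreover have "Z \<subseteq> End_maps n d" by (auto simp: Z_def)
  ultimately show ?thesis by blast
qed

end
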